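(* Let $1\le\bar p,\bar q,p_1,q_1,p_2,q_2\le\infty$ with $$\frac1{\bar p}+\frac1{p_1}+\frac1{p_2}=1,\qquad \frac1{\bar q}+\frac1{q_1}+\frac1{q_2}=1.$$ Let $f\in L^{p_1}(0,T;L^{q_1}(\Omega))$ with $\partial_tf\in L^{p_1}(0,T;W^{-1,q_1}(\Omega))$, let $g\in L^{p_2}(0,T;W^{1,q_2}(\Omega))$, and let $\varphi\in L^{\bar p}(0,T;W^{1,\bar q}_0(\Omega))$. If $p_2,q_2,\bar p,\bar q<\infty$, then $$\int_0^T\int_\Omega\varphi\left[\partial_t(fg)_\varepsilon-\partial_t(f\,g_\varepsilon)\right]dx\,dt\to0\qquad\text{as }\varepsilon\to0.$$
   Context: $T>0$, $N\in\{2,3\}$, and $\Omega$ is either the torus $\mathbb T^N$ (where $W_0^{1,q}=W^{1,q}$) or an open bounded domain in $\mathbb R^N$ with $C^1$ boundary. The subscript $\varepsilon$ denotes mollification in time only: $h_\varepsilon(t,x)=(\eta_{t,\varepsilon}*h)(t,x)=\int\eta_{t,\varepsilon}(t-s)h(s,x)\,ds$, where $\eta_{t,\varepsilon}(t)=\frac1\varepsilon\eta_t\left(\frac t\varepsilon\right)$ and $\eta_t\ge0$ is a smooth even function on $\mathbb R$ supported in $[-1,1]$ with integral $1$. The mollified functions are defined for times at distance more than $\varepsilon$ from the endpoints, and the time integral in the claim is understood over $t\in(\varepsilon,T-\varepsilon)$. $W^{-1,q_1}(\Omega)$ is the dual space of $W_0^{1,q_1'}(\Omega)$, with $\frac1{q_1}+\frac1{q_1'}=1$,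 equipped with the operator norm, and $\langle\cdot,\cdot\rangle$ is the duality pairing. Since $\partial_tf$ is only a distribution, the term containing $\partial_t(f g_\varepsilon)$ is understood as $$\int\int_\Omega\varphi\,\partial_t(f g_\varepsilon)\,dx\,dt=\int\langle\partial_tf,\,g_\varepsilon\varphi\rangle\,dt+\int\int_\Omega\varphi f\,\partial_tg_\varepsilon\,dx\,dt.$$ *)

theory Defs
  imports "HOL-Probability.Probability"
begin

section \<open>Smooth functions and \<open>C\<^sup>1\<close> boundaries\<close>

primrec Ck :: "nat \<Rightarrow> ('a::euclidean_space \<Rightarrow> real) \<Rightarrow> bool" where
  "Ck 0 u \<longleftrightarrow> continuous_on UNIV u"
| "Ck (Suc k) u \<longleftrightarrow>
     (\<exists>v :: 'a \<Rightarrow> 'a. (\<forall>x. (u has_derivative (\<lambda>h. v x \<bullet> h)) (at x)) \<and>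
                     (\<forall>i\<in>Basis. Ck k (\<lambda>x. v x \<bullet> i)))"

definition smooth :: "('a::euclidean_space \<Rightarrow> real) \<Rightarrow> bool" where
  "smooth u \<longleftrightarrow> (\<forall>k. Ck k u)"

definition Cc_infinity :: "'a::euclidean_space set \<Rightarrow> ('a \<Rightarrow> real) set" where
  "Cc_infinity S = {\<psi>. smooth \<psi> \<and> compact (closure {x. \<psi> x \<noteq> 0}) \<and> closure {x. \<psi> x \<noteq> 0} \<subseteq> S}"

text \<open>Locally the domain is the strict epigraph, in the direction of a unit vector \<open>e\<close>, of a
  \<open>C\<^sup>1\<close> function \<open>\<gamma>\<close> of the coordinates orthogonal to \<open>e\<close>; the latter is encoded as a
  function on the whole space that is constant along \<open>e\<close>.\<close>

definition C1_boundary :: "'a::euclidean_space set \<Rightarrow> bool" where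
  "C1_boundary \<Omega> \<longleftrightarrow>
     (\<forall>x0\<in>frontier \<Omega>. \<exists>r>0. \<exists>e \<gamma>. norm e = 1 \<and> Ck 1 \<gamma> \<and> (\<forall>x s. \<gamma> (x + s *\<^sub>R e) = \<gamma> x) \<and>
        \<Omega> \<inter> ball x0 r = {x \<in> ball x0 r. \<gamma> x < x \<bullet> e})"


section \<open>Lebesgue spaces\<close>

text \<open>Exponents range over \<open>[1, \<infinity>]\<close> inside \<^typ>\<open>ennreal\<close>, where \<open>1 / \<infinity> = 0\<close>. Elements of all
  function spaces are represented by functions, not by classes modulo null sets.\<close>

definition Lp :: "'a measure \<Rightarrow> ennreal \<Rightarrow> ('a \<Rightarrow> real) set" where
  "Lp M p = {u \<in> borel_measurable M.
     if p = \<infinity> then esssup M (\<lambda>x. ereal \<bar>u x\<bar>) < \<infinity>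
     else integrable M (\<lambda>x. \<bar>u x\<bar> powr enn2real p)}"

definition Lp_norm :: "'a measure \<Rightarrow> ennreal \<Rightarrow> ('a \<Rightarrow> real) \<Rightarrow> real" where
  "Lp_norm M p u =
     (if p = \<infinity> then real_of_ereal (esssup M (\<lambda>x. ereal \<bar>u x\<bar>))
      else (LINT x|M. \<bar>u x\<bar> powr enn2real p) powr (1 / enn2real p))"

definition conj_exponent :: "ennreal \<Rightarrow> ennreal" where
  "conj_exponent q = 1 / (1 - 1 / q)"

lemma conj_exponent_sum:
  assumes "1 \<le> q"
  shows "1 / q + 1 / conj_exponent q = 1"
proof -
  have "1 / q \<le> 1"
    using assms
    by (metis divide_right_mono_ennreal ennreal_divide_self ennreal_zero_less_divide
        ennreal_zero_less_one linorder_not_less order.strict_iff_order order.trans)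
  moreover have "inverse (inverse z) = z" for z :: ennreal
    by (cases z; cases "z = 0") (auto simp: inverse_ennreal)
  ultimately show ?thesis
    by (simp add: conj_exponent_def divide_ennreal_def add_diff_inverse_ennreal)
qed


section \<open>Spatial domains and Sobolev spaces\<close>

text \<open>A function on the torus \<open>\<real>\<^sup>N / \<int>\<^sup>N\<close> is given by its values on the unit cell; the torus
  enters through the test functions, which are smooth and periodic.\<close>

datatype 'a spatial_domain = Torus | Euclidean_Domain "'a set"

primrec admissible :: "(real^'n) spatial_domain \<Rightarrow> bool" where
  "admissible Torus \<longleftrightarrow> True"
| "admissible (Euclidean_Domain \<Omega>) \<longleftrightarrow>
     open \<Omega> \<and> bounded \<Omega> \<and> connected \<Omega> \<and> \<Omega> \<noteq> {} \<and> C1_boundary \<Omega>"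

primrec region :: "(real^'n) spatial_domain \<Rightarrow> (real^'n) set" where
  "region Torus = {x. \<forall>i. 0 \<le> x $ i \<and> x $ i < 1}"
| "region (Euclidean_Domain \<Omega>) = \<Omega>"

primrec test_functions :: "(real^'n) spatial_domain \<Rightarrow> (real^'n \<Rightarrow> real) set" where
  "test_functions Torus = {\<psi>. smooth \<psi> \<and> (\<forall>x i. \<psi> (x + axis i 1) = \<psi> x)}"
| "test_functions (Euclidean_Domain \<Omega>) = Cc_infinity \<Omega>"

abbreviation space_measure :: "(real^'n) spatial_domain \<Rightarrow> (real^'n) measure" where
  "space_measure D \<equiv> lebesgue_on (region D)"

abbreviation time_measure :: "real \<Rightarrow> real measure" where
  "time_measure T \<equiv> lebesgue_on {0<..<T}"

definition weak_gradient ::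
    "(real^'n) spatial_domain \<Rightarrow> ennreal \<Rightarrow> (real^'n \<Rightarrow> real) \<Rightarrow> (real^'n \<Rightarrow> real^'n) \<Rightarrow> bool" where
  "weak_gradient D q u v \<longleftrightarrow>
     (\<forall>i. (\<lambda>x. v x $ i) \<in> Lp (space_measure D) q \<and>
        (\<forall>\<psi>\<in>test_functions D.
           (LINT x|space_measure D. u x * frechet_derivative \<psi> (at x) (axis i 1)) =
           - (LINT x|space_measure D. v x $ i * \<psi> x)))"

definition W1 :: "(real^'n) spatial_domain \<Rightarrow> ennreal \<Rightarrow> (real^'n \<Rightarrow> real) set" where
  "W1 D q = {u \<in> Lp (space_measure D) q. \<exists>v. weak_gradient D q u v}"

text \<open>The weak gradient is unique up to null sets, so the choice does not matter.\<close>

definition W1_norm :: "(real^'n) spatial_domain \<Rightarrow> ennreal \<Rightarrow> (real^'n \<Rightarrow> real) \<Rightarrow> real" where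
  "W1_norm D q u = Lp_norm (space_measure D) q u +
     (\<Sum>i\<in>UNIV. Lp_norm (space_measure D) q (\<lambda>x. (SOME v. weak_gradient D q u v) x $ i))"

primrec W1_0 :: "(real^'n) spatial_domain \<Rightarrow> ennreal \<Rightarrow> (real^'n \<Rightarrow> real) set" where
  "W1_0 Torus q = W1 Torus q"
| "W1_0 (Euclidean_Domain \<Omega>) q =
     {u \<in> W1 (Euclidean_Domain \<Omega>) q. \<exists>\<psi> :: nat \<Rightarrow> real^'n \<Rightarrow> real.
        (\<forall>k. \<psi> k \<in> Cc_infinity \<Omega>) \<and> (\<lambda>k. W1_norm (Euclidean_Domain \<Omega>) q (u - \<psi> k)) \<longlonglongrightarrow> 0}"

text \<open>\<open>W\<^sup>-\<^sup>1\<^sup>,\<^sup>q\<close>: bounded linear functionals on \<open>W\<^sub>0\<^sup>1\<^sup>,\<^sup>q\<^sup>'\<close>. Their values outside that space are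
  irrelevant, and boundedness makes them respect equality almost everywhere.\<close>

definition W_minus1 ::
    "(real^'n) spatial_domain \<Rightarrow> ennreal \<Rightarrow> ((real^'n \<Rightarrow> real) \<Rightarrow> real) set" where
  "W_minus1 D q = {F.
     (\<forall>u\<in>W1_0 D (conj_exponent q). \<forall>v\<in>W1_0 D (conj_exponent q). \<forall>a b.
        F (\<lambda>x. a * u x + b * v x) = a * F u + b * F v) \<and>
     (\<exists>C. \<forall>u\<in>W1_0 D (conj_exponent q). \<bar>F u\<bar> \<le> C * W1_norm D (conj_exponent q) u)}"

definition W_minus1_norm ::
    "(real^'n) spatial_domain \<Rightarrow> ennreal \<Rightarrow> ((real^'n \<Rightarrow> real) \<Rightarrow> real) \<Rightarrow> real" where
  "W_minus1_norm D q F =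
     Sup {\<bar>F u\<bar> | u. u \<in> W1_0 D (conj_exponent q) \<and> W1_norm D (conj_exponent q) u \<le> 1}"


section \<open>Bochner spaces on \<open>(0,T)\<close>\<close>

text \<open>\<open>L\<^sup>p(0,T;X)\<close> for a seminormed space \<open>X\<close> given by its carrier \<open>X\<close> and seminorm \<open>nrm\<close>:
  strongly measurable \<open>u\<close> (an a.e. limit of \<open>X\<close>-valued simple functions) whose norm is in
  \<open>L\<^sup>p(0,T)\<close>.\<close>

definition strongly_measurable ::
    "real \<Rightarrow> 'b::minus set \<Rightarrow> ('b \<Rightarrow> real) \<Rightarrow> (real \<Rightarrow> 'b) \<Rightarrow> bool" where
  "strongly_measurable T X nrm u \<longleftrightarrow>
     (AE t in time_measure T. u t \<in> X) \<and>
     (\<exists>s :: nat \<Rightarrow> real \<Rightarrow> 'b.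
        (\<forall>k. simple_function (time_measure T) (s k) \<and> (\<forall>t\<in>{0<..<T}. s k t \<in> X)) \<and>
        (AE t in time_measure T. (\<lambda>k. nrm (u t - s k t)) \<longlonglongrightarrow> 0))"

definition bochner_Lp ::
    "real \<Rightarrow> ennreal \<Rightarrow> 'b::minus set \<Rightarrow> ('b \<Rightarrow> real) \<Rightarrow> (real \<Rightarrow> 'b) set" where
  "bochner_Lp T p X nrm =
     {u. strongly_measurable T X nrm u \<and> (\<lambda>t. nrm (u t)) \<in> Lp (time_measure T) p}"

text \<open>If \<open>X\<close> consists of functions of \<open>x\<close>, an element of the Bochner space is a class of functions
  of \<open>t\<close> with values in a space of classes, and has a representative that is jointly measurable
  in \<open>(t,x)\<close>. Such representatives are used throughout, so that pointwise products and the
  convolution in \<open>t\<close> for fixed \<open>x\<close> make sense.\<close>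

definition jointly_measurable ::
    "real \<Rightarrow> (real^'n) spatial_domain \<Rightarrow> (real \<Rightarrow> real^'n \<Rightarrow> real) set" where
  "jointly_measurable T D =
     {u. (\<lambda>(t, x). u t x) \<in> borel_measurable (lebesgue_on ({0<..<T} \<times> region D))}"

definition Lp_Lq where
  "Lp_Lq T p D q =
     bochner_Lp T p (Lp (space_measure D) q) (Lp_norm (space_measure D) q)
       \<inter> jointly_measurable T D"

definition Lp_W1 where
  "Lp_W1 T p D q = bochner_Lp T p (W1 D q) (W1_norm D q) \<inter> jointly_measurable T D"

definition Lp_W1_0 where
  "Lp_W1_0 T p D q = bochner_Lp T p (W1_0 D q) (W1_norm D q) \<inter> jointly_measurable T D"

definition Lp_W_minus1 where
  "Lp_W_minus1 T p D q = bochner_Lp T p (W_minus1 D q) (W_minus1_norm D q)"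

text \<open>\<open>F = \<partial>\<^sub>t f\<close> in the sense of \<open>W\<^sup>-\<^sup>1\<^sup>,\<^sup>q\<close>-valued distributions on \<open>(0,T)\<close>, where \<open>f(t)\<close> acts on
  \<open>W\<^sub>0\<^sup>1\<^sup>,\<^sup>q\<^sup>'\<close> by integration. The identity \<open>\<integral> \<theta>' f dt = - \<integral> \<theta> F dt\<close> in \<open>W\<^sup>-\<^sup>1\<^sup>,\<^sup>q\<close> is written out as
  equality of the two functionals at every \<open>v\<close>.\<close>

definition has_weak_time_derivative ::
    "real \<Rightarrow> (real^'n) spatial_domain \<Rightarrow> ennreal \<Rightarrow> (real \<Rightarrow> real^'n \<Rightarrow> real) \<Rightarrow>
     (real \<Rightarrow> (real^'n \<Rightarrow> real) \<Rightarrow> real) \<Rightarrow> bool" where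
  "has_weak_time_derivative T D q f F \<longleftrightarrow>
     (\<forall>\<theta>\<in>Cc_infinity {0<..<T}. \<forall>v\<in>W1_0 D (conj_exponent q).
        (LINT t|time_measure T. deriv \<theta> t * (LINT x|space_measure D. f t x * v x)) =
        - (LINT t|time_measure T. \<theta> t * F t v))"


section \<open>Mollification in time\<close>

definition mollifier_kernel :: "(real \<Rightarrow> real) \<Rightarrow> bool" where
  "mollifier_kernel \<eta> \<longleftrightarrow>
     smooth \<eta> \<and> (\<forall>t. 0 \<le> \<eta> t) \<and> (\<forall>t. \<eta> (- t) = \<eta> t) \<and> closure {t. \<eta> t \<noteq> 0} \<subseteq> {-1..1} \<and>
     (LINT t|lborel. \<eta> t) = 1"

text \<open>Meaningful for \<open>t \<in> (\<epsilon>, T - \<epsilon>)\<close>, where the kernel only sees times in \<open>(0,T)\<close>.\<close>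

definition mollify ::
    "(real \<Rightarrow> real) \<Rightarrow> real \<Rightarrow> real \<Rightarrow> (real \<Rightarrow> 'a \<Rightarrow> real) \<Rightarrow> real \<Rightarrow> 'a \<Rightarrow> real" where
  "mollify \<eta> T \<epsilon> h t x = (LINT s|time_measure T. (1 / \<epsilon>) * \<eta> ((t - s) / \<epsilon>) * h s x)"

text \<open>\<open>\<integral>\<integral> \<phi> \<partial>\<^sub>t (f g\<^sub>\<epsilon>) dx dt\<close> over \<open>(\<epsilon>, T - \<epsilon>)\<close>, defined by the product rule, with \<open>F\<close> standing for
  \<open>\<partial>\<^sub>t f\<close>.\<close>

definition integral_dt_f_mollified_g ::
    "(real \<Rightarrow> real) \<Rightarrow> real \<Rightarrow> (real^'n) spatial_domain \<Rightarrow> real \<Rightarrow>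
     (real \<Rightarrow> real^'n \<Rightarrow> real) \<Rightarrow> (real \<Rightarrow> real^'n \<Rightarrow> real) \<Rightarrow>
     (real \<Rightarrow> (real^'n \<Rightarrow> real) \<Rightarrow> real) \<Rightarrow> (real \<Rightarrow> real^'n \<Rightarrow> real) \<Rightarrow> real" where
  "integral_dt_f_mollified_g \<eta> T D \<epsilon> \<phi> f F g =
     (LINT t|lebesgue_on {\<epsilon><..<T - \<epsilon>}. F t (\<lambda>x. mollify \<eta> T \<epsilon> g t x * \<phi> t x)) +
     (LINT t|lebesgue_on {\<epsilon><..<T - \<epsilon>}. LINT x|space_measure D.
        \<phi> t x * f t x * deriv (\<lambda>\<tau>. mollify \<eta> T \<epsilon> g \<tau> x) t)"

definition integral_dt_mollified_fg ::
    "(real \<Rightarrow> real) \<Rightarrow> real \<Rightarrow> (real^'n) spatial_domain \<Rightarrow> real \<Rightarrow>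
     (real \<Rightarrow> real^'n \<Rightarrow> real) \<Rightarrow> (real \<Rightarrow> real^'n \<Rightarrow> real) \<Rightarrow> (real \<Rightarrow> real^'n \<Rightarrow> real) \<Rightarrow> real" where
  "integral_dt_mollified_fg \<eta> T D \<epsilon> \<phi> f g =
     (LINT t|lebesgue_on {\<epsilon><..<T - \<epsilon>}. LINT x|space_measure D.
        \<phi> t x * deriv (\<lambda>\<tau>. mollify \<eta> T \<epsilon> (\<lambda>s y. f s y * g s y) \<tau> x) t)"

end

theory Submission
  imports Defs
begin

text \<open>The time derivative of a mollification falls on the kernel, so that, with \<open>k = \<eta>\<^sub>\<epsilon>\<close> and \<open>F = \<partial>\<^sub>t f\<close>, the quantity
  in question is the integral over \<open>t\<close> of
  \<open>\<integral> k'(t - s) \<langle>f(s) - f(t), \<phi>(t) g(s)\<rangle> ds - \<langle>F(t), \<phi>(t) g\<^sub>\<epsilon>(t)\<rangle>\<close>.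
  Here \<open>k'\<close> is of size \<open>1/\<epsilon>\<^sup>2\<close> on an interval of length \<open>2\<epsilon>\<close>. What saves a factor \<open>\<epsilon>\<close> is the identity
  \<open>\<langle>f(s) - f(t), w\<rangle> = \<integral>\<^sub>t\<^sup>s \<langle>F(r), w\<rangle> dr\<close> for \<open>w = \<phi>(t) g(s)\<close>, which lies in \<open>W\<^sub>0\<^sup>1\<^sup>,\<^sup>r\<close> with \<open>r\<close> the exponent conjugate to
  \<open>q1\<close> (lemmas \<open>W1_0_times_W1\<close> and \<open>weak_increment_product\<close>). Hence both terms are bounded, uniformly in \<open>\<epsilon>\<close>, by the
  product of the Bochner norms of \<open>\<phi>\<close>, \<open>g\<close> and \<open>F\<close>: Hoelder's inequality in time is applied to three factors, some of which have
  been averaged over a window of width \<open>\<epsilon>\<close>, an operation that does not increase \<open>L\<^sup>p\<close> norms.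

  Because of this uniform bound, \<open>\<phi>\<close> and \<open>g\<close> may be replaced by simple functions of time with values in \<open>W\<^sub>0\<^sup>1\<^sup>,\<^sup>q\<close> and
  \<open>W\<^sup>1\<^sup>,\<^sup>q\<close> (lemma \<open>pointwise_bound\<close>); this is where the time exponents of \<open>\<phi>\<close> and \<open>g\<close> have to be finite. For simple functions
  only the scalar functions \<open>H(t) = \<langle>F(t), ab\<rangle>\<close> matter, with \<open>a\<close>, \<open>b\<close> values of \<open>\<phi>\<close>, \<open>g\<close>, and the commutator at time \<open>t\<close> is a
  finite sum of terms
  \<open>\<integral> \<chi>(s) (k'(t - s) \<integral>\<^sub>t\<^sup>s H(r) dr - k(t - s) H(t)) ds\<close>, where \<open>\<chi>\<close> is the indicator of \<open>{g = b}\<close>. If \<open>H\<close> and \<open>H\<chi>\<close> are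
  constant near \<open>t\<close> this vanishes, since \<open>(s - t) k'(t - s) - k(t - s)\<close> is the \<open>s\<close>-derivative of \<open>(t - s) k(t - s)\<close>.
  In general it is bounded by the mean oscillations of \<open>H\<close> and \<open>H\<chi>\<close> at scale \<open>\<epsilon>\<close> (lemma \<open>scalar_commutator_bound\<close>),
  which tend to \<open>0\<close> in \<open>L\<^sup>1\<close>.

  Most of the preparation concerns the function spaces. On the torus and on a bounded domain, mollification in space with an
  adapted kernel shows that weak gradients are unique and that the product of a Sobolev function with a test function is
  again a limit of test functions; this gives the product rule. Elements of Bochner spaces are only defined up to null sets, and the null sets of
  times at which an identity fails depend on the test function \<open>w\<close>; separability of the range of a strongly measurable
  function removes this dependence. Finally, the pointwise mollification \<open>g\<^sub>\<epsilon>(t)\<close> has to be identified with a Bochner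
  integral, in order that it can be inserted into \<open>F(t)\<close>.
  In the lemmas the scale \<open>\<epsilon>\<close> is called \<open>eps\<close>.\<close>

section \<open>Lebesgue spaces\<close>

text \<open>The unqualified names of these rules denote their analogues for the gauge integral.\<close>

lemmas Lintegrable_add = Bochner_Integration.integrable_add
lemmas Lintegrable_bound = Bochner_Integration.integrable_bound
lemmas Lintegrable_cong = Bochner_Integration.integrable_cong
lemmas Lintegrable_cong_AE_imp = Bochner_Integration.integrable_cong_AE_imp
lemmas Lintegrable_diff = Bochner_Integration.integrable_diff
lemmas Lintegrable_sum = Bochner_Integration.integrable_sum
lemmas Lintegral_add = Bochner_Integration.integral_add
lemmas Lintegral_cong = Bochner_Integration.integral_cong
lemmas Lintegral_diff = Bochner_Integration.integral_diff
lemmas Lintegral_nonneg = Bochner_Integration.integral_nonneg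
lemmas Lintegral_sum = Bochner_Integration.integral_sum

lemma Lp_ennreal:
  assumes "0 < p"
  shows "u \<in> Lp M (ennreal p) \<longleftrightarrow> u \<in> borel_measurable M \<and> integrable M (%x. \<bar>u x\<bar> powr p)"
  using assms by (simp add: Lp_def)

lemma Lp_norm_ennreal:
  assumes "0 < p"
  shows "Lp_norm M (ennreal p) u = (LINT x|M. \<bar>u x\<bar> powr p) powr (1 / p)"
  using assms by (simp add: Lp_norm_def)

lemma Lp_measurable [measurable_dest]: "u \<in> Lp M p ==> u \<in> borel_measurable M"
  by (simp add: Lp_def)

lemma Lp_norm_nonneg: "0 < p ==> 0 <= Lp_norm M (ennreal p) u"
  by (simp add: Lp_norm_ennreal)

lemma Lp_norm_powr:
  assumes "0 < p"
  shows "Lp_norm M (ennreal p) u powr p = (LINT x|M. \<bar>u x\<bar> powr p)"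
proof -
  have "0 <= (LINT x|M. \<bar>u x\<bar> powr p)" by (rule Lintegral_nonneg) auto
  then show ?thesis using assms by (simp add: Lp_norm_ennreal powr_powr)
qed

lemma Lp_norm_le_iff:
  assumes "0 < p" "0 <= c"
  shows "Lp_norm M (ennreal p) u <= c \<longleftrightarrow> (LINT x|M. \<bar>u x\<bar> powr p) <= c powr p"
  using assms powr_mono_both[of p p] 
  by (metis Lp_norm_nonneg Lp_norm_powr linorder_not_le nle_le powr_less_mono2 powr_mono2 order_less_imp_le)

lemma Lp_norm_cong_AE:
  assumes "0 < p" "u \<in> borel_measurable M" "v \<in> borel_measurable M" "AE x in M. u x = v x"
  shows "Lp_norm M (ennreal p) u = Lp_norm M (ennreal p) v"
proof -
  have "(LINT x|M. \<bar>u x\<bar> powr p) = (LINT x|M. \<bar>v x\<bar> powr p)"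
    using assms(4) by (intro integral_cong_AE) (use assms(2,3) in auto)
  then show ?thesis using assms(1) by (simp add: Lp_norm_ennreal)
qed

lemma Lp_cong_AE:
  assumes "0 < p" "u \<in> Lp M (ennreal p)" "v \<in> borel_measurable M" "AE x in M. u x = v x"
  shows "v \<in> Lp M (ennreal p)"
proof -
  have "integrable M (%x. \<bar>v x\<bar> powr p)"
    by (rule Lintegrable_cong_AE_imp[where g = "%x. \<bar>u x\<bar> powr p"])
       (use assms in \<open>auto simp: Lp_ennreal\<close>)
  then show ?thesis using assms by (simp add: Lp_ennreal)
qed

lemma Lp_norm_zero_AE:
  assumes "0 < p" "u \<in> Lp M (ennreal p)" "Lp_norm M (ennreal p) u = 0"
  shows "AE x in M. u x = 0"
proof -
  have "(LINT x|M. \<bar>u x\<bar> powr p) = 0"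
    using Lp_norm_powr[OF assms(1), of M u] assms by simp
  moreover have "integrable M (%x. \<bar>u x\<bar> powr p)" using assms by (simp add: Lp_ennreal)
  ultimately have "AE x in M. \<bar>u x\<bar> powr p = 0"
    by (subst (asm) integral_nonneg_eq_0_iff_AE) auto
  then show ?thesis by eventually_elim simp
qed

lemma Lp_norm_zero [simp]: "0 < p ==> Lp_norm M (ennreal p) (%x. 0) = 0"
  by (simp add: Lp_norm_ennreal)

lemma Lp_norm_scale:
  assumes "0 < p"
  shows "Lp_norm M (ennreal p) (%x. c * u x) = \<bar>c\<bar> * Lp_norm M (ennreal p) u"
proof -
  have "(LINT x|M. \<bar>c * u x\<bar> powr p) = \<bar>c\<bar> powr p * (LINT x|M. \<bar>u x\<bar> powr p)"
    by (simp add: abs_mult powr_mult)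
  moreover have "0 <= (LINT x|M. \<bar>u x\<bar> powr p)" by (rule Lintegral_nonneg) auto
  ultimately show ?thesis using assms by (simp add: Lp_norm_ennreal powr_mult powr_powr)
qed

lemma Lp_scale:
  assumes "0 < p" "u \<in> Lp M (ennreal p)"
  shows "(%x. c * u x) \<in> Lp M (ennreal p)"
  using assms by (auto simp: Lp_ennreal abs_mult powr_mult)

lemma powr_convex_nonneg:
  fixes a b :: real
  assumes "1 <= p" "0 <= a" "0 <= b" "0 <= t" "t <= 1"
  shows "((1 - t) * a + t * b) powr p <= (1 - t) * a powr p + t * b powr p"
proof -
  have small: "t powr p <= t" if "0 <= t" "t <= 1" for t :: real
    using powr_mono'[of 1 p t] that assms by (cases "t = 0") auto
  consider "a = 0" | "b = 0" | "0 < a" "0 < b" using assms by linarith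
  then show ?thesis
  proof cases
    case 1 then show ?thesis using assms small[of t] by (simp add: powr_mult mult_right_mono)
  next
    case 2 then show ?thesis using assms small[of "1 - t"] by (simp add: powr_mult mult_right_mono)
  next
    case 3 then show ?thesis
      using convex_onD[OF powr_convex[OF assms(1)], of t a b] assms by auto
  qed
qed

text \<open>Convexity in the form that is integrated in the proof of Jensen's inequality below.\<close>

lemma powr_tangent:
  fixes a m :: real
  assumes "1 <= p" "0 <= a" "0 < m"
  shows "m powr p + p * m powr (p - 1) * (a - m) <= a powr p"
proof (cases "a = 0")
  case True
  have "m powr (p - 1) * m = m powr p" using assms by (simp add: powr_mult_base mult.commute)
  moreover have "m powr p <= p * m powr p" using assms by simp
  ultimately show ?thesis using True by (simp add: algebra_simps)
next
  case False
  then have "0 < a" using assms by auto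
  have "((%x. x powr p) has_real_derivative p * m powr (p - 1)) (at m within {0<..})"
    using assms(3) by (auto intro!: derivative_eq_intros)
  then have "a powr p - m powr p \<ge> (p * m powr (p - 1)) * (a - m)"
    by (intro convex_on_imp_above_tangent[OF powr_convex[OF assms(1)]])
       (use \<open>0 < a\<close> assms in \<open>auto simp: interior_open\<close>)
  then show ?thesis by simp
qed

text \<open>This crude form of convexity gives closure of \<open>L\<^sup>p\<close> under sums, before Minkowski's inequality is available.\<close>

lemma powr_sum_le:
  fixes a b :: real
  assumes "1 <= p"
  shows "\<bar>a + b\<bar> powr p <= 2 powr p * (\<bar>a\<bar> powr p + \<bar>b\<bar> powr p)"
proof -
  have "\<bar>a + b\<bar> powr p <= (2 * max \<bar>a\<bar> \<bar>b\<bar>) powr p"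
    using assms by (intro powr_mono2) auto
  also have "... = 2 powr p * (max \<bar>a\<bar> \<bar>b\<bar>) powr p" by (simp add: powr_mult)
  also have "... <= 2 powr p * (\<bar>a\<bar> powr p + \<bar>b\<bar> powr p)"
    by (intro mult_left_mono) (auto simp: max_def)
  finally show ?thesis .
qed

lemma Lp_add:
  assumes p: "1 <= p" and "u \<in> Lp M (ennreal p)" "v \<in> Lp M (ennreal p)"
  shows "(%x. u x + v x) \<in> Lp M (ennreal p)"
proof -
  have [measurable]: "u \<in> borel_measurable M" "v \<in> borel_measurable M"
    using assms by (auto dest: Lp_measurable)
  have "integrable M (%x. 2 powr p * (\<bar>u x\<bar> powr p + \<bar>v x\<bar> powr p))"
    using assms by (auto simp: Lp_ennreal)
  then have "integrable M (%x. \<bar>u x + v x\<bar> powr p)"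
    by (rule Lintegrable_bound) (use powr_sum_le[OF p] in \<open>auto intro!: AE_I2\<close>)
  then show ?thesis using assms by (auto simp: Lp_ennreal)
qed

lemma Lp_diff:
  assumes p: "1 <= p" and "u \<in> Lp M (ennreal p)" "v \<in> Lp M (ennreal p)"
  shows "(%x. u x - v x) \<in> Lp M (ennreal p)"
  using Lp_add[OF p assms(2) Lp_scale[of p v M "-1"]] assms by auto

text \<open>Minkowski's inequality: \<open>|u + v|/(A + B)\<close> is a convex combination of the normalised
  functions \<open>|u|/A\<close> and \<open>|v|/B\<close>.\<close>

lemma Lp_norm_add:
  assumes p: "1 <= p" and u: "u \<in> Lp M (ennreal p)" and v: "v \<in> Lp M (ennreal p)"
  shows "Lp_norm M (ennreal p) (%x. u x + v x) <= Lp_norm M (ennreal p) u + Lp_norm M (ennreal p) v"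
proof -
  have p0: "0 < p" using p by simp
  define a where "a = Lp_norm M (ennreal p) u"
  define b where "b = Lp_norm M (ennreal p) v"
  have nn: "0 <= a" "0 <= b" using Lp_norm_nonneg[OF p0] by (auto simp: a_def b_def)
  have [measurable]: "u \<in> borel_measurable M" "v \<in> borel_measurable M"
    using assms by (auto dest: Lp_measurable)
  consider "a = 0" | "b = 0" | "0 < a" "0 < b" using nn by linarith
  then show ?thesis
  proof cases
    case 1
    then have "AE x in M. u x = 0" using Lp_norm_zero_AE[OF p0 u] a_def by simp
    then have "Lp_norm M (ennreal p) (%x. u x + v x) = Lp_norm M (ennreal p) v"
      by (intro Lp_norm_cong_AE[OF p0]) auto
    then show ?thesis using 1 by (simp add: a_def)
  next
    case 2
    then have "AE x in M. v x = 0" using Lp_norm_zero_AE[OF p0 v] b_def by simp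
    then have "Lp_norm M (ennreal p) (%x. u x + v x) = Lp_norm M (ennreal p) u"
      by (intro Lp_norm_cong_AE[OF p0]) auto
    then show ?thesis using 2 by (simp add: b_def)
  next
    case 3
    define t where "t = b / (a + b)"
    have t: "0 <= t" "t <= 1" "1 - t = a / (a + b)" using 3 by (auto simp: t_def field_simps)
    have pt: "\<bar>u x + v x\<bar> powr p <=
        (a + b) powr p * ((1 - t) * (\<bar>u x\<bar> powr p / a powr p) + t * (\<bar>v x\<bar> powr p / b powr p))" for x
    proof -
      have "\<bar>u x + v x\<bar> powr p <= (\<bar>u x\<bar> + \<bar>v x\<bar>) powr p" using p by (intro powr_mono2) auto
      also have "\<bar>u x\<bar> + \<bar>v x\<bar> = (a + b) * ((1 - t) * (\<bar>u x\<bar> / a) + t * (\<bar>v x\<bar> / b))"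
      proof -
        have "(a + b) * (1 - t) = a" "(a + b) * t = b" using 3 t by (simp_all add: t_def)
        then have "(a + b) * ((1 - t) * (\<bar>u x\<bar> / a)) = a * (\<bar>u x\<bar> / a)"
          "(a + b) * (t * (\<bar>v x\<bar> / b)) = b * (\<bar>v x\<bar> / b)"
          by (metis mult.assoc)+
        then show ?thesis using 3 by (simp add: distrib_left)
      qed
      also have "... powr p = (a + b) powr p * ((1 - t) * (\<bar>u x\<bar> / a) + t * (\<bar>v x\<bar> / b)) powr p"
        by (simp add: powr_mult)
      also have "... <= (a + b) powr p * ((1 - t) * (\<bar>u x\<bar> / a) powr p + t * (\<bar>v x\<bar> / b) powr p)"
        using 3 t by (intro mult_left_mono powr_convex_nonneg[OF p]) auto
      finally show ?thesis using 3 by (simp add: powr_divide)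
    qed
    have iu: "integrable M (%x. \<bar>u x\<bar> powr p)" and iv: "integrable M (%x. \<bar>v x\<bar> powr p)"
      using u v p0 by (auto simp: Lp_ennreal)
    have "(LINT x|M. \<bar>u x + v x\<bar> powr p) <= (LINT x|M. (a + b) powr p *
        ((1 - t) * (\<bar>u x\<bar> powr p / a powr p) + t * (\<bar>v x\<bar> powr p / b powr p)))"
      using Lp_add[OF assms] p0 iu iv pt by (intro integral_mono) (auto simp: Lp_ennreal)
    also have "... = (a + b) powr p * ((1 - t) * ((LINT x|M. \<bar>u x\<bar> powr p) / a powr p) +
        t * ((LINT x|M. \<bar>v x\<bar> powr p) / b powr p))"
      using iu iv by simp
    also have "... = (a + b) powr p"
    proof -
      have "(LINT x|M. \<bar>u x\<bar> powr p) = a powr p" "(LINT x|M. \<bar>v x\<bar> powr p) = b powr p"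
        using Lp_norm_powr[OF p0, of M u] Lp_norm_powr[OF p0, of M v] by (simp_all add: a_def b_def)
      moreover have "a powr p / a powr p = 1" "b powr p / b powr p = 1" using 3 by auto
      ultimately show ?thesis by simp
    qed
    finally show ?thesis using nn by (simp add: Lp_norm_le_iff[OF p0] flip: a_def b_def)
  qed
qed

lemma Lp_norm_minus: "0 < p ==> Lp_norm M (ennreal p) (%x. v x - u x) = Lp_norm M (ennreal p) (%x. u x - v x)"
  by (simp add: Lp_norm_ennreal abs_minus_commute)

lemma Lp_norm_triangle:
  assumes p: "1 <= p" and "u \<in> Lp M (ennreal p)" "v \<in> Lp M (ennreal p)" "w \<in> Lp M (ennreal p)"
  shows "Lp_norm M (ennreal p) (%x. u x - w x) <=
    Lp_norm M (ennreal p) (%x. u x - v x) + Lp_norm M (ennreal p) (%x. v x - w x)"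
  using Lp_norm_add[OF p Lp_diff[OF p assms(2,3)] Lp_diff[OF p assms(3,4)]] by simp

lemma Lp_norm_mono:
  assumes p: "0 < p" and v: "v \<in> Lp M (ennreal p)" and u: "u \<in> borel_measurable M"
    and le: "AE x in M. \<bar>u x\<bar> <= \<bar>v x\<bar>"
  shows "u \<in> Lp M (ennreal p)" "Lp_norm M (ennreal p) u <= Lp_norm M (ennreal p) v"
proof -
  have le': "AE x in M. \<bar>u x\<bar> powr p <= \<bar>v x\<bar> powr p"
    using le by eventually_elim (use p in \<open>auto intro: powr_mono2\<close>)
  have iv: "integrable M (%x. \<bar>v x\<bar> powr p)" using v p by (simp add: Lp_ennreal)
  have iu: "integrable M (%x. \<bar>u x\<bar> powr p)"
    by (rule Lintegrable_bound[OF iv]) (use u le' in auto)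
  then show "u \<in> Lp M (ennreal p)" using u p by (simp add: Lp_ennreal)
  have "(LINT x|M. \<bar>u x\<bar> powr p) <= (LINT x|M. \<bar>v x\<bar> powr p)"
    by (intro integral_mono_AE iu iv le')
  then show "Lp_norm M (ennreal p) u <= Lp_norm M (ennreal p) v"
    using p by (simp add: Lp_norm_ennreal powr_mono2 Lintegral_nonneg)
qed

text \<open>Hoelder's inequality in the form \<open>\<parallel>uv\<parallel>\<^sub>r <= \<parallel>u\<parallel>\<^sub>p \<parallel>v\<parallel>\<^sub>q\<close>, from Young's inequality for the
  normalised functions.\<close>

lemma Lp_mult:
  assumes pqr: "0 < p" "0 < q" "0 < r" "1 / r = 1 / p + 1 / q"
    and u: "u \<in> Lp M (ennreal p)" and v: "v \<in> Lp M (ennreal q)"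
  shows "(%x. u x * v x) \<in> Lp M (ennreal r)" (is ?A)
    and "Lp_norm M (ennreal r) (%x. u x * v x) <= Lp_norm M (ennreal p) u * Lp_norm M (ennreal q) v" (is ?B)
proof -
  have [measurable]: "u \<in> borel_measurable M" "v \<in> borel_measurable M"
    using assms by (auto dest: Lp_measurable)
  have young: "(s * t) powr r <= (r / p) * s powr p + (r / q) * t powr q" if "0 <= s" "0 <= t" for s t :: real
  proof (cases "s = 0 \<or> t = 0")
    case False
    have "r / p + r / q = 1"
      using arg_cong[OF pqr(4), of "%z. r * z"] pqr(1-3) by (simp add: ring_distribs)
    then have "(s powr p) powr (r/p) * (t powr q) powr (r/q) <= (r/p) * s powr p + (r/q) * t powr q"
      using pqr False that by (intro Youngs_inequality_0) auto
    then show ?thesis using False that pqr by (simp add: powr_powr powr_mult)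
  next
    case True
    then show ?thesis using pqr by auto
  qed
  have iu: "integrable M (%x. \<bar>u x\<bar> powr p)" and iv: "integrable M (%x. \<bar>v x\<bar> powr q)"
    using u v pqr by (auto simp: Lp_ennreal)
  have int: "integrable M (%x. (r / p) * \<bar>u x\<bar> powr p + (r / q) * \<bar>v x\<bar> powr q)"
    using iu iv by auto
  have iuv: "integrable M (%x. \<bar>u x * v x\<bar> powr r)"
  proof (rule Lintegrable_bound[OF int])
    show "AE x in M. norm (\<bar>u x * v x\<bar> powr r) <= norm ((r / p) * \<bar>u x\<bar> powr p + (r / q) * \<bar>v x\<bar> powr q)"
      using young[of "\<bar>u x\<bar>" "\<bar>v x\<bar>" for x]
      by (intro AE_I2) (auto simp: abs_mult intro: order.trans[OF _ abs_ge_self])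
  qed auto
  then show ?A using pqr by (simp add: Lp_ennreal)
  define a where "a = Lp_norm M (ennreal p) u"
  define b where "b = Lp_norm M (ennreal q) v"
  have nn: "0 <= a" "0 <= b" using Lp_norm_nonneg pqr by (auto simp: a_def b_def)
  consider "a = 0" | "b = 0" | "0 < a" "0 < b" using nn by linarith
  then show ?B
  proof cases
    case 1
    then have "AE x in M. u x = 0" using Lp_norm_zero_AE[OF _ u] pqr a_def by simp
    then have "Lp_norm M (ennreal r) (%x. u x * v x) = Lp_norm M (ennreal r) (%x. 0)"
      by (intro Lp_norm_cong_AE) (use pqr in auto)
    then show ?thesis using nn pqr by (simp flip: a_def b_def)
  next
    case 2
    then have "AE x in M. v x = 0" using Lp_norm_zero_AE[OF _ v] pqr b_def by simp
    then have "Lp_norm M (ennreal r) (%x. u x * v x) = Lp_norm M (ennreal r) (%x. 0)"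
      by (intro Lp_norm_cong_AE) (use pqr in auto)
    then show ?thesis using nn pqr by (simp flip: a_def b_def)
  next
    case 3
    have sum1: "r / p + r / q = 1"
      using arg_cong[OF pqr(4), of "%z. r * z"] pqr(1-3) by (simp add: ring_distribs)
    have "\<bar>u x * v x\<bar> powr r <= (a * b) powr r * ((r / p) * (\<bar>u x\<bar> powr p / a powr p) +
       (r / q) * (\<bar>v x\<bar> powr q / b powr q))" for x
    proof -
      have "\<bar>u x * v x\<bar> powr r = (a * b) powr r * ((\<bar>u x\<bar> / a) * (\<bar>v x\<bar> / b)) powr r"
        using 3 by (simp add: powr_mult powr_divide abs_mult)
      also have "... <= (a * b) powr r * ((r / p) * (\<bar>u x\<bar> / a) powr p + (r / q) * (\<bar>v x\<bar> / b) powr q)"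
        using 3 by (intro mult_left_mono young) auto
      finally show ?thesis using 3 by (simp add: powr_divide)
    qed
    then have "(LINT x|M. \<bar>u x * v x\<bar> powr r) <= (LINT x|M. (a * b) powr r *
        ((r / p) * (\<bar>u x\<bar> powr p / a powr p) + (r / q) * (\<bar>v x\<bar> powr q / b powr q)))"
      using iuv iu iv by (intro integral_mono) auto
    also have "... = (a * b) powr r * ((r / p) * ((LINT x|M. \<bar>u x\<bar> powr p) / a powr p) +
       (r / q) * ((LINT x|M. \<bar>v x\<bar> powr q) / b powr q))"
      using iu iv by simp
    also have "... = (a * b) powr r"
    proof -
      have "(LINT x|M. \<bar>u x\<bar> powr p) = a powr p" "(LINT x|M. \<bar>v x\<bar> powr q) = b powr q"
        using Lp_norm_powr[OF pqr(1), of M u] Lp_norm_powr[OF pqr(2), of M v] by (simp_all add: a_def b_def)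
      moreover have "a powr p / a powr p = 1" "b powr q / b powr q = 1" using 3 by auto
      ultimately show ?thesis using sum1 by (simp only: mult_1_right)
    qed
    finally show ?thesis using nn by (simp add: Lp_norm_le_iff[OF pqr(3)] flip: a_def b_def)
  qed
qed

text \<open>The exponents of \<open>\<phi>\<close>, \<open>g\<close> and of their product are finite and handled as real numbers, while those of \<open>f\<close> and \<open>F\<close>
  may be infinite; this is why the two conjugate exponents have different types.\<close>

definition conjugate_exponents :: "real => ennreal => bool" where
  "conjugate_exponents r s \<longleftrightarrow> 1 <= r \<and>
     (s = \<infinity> \<and> r = 1 \<or> (\<exists>s'. s = ennreal s' \<and> 1 <= s' \<and> 1 / r + 1 / s' = 1))"

lemma Lp_infinity_AE:
  assumes "u \<in> Lp M \<infinity>"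
  shows "AE x in M. \<bar>u x\<bar> <= Lp_norm M \<infinity> u"
proof -
  have fin: "esssup M (%x. ereal \<bar>u x\<bar>) < \<infinity>" using assms by (simp add: Lp_def)
  have "AE x in M. ereal \<bar>u x\<bar> <= esssup M (%x. ereal \<bar>u x\<bar>)" by (rule esssup_AE)
  then show ?thesis
  proof eventually_elim
    case (elim x)
    with fin show ?case
      by (cases "esssup M (%x. ereal \<bar>u x\<bar>)") (auto simp: Lp_norm_def)
  qed
qed

lemma Lp_norm_nonneg_conj: "conjugate_exponents r s ==> 0 <= Lp_norm M s f"
proof (cases "s = \<infinity>")
  case True
  have "0 <= real_of_ereal (esssup M (%x. ereal \<bar>f x\<bar>))"
  proof (cases "(%x. ereal \<bar>f x\<bar>) \<in> borel_measurable M \<and> emeasure M (space M) ~= 0")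
    case True
    then have "esssup M (%x. 0 :: ereal) <= esssup M (%x. ereal \<bar>f x\<bar>)"
      by (intro esssup_mono) auto
    then show ?thesis using True esssup_const[of M "0::ereal"] by (simp add: real_of_ereal_pos)
  next
    case False
    then show ?thesis
      using esssup_zero_space[of M "%x. ereal \<bar>f x\<bar>"] esssup_non_measurable[of "%x. ereal \<bar>f x\<bar>" M]
      by (cases "(%x. ereal \<bar>f x\<bar>) \<in> borel_measurable M") (auto simp: top_ereal_def)
  qed
  then show ?thesis using True by (simp add: Lp_norm_def)
qed (auto simp: Lp_norm_def)

lemma Lp_mult_conjugate:
  assumes c: "conjugate_exponents r s" and w: "w \<in> Lp M (ennreal r)" and f: "f \<in> Lp M s"
  shows "integrable M (%x. w x * f x)"
    and "(LINT x|M. \<bar>w x * f x\<bar>) <= Lp_norm M (ennreal r) w * Lp_norm M s f"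
proof -
  have [measurable]: "w \<in> borel_measurable M" "f \<in> borel_measurable M"
    using assms by (auto dest: Lp_measurable)
  have "integrable M (%x. w x * f x) \<and> (LINT x|M. \<bar>w x * f x\<bar>) <= Lp_norm M (ennreal r) w * Lp_norm M s f"
  proof (cases "s = \<infinity>")
    case True
    then have r: "r = 1" using c by (auto simp: conjugate_exponents_def)
    have iw: "integrable M w" using w r Lp_ennreal[of 1 w M] by (simp add: integrable_abs_iff)
    have "AE x in M. \<bar>f x\<bar> <= Lp_norm M s f" using Lp_infinity_AE f True by auto
    then have le: "AE x in M. \<bar>w x * f x\<bar> <= \<bar>w x\<bar> * Lp_norm M s f"
      by eventually_elim (auto simp: abs_mult intro: mult_left_mono)
    have i: "integrable M (%x. w x * f x)"
      by (rule Lintegrable_bound[where f = "%x. \<bar>w x\<bar> * Lp_norm M s f"])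
         (use iw le in auto)
    have "(LINT x|M. \<bar>w x * f x\<bar>) <= (LINT x|M. \<bar>w x\<bar> * Lp_norm M s f)"
      using le iw i by (intro integral_mono_AE) auto
    also have "... = Lp_norm M (ennreal r) w * Lp_norm M s f"
      using r Lp_norm_ennreal[of 1 M w] by (simp add: Lintegral_nonneg)
    finally show ?thesis using i by simp
  next
    case False
    then obtain s' where s: "s = ennreal s'" "1 <= s'" "1 / r + 1 / s' = 1" "1 <= r"
      using c by (auto simp: conjugate_exponents_def)
    have "(%x. w x * f x) \<in> Lp M (ennreal 1)"
      "Lp_norm M (ennreal 1) (%x. w x * f x) <= Lp_norm M (ennreal r) w * Lp_norm M (ennreal s') f"
      using s w f Lp_mult[of r s' 1 w M f] by auto
    then show ?thesis using s Lp_ennreal[of 1 "%x. w x * f x" M] Lp_norm_ennreal[of 1 M]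
      by (simp add: integrable_abs_iff Lintegral_nonneg)
  qed
  then show "integrable M (%x. w x * f x)"
    and "(LINT x|M. \<bar>w x * f x\<bar>) <= Lp_norm M (ennreal r) w * Lp_norm M s f" by auto
qed

text \<open>The form in which the relation between the three exponents enters, once in space and once in time.\<close>

lemma triple_Hoelder:
  assumes c: "conjugate_exponents r s" and pq: "1 <= p" "1 <= q" "1 / r = 1 / p + 1 / q"
    and u: "u \<in> Lp M (ennreal p)" and v: "v \<in> Lp M (ennreal q)" and f: "f \<in> Lp M s"
  shows "integrable M (%x. u x * v x * f x)"
    and "(LINT x|M. \<bar>u x * v x * f x\<bar>) <= Lp_norm M (ennreal p) u * Lp_norm M (ennreal q) v * Lp_norm M s f"
proof -
  have r: "0 < r" using c by (auto simp: conjugate_exponents_def)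
  note m = Lp_mult[OF _ _ r pq(3) u v]
  show "integrable M (%x. u x * v x * f x)" using Lp_mult_conjugate(1)[OF c m(1) f] pq by auto
  have "(LINT x|M. \<bar>u x * v x * f x\<bar>) <= Lp_norm M (ennreal r) (%x. u x * v x) * Lp_norm M s f"
    using Lp_mult_conjugate(2)[OF c m(1) f] pq by auto
  also have "... <= Lp_norm M (ennreal p) u * Lp_norm M (ennreal q) v * Lp_norm M s f"
    using m(2) pq Lp_norm_nonneg_conj[OF c] by (intro mult_right_mono) auto
  finally show "(LINT x|M. \<bar>u x * v x * f x\<bar>) <=
    Lp_norm M (ennreal p) u * Lp_norm M (ennreal q) v * Lp_norm M s f" .
qed

lemma Lp_subset_finite_measure:
  assumes "finite_measure M" "0 < r" "r <= q" "u \<in> Lp M (ennreal q)"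
  shows "u \<in> Lp M (ennreal r)"
proof -
  interpret finite_measure M by fact
  have [measurable]: "u \<in> borel_measurable M" using assms by (auto dest: Lp_measurable)
  have i: "integrable M (%x. 1 + \<bar>u x\<bar> powr q)" using assms by (auto simp: Lp_ennreal)
  have "\<bar>u x\<bar> powr r <= 1 + \<bar>u x\<bar> powr q" for x
  proof (cases "\<bar>u x\<bar> <= 1")
    case True
    then have "\<bar>u x\<bar> powr r <= 1" using assms powr_le1[of r "\<bar>u x\<bar>"] by auto
    then show ?thesis by (smt (verit) powr_ge_zero)
  next
    case False
    then have "\<bar>u x\<bar> powr r <= \<bar>u x\<bar> powr q" using assms by (intro powr_mono) auto
    then show ?thesis by simp
  qed
  then have "integrable M (%x. \<bar>u x\<bar> powr r)"
    by (intro Lintegrable_bound[OF i]) (auto intro!: AE_I2 order.trans[OF _ abs_ge_self])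
  then show ?thesis using assms by (simp add: Lp_ennreal)
qed

lemma Lp_L1_bound:
  assumes "finite_measure M" "1 <= q"
  obtains C where "0 <= C"
    "\<And>u. u \<in> Lp M (ennreal q) ==> integrable M u \<and> (LINT x|M. \<bar>u x\<bar>) <= C * Lp_norm M (ennreal q) u"
proof -
  interpret finite_measure M by fact
  have ex: "\<exists>s. conjugate_exponents q s \<and> (%x. 1) \<in> Lp M s"
  proof (cases "q = 1")
    case True
    have "esssup M (%x. 1 :: ereal) <= 1" by (rule esssup_I) auto
    then have "(%x. 1) \<in> Lp M \<infinity>" by (auto simp: Lp_def one_ereal_def[symmetric])
    then show ?thesis using True by (auto simp: conjugate_exponents_def)
  next
    case False
    then have "1 < q" using assms by auto
    then have "1 / q + 1 / (q / (q - 1)) = 1" by (simp add: field_simps)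
    moreover have "1 <= q / (q - 1)" using \<open>1 < q\<close> by simp
    ultimately have "conjugate_exponents q (ennreal (q / (q - 1)))"
      unfolding conjugate_exponents_def using assms by blast
    moreover have "(%x. 1) \<in> Lp M (ennreal (q / (q - 1)))"
      using \<open>1 < q\<close> by (auto simp: Lp_ennreal)
    ultimately show ?thesis by auto
  qed
  then obtain s where s: "conjugate_exponents q s" "(%x. 1) \<in> Lp M s" by auto
  show ?thesis
  proof (rule that[of "Lp_norm M s (%x. 1)"])
    show "0 <= Lp_norm M s (%x. 1)" using Lp_norm_nonneg_conj[OF s(1)] .
    fix u assume "u \<in> Lp M (ennreal q)"
    from Lp_mult_conjugate[OF s(1) this s(2)]
    show "integrable M u \<and> (LINT x|M. \<bar>u x\<bar>) <= Lp_norm M s (%x. 1) * Lp_norm M (ennreal q) u"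
      by (simp add: mult.commute)
  qed
qed

text \<open>Fatou's lemma: almost everywhere convergence together with a norm bound suffices for membership of the limit.\<close>

lemma Lp_Fatou:
  assumes p: "0 < p" and u: "\<And>k. u k \<in> Lp M (ennreal p)" and w: "w \<in> borel_measurable M"
    and lim: "AE x in M. (%k. u k x) \<longlonglongrightarrow> w x"
    and bd: "\<And>k. Lp_norm M (ennreal p) (u k) <= c"
  shows "w \<in> Lp M (ennreal p)" "Lp_norm M (ennreal p) w <= c"
proof -
  have [measurable]: "u k \<in> borel_measurable M" for k using u by (auto dest: Lp_measurable)
  note w[measurable]
  have c: "0 <= c" using bd[of 0] Lp_norm_nonneg[OF p, of M "u 0"] by simp
  have ik: "integrable M (%x. \<bar>u k x\<bar> powr p)" for k using u p by (simp add: Lp_ennreal)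
  have "AE x in M. ennreal (\<bar>w x\<bar> powr p) = liminf (%k. ennreal (\<bar>u k x\<bar> powr p))"
    using lim
  proof eventually_elim
    case (elim x)
    have "(%k. ennreal (\<bar>u k x\<bar> powr p)) \<longlonglongrightarrow> ennreal (\<bar>w x\<bar> powr p)"
      using elim p by (intro tendsto_ennrealI tendsto_powr2 tendsto_rabs tendsto_const) auto
    then show ?case by (rule lim_imp_Liminf[symmetric, rotated]) simp
  qed
  then have "(\<integral>\<^sup>+x. ennreal (\<bar>w x\<bar> powr p) \<partial>M) = (\<integral>\<^sup>+x. liminf (%k. ennreal (\<bar>u k x\<bar> powr p)) \<partial>M)"
    by (rule nn_integral_cong_AE)
  also have "... <= liminf (%k. \<integral>\<^sup>+x. ennreal (\<bar>u k x\<bar> powr p) \<partial>M)"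
    by (rule nn_integral_liminf) auto
  also have "... <= liminf (%k. ennreal (c powr p))"
  proof (intro Liminf_mono always_eventually allI)
    fix k
    have "(LINT x|M. \<bar>u k x\<bar> powr p) <= c powr p" using bd[of k] c p by (simp add: Lp_norm_le_iff)
    then show "(\<integral>\<^sup>+x. ennreal (\<bar>u k x\<bar> powr p) \<partial>M) <= ennreal (c powr p)"
      by (subst nn_integral_eq_integral[OF ik]) auto
  qed
  also have "... = ennreal (c powr p)" by (rule Liminf_const) simp
  finally have le: "(\<integral>\<^sup>+x. ennreal (\<bar>w x\<bar> powr p) \<partial>M) <= ennreal (c powr p)" .
  then have i: "integrable M (%x. \<bar>w x\<bar> powr p)"
    by (intro integrableI_bounded) (auto simp: less_top[symmetric] top_unique order_le_less_trans)
  then show "w \<in> Lp M (ennreal p)" using p by (simp add: Lp_ennreal)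
  have "ennreal (LINT x|M. \<bar>w x\<bar> powr p) <= ennreal (c powr p)"
    using le by (subst (asm) nn_integral_eq_integral[OF i]) auto
  then show "Lp_norm M (ennreal p) w <= c" using p c by (simp add: Lp_norm_le_iff)
qed

text \<open>Completeness of \<open>L\<^sup>p\<close>, for finite measures: a sufficiently fast subsequence converges
  absolutely almost everywhere, because its increments are summable in \<open>L\<^sup>1\<close>; Fatou's lemma then
  identifies the pointwise limit as the limit in \<open>L\<^sup>p\<close>.\<close>

lemma Lp_complete:
  assumes fin: "finite_measure M" and p: "1 <= p" and u: "\<And>k. u k \<in> Lp M (ennreal p)"
    and cauchy: "\<And>e. 0 < e ==> \<exists>N. \<forall>k\<ge>N. \<forall>l\<ge>N. Lp_norm M (ennreal p) (%x. u k x - u l x) <= e"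
  obtains w where "w \<in> Lp M (ennreal p)" "(%k. Lp_norm M (ennreal p) (%x. u k x - w x)) \<longlonglongrightarrow> 0"
proof -
  interpret finite_measure M by fact
  have p0: "0 < p" using p by simp
  have [measurable]: "u k \<in> borel_measurable M" for k using u by (auto dest: Lp_measurable)
  obtain C where C: "0 <= C" "\<And>u. u \<in> Lp M (ennreal p) ==> integrable M u \<and>
      (LINT x|M. \<bar>u x\<bar>) <= C * Lp_norm M (ennreal p) u"
    using Lp_L1_bound[OF fin p] by blast
  have "\<exists>N. \<forall>j. \<forall>k\<ge>N j. \<forall>l\<ge>N j. Lp_norm M (ennreal p) (%x. u k x - u l x) <= (1/2)^j"
    by (rule choice) (use cauchy in auto)
  then obtain N where N: "\<And>j k l. N j <= k ==> N j <= l ==>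
      Lp_norm M (ennreal p) (%x. u k x - u l x) <= (1/2)^j" by blast
  define r where "r j = Max (N ` {..Suc j}) + j" for j
  have rN: "N j <= r j" "N j <= r (Suc j)" and rj: "j <= r j" for j
  proof -
    have "N j <= Max (N ` {..Suc j})" "N j <= Max (N ` {..Suc (Suc j)})" by (auto intro!: Max_ge)
    then show "N j <= r j" "N j <= r (Suc j)" "j <= r j" unfolding r_def by linarith+
  qed
  define d where "d j x = u (r (Suc j)) x - u (r j) x" for j x
  have d: "d j \<in> Lp M (ennreal p)" "Lp_norm M (ennreal p) (d j) <= (1/2)^j" for j
    using Lp_diff[OF p u u] N[OF rN(2) rN(1)] unfolding d_def by blast+
  have [measurable]: "d j \<in> borel_measurable M" for j using d by (auto dest: Lp_measurable)
  have "(\<integral>\<^sup>+x. ennreal \<bar>d j x\<bar> \<partial>M) <= ennreal (C * (1/2)^j)" for j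
  proof -
    have "(\<integral>\<^sup>+x. ennreal \<bar>d j x\<bar> \<partial>M) = ennreal (LINT x|M. \<bar>d j x\<bar>)"
      using C(2)[OF d(1)] by (intro nn_integral_eq_integral) auto
    also have "... <= ennreal (C * (1/2)^j)"
      using C d[of j] by (intro ennreal_leI) (meson mult_left_mono order.trans)
    finally show ?thesis .
  qed
  then have "(\<Sum>j. \<integral>\<^sup>+x. ennreal \<bar>d j x\<bar> \<partial>M) <= (\<Sum>j. ennreal (C * (1/2)^j))"
    by (intro suminf_le) auto
  also have "... = ennreal (\<Sum>j. C * (1/2)^j)"
    using C(1) by (intro suminf_ennreal2 summable_mult summable_geometric) auto
  also have "... < \<infinity>" by simp
  finally have "(\<integral>\<^sup>+x. (\<Sum>j. ennreal \<bar>d j x\<bar>) \<partial>M) < \<infinity>"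
    by (subst nn_integral_suminf) auto
  then have "AE x in M. (\<Sum>j. ennreal \<bar>d j x\<bar>) ~= \<infinity>"
    by (intro nn_integral_PInf_AE) auto
  then have conv: "AE x in M. convergent (%j. u (r j) x)"
  proof eventually_elim
    case (elim x)
    then have "summable (%j. \<bar>d j x\<bar>)" by (intro summable_suminf_not_top) auto
    then have "summable (%j. d j x)" by (rule summable_rabs_cancel)
    then have "convergent (%n. (\<Sum>j<n. d j x) + u (r 0) x)"
      by (intro convergent_add convergent_const) (simp add: summable_iff_convergent)
    moreover have "(\<Sum>j<n. d j x) + u (r 0) x = u (r n) x" for n
      using sum_lessThan_telescope[of "%j. u (r j) x" n] by (simp add: d_def)
    ultimately show ?case by simp
  qed
  define w where "w x = lim (%j. u (r j) x)" for x
  have w[measurable]: "w \<in> borel_measurable M" unfolding w_def by measurable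
  have lim: "AE x in M. (%j. u (r j) x) \<longlonglongrightarrow> w x"
    using conv by eventually_elim (simp add: w_def convergent_LIMSEQ_iff)
  have bd: "(%x. u k x - w x) \<in> Lp M (ennreal p) \<and> Lp_norm M (ennreal p) (%x. u k x - w x) <= e"
    if "\<And>l. l \<ge> K ==> Lp_norm M (ennreal p) (%x. u k x - u l x) <= e" for k K e
  proof -
    have "AE x in M. (%j. u k x - u (r (j + K)) x) \<longlonglongrightarrow> u k x - w x"
      using lim by eventually_elim (intro tendsto_intros LIMSEQ_ignore_initial_segment)
    moreover have "Lp_norm M (ennreal p) (%x. u k x - u (r (j + K)) x) <= e" for j
      using rj[of "j + K"] by (intro that) auto
    ultimately show ?thesis
      using Lp_Fatou[OF p0, of "%j x. u k x - u (r (j + K)) x" M "%x. u k x - w x" e] Lp_diff[OF p u u]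
      by auto
  qed
  obtain K where K: "\<And>k l. K <= k ==> K <= l ==> Lp_norm M (ennreal p) (%x. u k x - u l x) <= 1"
    using cauchy[of 1] by auto
  have "(%x. u K x - w x) \<in> Lp M (ennreal p)" using bd[of K K 1] K[of K] by simp
  then have "(%x. u K x - (u K x - w x)) \<in> Lp M (ennreal p)" by (rule Lp_diff[OF p u])
  then have wp: "w \<in> Lp M (ennreal p)" by simp
  have "(%k. Lp_norm M (ennreal p) (%x. u k x - w x)) \<longlonglongrightarrow> 0"
  proof (rule LIMSEQ_I)
    fix e :: real assume e: "0 < e"
    obtain K where "\<And>k l. K <= k ==> K <= l ==> Lp_norm M (ennreal p) (%x. u k x - u l x) <= e / 2"
      using cauchy[of "e / 2"] e by auto
    then have "Lp_norm M (ennreal p) (%x. u k x - w x) <= e / 2" if "K <= k" for k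
      using bd[of K k "e / 2"] that by auto
    then show "\<exists>K. \<forall>k\<ge>K. norm (Lp_norm M (ennreal p) (%x. u k x - w x) - 0) < e"
      using e Lp_norm_nonneg[OF p0] by (smt (verit) field_sum_of_halves real_norm_def)
  qed
  with wp show ?thesis by (rule that)
qed

text \<open>If moreover the sequence is known to converge in \<open>L\<^sup>1\<close>, the two limits agree.\<close>

lemma Lp_Cauchy_L1_limit:
  assumes fin: "finite_measure M" and p: "1 <= p" and u: "\<And>k. u k \<in> Lp M (ennreal p)"
    and cauchy: "\<And>e. 0 < e ==> \<exists>N. \<forall>k\<ge>N. \<forall>l\<ge>N. Lp_norm M (ennreal p) (%x. u k x - u l x) <= e"
    and w: "integrable M w" and lim: "(%k. LINT x|M. \<bar>u k x - w x\<bar>) \<longlonglongrightarrow> 0"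
  shows "w \<in> Lp M (ennreal p)" "(%k. Lp_norm M (ennreal p) (%x. u k x - w x)) \<longlonglongrightarrow> 0"
proof -
  have p0: "0 < p" using p by simp
  obtain z where z: "z \<in> Lp M (ennreal p)" "(%k. Lp_norm M (ennreal p) (%x. u k x - z x)) \<longlonglongrightarrow> 0"
    using Lp_complete[OF fin p u cauchy] by blast
  obtain C where C: "0 <= C" "\<And>u. u \<in> Lp M (ennreal p) ==> integrable M u \<and>
      (LINT x|M. \<bar>u x\<bar>) <= C * Lp_norm M (ennreal p) u"
    using Lp_L1_bound[OF fin p] by blast
  have iu: "integrable M (u k)" and iz: "integrable M z" for k using C(2) u z(1) by auto
  have "(LINT x|M. \<bar>z x - w x\<bar>) <= C * Lp_norm M (ennreal p) (%x. u k x - z x) + (LINT x|M. \<bar>u k x - w x\<bar>)" for k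
  proof -
    have "(LINT x|M. \<bar>z x - w x\<bar>) <= (LINT x|M. \<bar>u k x - z x\<bar> + \<bar>u k x - w x\<bar>)"
      using iu[of k] iz w by (intro integral_mono) auto
    also have "... = (LINT x|M. \<bar>u k x - z x\<bar>) + (LINT x|M. \<bar>u k x - w x\<bar>)"
      using iu[of k] iz w by simp
    also have "(LINT x|M. \<bar>u k x - z x\<bar>) <= C * Lp_norm M (ennreal p) (%x. u k x - z x)"
      using C(2)[OF Lp_diff[OF p u z(1)]] by auto
    finally show ?thesis by simp
  qed
  moreover have "(%k. C * Lp_norm M (ennreal p) (%x. u k x - z x) + (LINT x|M. \<bar>u k x - w x\<bar>)) \<longlonglongrightarrow> C * 0 + 0"
    by (intro tendsto_intros z lim)
  ultimately have "(LINT x|M. \<bar>z x - w x\<bar>) <= 0"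
    by (intro LIMSEQ_le_const[of _ 0]) auto
  moreover have "0 <= (LINT x|M. \<bar>z x - w x\<bar>)" by (rule Lintegral_nonneg) auto
  ultimately have "(LINT x|M. \<bar>z x - w x\<bar>) = 0" by simp
  then have eq: "AE x in M. z x = w x"
    using iz w by (subst (asm) integral_nonneg_eq_0_iff_AE) auto
  then show wp: "w \<in> Lp M (ennreal p)" using Lp_cong_AE[OF p0 z(1) borel_measurable_integrable[OF w] eq] by blast
  have "Lp_norm M (ennreal p) (%x. u k x - w x) = Lp_norm M (ennreal p) (%x. u k x - z x)" for k
    by (intro Lp_norm_cong_AE[OF p0]) (use eq u[of k] z wp in \<open>auto dest: Lp_measurable\<close>)
  then show "(%k. Lp_norm M (ennreal p) (%x. u k x - w x)) \<longlonglongrightarrow> 0" using z(2) by simp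
qed

section \<open>Density of continuous functions\<close>

definition Cc_functions :: "'a::euclidean_space set => ('a => real) set" where
  "Cc_functions G = {c. continuous_on UNIV c \<and> (\<exists>C. compact C \<and> C \<subseteq> G \<and> (\<forall>x. x \<notin> C --> c x = 0))}"

lemma Cc_functions_integrable:
  assumes S: "S \<in> sets lebesgue" and c: "c \<in> Cc_functions G"
  shows "integrable (lebesgue_on S) c"
proof -
  obtain C where C: "continuous_on UNIV c" "compact C" "\<And>x. x \<notin> C ==> c x = 0"
    using c by (auto simp: Cc_functions_def)
  have "integrable lborel (%x. indicator C x *\<^sub>R c x)"
    using C by (intro borel_integrable_compact) (auto intro: continuous_on_subset)
  moreover have "(%x. indicator C x *\<^sub>R c x) = c" using C(3) by (auto simp: indicator_def fun_eq_iff)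
  ultimately have "integrable lebesgue c" by (simp add: integrable_completion)
  then show ?thesis using integrable_mult_indicator[OF S, of c] S by (simp add: integrable_restrict_space)
qed

lemma Lp_dominated_convergence:
  assumes p: "0 < p" and v: "v \<in> borel_measurable M" "\<And>n. u n \<in> borel_measurable M"
    and lim: "AE x in M. (%n. u n x) \<longlonglongrightarrow> v x"
    and w: "w \<in> Lp M (ennreal p)" "\<And>n. AE x in M. \<bar>v x - u n x\<bar> <= \<bar>w x\<bar>"
  shows "(%n. Lp_norm M (ennreal p) (%x. v x - u n x)) \<longlonglongrightarrow> 0"
proof -
  have "(%n. LINT x|M. \<bar>v x - u n x\<bar> powr p) \<longlonglongrightarrow> (LINT x|M. 0)"
  proof (rule integral_dominated_convergence[where w = "%x. \<bar>w x\<bar> powr p"])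
    show "integrable M (%x. \<bar>w x\<bar> powr p)" using w(1) p by (simp add: Lp_ennreal)
    show "AE x in M. (%n. \<bar>v x - u n x\<bar> powr p) \<longlonglongrightarrow> 0"
      using lim
    proof eventually_elim
      case (elim x)
      have "(%n. \<bar>v x - u n x\<bar>) \<longlonglongrightarrow> 0" using tendsto_rabs[OF tendsto_diff[OF tendsto_const elim, of "v x"]] by simp
      then show ?case using tendsto_powr'[of _ 0 _ _ p] p by (auto intro: tendsto_eq_intros)
    qed
    show "AE x in M. norm (\<bar>v x - u n x\<bar> powr p) <= \<bar>w x\<bar> powr p" for n
      using w(2)[of n]
    proof eventually_elim
      case (elim x)
      then show ?case using p by (auto intro!: powr_mono2)
    qed
  qed (use v in auto)
  then have "(%n. (LINT x|M. \<bar>v x - u n x\<bar> powr p) powr (1 / p)) \<longlonglongrightarrow> 0 powr (1 / p)"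
    using p by (intro tendsto_powr') (auto intro!: always_eventually Lintegral_nonneg)
  then show ?thesis using p by (simp add: Lp_norm_ennreal)
qed

text \<open>A measurable function is almost everywhere a limit of continuous functions. After truncating both at a high level,
  continuous cutoffs exhausting \<open>G\<close> provide the compact support, and dominated convergence applies on the bounded set \<open>S\<close>.\<close>

lemma Cc_dense_Lp:
  fixes G S :: "'a::euclidean_space set"
  assumes G: "open G" "G \<subseteq> S" "S - G \<in> null_sets lebesgue" and S: "S \<in> sets lebesgue" "bounded S"
    and p: "1 <= p" and u: "u \<in> Lp (lebesgue_on S) (ennreal p)" and e: "0 < e"
  obtains c where "c \<in> Cc_functions G" "c \<in> Lp (lebesgue_on S) (ennreal p)"
    "Lp_norm (lebesgue_on S) (ennreal p) (%x. u x - c x) <= e"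
proof -
  let ?M = "lebesgue_on S" and ?N = "Lp_norm (lebesgue_on S) (ennreal p)"
  have p0: "0 < p" using p by simp
  have fin: "finite_measure ?M" using S bounded_set_imp_lmeasurable finite_measure_lebesgue_on by blast
  interpret finite_measure ?M by fact
  have um: "u \<in> borel_measurable ?M" using u by (rule Lp_measurable)
  define cl :: "real => real => real" where "cl m y = max (- m) (min m y)" for m y
  have clb: "\<bar>cl m y\<bar> <= m" "\<bar>y - cl m y\<bar> <= \<bar>y\<bar>" if "0 <= m" for m y
    using that by (auto simp: cl_def max_def min_def abs_if)
  have clm: "(%x. cl m (h x)) \<in> borel_measurable ?M" if [measurable]: "h \<in> borel_measurable ?M" for m h
    unfolding cl_def by measurable
  have bounded_Lp: "h \<in> Lp ?M (ennreal p)" if "h \<in> borel_measurable ?M" "\<And>x. \<bar>h x\<bar> <= m" for h and m :: real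
  proof -
    have "integrable ?M (%x. \<bar>h x\<bar> powr p)"
      using that p0 by (intro integrable_const_bound[where B = "m powr p"]) (auto intro!: powr_mono2)
    then show ?thesis using that p0 by (simp add: Lp_ennreal)
  qed
  have "(%n. ?N (%x. u x - cl (real n) (u x))) \<longlonglongrightarrow> 0"
  proof (rule Lp_dominated_convergence[OF p0 um clm[OF um] _ u])
    show "AE x in ?M. (%n. cl (real n) (u x)) \<longlonglongrightarrow> u x"
    proof (rule AE_I2)
      fix x
      obtain N where "\<bar>u x\<bar> <= real N" using real_arch_simple by blast
      then have "cl (real n) (u x) = u x" if "N <= n" for n using that by (auto simp: cl_def)
      then show "(%n. cl (real n) (u x)) \<longlonglongrightarrow> u x" by (intro tendsto_eventually eventually_sequentiallyI)
    qed
  qed (use clb in auto)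
  from order_tendstoD(2)[OF this, of "e / 2"] e obtain n where n: "?N (%x. u x - cl (real n) (u x)) < e / 2"
    by (auto simp: eventually_sequentially)
  define m where "m = real n"
  have m: "0 <= m" by (simp add: m_def)
  have "u measurable_on S" using measurable_on_iff_borel_measurable[OF S(1)] um by blast
  then obtain X g where g: "negligible X" "\<And>j. continuous_on UNIV (g j)"
      "\<And>x. x \<notin> X ==> (%j. g j x) \<longlonglongrightarrow> (if x \<in> S then u x else 0)"
    unfolding measurable_on_def by blast
  let ?F = "- G"
  have "G ~= UNIV" using G(2) S(2) not_bounded_UNIV[where 'a = 'a] by (metis top.extremum_uniqueI)
  then have F: "closed ?F" "?F ~= {}" using G(1) by (auto simp: closed_Compl)
  \<comment> \<open>The cutoff vanishes at distance up to \<open>1/j\<close> from the complement of \<open>G\<close> and is \<open>1\<close> from distance \<open>2/j\<close> on.\<close>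
  define cut where "cut j x = max 0 (min 1 (real j * infdist x ?F - 1))" for j x
  define c where "c j x = cut j x * cl m (g j x)" for j x
  have cc: "continuous_on UNIV (c j)" for j
    unfolding c_def cut_def cl_def by (intro continuous_intros g(2))
  have c: "c j \<in> Cc_functions G" for j
  proof -
    let ?C = "{x. 1 <= real j * infdist x ?F}"
    have "?C \<subseteq> G"
    proof
      fix x assume "x \<in> ?C"
      then have "infdist x ?F ~= 0" by auto
      then show "x \<in> G" using infdist_zero[of x ?F] by blast
    qed
    moreover have "closed ?C" by (intro closed_Collect_le continuous_intros)
    moreover have "bounded ?C" using \<open>?C \<subseteq> G\<close> G(2) S(2) by (meson bounded_subset order.trans)
    moreover have "\<forall>x. x \<notin> ?C --> c j x = 0" by (auto simp: c_def cut_def)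
    ultimately show ?thesis using cc unfolding Cc_functions_def compact_eq_bounded_closed by blast
  qed
  have cm: "c j \<in> borel_measurable ?M" for j using Cc_functions_integrable[OF S(1) c] by auto
  have cb: "\<bar>c j x\<bar> <= m" for j x
  proof -
    have "\<bar>cut j x\<bar> * \<bar>cl m (g j x)\<bar> <= 1 * m" by (intro mult_mono clb m) (auto simp: cut_def)
    then show ?thesis by (simp add: c_def abs_mult)
  qed
  have cLp: "c j \<in> Lp ?M (ennreal p)" "(%x. cl m (u x)) \<in> Lp ?M (ennreal p)" for j
    using bounded_Lp[OF cm cb] bounded_Lp[OF clm[OF um] clb(1)[OF m]] by blast+
  have "(%j. ?N (%x. cl m (u x) - c j x)) \<longlonglongrightarrow> 0"
  proof (rule Lp_dominated_convergence[OF p0 clm[OF um] cm])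
    show "(%x. 2 * m) \<in> Lp ?M (ennreal p)" by (rule bounded_Lp[where m = "2 * m"]) (use m in auto)
    show "AE x in ?M. \<bar>cl m (u x) - c j x\<bar> <= \<bar>2 * m\<bar>" for j
    proof (rule AE_I2)
      fix x show "\<bar>cl m (u x) - c j x\<bar> <= \<bar>2 * m\<bar>" using cb[of j x] clb(1)[OF m, of "u x"] by linarith
    qed
    have "AE x in lebesgue. x \<notin> S - G" "AE x in lebesgue. x \<notin> X"
      by (rule AE_not_in[OF G(3)], rule AE_not_in) (use g(1) in \<open>simp add: negligible_iff_null_sets\<close>)
    then have "AE x in lebesgue. x \<in> S --> x \<in> G \<and> x \<in> S \<and> x \<notin> X" by eventually_elim blast
    then have "AE x in ?M. x \<in> G \<and> x \<in> S \<and> x \<notin> X" using S(1) by (subst AE_restrict_space_iff) auto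
    then show "AE x in ?M. (%j. c j x) \<longlonglongrightarrow> cl m (u x)"
    proof eventually_elim
      case (elim x)
      have gx: "(%j. g j x) \<longlonglongrightarrow> u x" using g(3)[of x] elim by simp
      have "0 < infdist x ?F" using elim F infdist_pos_not_in_closed by blast
      then obtain N where N: "2 / infdist x ?F <= real N" using real_arch_simple by blast
      have "cut j x = 1" if "N <= j" for j
      proof -
        have "2 / infdist x ?F <= real j" using N that by linarith
        then show ?thesis using \<open>0 < infdist x ?F\<close> by (simp add: cut_def field_simps)
      qed
      then have "(%j. cut j x) \<longlonglongrightarrow> 1" by (intro tendsto_eventually eventually_sequentiallyI)
      moreover have "(%j. cl m (g j x)) \<longlonglongrightarrow> cl m (u x)" unfolding cl_def by (intro tendsto_intros gx)
      ultimately show ?case unfolding c_def using tendsto_mult by fastforce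
    qed
  qed
  from order_tendstoD(2)[OF this, of "e / 2"] e obtain j where j: "?N (%x. cl m (u x) - c j x) < e / 2"
    by (auto simp: eventually_sequentially)
  have "?N (%x. u x - c j x) <= ?N (%x. u x - cl m (u x)) + ?N (%x. cl m (u x) - c j x)"
    by (rule Lp_norm_triangle[OF p u cLp(2,1)])
  then have "?N (%x. u x - c j x) <= e" using n j unfolding m_def by linarith
  then show ?thesis using that c cLp(1) by blast
qed

section \<open>Smooth functions and convolution\<close>

lemma Ck_Suc_intro:
  assumes "\<And>x. (u has_derivative (%h. v x \<bullet> h)) (at x)" "\<And>i. i \<in> Basis ==> Ck k (%x. v x \<bullet> i)"
  shows "Ck (Suc k) u"
  using assms by auto

lemma Ck_SucD: "Ck (Suc k) u ==> Ck k u"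
proof (induction k arbitrary: u)
  case 0
  then obtain v where "\<And>x. (u has_derivative (%h. v x \<bullet> h)) (at x)" by auto
  then have "continuous (at x) u" for x using has_derivative_continuous by blast
  then show ?case by (simp add: continuous_at_imp_continuous_on)
next
  case (Suc k)
  from Suc.prems obtain v where v: "\<And>x. (u has_derivative (%h. v x \<bullet> h)) (at x)"
    "\<And>i. i \<in> Basis ==> Ck (Suc k) (%x. v x \<bullet> i)" by (subst (asm) Ck.simps(2)) blast
  show ?case by (rule Ck_Suc_intro[OF v(1)]) (use v(2) Suc.IH in blast)
qed

lemma Ck_const: "Ck k (%x. c)"
proof (induction k arbitrary: c)
  case (Suc k)
  show ?case by (rule Ck_Suc_intro[where v = "%x. 0"]) (use Suc in auto)
qed simp

lemma Ck_inner: "Ck k (%x. x \<bullet> b)"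
proof (cases k)
  case (Suc k)
  show ?thesis unfolding Suc
    by (rule Ck_Suc_intro[where v = "%x. b"])
       (auto intro!: derivative_eq_intros Ck_const simp: inner_commute)
qed (auto intro!: continuous_intros)

lemma Ck_add: "Ck k u ==> Ck k w ==> Ck k (%x. u x + w x)"
proof (induction k arbitrary: u w)
  case (Suc k)
  from Suc.prems obtain v v' where v: "\<And>x. (u has_derivative (%h. v x \<bullet> h)) (at x)"
    "\<And>i. i \<in> Basis ==> Ck k (%x. v x \<bullet> i)" "\<And>x. (w has_derivative (%h. v' x \<bullet> h)) (at x)"
    "\<And>i. i \<in> Basis ==> Ck k (%x. v' x \<bullet> i)" unfolding Ck.simps by blast
  show ?case
    by (rule Ck_Suc_intro[where v = "%x. v x + v' x"])
       (use v Suc.IH in \<open>auto intro!: derivative_eq_intros simp: inner_add_left\<close>)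
qed (auto intro!: continuous_intros)

lemma Ck_mult: "Ck k u ==> Ck k w ==> Ck k (%x. u x * w x)"
proof (induction k arbitrary: u w)
  case (Suc k)
  from Suc.prems obtain v v' where v: "\<And>x. (u has_derivative (%h. v x \<bullet> h)) (at x)"
    "\<And>i. i \<in> Basis ==> Ck k (%x. v x \<bullet> i)" "\<And>x. (w has_derivative (%h. v' x \<bullet> h)) (at x)"
    "\<And>i. i \<in> Basis ==> Ck k (%x. v' x \<bullet> i)" unfolding Ck.simps by blast
  show ?case
  proof (rule Ck_Suc_intro[where v = "%x. u x *\<^sub>R v' x + w x *\<^sub>R v x"])
    show "((%x. u x * w x) has_derivative (%h. (u x *\<^sub>R v' x + w x *\<^sub>R v x) \<bullet> h)) (at x)" for x
      by (rule derivative_eq_intros v refl)+ (auto simp: fun_eq_iff inner_add_left)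
    show "Ck k (%x. (u x *\<^sub>R v' x + w x *\<^sub>R v x) \<bullet> i)" if "i \<in> Basis" for i
      unfolding inner_add_left inner_scaleR_left
      by (rule Ck_add[OF Suc.IH[OF Ck_SucD[OF Suc.prems(1)] v(4)[OF that]]
            Suc.IH[OF Ck_SucD[OF Suc.prems(2)] v(2)[OF that]]])
  qed
qed (auto intro!: continuous_intros)

lemma Ck_compose_real: "Ck k h ==> Ck k u ==> Ck k (%x. (h :: real => real) (u x))"
proof (induction k arbitrary: h u)
  case (Suc k)
  from Suc.prems obtain v v' where v: "\<And>x. (u has_derivative (%h. v x \<bullet> h)) (at x)"
    "\<And>i. i \<in> Basis ==> Ck k (%x. v x \<bullet> i)" "\<And>x. (h has_derivative (%d. v' x \<bullet> d)) (at x)"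
    "\<And>i. i \<in> Basis ==> Ck k (%x. v' x \<bullet> i)" unfolding Ck.simps by blast
  show ?case
  proof (rule Ck_Suc_intro[where v = "%x. v' (u x) *\<^sub>R v x"])
    show "((%x. h (u x)) has_derivative (%d. (v' (u x) *\<^sub>R v x) \<bullet> d)) (at x)" for x
      using has_derivative_compose[OF v(1) v(3), of x] by simp
    show "Ck k (%x. (v' (u x) *\<^sub>R v x) \<bullet> i)" if "i \<in> Basis" for i
      unfolding inner_scaleR_left
      using Suc.IH[of v' u] v(4)[of 1] Ck_SucD[OF Suc.prems(2)] v(2)[OF that] by (intro Ck_mult) auto
  qed
qed (auto intro: continuous_on_compose2)

lemma Ck_reflect: "Ck k u ==> Ck k (%y. u (x - y))"
proof (induction k arbitrary: u)
  case (Suc k)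
  from Suc.prems obtain v where v: "\<And>x. (u has_derivative (%h. v x \<bullet> h)) (at x)"
    "\<And>i. i \<in> Basis ==> Ck k (%x. v x \<bullet> i)" unfolding Ck.simps by blast
  show ?case
  proof (rule Ck_Suc_intro[where v = "%y. - v (x - y)"])
    have "((%y. x - y) has_derivative (%h. - h)) (at y)" for y
      by (auto intro!: derivative_eq_intros)
    from has_derivative_compose[OF this v(1)]
    show "((%y. u (x - y)) has_derivative (%h. (- v (x - y)) \<bullet> h)) (at y)" for y by simp
    show "Ck k (%y. (- v (x - y)) \<bullet> i)" if "i \<in> Basis" for i
      using Ck_mult[OF Ck_const Suc.IH[OF v(2)[OF that]], of "-1"] by simp
  qed
qed (auto intro!: continuous_intros elim: continuous_on_compose2)

lemma smooth_add: "smooth u ==> smooth w ==> smooth (%x. u x + w x)"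
  by (simp add: smooth_def Ck_add)
lemma smooth_mult: "smooth u ==> smooth w ==> smooth (%x. u x * w x)"
  by (simp add: smooth_def Ck_mult)
lemma smooth_const: "smooth (%x. c)"
  by (simp add: smooth_def Ck_const)
lemma smooth_inner: "smooth (%x. x \<bullet> b)"
  by (simp add: smooth_def Ck_inner)
lemma smooth_compose_real: "smooth h ==> smooth u ==> smooth (%x. (h :: real => real) (u x))"
  by (simp add: smooth_def Ck_compose_real)
lemma smooth_reflect: "smooth u ==> smooth (%y. u (x - y))"
  by (simp add: smooth_def Ck_reflect)
lemma smooth_prod: "finite I ==> (\<And>i. i \<in> I ==> smooth (u i)) ==> smooth (%x. \<Prod>i\<in>I. u i x)"
  by (induction rule: finite_induct) (auto intro: smooth_const smooth_mult)
lemma smooth_continuous: "smooth u ==> continuous_on UNIV u"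
  unfolding smooth_def by (metis Ck.simps(1))

lemma smooth_gradient:
  assumes "smooth u"
  obtains v where "\<And>x. (u has_derivative (%h. v x \<bullet> h)) (at x)" "\<And>i. i \<in> Basis ==> smooth (%x. v x \<bullet> i)"
proof -
  have "Ck (Suc 0) u" using assms unfolding smooth_def by blast
  then obtain v where v: "\<And>x. (u has_derivative (%h. v x \<bullet> h)) (at x)" by auto
  have "Ck k (%x. v x \<bullet> i)" if i: "i \<in> Basis" for k i
  proof -
    have "Ck (Suc k) u" using assms unfolding smooth_def by blast
    then obtain v' where v': "\<And>x. (u has_derivative (%h. v' x \<bullet> h)) (at x)" "Ck k (%x. v' x \<bullet> i)"
      using i unfolding Ck.simps by blast
    have "v x \<bullet> i = v' x \<bullet> i" for x
      using has_derivative_unique[OF v[of x] v'(1)[of x]] by metis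
    then show ?thesis using v'(2) by simp
  qed
  then show ?thesis using v by (intro that) (auto simp: smooth_def)
qed

lemma smooth_sin: "smooth (sin :: real => real)" 
proof -
  have "Ck k (sin :: real => real) \<and> Ck k (cos :: real => real)" for k
  proof (induction k)
    case (Suc k)
    have "Ck (Suc k) (sin :: real => real)"
    proof (rule Ck_Suc_intro[where v = cos])
      show "(sin has_derivative (%h. cos x \<bullet> h)) (at x)" for x :: real
        using DERIV_sin[of x] by (simp add: has_field_derivative_def)
    qed (use Suc in auto)
    moreover have "Ck (Suc k) (cos :: real => real)"
    proof (rule Ck_Suc_intro[where v = "%x. - sin x"])
      show "(cos has_derivative (%h. (- sin x) \<bullet> h)) (at x)" for x :: real
        using DERIV_cos[of x] unfolding has_field_derivative_def by (rule has_derivative_eq_rhs) (simp add: fun_eq_iff)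
    qed (use Suc Ck_mult[OF Ck_const, of k sin "-1"] in auto)
    ultimately show ?case by simp
  qed (auto intro!: continuous_intros)
  then show ?thesis by (simp add: smooth_def)
qed

subsection \<open>Convolution over a bounded set\<close>

definition conv :: "'a::euclidean_space set => ('a => real) => ('a => real) => 'a => real" where
  "conv S K u x = (LINT y|lebesgue_on S. K (x - y) * u y)"

lemma kernel_bounded:
  assumes K: "continuous_on UNIV K" and S: "bounded (S :: 'a::euclidean_space set)" and C: "bounded C"
  obtains B :: real where "0 <= B" "\<And>x y. x \<in> C ==> y \<in> S ==> \<bar>K (x - y)\<bar> <= B"
proof -
  obtain R where R: "\<And>x. x \<in> C ==> norm x <= R" using C by (auto simp: bounded_iff)
  obtain R' where R': "\<And>x. x \<in> S ==> norm x <= R'" using S by (auto simp: bounded_iff)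
  have "compact (K ` cball 0 (R + R'))"
    using K by (intro compact_continuous_image) (auto intro: continuous_on_subset)
  then obtain B where "\<And>z. z \<in> cball 0 (R + R') ==> \<bar>K z\<bar> <= B"
    using compact_imp_bounded bounded_iff real_norm_def by (metis image_eqI)
  moreover have "x - y \<in> cball 0 (R + R')" if "x \<in> C" "y \<in> S" for x y
    using R[OF that(1)] R'[OF that(2)] norm_triangle_ineq4[of x y] by simp
  ultimately show ?thesis by (intro that[of "max B 0"]) (auto simp: le_max_iff_disj)
qed

lemma continuous_measurable_lebesgue_on:
  assumes "continuous_on UNIV (K :: 'a::euclidean_space => real)"
  shows "(%y. K (x - y)) \<in> borel_measurable (lebesgue_on S)"
proof -
  have "continuous_on UNIV (%y. K (x - y))"
    by (rule continuous_on_compose2[OF assms]) (auto intro!: continuous_intros)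
  then have "(%y. K (x - y)) \<in> borel_measurable lborel" by (simp add: borel_measurable_continuous_onI)
  then show ?thesis by (intro measurable_restrict_space1 measurable_completion)
qed

lemma integrable_conv:
  assumes K: "continuous_on UNIV (K :: 'a => real)" and S: "S \<in> sets lebesgue" "bounded (S :: 'a::euclidean_space set)"
    and u: "integrable (lebesgue_on S) u"
  shows "integrable (lebesgue_on S) (%y. K (x - y) * u y)"
proof -
  obtain B where B: "0 <= B" "\<And>y. y \<in> S ==> \<bar>K (x - y)\<bar> <= B"
  proof (rule kernel_bounded[OF K S(2) bounded_empty[THEN bounded_insert[THEN iffD2, of _ x]]])
    fix B assume "0 <= B" "\<And>x' y. x' \<in> {x} ==> y \<in> S ==> \<bar>K (x' - y)\<bar> <= B"
    then show thesis by (intro that[of B]) auto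
  qed
  note [measurable] = continuous_measurable_lebesgue_on[OF K]
  have [measurable]: "u \<in> borel_measurable (lebesgue_on S)" using u by auto
  show ?thesis
    by (rule Lintegrable_bound[where f = "%y. B * u y"])
       (use u B in \<open>auto intro!: AE_I2 mult_right_mono simp: abs_mult\<close>)
qed

lemma conv_diff:
  assumes K: "continuous_on UNIV (K :: 'a => real)" and S: "S \<in> sets lebesgue" "bounded (S :: 'a::euclidean_space set)"
    and u: "integrable (lebesgue_on S) u" "integrable (lebesgue_on S) w"
  shows "conv S K (%y. u y - w y) x = conv S K u x - conv S K w x"
  unfolding conv_def right_diff_distrib
  by (rule Lintegral_diff[OF integrable_conv[OF K S u(1)] integrable_conv[OF K S u(2)]])

text \<open>Differentiation under the integral sign for a kernel that need not have compact support: only arguments from a bounded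
  set occur, and there the derivative of the kernel is uniformly continuous.\<close>

lemma conv_has_derivative:
  fixes S :: "'a::euclidean_space set"
  assumes K: "\<And>z. (K has_derivative (%h. v z \<bullet> h)) (at z)" and v: "\<And>i. i \<in> Basis ==> continuous_on UNIV (%z. v z \<bullet> i)"
    and S: "S \<in> sets lebesgue" "bounded S" and u: "integrable (lebesgue_on S) u"
  shows "(conv S K u has_derivative (%h. (\<Sum>i\<in>Basis. conv S (%z. v z \<bullet> i) u x *\<^sub>R i) \<bullet> h)) (at x)"
proof -
  let ?M = "lebesgue_on S"
  have Kc: "continuous_on UNIV K"
    by (intro continuous_at_imp_continuous_on ballI has_derivative_continuous[OF K])
  have vc: "continuous_on UNIV v"
    by (subst continuous_on_componentwise) (use v in auto)
  obtain R where R: "\<And>y. y \<in> S ==> norm y <= R" using S(2) by (auto simp: bounded_iff)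
  define R' where "R' = norm x + R + 1"
  have iv: "integrable ?M (%y. (v (x - y) \<bullet> i) * u y)" if "i \<in> Basis" for i
    using integrable_conv[OF v[OF that] S u] .
  have sum_eq: "(\<Sum>i\<in>Basis. conv S (%z. v z \<bullet> i) u x *\<^sub>R i) \<bullet> h = (LINT y|?M. (v (x - y) \<bullet> h) * u y)"
    and iv': "integrable ?M (%y. (v (x - y) \<bullet> h) * u y)" for h
  proof -
    have eq: "(v (x - y) \<bullet> h) * u y = (\<Sum>i\<in>Basis. (h \<bullet> i) * ((v (x - y) \<bullet> i) * u y))" for y
      by (subst euclidean_inner) (simp add: sum_distrib_left sum_distrib_right mult_ac)
    show "integrable ?M (%y. (v (x - y) \<bullet> h) * u y)" unfolding eq using iv by auto
    have "(LINT y|?M. (v (x - y) \<bullet> h) * u y) = (\<Sum>i\<in>Basis. (h \<bullet> i) * conv S (%z. v z \<bullet> i) u x)"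
      unfolding eq conv_def using iv by simp
    then show "(\<Sum>i\<in>Basis. conv S (%z. v z \<bullet> i) u x *\<^sub>R i) \<bullet> h = (LINT y|?M. (v (x - y) \<bullet> h) * u y)"
      by (simp add: inner_sum_right inner_commute[of _ h] mult.commute)
  qed
  let ?D = "\<Sum>i\<in>Basis. conv S (%z. v z \<bullet> i) u x *\<^sub>R i" and ?U = "(LINT y|?M. \<bar>u y\<bar>) + 1"
  have U: "0 < ?U" by (intro add_nonneg_pos Lintegral_nonneg) auto
  \<comment> \<open>The linearization error of \<open>K\<close> is uniform over the bounded set of arguments that occur.\<close>
  have "\<exists>d>0. \<forall>x'. norm (x' - x) < d --> norm (conv S K u x' - conv S K u x - ?D \<bullet> (x' - x)) <= e * norm (x' - x)"
    if e: "0 < e" for e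
  proof -
    have "0 < e / ?U" using e U by simp
    moreover have "uniformly_continuous_on (cball 0 R') v"
      using vc by (intro compact_uniformly_continuous) (auto intro: continuous_on_subset)
    ultimately obtain d where d: "0 < d"
      "\<And>z z'. z \<in> cball 0 R' ==> z' \<in> cball 0 R' ==> dist z' z < d ==> dist (v z') (v z) < e / ?U"
      unfolding uniformly_continuous_on_def by metis
    have "norm (conv S K u x' - conv S K u x - ?D \<bullet> (x' - x)) <= e * norm (x' - x)" if x': "norm (x' - x) < min d 1" for x'
    proof -
      let ?h = "x' - x"
      have lin: "\<bar>K (x' - y) - K (x - y) - v (x - y) \<bullet> ?h\<bar> <= norm ?h * (e / ?U)" if y: "y \<in> S" for y
      proof -
        let ?B = "cball (x - y) (norm ?h)"
        have B: "z \<in> cball 0 R'" "dist z (x - y) < d" if "z \<in> ?B" for z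
        proof -
          have "norm z <= norm (z - (x - y)) + norm (x - y)" using norm_triangle_sub[of z "x - y"] by simp
          also have "... <= norm ?h + (norm x + norm y)"
            using that norm_triangle_ineq4[of x y] by (intro add_mono) (auto simp: dist_norm norm_minus_commute)
          finally show "z \<in> cball 0 R'" using R[OF y] x' by (simp add: R'_def)
          show "dist z (x - y) < d" using that x' by (simp add: dist_commute)
        qed
        have "norm (K (x' - y) - K (x - y) - v (x - y) \<bullet> ((x' - y) - (x - y))) <= norm ((x' - y) - (x - y)) * (e / ?U)"
        proof (rule differentiable_bound_linearization[where S = ?B and f' = "%z h. v z \<bullet> h"])
          show "(x - y) + t *\<^sub>R ((x' - y) - (x - y)) \<in> ?B" if "t \<in> {0..1}" for t
            using that by (simp add: dist_norm mult_left_le_one_le)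
          show "(K has_derivative (\<bullet>) (v z)) (at z within ?B)" for z using K by (rule has_derivative_at_withinI)
          show "onorm ((%h. v z \<bullet> h) - (%h. v (x - y) \<bullet> h)) <= e / ?U" if z: "z \<in> ?B" for z
          proof (rule onorm_le)
            fix h
            have "\<bar>(v z - v (x - y)) \<bullet> h\<bar> <= norm (v z - v (x - y)) * norm h" by (rule Cauchy_Schwarz_ineq2)
            also have "... <= e / ?U * norm h"
              using d(2)[OF B(1)[of "x - y"] B(1)[OF z] B(2)[OF z]] by (intro mult_right_mono) (auto simp: dist_norm)
            finally show "norm (((%h. v z \<bullet> h) - (%h. v (x - y) \<bullet> h)) h) <= e / ?U * norm h" by (simp add: inner_diff_left)
          qed
        qed simp
        then show ?thesis by simp
      qed
      have "conv S K u x' - conv S K u x - ?D \<bullet> ?h = (LINT y|?M. (K (x' - y) - K (x - y) - v (x - y) \<bullet> ?h) * u y)"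
        unfolding sum_eq unfolding conv_def left_diff_distrib
        using integrable_conv[OF Kc S u, of x'] integrable_conv[OF Kc S u, of x] iv'[of ?h] by simp
      also have "\<bar>...\<bar> <= (LINT y|?M. norm ?h * (e / ?U) * \<bar>u y\<bar>)"
      proof (rule order.trans[OF integral_abs_bound], rule integral_mono)
        show "integrable ?M (%y. \<bar>(K (x' - y) - K (x - y) - v (x - y) \<bullet> ?h) * u y\<bar>)"
          unfolding left_diff_distrib using integrable_conv[OF Kc S u, of x'] integrable_conv[OF Kc S u, of x] iv'[of ?h] by simp
        fix y assume "y \<in> space ?M"
        then have "y \<in> S" by simp
        from mult_right_mono[OF lin[OF this] abs_ge_zero]
        show "\<bar>(K (x' - y) - K (x - y) - v (x - y) \<bullet> ?h) * u y\<bar> <= norm ?h * (e / ?U) * \<bar>u y\<bar>" by (simp add: abs_mult)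
      qed (use u in auto)
      also have "... = (e * norm ?h) * ((LINT y|?M. \<bar>u y\<bar>) / ?U)" by simp
      also have "... <= (e * norm ?h) * 1" using e U by (intro mult_left_mono) auto
      finally show ?thesis by simp
    qed
    then show ?thesis using d(1) by (intro exI[of _ "min d 1"]) auto
  qed
  then show ?thesis by (simp add: has_derivative_at_alt bounded_linear_inner_right)
qed

lemma conv_Ck:
  fixes S :: "'a::euclidean_space set"
  assumes S: "S \<in> sets lebesgue" "bounded S" and u: "integrable (lebesgue_on S) u"
  shows "Ck (Suc k) K ==> Ck k (conv S K u)"
proof (induction k arbitrary: K)
  case 0
  then obtain v where v: "\<And>x. (K has_derivative (%h. v x \<bullet> h)) (at x)"
    "\<And>i. i \<in> Basis ==> continuous_on UNIV (%x. v x \<bullet> i)" unfolding Ck.simps by blast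
  have "continuous (at x) (conv S K u)" for x
    using conv_has_derivative[OF v S u] has_derivative_continuous by blast
  then show ?case by (simp add: continuous_at_imp_continuous_on)
next
  case (Suc k)
  then obtain v where v: "\<And>x. (K has_derivative (%h. v x \<bullet> h)) (at x)"
    "\<And>i. i \<in> Basis ==> Ck (Suc k) (%x. v x \<bullet> i)" by (subst (asm) Ck.simps(2)) blast
  have "Ck 0 (%x. v x \<bullet> i)" if "i \<in> Basis" for i
    using v(2)[OF that] by (induction k) (auto dest: Ck_SucD simp del: Ck.simps)
  then have vc: "continuous_on UNIV (%x. v x \<bullet> i)" if "i \<in> Basis" for i using that by simp
  show ?case
  proof (rule Ck_Suc_intro[OF conv_has_derivative[OF v(1) vc S u]])
    fix i :: 'a assume i: "i \<in> Basis"
    have "(%x. (\<Sum>i\<in>Basis. conv S (%z. v z \<bullet> i) u x *\<^sub>R i) \<bullet> i) = conv S (%z. v z \<bullet> i) u"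
      using i by (auto simp: inner_sum_left inner_Basis if_distrib cong: if_cong)
    then show "Ck k (%x. (\<Sum>i\<in>Basis. conv S (%z. v z \<bullet> i) u x *\<^sub>R i) \<bullet> i)"
      using Suc.IH[OF v(2)[OF i]] by simp
  qed auto
qed

lemma smooth_conv:
  assumes "S \<in> sets lebesgue" "bounded S" "integrable (lebesgue_on S) u" "smooth K"
  shows "smooth (conv S K u)"
  using assms conv_Ck[OF assms(1-3)] by (simp add: smooth_def del: Ck.simps)

section \<open>Approximate identities\<close>

lemma Lp_1: "u \<in> Lp M 1 \<longleftrightarrow> integrable M u"
  by (auto simp: Lp_def integrable_abs_iff)

lemma Lp_norm_1: "Lp_norm M 1 u = (LINT x|M. \<bar>u x\<bar>)"
  by (simp add: Lp_norm_def Lintegral_nonneg)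

text \<open>Besides the normalisation, only mass near the diagonal is required, and this only when one of the
  two points lies in a fixed compact set; this admits periodic kernels.\<close>

definition approximate_identity :: "'a::euclidean_space set => (nat => 'a => real) => bool" where
  "approximate_identity S K \<longleftrightarrow>
     (\<forall>n. continuous_on UNIV (K n) \<and> (\<forall>z. 0 <= K n z) \<and> (\<forall>z. K n (- z) = K n z) \<and>
        (\<forall>x. (LINT y|lebesgue_on S. K n (x - y)) <= 1)) \<and>
     (\<forall>C d. compact C \<and> C \<subseteq> interior S \<and> 0 < d -->
        (\<forall>\<^sub>F n in sequentially. (\<forall>x\<in>C. (LINT y|lebesgue_on S. K n (x - y)) = 1) \<and>
           (\<forall>x\<in>S. \<forall>y\<in>S. K n (x - y) ~= 0 --> x \<in> C \<or> y \<in> C --> dist x y < d)))"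

lemma measurable_kernel_pair:
  fixes K :: "'a::euclidean_space => real"
  assumes "continuous_on UNIV K"
  shows "(%(x, y). K (x - y)) \<in> borel_measurable (lebesgue_on S \<Otimes>\<^sub>M lebesgue_on S)"
proof -
  have [measurable]: "K \<in> borel_measurable borel" using assms by (rule borel_measurable_continuous_onI)
  have [measurable]: "(%x. x) \<in> borel_measurable (lebesgue_on S)"
    by (intro measurable_restrict_space1 measurable_completion) auto
  have "fst \<in> measurable (lebesgue_on S \<Otimes>\<^sub>M lebesgue_on S) borel"
    "snd \<in> measurable (lebesgue_on S \<Otimes>\<^sub>M lebesgue_on S) borel"
    by (auto intro: measurable_compose[OF measurable_fst] measurable_compose[OF measurable_snd])
  then show ?thesis unfolding split_beta by measurable
qed

context
  fixes S :: "'a::euclidean_space set" and K :: "'a => real"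
  assumes S: "S \<in> sets lebesgue" "bounded S"
    and Kc: "continuous_on UNIV K" and K0: "\<And>z. 0 <= K z" and Ksym: "\<And>z. K (- z) = K z"
    and K1: "\<And>x. (LINT y|lebesgue_on S. K (x - y)) <= 1"
begin

lemma finite_measure_bounded: "finite_measure (lebesgue_on S)"
  using S bounded_set_imp_lmeasurable finite_measure_lebesgue_on by blast

lemma integrable_kernel: "integrable (lebesgue_on S) (%y. K (x - y))"
proof -
  interpret finite_measure "lebesgue_on S" by (rule finite_measure_bounded)
  show ?thesis using integrable_conv[OF Kc S, of "%_. 1" x] by simp
qed

text \<open>Jensen's inequality for the measure with density \<open>K(x - y)\<close>, whose mass \<open>\<theta>\<close> is at most one: integrate the tangent
  inequality at \<open>m = \<integral> K(x - y) |u(y)| dy\<close> and use \<open>\<theta> + p (1 - \<theta>) \<ge> 1\<close>.\<close>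

lemma conv_powr_le:
  assumes p: "1 <= p" and u: "u \<in> Lp (lebesgue_on S) (ennreal p)"
  shows "\<bar>conv S K u x\<bar> powr p <= conv S K (%y. \<bar>u y\<bar> powr p) x"
proof -
  let ?M = "lebesgue_on S"
  have iu: "integrable ?M u" using Lp_L1_bound[OF finite_measure_bounded p] u by metis
  have iup: "integrable ?M (%y. \<bar>u y\<bar> powr p)" using u p by (simp add: Lp_ennreal)
  have i1: "integrable ?M (%y. K (x - y) * \<bar>u y\<bar>)" using integrable_conv[OF Kc S, of "%y. \<bar>u y\<bar>" x] iu by simp
  have i2: "integrable ?M (%y. K (x - y) * \<bar>u y\<bar> powr p)" using integrable_conv[OF Kc S iup] .
  define m where "m = (LINT y|?M. K (x - y) * \<bar>u y\<bar>)"
  define \<theta> where "\<theta> = (LINT y|?M. K (x - y))"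
  have \<theta>: "0 <= \<theta>" "\<theta> <= 1" using K0 K1 by (auto simp: \<theta>_def intro: Lintegral_nonneg)
  have m0: "0 <= m" using K0 by (auto simp: m_def intro!: Lintegral_nonneg)
  have "\<bar>conv S K u x\<bar> <= (LINT y|?M. \<bar>K (x - y) * u y\<bar>)" unfolding conv_def by (rule integral_abs_bound)
  also have "... = m" using K0 by (simp add: m_def abs_mult)
  finally have le: "\<bar>conv S K u x\<bar> <= m" .
  have "m powr p <= conv S K (%y. \<bar>u y\<bar> powr p) x"
  proof (cases "m = 0")
    case True
    then show ?thesis using K0 by (auto simp: conv_def intro!: Lintegral_nonneg)
  next
    case False
    then have m: "0 < m" using m0 by simp
    have "(LINT y|?M. (m powr p - p * m powr (p - 1) * m) * K (x - y) + p * m powr (p - 1) * (K (x - y) * \<bar>u y\<bar>))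
        <= (LINT y|?M. K (x - y) * \<bar>u y\<bar> powr p)"
    proof (rule integral_mono)
      fix y
      have "K (x - y) * (m powr p + p * m powr (p - 1) * (\<bar>u y\<bar> - m)) <= K (x - y) * \<bar>u y\<bar> powr p"
        using powr_tangent[OF p abs_ge_zero m] K0 by (intro mult_left_mono) auto
      then show "(m powr p - p * m powr (p - 1) * m) * K (x - y) + p * m powr (p - 1) * (K (x - y) * \<bar>u y\<bar>)
          <= K (x - y) * \<bar>u y\<bar> powr p" by (simp add: algebra_simps)
    qed (use i1 i2 integrable_kernel in auto)
    moreover have "(LINT y|?M. (m powr p - p * m powr (p - 1) * m) * K (x - y) + p * m powr (p - 1) * (K (x - y) * \<bar>u y\<bar>))
       = (m powr p - p * m powr (p - 1) * m) * \<theta> + p * m powr (p - 1) * m"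
      using i1 integrable_kernel by (simp add: \<theta>_def m_def)
    moreover have "m powr (p - 1) * m = m powr p" using m by (simp add: powr_mult_base mult.commute)
    moreover have "(m powr p - p * m powr p) * \<theta> + p * m powr p \<ge> m powr p"
    proof -
      have "0 <= m powr p * ((p - 1) * (1 - \<theta>))" using \<theta> p by simp
      then show ?thesis by (simp add: algebra_simps)
    qed
    ultimately show ?thesis by (simp add: conv_def mult.assoc)
  qed
  moreover have "\<bar>conv S K u x\<bar> powr p <= m powr p" using le p by (intro powr_mono2) auto
  ultimately show ?thesis by simp
qed

lemma conv_measurable:
  assumes u: "u \<in> borel_measurable (lebesgue_on S)"
  shows "conv S K u \<in> borel_measurable (lebesgue_on S)"
proof -
  let ?M = "lebesgue_on S"
  interpret finite_measure ?M by (rule finite_measure_bounded)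
  note [measurable] = u measurable_kernel_pair[OF Kc, of S]
  have "(%(x, y). K (x - y) * u y) \<in> borel_measurable (?M \<Otimes>\<^sub>M ?M)"
    using measurable_kernel_pair[OF Kc, of S] by (auto simp: split_beta intro!: borel_measurable_times measurable_compose[OF measurable_snd u])
  from borel_measurable_lebesgue_integral[OF this] show ?thesis by (simp add: conv_def[abs_def])
qed

lemma integral_conv_le:
  assumes u: "integrable (lebesgue_on S) u" "\<And>y. 0 <= u y"
  shows "integrable (lebesgue_on S) (conv S K u)"
    and "(LINT x|lebesgue_on S. conv S K u x) <= (LINT y|lebesgue_on S. u y)"
proof -
  let ?M = "lebesgue_on S"
  interpret finite_measure ?M by (rule finite_measure_bounded)
  interpret pair_sigma_finite ?M ?M ..
  have m: "(%(x, y). K (x - y) * u y) \<in> borel_measurable (?M \<Otimes>\<^sub>M ?M)"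
    using measurable_kernel_pair[OF Kc, of S] u(1) by (auto simp: split_beta intro!: borel_measurable_times measurable_compose[OF measurable_snd])
  obtain B where B: "0 <= B" "\<And>x y. x \<in> S ==> y \<in> S ==> \<bar>K (x - y)\<bar> <= B"
    using kernel_bounded[OF Kc S(2) S(2)] by blast
  have bd: "conv S K u x <= B * (LINT y|?M. u y)" if "x \<in> S" for x
  proof -
    have "(LINT y|?M. K (x - y) * u y) <= (LINT y|?M. B * u y)"
    proof (rule integral_mono)
      show "K (x - y) * u y <= B * u y" if "y \<in> space ?M" for y
        using B(2)[OF \<open>x \<in> S\<close>, of y] that u(2) by (intro mult_right_mono) auto
    qed (use integrable_conv[OF Kc S u(1)] u in auto)
    then show ?thesis by (simp add: conv_def)
  qed
  have nn: "0 <= conv S K u x" for x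
    unfolding conv_def using K0 u(2) by (intro Lintegral_nonneg) auto
  show i: "integrable ?M (conv S K u)"
    using bd nn conv_measurable[of u] u by (intro integrable_const_bound[where B = "B * (LINT y|?M. u y)"]) auto
  have ip: "integrable (?M \<Otimes>\<^sub>M ?M) (%(x, y). K (x - y) * u y)"
  proof (rule Fubini_integrable[OF m])
    have "(%x. LINT y|?M. norm (K (x - y) * u y)) = conv S K u"
      using K0 u(2) by (auto simp: conv_def fun_eq_iff abs_mult)
    then show "integrable ?M (%x. LINT y|?M. norm (case (x, y) of (x, y) => K (x - y) * u y))" using i by simp
    show "AE x in ?M. integrable ?M (%y. case (x, y) of (x, y) => K (x - y) * u y)"
      using integrable_conv[OF Kc S u(1)] by simp
  qed
  have "(LINT x|?M. conv S K u x) = (LINT y|?M. LINT x|?M. K (x - y) * u y)"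
    unfolding conv_def by (rule Fubini_integral[OF ip, symmetric])
  also have "... <= (LINT y|?M. u y)"
  proof (rule integral_mono)
    show "integrable ?M (%y. LINT x|?M. K (x - y) * u y)" using integrable_snd[OF ip] by simp
    have "(LINT x|?M. K (x - y)) = (LINT x|?M. K (y - x))" for y
      using Ksym[of "y - _"] by (intro Lintegral_cong) (metis minus_diff_eq)+
    then have "(LINT x|?M. K (x - y)) <= 1" for y using K1[of y] by simp
    then show "(LINT x|?M. K (x - y) * u y) <= u y" for y
      using u(2)[of y] by (simp add: mult_left_le_one_le Lintegral_nonneg K0)
  qed (use u in auto)
  finally show "(LINT x|?M. conv S K u x) <= (LINT y|?M. u y)" .
qed

lemma conv_Lp_contraction:
  assumes p: "1 <= p" and u: "u \<in> Lp (lebesgue_on S) (ennreal p)"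
  shows "conv S K u \<in> Lp (lebesgue_on S) (ennreal p)"
    and "Lp_norm (lebesgue_on S) (ennreal p) (conv S K u) <= Lp_norm (lebesgue_on S) (ennreal p) u"
proof -
  let ?M = "lebesgue_on S"
  have p0: "0 < p" using p by simp
  have iup: "integrable ?M (%y. \<bar>u y\<bar> powr p)" using u p by (simp add: Lp_ennreal)
  note c = integral_conv_le[OF iup powr_ge_zero]
  have m: "conv S K u \<in> borel_measurable ?M" using u by (intro conv_measurable) (auto dest: Lp_measurable)
  have i: "integrable ?M (%x. \<bar>conv S K u x\<bar> powr p)"
    by (rule Lintegrable_bound[OF c(1)])
       (use m conv_powr_le[OF p u] in \<open>auto intro!: AE_I2 order.trans[OF _ abs_ge_self]\<close>)
  then show "conv S K u \<in> Lp ?M (ennreal p)" using m p0 by (simp add: Lp_ennreal)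
  have "(LINT x|?M. \<bar>conv S K u x\<bar> powr p) <= (LINT x|?M. conv S K (%y. \<bar>u y\<bar> powr p) x)"
    by (intro integral_mono i c conv_powr_le[OF p u])
  also have "... <= (LINT x|?M. \<bar>u x\<bar> powr p)" by (rule c(2))
  finally show "Lp_norm ?M (ennreal p) (conv S K u) <= Lp_norm ?M (ennreal p) u"
    using p0 by (simp add: Lp_norm_ennreal powr_mono2 Lintegral_nonneg)
qed

end

lemma Lp_norm_le_sup:
  assumes fin: "finite_measure M" and p: "1 <= p" and u: "u \<in> borel_measurable M"
    and b: "\<And>x. x \<in> space M ==> \<bar>u x\<bar> <= b" "0 <= b"
  shows "u \<in> Lp M (ennreal p)" "Lp_norm M (ennreal p) u <= b * (measure M (space M) + 1)"
proof -
  interpret finite_measure M by fact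
  have p0: "0 < p" using p by simp
  have le: "\<bar>u x\<bar> powr p <= b powr p" if "x \<in> space M" for x using b(1)[OF that] p0 by (intro powr_mono2) auto
  have i: "integrable M (%x. \<bar>u x\<bar> powr p)"
    using u le by (intro integrable_const_bound[where B = "b powr p"]) auto
  then show "u \<in> Lp M (ennreal p)" using u p0 by (simp add: Lp_ennreal)
  have "(LINT x|M. \<bar>u x\<bar> powr p) <= (LINT x|M. b powr p)" using i le by (intro integral_mono) auto
  also have "... = b powr p * measure M (space M)" by simp
  also have "... <= b powr p * (measure M (space M) + 1) powr p"
  proof (rule mult_left_mono)
    have "measure M (space M) + 1 <= (measure M (space M) + 1) powr p"
      using powr_mono[OF p, of "measure M (space M) + 1"] by simp
    then show "measure M (space M) <= (measure M (space M) + 1) powr p" by simp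
  qed simp
  also have "... = (b * (measure M (space M) + 1)) powr p" using b(2) by (simp add: powr_mult)
  finally show "Lp_norm M (ennreal p) u <= b * (measure M (space M) + 1)"
    using b(2) by (subst Lp_norm_le_iff[OF p0]) auto
qed

text \<open>On \<open>C\<^sub>c\<close> the convergence is uniform, and the contraction property carries it over to \<open>L\<^sup>p\<close>.\<close>

lemma approximate_identity_Lp:
  fixes S :: "'a::euclidean_space set"
  assumes K: "approximate_identity S K" and S: "S \<in> sets lebesgue" "bounded S" "S - interior S \<in> null_sets lebesgue"
    and p: "1 <= p" and u: "u \<in> Lp (lebesgue_on S) (ennreal p)"
  shows "(%n. Lp_norm (lebesgue_on S) (ennreal p) (%x. conv S (K n) u x - u x)) \<longlonglongrightarrow> 0"
proof (rule LIMSEQ_I)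
  let ?M = "lebesgue_on S"
  let ?N = "Lp_norm ?M (ennreal p)"
  fix e :: real assume e: "0 < e"
  have p0: "0 < p" using p by simp
  have K': "continuous_on UNIV (K n)" "0 <= K n z" "K n (- z) = K n z" "(LINT y|?M. K n (x - y)) <= 1" for n x z
    using K by (auto simp: approximate_identity_def)
  note kn = K'(1) K'(2) K'(3) K'(4)
  have fin: "finite_measure ?M" by (rule finite_measure_bounded[OF S(1,2) kn])
  interpret finite_measure ?M by fact
  obtain c where c: "c \<in> Cc_functions (interior S)" "c \<in> Lp ?M (ennreal p)" "?N (%x. u x - c x) <= e / 4"
    using Cc_dense_Lp[OF open_interior interior_subset S(3,1,2) p u, of "e / 4"] e by auto
  obtain C where C: "compact C" "C \<subseteq> interior S" "\<And>x. x \<notin> C ==> c x = 0" "continuous_on UNIV c"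
    using c(1) by (auto simp: Cc_functions_def)
  define \<mu> where "\<mu> = measure ?M (space ?M) + 1"
  have \<mu>: "0 < \<mu>" by (simp add: \<mu>_def add_nonneg_pos)
  define b where "b = e / (4 * \<mu>)"
  have b: "0 < b" using e \<mu> by (simp add: b_def)
  obtain R where R: "S \<subseteq> cball 0 R" using bounded_subset_ballD[OF S(2)] ball_subset_cball by (metis order.trans)
  have "uniformly_continuous_on (cball 0 R) c"
    using C(4) by (intro compact_uniformly_continuous) (auto intro: continuous_on_subset)
  then obtain d where d: "0 < d" "\<And>x y. x \<in> S ==> y \<in> S ==> dist x y < d ==> \<bar>c x - c y\<bar> <= b"
    using R b unfolding uniformly_continuous_on_def dist_real_def by (metis dist_commute less_imp_le subsetD abs_minus_commute)
  have ev: "\<forall>\<^sub>F n in sequentially. (\<forall>x\<in>C. (LINT y|?M. K n (x - y)) = 1) \<and>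
           (\<forall>x\<in>S. \<forall>y\<in>S. K n (x - y) ~= 0 --> x \<in> C \<or> y \<in> C --> dist x y < d)"
    using K C d(1) unfolding approximate_identity_def by blast
  have ic: "integrable ?M c" by (rule Cc_functions_integrable[OF S(1) c(1)])
  have iu: "integrable ?M u" using Lp_L1_bound[OF fin p] u by metis
  from ev have "\<forall>\<^sub>F n in sequentially. ?N (%x. conv S (K n) u x - u x) < e"
  proof eventually_elim
    case (elim n)
    have iK: "integrable ?M (%y. K n (x - y))" for x
      by (rule integrable_kernel[OF S(1,2) kn])
    have sup: "\<bar>conv S (K n) c x - c x\<bar> <= b" if x: "x \<in> S" for x
    proof -
      have "conv S (K n) c x - c x = (LINT y|?M. K n (x - y) * (c y - c x))"
      proof -
        have "(LINT y|?M. K n (x - y) * (c y - c x)) = conv S (K n) c x - (LINT y|?M. K n (x - y)) * c x"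
          unfolding conv_def right_diff_distrib using integrable_conv[OF kn(1) S(1,2) ic, of n x] iK by simp
        moreover have "(LINT y|?M. K n (x - y)) * c x = c x" using elim C(3)[of x] by (cases "x \<in> C") auto
        ultimately show ?thesis by simp
      qed
      also have "\<bar>...\<bar> <= (LINT y|?M. \<bar>K n (x - y) * (c y - c x)\<bar>)" by (rule integral_abs_bound)
      also have "... <= (LINT y|?M. K n (x - y) * b)"
      proof (rule integral_mono)
        have "(%y. K n (x - y) * (c y - c x)) = (%y. K n (x - y) * c y - c x * K n (x - y))"
          by (auto simp: algebra_simps)
        then show "integrable ?M (%y. \<bar>K n (x - y) * (c y - c x)\<bar>)"
          using integrable_conv[OF kn(1) S(1,2) ic, of n x] iK[of x] by simp
        fix y assume "y \<in> space ?M"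
        then have y: "y \<in> S" by simp
        show "\<bar>K n (x - y) * (c y - c x)\<bar> <= K n (x - y) * b"
        proof (cases "K n (x - y) ~= 0 \<and> (x \<in> C \<or> y \<in> C)")
          case True
          then have "dist x y < d" using elim x y by blast
          then have "\<bar>c y - c x\<bar> <= b" using d(2)[OF x y] by (simp add: abs_minus_commute)
          then show ?thesis using kn(2) by (simp add: abs_mult mult_left_mono)
        next
          case False
          then have "K n (x - y) = 0 \<or> c x = 0 \<and> c y = 0" using C(3) by blast
          then show ?thesis using kn(2) b by (auto simp: abs_mult)
        qed
      qed (use iK in auto)
      also have "... <= 1 * b" using K'(4)[of n x] b by simp
      finally show ?thesis by simp
    qed
    have m: "(%x. conv S (K n) c x - c x) \<in> borel_measurable ?M"
      using conv_measurable[OF S(1,2) kn, of c] ic by auto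
    have "?N (%x. conv S (K n) c x - c x) <= b * \<mu>" unfolding \<mu>_def
      by (rule Lp_norm_le_sup(2)[OF fin p m]) (use sup b in auto)
    also have "... = e / 4"
      using \<mu> by (simp add: b_def)
    finally have n1: "?N (%x. conv S (K n) c x - c x) <= e / 4" .
    note cc = conv_Lp_contraction[OF S(1,2) kn p]
    have eq: "(%x. conv S (K n) u x - conv S (K n) c x) = conv S (K n) (%y. u y - c y)"
      using conv_diff[OF kn(1) S(1,2) iu ic] by auto
    have n2: "?N (%x. conv S (K n) u x - conv S (K n) c x) <= e / 4"
      unfolding eq by (rule order.trans[OF cc(2)[OF Lp_diff[OF p u c(2)]] c(3)])
    have "?N (%x. conv S (K n) u x - u x) <= ?N (%x. conv S (K n) u x - conv S (K n) c x) + ?N (%x. conv S (K n) c x - u x)"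
      by (rule Lp_norm_triangle[OF p cc(1)[OF u] cc(1)[OF c(2)] u])
    also have "?N (%x. conv S (K n) c x - u x) <= ?N (%x. conv S (K n) c x - c x) + ?N (%x. c x - u x)"
      by (rule Lp_norm_triangle[OF p cc(1)[OF c(2)] c(2) u])
    also have "?N (%x. c x - u x) = ?N (%x. u x - c x)" by (rule Lp_norm_minus[OF p0])
    finally show ?case using n1 n2 c(3) e by simp
  qed
  then show "\<exists>no. \<forall>n\<ge>no. norm (?N (%x. conv S (K n) u x - u x) - 0) < e"
    using Lp_norm_nonneg[OF p0, of ?M] by (simp add: eventually_sequentially)
qed

text \<open>A function whose mollifications vanish eventually on every compact subset vanishes, because it is the \<open>L\<^sup>1\<close> limit of
  its mollifications; interior compact sets exhaust \<open>S\<close> up to a null set.\<close>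

lemma conv_zero_imp_AE_zero:
  fixes S :: "'a::euclidean_space set"
  assumes K: "approximate_identity S K" and S: "S \<in> sets lebesgue" "bounded S" "S - interior S \<in> null_sets lebesgue"
    and u: "integrable (lebesgue_on S) u"
    and z: "\<And>C. compact C ==> C \<subseteq> interior S ==> \<forall>\<^sub>F n in sequentially. \<forall>x\<in>C. conv S (K n) u x = 0"
  shows "AE x in lebesgue_on S. u x = 0"
proof -
  let ?M = "lebesgue_on S"
  have u1: "u \<in> Lp ?M (ennreal 1)" using u by (simp add: Lp_1)
  have lim: "(%n. LINT x|?M. \<bar>conv S (K n) u x - u x\<bar>) \<longlonglongrightarrow> 0"
    using approximate_identity_Lp[OF K S _ u1] by (simp add: Lp_norm_1)
  have K': "continuous_on UNIV (K n)" "0 <= K n z" "K n (- z) = K n z" "(LINT y|?M. K n (x - y)) <= 1" for n x z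
    using K by (auto simp: approximate_identity_def)
  note kn = K'(1) K'(2) K'(3) K'(4)
  have ic: "integrable ?M (conv S (K n) u)" for n
    using conv_Lp_contraction(1)[OF S(1,2) kn _ u1] by (simp add: Lp_1)
  have AEC: "AE x in ?M. x \<in> C --> u x = 0" if C: "compact C" "C \<subseteq> interior S" for C
  proof -
    have CS: "C \<in> sets ?M" using C S interior_subset[of S] fmeasurableD[OF lmeasurable_compact[OF C(1)]]
      by (auto simp: sets_restrict_space_iff)
    have iC: "integrable ?M (%x. indicator C x * \<bar>u x\<bar>)"
      using integrable_mult_indicator[OF CS, of "%x. \<bar>u x\<bar>"] u by simp
    have "\<forall>\<^sub>F n in sequentially. (LINT x|?M. indicator C x * \<bar>u x\<bar>) <= (LINT x|?M. \<bar>conv S (K n) u x - u x\<bar>)"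
      using z[OF C]
    proof eventually_elim
      case (elim n)
      show ?case by (rule integral_mono) (use iC ic[of n] u elim in \<open>auto simp: indicator_def\<close>)
    qed
    then have "(LINT x|?M. indicator C x * \<bar>u x\<bar>) <= 0"
      by (intro tendsto_le[OF _ lim tendsto_const]) auto
    moreover have "0 <= (LINT x|?M. indicator C x * \<bar>u x\<bar>)" by (rule Lintegral_nonneg) auto
    ultimately have "(LINT x|?M. indicator C x * \<bar>u x\<bar>) = 0" by simp
    then have "AE x in ?M. indicator C x * \<bar>u x\<bar> = 0"
      using iC by (subst (asm) integral_nonneg_eq_0_iff_AE) auto
    then show ?thesis by eventually_elim (auto simp: indicator_def)
  qed
  obtain C where C: "\<And>n. compact (C n)" "\<And>n. C n \<subseteq> interior S" "interior S = (\<Union>n. C (n::nat))"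
    using open_Union_compact_subsets[OF open_interior[of S]] by metis
  have "AE x in ?M. \<forall>n. x \<in> C n --> u x = 0"
    unfolding AE_all_countable using AEC C by blast
  moreover have "AE x in lebesgue. x \<notin> S - interior S" using S(3) by (rule AE_not_in)
  then have "AE x in ?M. x \<in> interior S" using S by (auto simp: AE_restrict_space_iff)
  ultimately show ?thesis by eventually_elim (use C(3) in auto)
qed

section \<open>Mollifying kernels in space\<close>

lemma mollifier_kernelD:
  assumes "mollifier_kernel \<eta>"
  shows "smooth \<eta>" "0 <= \<eta> t" "\<eta> (- t) = \<eta> t" "1 < \<bar>t\<bar> ==> \<eta> t = 0" "continuous_on UNIV \<eta>"
    "integrable lborel \<eta>" "(\<integral>\<^sup>+t. ennreal (\<eta> t) \<partial>lborel) = 1"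
proof -
  have m: "smooth \<eta>" "\<And>t. 0 <= \<eta> t" "\<And>t. \<eta> (- t) = \<eta> t" "closure {t. \<eta> t ~= 0} \<subseteq> {-1..1}" "(LINT t|lborel. \<eta> t) = 1"
    using assms by (auto simp: mollifier_kernel_def)
  show "smooth \<eta>" "0 <= \<eta> t" "\<eta> (- t) = \<eta> t" using m by auto
  show "\<eta> t = 0" if "1 < \<bar>t\<bar>"
  proof (rule ccontr)
    assume "\<eta> t ~= 0"
    then have "t \<in> closure {t. \<eta> t ~= 0}" by (auto intro: closure_subset[THEN subsetD])
    then have "t \<in> {-1..1}" using m(4) by blast
    then show False using that by auto
  qed
  show "continuous_on UNIV \<eta>" using m(1) by (rule smooth_continuous)
  show i: "integrable lborel \<eta>" using m(5) not_integrable_integral_eq by fastforce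
  show "(\<integral>\<^sup>+t. ennreal (\<eta> t) \<partial>lborel) = 1"
    using m(2,5) by (subst nn_integral_eq_integral[OF i]) auto
qed

text \<open>The kernels in several variables are products, so that their normalisation reduces to one variable by Fubini.\<close>

lemma integral_product_kernel:
  fixes h :: "'a::euclidean_space => real => real"
  assumes "\<And>b. b \<in> Basis ==> h b \<in> borel_measurable borel" "\<And>b t. b \<in> Basis ==> 0 <= h b t"
    and "\<And>b. b \<in> Basis ==> (\<integral>\<^sup>+t. ennreal (h b t) \<partial>lborel) = 1"
  shows "integrable lborel (%y. \<Prod>b\<in>Basis. h b (y \<bullet> b))" "(LINT y|lborel. (\<Prod>b\<in>Basis. h b (y \<bullet> b))) = 1"
proof -
  note [measurable] = assms(1)
  have "(\<integral>\<^sup>+y. ennreal (\<Prod>b\<in>Basis. h b (y \<bullet> b)) \<partial>lborel) = (\<integral>\<^sup>+y. (\<Prod>b\<in>Basis. ennreal (h b (y \<bullet> b))) \<partial>lborel)"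
    using assms(2) by (intro nn_integral_cong) (simp add: prod_ennreal)
  also have "... = (\<Prod>b\<in>Basis. (\<integral>\<^sup>+t. ennreal (h b t) \<partial>lborel))"
    by (rule nn_integral_lborel_prod) (auto intro: assms(1))
  also have "... = 1" using assms(3) by simp
  finally have n: "(\<integral>\<^sup>+y. ennreal (\<Prod>b\<in>Basis. h b (y \<bullet> b)) \<partial>lborel) = 1" .
  have m: "(%y. \<Prod>b\<in>Basis. h b (y \<bullet> b)) \<in> borel_measurable lborel"
    by (intro borel_measurable_prod measurable_compose[OF _ assms(1)]) auto
  have nn: "0 <= (\<Prod>b\<in>Basis. h b (y \<bullet> b))" for y using assms(2) by (simp add: prod_nonneg)
  show "integrable lborel (%y. \<Prod>b\<in>Basis. h b (y \<bullet> b))"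
    using m nn n by (intro integrableI_nonneg) auto
  show "(LINT y|lborel. (\<Prod>b\<in>Basis. h b (y \<bullet> b))) = 1"
    using m nn n by (subst integral_eq_nn_integral) auto
qed

lemma integral_lebesgue_on_eq_lborel:
  assumes S: "S \<in> sets lebesgue" and g: "g \<in> borel_measurable borel" "integrable lborel g"
    and z: "\<And>y. y \<notin> S ==> g y = (0::real)"
  shows "(LINT y|lebesgue_on S. g y) = (LINT y|lborel. g y)"
proof -
  have "(LINT y|lebesgue_on S. g y) = (LINT y|lebesgue. indicator S y *\<^sub>R g y)"
    using S by (intro integral_restrict_space) auto
  also have "(%y. indicator S y *\<^sub>R g y) = g" using z by (auto simp: indicator_def fun_eq_iff)
  also have "(LINT y|lebesgue. g y) = (LINT y|lborel. g y)" using g by (intro integral_completion) auto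
  finally show ?thesis .
qed

subsection \<open>The product kernel\<close>

definition euclid_kernel :: "(real => real) => nat => 'a::euclidean_space => real" where
  "euclid_kernel \<eta> n z = (\<Prod>b\<in>Basis. real (Suc n) * \<eta> (real (Suc n) * (z \<bullet> b)))"

context
  fixes \<eta> :: "real => real"
  assumes \<eta>: "mollifier_kernel \<eta>"
begin

lemma euclid_kernel_smooth: "smooth (euclid_kernel \<eta> n :: 'a::euclidean_space => real)"
proof -
  have "euclid_kernel \<eta> n = (%z::'a. \<Prod>b\<in>Basis. real (Suc n) * \<eta> (real (Suc n) * (z \<bullet> b)))"
    by (simp add: euclid_kernel_def[abs_def])
  moreover have "smooth ..."
    by (intro smooth_prod smooth_mult smooth_const smooth_compose_real[OF mollifier_kernelD(1)[OF \<eta>]] smooth_inner) auto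
  ultimately show ?thesis by simp
qed

lemma euclid_kernel_nonneg: "0 <= euclid_kernel \<eta> n z"
  using mollifier_kernelD(2)[OF \<eta>] by (simp add: euclid_kernel_def prod_nonneg)

lemma euclid_kernel_even: "euclid_kernel \<eta> n (- z) = euclid_kernel \<eta> n z"
  using mollifier_kernelD(3)[OF \<eta>] by (simp add: euclid_kernel_def)

lemma euclid_kernel_support:
  assumes "euclid_kernel \<eta> n (z :: 'a::euclidean_space) ~= 0"
  shows "norm z <= DIM('a) / real (Suc n)"
proof -
  have b: "\<bar>z \<bullet> b\<bar> <= 1 / real (Suc n)" if "b \<in> Basis" for b
  proof -
    have "\<eta> (real (Suc n) * (z \<bullet> b)) ~= 0" using assms that by (auto simp: euclid_kernel_def)
    then have "\<bar>real (Suc n) * (z \<bullet> b)\<bar> <= 1" using mollifier_kernelD(4)[OF \<eta>] by (meson not_le)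
    then show ?thesis by (simp add: abs_mult field_simps)
  qed
  have "norm z <= (\<Sum>b\<in>Basis. \<bar>z \<bullet> b\<bar>)" by (rule norm_le_l1)
  also have "... <= (\<Sum>b\<in>(Basis :: 'a set). 1 / real (Suc n))" by (intro sum_mono b)
  finally show ?thesis by simp
qed

lemma euclid_kernel_integral:
  fixes x :: "'a::euclidean_space"
  shows "integrable lborel (%y. euclid_kernel \<eta> n (x - y))" "(LINT y|lborel. euclid_kernel \<eta> n (x - y)) = 1"
proof -
  define h where "h b t = real (Suc n) * \<eta> (real (Suc n) * (x \<bullet> b - t))" for b :: 'a and t
  have [measurable]: "\<eta> \<in> borel_measurable borel"
    using mollifier_kernelD(5)[OF \<eta>] by (rule borel_measurable_continuous_onI)
  have eq: "euclid_kernel \<eta> n (x - y) = (\<Prod>b\<in>Basis. h b (y \<bullet> b))" for y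
    by (simp add: euclid_kernel_def h_def inner_diff_left)
  have m: "h b \<in> borel_measurable borel" for b unfolding h_def by measurable
  have nn: "0 <= h b t" for b t using mollifier_kernelD(2)[OF \<eta>] by (simp add: h_def)
  have "(\<integral>\<^sup>+t. ennreal (h b t) \<partial>lborel) = 1" for b
  proof -
    have "1 = (\<integral>\<^sup>+t. ennreal (\<eta> t) \<partial>lborel)" using mollifier_kernelD(7)[OF \<eta>] by simp
    also have "... = ennreal \<bar>- real (Suc n)\<bar> * (\<integral>\<^sup>+t. ennreal (\<eta> (real (Suc n) * (x \<bullet> b) + (- real (Suc n)) * t)) \<partial>lborel)"
      by (rule nn_integral_real_affine) auto
    also have "... = (\<integral>\<^sup>+t. ennreal (h b t) \<partial>lborel)"
    proof (subst nn_integral_cmult[symmetric], measurable, intro nn_integral_cong)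
      fix t
      have "real (Suc n) * (x \<bullet> b) + - real (Suc n) * t = real (Suc n) * (x \<bullet> b - t)" by (simp add: algebra_simps)
      then show "ennreal \<bar>- real (Suc n)\<bar> * ennreal (\<eta> (real (Suc n) * (x \<bullet> b) + - real (Suc n) * t)) = ennreal (h b t)"
        unfolding h_def using mollifier_kernelD(2)[OF \<eta>] by (simp only: ennreal_mult'[symmetric] abs_minus_cancel abs_of_nat abs_ge_zero)
    qed
    finally show ?thesis by simp
  qed
  from integral_product_kernel[of h, OF m nn this]
  show "integrable lborel (%y. euclid_kernel \<eta> n (x - y))" "(LINT y|lborel. euclid_kernel \<eta> n (x - y)) = 1"
    unfolding eq by blast+
qed

lemma eventually_euclid_kernel_support:
  assumes "0 < d"
  shows "\<forall>\<^sub>F n in sequentially. \<forall>z::'a::euclidean_space. euclid_kernel \<eta> n z ~= 0 --> norm z < d"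
proof -
  have "(%n. real DIM('a) / real (Suc n)) \<longlonglongrightarrow> 0"
    by (rule LIMSEQ_Suc[OF lim_const_over_n])
  then have "\<forall>\<^sub>F n in sequentially. real DIM('a) / real (Suc n) < d" using assms by (rule order_tendstoD)
  then show ?thesis by eventually_elim (use euclid_kernel_support in \<open>force\<close>)
qed

lemma approximate_identity_euclid:
  fixes S :: "'a::euclidean_space set"
  assumes S: "open S" "bounded S"
  shows "approximate_identity S (euclid_kernel \<eta>)"
proof -
  let ?K = "euclid_kernel \<eta> :: nat => 'a => real"
  have Sm: "S \<in> sets lebesgue" using S by auto
  have Kc: "continuous_on UNIV (?K n)" for n by (rule smooth_continuous[OF euclid_kernel_smooth])
  have Kb: "(%y. ?K n (x - y)) \<in> borel_measurable borel" for n x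
    by (intro borel_measurable_continuous_onI continuous_on_compose2[OF Kc]) (auto intro!: continuous_intros)
  have le1: "(LINT y|lebesgue_on S. ?K n (x - y)) <= 1" for n x
  proof -
    have i: "integrable lebesgue (%y. ?K n (x - y))"
      using euclid_kernel_integral(1)[of n x] Kb by (simp add: integrable_completion)
    have "(LINT y|lebesgue_on S. ?K n (x - y)) = (LINT y|lebesgue. indicator S y *\<^sub>R ?K n (x - y))"
      using Sm by (intro integral_restrict_space) auto
    also have "... <= (LINT y|lebesgue. ?K n (x - y))"
      using integrable_mult_indicator[OF Sm i] i euclid_kernel_nonneg
      by (intro integral_mono) (auto simp: indicator_def)
    also have "... = 1" using euclid_kernel_integral(2)[of n x] Kb by (subst integral_completion) auto
    finally show ?thesis .
  qed
  have "\<forall>\<^sub>F n in sequentially. (\<forall>x\<in>C. (LINT y|lebesgue_on S. ?K n (x - y)) = 1) \<and>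
      (\<forall>x\<in>S. \<forall>y\<in>S. ?K n (x - y) ~= 0 --> x \<in> C \<or> y \<in> C --> dist x y < d)"
    if C: "compact C" "C \<subseteq> interior S" "0 < d" for C d
  proof -
    obtain r where r: "0 < r" "(\<Union>x\<in>C. ball x r) \<subseteq> S"
      using compact_subset_open_imp_ball_epsilon_subset[OF C(1) S(1)] C(2) interior_subset by blast
    have "\<forall>\<^sub>F n in sequentially. \<forall>z::'a. ?K n z ~= 0 --> norm z < min r d"
      using r C(3) by (intro eventually_euclid_kernel_support) auto
    then show ?thesis
    proof eventually_elim
      case (elim n)
      have "(LINT y|lebesgue_on S. ?K n (x - y)) = 1" if x: "x \<in> C" for x
      proof -
        have "?K n (x - y) = 0" if "y \<notin> S" for y
        proof (rule ccontr)
          assume "?K n (x - y) ~= 0"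
          then have "y \<in> ball x r" using elim by (auto simp: dist_norm)
          then show False using r(2) x that by blast
        qed
        then show ?thesis
          using integral_lebesgue_on_eq_lborel[OF Sm Kb euclid_kernel_integral(1)] euclid_kernel_integral(2)[of n x] by simp
      qed
      then show ?case using elim by (auto simp: dist_norm)
    qed
  qed
  then show ?thesis
    using Kc euclid_kernel_nonneg euclid_kernel_even le1 by (auto simp: approximate_identity_def)
qed

lemma euclid_kernel_test_function:
  fixes C G :: "'a::euclidean_space set"
  assumes C: "compact C" "C \<subseteq> G" and G: "open G"
  shows "\<forall>\<^sub>F n in sequentially. \<forall>x\<in>C. (%y. euclid_kernel \<eta> n (x - y)) \<in> Cc_infinity G"
proof -
  obtain r where r: "0 < r" "(\<Union>x\<in>C. ball x r) \<subseteq> G"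
    using compact_subset_open_imp_ball_epsilon_subset[OF C(1) G C(2)] by blast
  have "\<forall>\<^sub>F n in sequentially. \<forall>z::'a. euclid_kernel \<eta> n z ~= 0 --> norm z < r / 2"
    using r by (intro eventually_euclid_kernel_support) auto
  then show ?thesis
  proof (eventually_elim, intro ballI)
    fix n x assume z: "\<forall>z::'a. euclid_kernel \<eta> n z ~= 0 --> norm z < r / 2" and x: "x \<in> C"
    have sub: "closure {y. euclid_kernel \<eta> n (x - y) ~= 0} \<subseteq> cball x (r / 2)"
      using z by (intro closure_minimal) (auto simp: dist_norm less_imp_le)
    have "cball x (r / 2) \<subseteq> ball x r" using r(1) by auto
    then have "closure {y. euclid_kernel \<eta> n (x - y) ~= 0} \<subseteq> G" using sub r(2) x by blast
    moreover have "compact (closure {y. euclid_kernel \<eta> n (x - y) ~= 0})"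
      using sub by (simp add: compact_eq_bounded_closed bounded_subset[OF bounded_cball])
    ultimately show "(%y. euclid_kernel \<eta> n (x - y)) \<in> Cc_infinity G"
      using euclid_kernel_smooth by (auto simp: Cc_infinity_def intro!: smooth_reflect)
  qed
qed

subsection \<open>The periodic kernel\<close>

text \<open>A one-periodic bump: composing \<open>\<eta>\<close> with \<open>sin\<close> avoids summing translates, and evenness of \<open>\<eta>\<close> turns the sign change of
  \<open>sin (\<pi>t)\<close> under \<open>t \<mapsto> t + 1\<close> into periodicity.\<close>

definition periodic_profile :: "nat => real => real" where
  "periodic_profile n t = \<eta> (real (Suc n) * sin (pi * t)) / integral {0..1} (%s. \<eta> (real (Suc n) * sin (pi * s)))"

definition periodic_kernel :: "nat => 'a::euclidean_space => real" where
  "periodic_kernel n z = (\<Prod>b\<in>Basis. periodic_profile n (z \<bullet> b))"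

text \<open>The integral of a periodic function over a period does not depend on where the period starts, which makes the
  normalisation of the kernel independent of \<open>x\<close>.\<close>

lemma has_integral_period:
  fixes q :: "real => real"
  assumes q: "continuous_on UNIV q" and per: "\<And>t. q (t + 1) = q t"
  obtains c where "\<And>x. ((%t. q (x - t)) has_integral c) {0..1}"
proof -
  have "\<exists>c. ((%t. q (x - t)) has_integral c) {0..1} \<and> ((%t. q (0 - t)) has_integral c) {0..1}" for x
  proof -
    define a where "a = - \<bar>x\<bar> - 3" define b where "b = \<bar>x\<bar> + 3"
    obtain g where g: "\<And>y. y \<in> {a..b} ==> (g has_vector_derivative q y) (at y within {a..b})"
      using antiderivative_continuous[of a b q] q continuous_on_subset by blast
    have g': "(g has_real_derivative q y) (at y)" if "a < y" "y < b" for y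
      using g[of y] that at_within_Icc_at[of a y b] by (simp add: has_real_derivative_iff_has_vector_derivative)
    have const: "g x - g (x - 1) = g 0 - g (0 - 1)"
    proof -
      define P where "P y = g y - g (y - 1)" for y
      have "(P has_real_derivative 0) (at y)" if "y \<in> {a+1<..<b}" for y
      proof -
        have "((%y. g (y - 1)) has_real_derivative q (y - 1) * 1) (at y)"
          using that by (intro DERIV_chain2[OF g']) (auto intro!: derivative_eq_intros)
        moreover have "(g has_real_derivative q y) (at y)" using that g' by auto
        ultimately have "(P has_real_derivative q y - q (y - 1) * 1) (at y)"
          unfolding P_def by (intro derivative_intros)
        then show ?thesis using per[of "y - 1"] by simp
      qed
      then obtain c where "\<And>y. y \<in> {a+1<..<b} ==> P y = c"
        using has_field_derivative_zero_constant[of "{a+1<..<b}" P] has_field_derivative_at_within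
        by (metis convex_real_interval(8))
      moreover have "x \<in> {a+1<..<b}" "0 \<in> {a+1<..<b}" by (auto simp: a_def b_def)
      ultimately have "P x = P 0" by metis
      then show ?thesis by (simp add: P_def)
    qed
    have "((%t. q (y - t)) has_integral g y - g (y - 1)) {0..1}" if "\<bar>y\<bar> <= \<bar>x\<bar>" for y
    proof -
      have "((%t. q (y - t)) has_integral (- g (y - 1)) - (- g (y - 0))) {0..1}"
      proof (rule fundamental_theorem_of_calculus)
        fix t :: real assume t: "t \<in> {0..1}"
        have "((%t. - g (y - t)) has_real_derivative - (q (y - t) * (- 1))) (at t)"
          using t that by (intro DERIV_minus DERIV_chain2[OF g']) (auto simp: a_def b_def intro!: derivative_eq_intros)
        then show "((%t. - g (y - t)) has_vector_derivative q (y - t)) (at t within {0..1})"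
          by (simp add: has_real_derivative_iff_has_vector_derivative has_vector_derivative_at_within)
      qed simp
      then show ?thesis by simp
    qed
    from this[of x] this[of 0] const show ?thesis by auto
  qed
  then have "((%t. q (x - t)) has_integral integral {0..1} (%t. q (0 - t))) {0..1}" for x
    by (metis integral_unique)
  then show ?thesis by (rule that)
qed

lemma periodic_profile_props:
  shows "smooth (periodic_profile n)" "0 <= periodic_profile n t" "periodic_profile n (- t) = periodic_profile n t"
    "periodic_profile n (t + 1) = periodic_profile n t"
    "(\<integral>\<^sup>+t. ennreal (indicator {0..<1} t * periodic_profile n (x - t)) \<partial>lborel) = 1"
    "periodic_profile n t ~= 0 ==> \<bar>sin (pi * t)\<bar> <= 1 / real (Suc n)"
proof -
  define q where "q t = \<eta> (real (Suc n) * sin (pi * t))" for t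
  define c where "c = integral {0..1} q"
  have prof: "periodic_profile n t = q t / c" for t by (simp add: periodic_profile_def q_def[abs_def] c_def)
  have "smooth (%t. q t)"
    unfolding q_def
    using smooth_inner[of "1::real"]
    by (intro smooth_compose_real[OF mollifier_kernelD(1)[OF \<eta>]] smooth_mult smooth_const smooth_compose_real[OF smooth_sin]) auto
  then have qs: "smooth q" by simp
  have qc: "continuous_on UNIV q" by (rule smooth_continuous[OF qs])
  have q0: "0 <= q t" for t using mollifier_kernelD(2)[OF \<eta>] by (simp add: q_def)
  have qe: "q (- t) = q t" for t using mollifier_kernelD(3)[OF \<eta>] by (simp add: q_def)
  have qp: "q (t + 1) = q t" for t using mollifier_kernelD(3)[OF \<eta>] by (simp add: q_def distrib_left)
  obtain c' where c': "\<And>x. ((%t. q (x - t)) has_integral c') {0..1}"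
    using has_integral_period[OF qc qp] by blast
  have "c = c'" using c'[of 0] qe by (simp add: c_def integral_unique)
  then have c: "((%t. q (x - t)) has_integral c) {0..1}" for x using c' by simp
  have "0 <= c" unfolding c_def by (rule integral_nonneg) (use qc q0 in \<open>auto intro: integrable_continuous_real continuous_on_subset\<close>)
  moreover have "c ~= 0"
  proof
    assume "c = 0"
    then have hi: "(q has_integral 0) (cbox 0 1)" using c[of 0] qe by simp
    have z: "q t = 0" if "t \<in> cbox 0 1" for t
      by (rule has_integral_0_cbox_imp_0[OF _ _ hi _ that]) (use qc q0 in \<open>auto intro: continuous_on_subset\<close>)
    have "\<eta> t = 0" for t
    proof (cases "\<bar>t\<bar> <= 1")
      case True
      define s where "s = arcsin (\<bar>t\<bar> / real (Suc n)) / pi"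
      have le: "0 <= \<bar>t\<bar> / real (Suc n)" "\<bar>t\<bar> / real (Suc n) <= 1" using True by (auto simp: field_simps)
      then have le1: "-1 <= \<bar>t\<bar> / real (Suc n)" by linarith
      have "0 <= arcsin (\<bar>t\<bar> / real (Suc n))" "arcsin (\<bar>t\<bar> / real (Suc n)) <= pi / 2"
        using le arcsin_le_arcsin[of 0 "\<bar>t\<bar> / real (Suc n)"] arcsin_bounded[OF le1 le(2)] by auto
      then have "s \<in> cbox 0 1" using pi_gt_zero by (simp add: s_def field_simps)
      then have "q s = 0" by (rule z)
      moreover have "sin (pi * s) = \<bar>t\<bar> / real (Suc n)" using sin_arcsin[OF le1 le(2)] by (simp only: s_def) simp
      ultimately have "\<eta> \<bar>t\<bar> = 0" by (simp add: q_def)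
      then show ?thesis using mollifier_kernelD(3)[OF \<eta>, of t] by (auto simp: abs_if split: if_splits)
    qed (use mollifier_kernelD(4)[OF \<eta>] in auto)
    then show False using mollifier_kernelD(7)[OF \<eta>] by simp
  qed
  ultimately have cp: "0 < c" by simp
  have "periodic_profile n = (%t. inverse c * q t)" by (auto simp: prof field_simps)
  then show "smooth (periodic_profile n)" using qs by (simp add: smooth_mult smooth_const)
  show "0 <= periodic_profile n t" "periodic_profile n (- t) = periodic_profile n t"
    "periodic_profile n (t + 1) = periodic_profile n t" using q0 qe qp cp by (auto simp: prof)
  show "\<bar>sin (pi * t)\<bar> <= 1 / real (Suc n)" if "periodic_profile n t ~= 0"
  proof -
    have "\<bar>real (Suc n) * sin (pi * t)\<bar> <= 1"
      using that mollifier_kernelD(4)[OF \<eta>] by (force simp: prof q_def not_le[symmetric])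
    then show ?thesis by (simp add: abs_mult field_simps)
  qed
  have "((%t. periodic_profile n (x - t)) has_integral c / c) {0..1}"
    unfolding prof using has_integral_divide[OF c] by blast
  then have "((%t. periodic_profile n (x - t)) has_integral 1) {0..<1}"
    using cp by (subst has_integral_spike_set_eq[where T = "{0..1}"]) (auto intro: negligible_subset[of "{1}"])
  from nn_integral_has_integral_lebesgue[OF _ this]
  show "(\<integral>\<^sup>+t. ennreal (indicator {0..<1} t * periodic_profile n (x - t)) \<partial>lborel) = 1"
    using q0 cp by (simp add: prof)
qed

end

section \<open>Spatial domains and test functions\<close>

lemma Basis_real_vec: "b \<in> (Basis :: (real^'n) set) \<longleftrightarrow> (\<exists>i. b = axis i 1)"
  by (auto simp: Basis_vec_def)

lemma region_Torus_eq: "region Torus = {x :: real^'n. \<forall>b\<in>Basis. x \<bullet> b \<in> {0..<1}}"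
  by (auto simp: Basis_vec_def inner_axis)

lemma region_properties:
  assumes "admissible (D :: (real^'n) spatial_domain)"
  shows "region D \<in> sets lebesgue" "bounded (region D)" "region D - interior (region D) \<in> null_sets lebesgue"
    and "region D ~= {}"
proof -
  have "region D \<in> sets lebesgue \<and> bounded (region D) \<and> region D - interior (region D) \<in> null_sets lebesgue \<and> region D ~= {}"
  proof (cases D)
    case (Euclidean_Domain \<Omega>)
    then show ?thesis using assms by (auto simp: interior_open)
  next
    case Torus
    let ?b = "box 0 One :: (real^'n) set" and ?c = "cbox 0 One :: (real^'n) set"
    have b: "?b \<subseteq> region Torus" "region Torus \<subseteq> ?c"
      unfolding region_Torus_eq by (auto simp: mem_box less_imp_le)
    have "negligible (?c - ?b)" by (rule negligible_frontier_interval)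
    then have n: "negligible (region Torus - ?b)" using b by (auto intro: negligible_subset)
    have "?b \<subseteq> interior (region Torus)" using b(1) by (intro interior_maximal) auto
    then have "negligible (region Torus - interior (region Torus :: (real^'n) set))"
      using n by (auto intro: negligible_subset)
    moreover have eq: "region Torus = ?b \<union> (region Torus - ?b)" using b by auto
    have "?b \<union> (region Torus - ?b) \<in> sets lebesgue"
      using n by (intro sets.Un) (auto simp: negligible_iff_null_sets)
    then have "region Torus \<in> sets (lebesgue :: (real^'n) measure)"
      by (rule ssubst[OF eq, of "%X. X \<in> sets lebesgue"])
    moreover have "bounded (region Torus :: (real^'n) set)" using b(2) bounded_cbox bounded_subset by blast
    moreover have "(0 :: real^'n) \<in> region Torus" by simp
    then have "region Torus ~= ({} :: (real^'n) set)" by blast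
    ultimately show ?thesis unfolding Torus negligible_iff_null_sets by blast
  qed
  then show "region D \<in> sets lebesgue" "bounded (region D)" "region D - interior (region D) \<in> null_sets lebesgue"
    and "region D ~= {}" by auto
qed

lemma region_borel:
  assumes "admissible D"
  shows "region D \<in> sets borel"
proof (cases D)
  case Torus
  have "region Torus = (\<Inter>b\<in>Basis. {x :: real^'n. x \<bullet> b \<in> {0..<1}})" unfolding region_Torus_eq by auto
  also have "... \<in> sets borel" by (intro sets.finite_INT) (auto simp del: atLeastLessThan_iff)
  finally show ?thesis using Torus by simp
next
  case (Euclidean_Domain \<Omega>)
  then show ?thesis using assms by simp
qed

lemma finite_measure_region:
  assumes "admissible D"
  shows "finite_measure (space_measure D)"
  by (intro finite_measure_lebesgue_on bounded_set_imp_lmeasurable region_properties(1,2)[OF assms])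

text \<open>On the torus the kernel has to be periodic, so that mollification produces test functions.\<close>

primrec space_kernel :: "(real => real) => (real^'n) spatial_domain => nat => real^'n => real" where
  "space_kernel \<eta> Torus = periodic_kernel \<eta>"
| "space_kernel \<eta> (Euclidean_Domain \<Omega>) = euclid_kernel \<eta>"

lemma inner_axis_Basis: "b \<in> Basis ==> axis i 1 \<bullet> b = (if b = axis i (1::real) then 1 else 0)"
  by (auto simp: Basis_real_vec inner_axis_axis axis_eq_axis)

context
  fixes \<eta> :: "real => real"
  assumes \<eta>: "mollifier_kernel \<eta>"
begin

lemma periodic_kernel_smooth: "smooth (periodic_kernel \<eta> n :: 'a::euclidean_space => real)"
proof -
  have "periodic_kernel \<eta> n = (%z::'a. \<Prod>b\<in>Basis. periodic_profile \<eta> n (z \<bullet> b))"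
    by (simp add: periodic_kernel_def[OF \<eta>] fun_eq_iff)
  moreover have "smooth ..."
    by (intro smooth_prod smooth_compose_real[OF periodic_profile_props(1)[OF \<eta>]] smooth_inner) auto
  ultimately show ?thesis by simp
qed

lemma periodic_kernel_translate: "periodic_kernel \<eta> n (z + axis i 1) = periodic_kernel \<eta> n (z :: real^'n)"
  unfolding periodic_kernel_def[OF \<eta>] inner_add_left
  by (intro prod.cong) (auto simp: inner_axis_Basis periodic_profile_props(4)[OF \<eta>])

lemma periodic_kernel_integral:
  fixes x :: "real^'n"
  shows "(LINT y|space_measure Torus. periodic_kernel \<eta> n (x - y)) = 1"
proof -
  note pp = periodic_profile_props[OF \<eta>]
  have [measurable]: "periodic_profile \<eta> n \<in> borel_measurable borel"
    using smooth_continuous[OF pp(1)] by (rule borel_measurable_continuous_onI)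
  define h where "h b t = indicator {0..<1} t * periodic_profile \<eta> n (x \<bullet> b - t)" for b :: "real^'n" and t
  have hm: "h b \<in> borel_measurable borel" for b unfolding h_def by measurable
  have eq: "(\<Prod>b\<in>Basis. h b (y \<bullet> b)) = indicator (region Torus) y *\<^sub>R periodic_kernel \<eta> n (x - y)" for y
  proof -
    have "(\<Prod>b\<in>(Basis::(real^'n) set). indicator {0..<1} (y \<bullet> b)) = (indicator (region Torus) y :: real)"
    proof (cases "y \<in> region Torus")
      case True then show ?thesis unfolding region_Torus_eq by simp
    next
      case False
      then have "\<exists>b\<in>Basis. indicator {0..<1} (y \<bullet> b) = (0::real)" unfolding region_Torus_eq by (auto simp: indicator_def)
      then have "(\<Prod>b\<in>(Basis::(real^'n) set). indicator {0..<1} (y \<bullet> b)) = (0::real)" by (intro prod_zero) auto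
      then show ?thesis using False by simp
    qed
    then show ?thesis by (simp add: h_def prod.distrib periodic_kernel_def[OF \<eta>] inner_diff_left)
  qed
  have "0 <= h b t" for b t using pp(2) by (simp add: h_def)
  moreover have "(\<integral>\<^sup>+t. ennreal (h b t) \<partial>lborel) = 1" for b using pp(5)[of n "x \<bullet> b"] by (simp only: h_def)
  ultimately have ip: "integrable lborel (%y. \<Prod>b\<in>Basis. h b (y \<bullet> b))" "(LINT y|lborel. (\<Prod>b\<in>Basis. h b (y \<bullet> b))) = 1"
    using integral_product_kernel[of h] hm by blast+
  have "(LINT y|space_measure Torus. periodic_kernel \<eta> n (x - y)) =
      (LINT y|lebesgue. indicator (region Torus) y *\<^sub>R periodic_kernel \<eta> n (x - y))"
    using region_properties(1)[of "Torus :: (real^'n) spatial_domain"] by (intro integral_restrict_space) auto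
  also have "... = (LINT y|lebesgue. (\<Prod>b\<in>Basis. h b (y \<bullet> b)))" unfolding eq ..
  also have "... = (LINT y|lborel. (\<Prod>b\<in>Basis. h b (y \<bullet> b)))"
    using borel_measurable_integrable[OF ip(1)] by (rule integral_completion)
  also have "... = 1" by (rule ip(2))
  finally show ?thesis .
qed

text \<open>If one of two points of the unit cube keeps the distance \<open>m\<close> from the faces, their coordinates differ by at
  most \<open>1 - m\<close>; on \<open>[d, 1 - m]\<close> the sine of \<open>\<pi>t\<close> is bounded away from zero.\<close>

lemma periodic_kernel_near_diagonal:
  fixes C :: "(real^'n) set"
  assumes C: "compact C" "C \<subseteq> interior (region Torus)" and d: "0 < d"
  shows "\<forall>\<^sub>F n in sequentially. \<forall>x\<in>region Torus. \<forall>y\<in>region Torus.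
           periodic_kernel \<eta> n (x - y) ~= 0 --> x \<in> C \<or> y \<in> C --> dist x y < d"
proof -
  obtain r where r: "0 < r" "(\<Union>x\<in>C. ball x r) \<subseteq> interior (region Torus)"
    using compact_subset_open_imp_ball_epsilon_subset[OF C(1) open_interior C(2)] by blast
  define m where "m = min (r / 2) (1 / 2)"
  have m: "0 < m" "m <= 1 / 2" using r by (auto simp: m_def)
  have inC: "m <= x \<bullet> b \<and> x \<bullet> b <= 1 - m" if x: "x \<in> C" and b: "b \<in> Basis" for x b
  proof -
    have "norm (m *\<^sub>R b) < r" using m b r by (simp add: m_def)
    then have "x - m *\<^sub>R b \<in> ball x r" "x + m *\<^sub>R b \<in> ball x r" by (auto simp: dist_norm)
    then have "x - m *\<^sub>R b \<in> region Torus" "x + m *\<^sub>R b \<in> region Torus"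
      using r(2) x interior_subset by blast+
    then have "0 <= (x - m *\<^sub>R b) \<bullet> b" "(x + m *\<^sub>R b) \<bullet> b < 1" unfolding region_Torus_eq using b by auto
    then show ?thesis using b by (simp add: inner_diff_left inner_add_left)
  qed
  define d' where "d' = min (d / (2 * real CARD('n))) (1 / 2)"
  have d': "0 < d'" "d' <= 1 / 2" using d by (auto simp: d'_def)
  define \<mu> where "\<mu> = min (sin (pi * d')) (sin (pi * m))"
  have sin_mono: "sin (pi * s) <= sin (pi * t)" if "0 <= s" "s <= t" "t <= 1 / 2" for s t
  proof (rule sin_monotone_2pi_le)
    have "0 <= pi * s" using that pi_gt_zero by simp
    then show "- (pi / 2) <= pi * s" using pi_gt_zero by linarith
  qed (use that pi_gt_zero in auto)
  have pos: "0 < sin (pi * s)" if "0 < s" "s <= 1 / 2" for s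
    using that pi_gt_zero by (intro sin_gt_zero) (auto simp: field_simps intro: order.strict_trans1)
  have \<mu>: "0 < \<mu>" using pos m d' by (simp add: \<mu>_def)
  have close: "\<bar>t\<bar> < d'" if "\<bar>t\<bar> <= 1 - m" "\<bar>sin (pi * t)\<bar> < \<mu>" for t
  proof (rule ccontr)
    assume "\<not> \<bar>t\<bar> < d'"
    then have t: "d' <= \<bar>t\<bar>" by simp
    have abs: "\<bar>sin (pi * t)\<bar> = \<bar>sin (pi * \<bar>t\<bar>)\<bar>" by (auto simp: abs_if)
    have "\<mu> <= sin (pi * \<bar>t\<bar>)"
    proof (cases "\<bar>t\<bar> <= 1 / 2")
      case True
      then show ?thesis using sin_mono[of d' "\<bar>t\<bar>"] t d' by (simp add: \<mu>_def)
    next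
      case False
      have "sin (pi * \<bar>t\<bar>) = sin (pi * (1 - \<bar>t\<bar>))" by (simp add: right_diff_distrib)
      moreover have "sin (pi * m) <= sin (pi * (1 - \<bar>t\<bar>))" using sin_mono[of m "1 - \<bar>t\<bar>"] that(1) m False by simp
      ultimately show ?thesis by (simp add: \<mu>_def)
    qed
    then show False using that(2) abs by linarith
  qed
  have "(%n. 1 / real (Suc n)) \<longlonglongrightarrow> 0" by (rule LIMSEQ_Suc[OF lim_const_over_n])
  then have "\<forall>\<^sub>F n in sequentially. 1 / real (Suc n) < \<mu>" using \<mu> by (rule order_tendstoD)
  then show ?thesis
  proof (eventually_elim, intro ballI impI)
    fix n and x y :: "real^'n"
    assume n: "1 / real (Suc n) < \<mu>" and xy: "x \<in> region Torus" "y \<in> region Torus"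
      and K: "periodic_kernel \<eta> n (x - y) ~= 0" and C: "x \<in> C \<or> y \<in> C"
    have b: "\<bar>(x - y) \<bullet> b\<bar> <= d'" if b: "b \<in> Basis" for b
    proof -
      have "periodic_profile \<eta> n ((x - y) \<bullet> b) ~= 0" using K b by (auto simp: periodic_kernel_def[OF \<eta>])
      then have "\<bar>sin (pi * ((x - y) \<bullet> b))\<bar> < \<mu>" using periodic_profile_props(6)[OF \<eta>] n by (meson order.strict_trans1)
      moreover have "0 <= x \<bullet> b" "x \<bullet> b < 1" "0 <= y \<bullet> b" "y \<bullet> b < 1" using xy b unfolding region_Torus_eq by auto
      then have "\<bar>(x - y) \<bullet> b\<bar> <= 1 - m" using C inC[of x b] inC[of y b] b by (auto simp: inner_diff_left)
      ultimately show ?thesis using close by fastforce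
    qed
    have "dist x y <= (\<Sum>b\<in>Basis. \<bar>(x - y) \<bullet> b\<bar>)" unfolding dist_norm by (rule norm_le_l1)
    also have "... <= (\<Sum>b\<in>(Basis :: (real^'n) set). d')" by (intro sum_mono b)
    also have "... = real CARD('n) * d'" by simp
    also have "... <= real CARD('n) * (d / (2 * real CARD('n)))" by (intro mult_left_mono) (auto simp: d'_def)
    also have "... = d / 2" by simp
    also have "... < d" using d by simp
    finally show "dist x y < d" .
  qed
qed

lemma approximate_identity_periodic:
  "approximate_identity (region Torus :: (real^'n) set) (periodic_kernel \<eta>)"
proof (unfold approximate_identity_def, intro conjI allI impI)
  fix n and x z :: "real^'n"
  show "continuous_on UNIV (periodic_kernel \<eta> n :: real^'n => real)" by (rule smooth_continuous[OF periodic_kernel_smooth])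
  show "0 <= periodic_kernel \<eta> n z" "periodic_kernel \<eta> n (- z) = periodic_kernel \<eta> n z"
    using periodic_profile_props(2,3)[OF \<eta>] by (auto simp: periodic_kernel_def[OF \<eta>] prod_nonneg)
  show "(LINT y|space_measure Torus. periodic_kernel \<eta> n (x - y)) <= 1" by (simp only: periodic_kernel_integral order_refl)
next
  fix C :: "(real^'n) set" and d :: real
  assume "compact C \<and> C \<subseteq> interior (region Torus) \<and> 0 < d"
  then have "\<forall>\<^sub>F n in sequentially. \<forall>x\<in>region Torus. \<forall>y\<in>region Torus.
           periodic_kernel \<eta> n (x - y) ~= 0 --> x \<in> C \<or> y \<in> C --> dist x y < d"
    by (intro periodic_kernel_near_diagonal) auto
  then show "\<forall>\<^sub>F n in sequentially. (\<forall>x\<in>C. (LINT y|space_measure Torus. periodic_kernel \<eta> n (x - y)) = 1) \<and>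
     (\<forall>x\<in>region Torus. \<forall>y\<in>region Torus. periodic_kernel \<eta> n (x - y) ~= 0 --> x \<in> C \<or> y \<in> C --> dist x y < d)"
    by (rule eventually_mono) (use periodic_kernel_integral in blast)
qed

lemma approximate_identity_space_kernel:
  assumes "admissible D"
  shows "approximate_identity (region D) (space_kernel \<eta> D)"
proof (cases D)
  case Torus
  show ?thesis unfolding Torus space_kernel.simps by (rule approximate_identity_periodic)
next
  case (Euclidean_Domain \<Omega>)
  have "open \<Omega>" "bounded \<Omega>" using assms unfolding Euclidean_Domain by simp_all
  then show ?thesis unfolding Euclidean_Domain space_kernel.simps region.simps by (rule approximate_identity_euclid[OF \<eta>])
qed

lemma space_kernel_smooth: "smooth (space_kernel \<eta> D n)"
  by (cases D) (simp_all add: periodic_kernel_smooth euclid_kernel_smooth[OF \<eta>])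

lemma space_kernel_periodic: "(%y. space_kernel \<eta> Torus n (x - y)) \<in> test_functions Torus"
proof -
  have "periodic_kernel \<eta> n (x - (y + axis i 1)) = periodic_kernel \<eta> n (x - y)" for y i
  proof -
    have "x - (y + axis i 1) + axis i 1 = x - y" by simp
    then show ?thesis using periodic_kernel_translate[of n "x - (y + axis i 1)" i] by (simp only:)
  qed
  then show ?thesis using smooth_reflect[OF periodic_kernel_smooth] by simp
qed

lemma space_kernel_test_function:
  assumes D: "admissible D" and C: "compact C" "C \<subseteq> interior (region D)"
  shows "\<forall>\<^sub>F n in sequentially. \<forall>x\<in>C. (%y. space_kernel \<eta> D n (x - y)) \<in> test_functions D"
proof (cases D)
  case Torus
  show ?thesis unfolding Torus by (intro always_eventually allI ballI space_kernel_periodic)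
next
  case (Euclidean_Domain \<Omega>)
  then show ?thesis using euclid_kernel_test_function[OF \<eta> C(1), of \<Omega>] C D by (auto simp: interior_open)
qed

end

subsection \<open>Test functions and partial derivatives\<close>

definition partial :: "'n => (real^'n => real) => real^'n => real" where
  "partial i \<psi> x = frechet_derivative \<psi> (at x) (axis i 1)"

lemma partial_eq:
  assumes "(\<psi> has_derivative \<psi>') (at x)"
  shows "partial i \<psi> x = \<psi>' (axis i 1)"
  unfolding partial_def frechet_derivative_at[OF assms, symmetric] ..

lemma smooth_partial:
  assumes "smooth \<psi>"
  shows "smooth (partial i \<psi>)" "\<psi> differentiable (at x)"
proof -
  obtain v where v: "\<And>x. (\<psi> has_derivative (%h. v x \<bullet> h)) (at x)" "\<And>i. i \<in> Basis ==> smooth (%x. v x \<bullet> i)"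
    using smooth_gradient[OF assms] by blast
  have "partial i \<psi> = (%x. v x \<bullet> axis i 1)" using partial_eq[OF v(1)] by auto
  then show "smooth (partial i \<psi>)" using v(2)[of "axis i 1"] Basis_real_vec[of "axis i 1"] by auto
  show "\<psi> differentiable (at x)" using v(1) by (auto simp: differentiable_def)
qed

lemma has_derivative_frechet: "smooth (\<psi> :: real^'n => real) ==> (\<psi> has_derivative frechet_derivative \<psi> (at x)) (at x)"
  using smooth_partial(2)[of \<psi> x] by (simp only: frechet_derivative_works)

lemma partial_mult:
  assumes "smooth \<psi>" "smooth \<theta>"
  shows "partial i (%x. \<psi> x * \<theta> x) x = \<psi> x * partial i \<theta> x + partial i \<psi> x * \<theta> x"
proof -
  have "((%x. \<psi> x * \<theta> x) has_derivative
      (%h. \<psi> x * frechet_derivative \<theta> (at x) h + frechet_derivative \<psi> (at x) h * \<theta> x)) (at x)"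
    by (rule has_derivative_mult[OF has_derivative_frechet[OF assms(1)] has_derivative_frechet[OF assms(2)]])
  from partial_eq[OF this] show ?thesis by (simp only: partial_def)
qed

lemma test_function_smooth: "\<psi> \<in> test_functions D ==> smooth \<psi>"
  by (cases D) (simp_all add: Cc_infinity_def)

lemma Cc_infinity_mult:
  assumes "\<psi> \<in> Cc_infinity S" "smooth \<theta>"
  shows "(%x. \<psi> x * \<theta> x) \<in> Cc_infinity S"
proof -
  have sub: "closure {x. \<psi> x * \<theta> x ~= 0} \<subseteq> closure {x. \<psi> x ~= 0}" by (intro closure_mono) auto
  moreover have "compact (closure {x. \<psi> x * \<theta> x ~= 0})"
    using sub assms by (auto simp: Cc_infinity_def compact_eq_bounded_closed intro: bounded_subset)
  ultimately show ?thesis using assms by (auto simp: Cc_infinity_def smooth_mult)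
qed

lemma Cc_infinity_add:
  assumes "\<psi> \<in> Cc_infinity S" "\<theta> \<in> Cc_infinity S"
  shows "(%x. \<psi> x + \<theta> x) \<in> Cc_infinity S"
proof -
  have "closure {x. \<psi> x + \<theta> x ~= 0} \<subseteq> closure ({x. \<psi> x ~= 0} \<union> {x. \<theta> x ~= 0})" by (intro closure_mono) auto
  then have sub: "closure {x. \<psi> x + \<theta> x ~= 0} \<subseteq> closure {x. \<psi> x ~= 0} \<union> closure {x. \<theta> x ~= 0}" by simp
  have "compact (closure {x. \<psi> x ~= 0} \<union> closure {x. \<theta> x ~= 0})"
    using assms by (auto simp: Cc_infinity_def)
  then have "compact (closure {x. \<psi> x + \<theta> x ~= 0})"
    unfolding compact_eq_bounded_closed using bounded_subset[OF _ sub] by simp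
  moreover note sub
  ultimately show ?thesis using assms by (auto simp: Cc_infinity_def smooth_add)
qed

text \<open>These are the functions by which test functions may be multiplied. The weak formulation of a gradient extends to all of
  them for functions that vanish near the boundary, and they include the mollifying kernels.\<close>

primrec multipliers :: "(real^'n) spatial_domain => (real^'n => real) set" where
  "multipliers Torus = test_functions Torus"
| "multipliers (Euclidean_Domain \<Omega>) = Collect smooth"

lemma test_function_mult:
  assumes "\<psi> \<in> test_functions D" "\<theta> \<in> multipliers D"
  shows "(%x. \<psi> x * \<theta> x) \<in> test_functions D"
proof (cases D)
  case Torus
  have "smooth \<psi>" "smooth \<theta>" "\<And>x i. \<psi> (x + axis i 1) = \<psi> x" "\<And>x i. \<theta> (x + axis i 1) = \<theta> x"
    using assms unfolding Torus by simp_all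
  then show ?thesis unfolding Torus by (simp add: smooth_mult)
next
  case (Euclidean_Domain \<Omega>)
  then show ?thesis using Cc_infinity_mult[of \<psi> \<Omega> \<theta>] assms by simp
qed

lemma multiplier_smooth: "\<psi> \<in> multipliers D ==> smooth \<psi>"
  by (cases D) simp_all

lemma test_function_multiplier: "\<psi> \<in> test_functions D ==> \<psi> \<in> multipliers D"
  using test_function_smooth[of \<psi> D] by (cases D) simp_all

lemma space_kernel_multiplier:
  assumes "mollifier_kernel \<eta>"
  shows "(%y. space_kernel \<eta> D n (x - y)) \<in> multipliers D"
proof (cases D)
  case Torus
  show ?thesis unfolding Torus multipliers.simps by (rule space_kernel_periodic[OF assms])
next
  case (Euclidean_Domain \<Omega>)
  show ?thesis unfolding Euclidean_Domain multipliers.simps mem_Collect_eq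
    by (rule smooth_reflect[OF space_kernel_smooth[OF assms]])
qed

lemma lborel_integral_translate:
  fixes g :: "'a::euclidean_space => real"
  assumes "g \<in> borel_measurable borel"
  shows "(LINT y|lborel. g (y + w)) = (LINT y|lborel. g y)"
proof -
  have "(LINT y|lborel. g y) = (LINT y|distr lborel borel ((+) w). g y)" by (simp only: lborel_distr_plus)
  also have "... = (LINT y|lborel. g (w + y))" using assms by (intro integral_distr) auto
  finally show ?thesis by (simp add: add.commute)
qed

text \<open>Shifting the unit cube by \<open>h\<close> in direction \<open>i\<close> moves the slab \<open>{x\<^sub>i < h}\<close> by a full period.\<close>

lemma integral_periodic_translate:
  fixes \<theta> :: "real^'n => real"
  assumes c: "continuous_on UNIV \<theta>" and per: "\<And>x. \<theta> (x + axis i 1) = \<theta> x" and h: "0 <= h" "h < 1"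
  shows "(LINT y|space_measure Torus. \<theta> (y + h *\<^sub>R axis i 1)) = (LINT y|space_measure Torus. \<theta> y)"
proof -
  let ?S = "region Torus :: (real^'n) set" and ?e = "axis i 1 :: real^'n"
  have SB: "?S \<in> sets borel" by (rule region_borel) simp
  have [measurable]: "\<theta> \<in> borel_measurable borel" using c by (rule borel_measurable_continuous_onI)
  have e: "?e \<in> Basis" "?e \<bullet> ?e = 1" by (auto simp: Basis_real_vec inner_axis_axis)
  have conv: "(LINT y|space_measure Torus. g y) = (LINT y|lborel. indicator ?S y * g y)"
    if [measurable]: "g \<in> borel_measurable borel" for g :: "real^'n => real"
  proof -
    have "(LINT y|space_measure Torus. g y) = (LINT y|lebesgue. indicator ?S y *\<^sub>R g y)"
      using SB by (intro integral_restrict_space) auto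
    also have "... = (LINT y|lborel. indicator ?S y *\<^sub>R g y)"
      using SB by (intro integral_completion) auto
    finally show ?thesis by simp
  qed
  have int: "integrable lborel (%y. indicator A y * \<theta> y)" if A: "A \<in> sets borel" "bounded A" for A
  proof -
    have "bounded (closure A)" using A by (simp add: bounded_closure)
    then have "integrable lborel (%y. indicator (closure A) y *\<^sub>R \<theta> y)"
      using c by (intro borel_integrable_compact) (auto simp: compact_eq_bounded_closed intro: continuous_on_subset)
    from integrable_mult_indicator[OF _ this, of A]
    have "integrable lborel (%y. indicator A y *\<^sub>R (indicator (closure A) y *\<^sub>R \<theta> y))" using A by simp
    moreover have "(%y. indicator A y *\<^sub>R (indicator (closure A) y *\<^sub>R \<theta> y)) = (%y. indicator A y * \<theta> y)"
      using closure_subset[of A] by (auto simp: indicator_def fun_eq_iff)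
    ultimately show ?thesis by (simp only:)
  qed
  define A where "A = {y\<in>?S. h <= y \<bullet> ?e}"
  define B where "B = {y\<in>?S. y \<bullet> ?e < h}"
  have Am: "A \<in> sets borel" "B \<in> sets borel"
  proof -
    have "A = ?S \<inter> {y. h <= y \<bullet> ?e}" "B = ?S \<inter> {y. y \<bullet> ?e < h}" by (auto simp: A_def B_def)
    then show "A \<in> sets borel" "B \<in> sets borel" using SB by auto
  qed
  have bS: "bounded ?S" using region_properties(2)[of Torus] by simp
  have Ab: "bounded A" "bounded B" using bS by (auto simp: A_def B_def intro: bounded_subset)
  have Be: "(%y. y - ?e) -` B \<in> sets borel"
  proof -
    have "(%y. y - ?e) -` B \<inter> space borel \<in> sets borel" using Am(2) by (intro measurable_sets[of _ borel borel]) auto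
    then show ?thesis by simp
  qed
  have Bb: "bounded ((%y. y - ?e) -` B)"
  proof -
    have "(%y. y - ?e) -` B = (%y. ?e + y) ` B"
    proof (intro equalityI subsetI)
      fix y assume "y \<in> (%y. y - ?e) -` B"
      then show "y \<in> (%y. ?e + y) ` B" by (intro image_eqI[of _ _ "y - ?e"]) auto
    qed auto
    then show ?thesis using bounded_translation[OF Ab(2)] by simp
  qed
  have ind: "indicator ?S (y - h *\<^sub>R ?e) = (indicator A y + indicator ((%y. y - ?e) -` B) y :: real)" for y
  proof -
    have "y - h *\<^sub>R ?e \<in> ?S \<longleftrightarrow> y \<in> A \<or> y - ?e \<in> B"
    proof -
      have 1: "y - h *\<^sub>R ?e \<in> ?S \<longleftrightarrow> (\<forall>b\<in>Basis. b ~= ?e --> y \<bullet> b \<in> {0..<1}) \<and> y \<bullet> ?e - h \<in> {0..<1}"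
        unfolding region_Torus_eq using e by (auto simp: inner_diff_left inner_axis_Basis split: if_splits)
      have 2: "y \<in> A \<longleftrightarrow> (\<forall>b\<in>Basis. b ~= ?e --> y \<bullet> b \<in> {0..<1}) \<and> y \<bullet> ?e \<in> {0..<1} \<and> h <= y \<bullet> ?e"
        unfolding A_def region_Torus_eq using e by auto
      have 3: "y - ?e \<in> B \<longleftrightarrow> (\<forall>b\<in>Basis. b ~= ?e --> y \<bullet> b \<in> {0..<1}) \<and> y \<bullet> ?e - 1 \<in> {0..<1} \<and> y \<bullet> ?e - 1 < h"
        unfolding B_def region_Torus_eq using e by (auto simp: inner_diff_left inner_axis_Basis split: if_splits)
      show ?thesis unfolding 1 2 3 using h by auto
    qed
    moreover have "\<not> (y \<in> A \<and> y - ?e \<in> B)"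
    proof
      assume "y \<in> A \<and> y - ?e \<in> B"
      then have "y \<in> ?S" "y - ?e \<in> ?S" by (auto simp: A_def B_def)
      then have "y \<bullet> ?e < 1" "0 <= (y - ?e) \<bullet> ?e" unfolding region_Torus_eq using e(1) by auto
      then show False using e(2) by (simp add: inner_diff_left)
    qed
    ultimately show ?thesis by (auto simp: indicator_def)
  qed
  have "(LINT y|space_measure Torus. \<theta> (y + h *\<^sub>R ?e)) = (LINT y|lborel. indicator ?S y * \<theta> (y + h *\<^sub>R ?e))"
    by (rule conv) simp
  also have "... = (LINT y|lborel. indicator ?S (y - h *\<^sub>R ?e) * \<theta> y)"
    using lborel_integral_translate[of "%y. indicator ?S (y - h *\<^sub>R ?e) * \<theta> y" "h *\<^sub>R ?e"] SB by simp
  also have "... = (LINT y|lborel. indicator A y * \<theta> y + indicator ((%y. y - ?e) -` B) y * \<theta> y)"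
    unfolding ind by (simp add: distrib_right)
  also have "... = (LINT y|lborel. indicator A y * \<theta> y) + (LINT y|lborel. indicator ((%y. y - ?e) -` B) y * \<theta> y)"
    by (intro Lintegral_add int Am Ab Be Bb)
  also have "(LINT y|lborel. indicator ((%y. y - ?e) -` B) y * \<theta> y) = (LINT y|lborel. indicator B y * \<theta> y)"
  proof -
    have "(%y. indicator ((%y. y - ?e) -` B) y * \<theta> y) \<in> borel_measurable borel" using Be by auto
    from lborel_integral_translate[OF this, of ?e] show ?thesis by (simp add: per indicator_def)
  qed
  also have "(LINT y|lborel. indicator A y * \<theta> y) + (LINT y|lborel. indicator B y * \<theta> y)
      = (LINT y|lborel. indicator A y * \<theta> y + indicator B y * \<theta> y)"
    by (intro Lintegral_add[symmetric] int Am Ab)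
  also have "... = (LINT y|lborel. indicator ?S y * \<theta> y)"
    by (intro Lintegral_cong) (auto simp: A_def B_def indicator_def)
  also have "... = (LINT y|space_measure Torus. \<theta> y)" by (rule conv[symmetric]) simp
  finally show ?thesis .
qed

section \<open>Sobolev spaces\<close>

lemma integrable_mult_continuous:
  fixes \<psi> u :: "'a::euclidean_space => real"
  assumes \<psi>: "continuous_on UNIV \<psi>" and S: "S \<in> sets lebesgue" "bounded S"
    and u: "integrable (lebesgue_on S) u"
  shows "integrable (lebesgue_on S) (%x. u x * \<psi> x)"
proof -
  have "continuous_on UNIV (%z. \<psi> (- z))"
    by (rule continuous_on_compose2[OF \<psi>]) (auto intro!: continuous_intros)
  from integrable_conv[OF this S u, of 0] show ?thesis by (simp add: mult.commute)
qed

lemma continuous_bound_on: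
  fixes \<psi> :: "'a::euclidean_space => real"
  assumes \<psi>: "continuous_on UNIV \<psi>" and S: "bounded S"
  obtains B :: real where "0 <= B" "\<And>x. x \<in> S ==> \<bar>\<psi> x\<bar> <= B"
proof -
  obtain B where "0 <= B" "\<And>x y. x \<in> S ==> y \<in> {0} ==> \<bar>\<psi> (x - y)\<bar> <= B"
    using kernel_bounded[OF \<psi> bounded_insert[THEN iffD2, OF bounded_empty] S] by blast
  then show ?thesis by (intro that[of B]) auto
qed

lemma Lp_mult_bounded:
  assumes p: "0 < p" and u: "u \<in> Lp (lebesgue_on S) (ennreal p)"
    and \<psi>: "continuous_on UNIV \<psi>" "\<And>x. x \<in> S ==> \<bar>\<psi> x\<bar> <= B" and S: "S \<in> sets lebesgue"
  shows "(%x. \<psi> x * u x) \<in> Lp (lebesgue_on S) (ennreal p)"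
proof (rule Lp_norm_mono(1)[OF p Lp_scale[OF p u, of B]])
  have "\<psi> \<in> borel_measurable (lebesgue_on S)"
    using \<psi>(1) by (intro measurable_restrict_space1 measurable_completion) (simp add: borel_measurable_continuous_onI)
  then show "(%x. \<psi> x * u x) \<in> borel_measurable (lebesgue_on S)" using u by (auto dest: Lp_measurable)
  show "AE x in lebesgue_on S. \<bar>\<psi> x * u x\<bar> <= \<bar>B * u x\<bar>"
  proof (rule AE_I2)
    fix x assume "x \<in> space (lebesgue_on S)"
    then have "\<bar>\<psi> x\<bar> <= \<bar>B\<bar>" using \<psi>(2)[of x] by auto
    from mult_right_mono[OF this, of "\<bar>u x\<bar>"] show "\<bar>\<psi> x * u x\<bar> <= \<bar>B * u x\<bar>" by (simp add: abs_mult)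
  qed
qed

lemma Cc_infinity_integral_translate:
  fixes \<theta> :: "'a::euclidean_space => real"
  assumes \<theta>: "\<theta> \<in> Cc_infinity \<Omega>" and \<Omega>: "open \<Omega>"
  obtains r where "0 < r" "\<And>w. norm w < r ==> (LINT y|lebesgue_on \<Omega>. \<theta> (y + w)) = (LINT y|lebesgue_on \<Omega>. \<theta> y)"
proof -
  define C where "C = closure {x. \<theta> x ~= 0}"
  have C: "compact C" "C \<subseteq> \<Omega>" and c: "continuous_on UNIV \<theta>"
    using \<theta> by (auto simp: Cc_infinity_def C_def smooth_continuous)
  have z: "\<theta> x = 0" if "x \<notin> C" for x using that closure_subset[of "{x. \<theta> x ~= 0}"] by (auto simp: C_def)
  have \<theta>b: "(%y. \<theta> (y + w)) \<in> borel_measurable borel" for w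
    by (intro borel_measurable_continuous_onI continuous_on_compose2[OF c]) (auto intro!: continuous_intros)
  have i: "integrable lborel \<theta>"
  proof -
    have "integrable lborel (%x. indicator C x *\<^sub>R \<theta> x)"
      using C c by (intro borel_integrable_compact) (auto intro: continuous_on_subset)
    moreover have "(%x. indicator C x *\<^sub>R \<theta> x) = \<theta>" using z by (auto simp: indicator_def fun_eq_iff)
    ultimately show ?thesis by simp
  qed
  have iw: "integrable lborel (%y. \<theta> (y + w))" for w
  proof -
    have "integrable (distr lborel borel ((+) w)) \<theta>" using i by (simp add: lborel_distr_plus)
    then have "integrable lborel (%y. \<theta> (w + y))" using \<theta>b[of 0] by (subst (asm) integrable_distr_eq) auto
    then show ?thesis by (simp add: add.commute)
  qed
  obtain r where r: "0 < r" "(\<Union>x\<in>C. ball x r) \<subseteq> \<Omega>"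
    using compact_subset_open_imp_ball_epsilon_subset[OF C(1) \<Omega> C(2)] by blast
  have eq: "(LINT y|lebesgue_on \<Omega>. \<theta> (y + w)) = (LINT y|lborel. \<theta> y)" if w: "norm w < r" for w
  proof -
    have "\<theta> (y + w) = 0" if "y \<notin> \<Omega>" for y
    proof (rule z, rule notI)
      assume "y + w \<in> C"
      then have "y \<in> ball (y + w) r \<and> y + w \<in> C" using w by (simp add: dist_norm)
      then show False using r(2) that by blast
    qed
    then have "(LINT y|lebesgue_on \<Omega>. \<theta> (y + w)) = (LINT y|lborel. \<theta> (y + w))"
      using \<Omega> by (intro integral_lebesgue_on_eq_lborel \<theta>b iw) auto
    also have "... = (LINT y|lborel. \<theta> y)" using \<theta>b[of 0] by (intro lborel_integral_translate) simp
    finally show ?thesis .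
  qed
  show ?thesis using that[of r] r(1) eq eq[of 0] by simp
qed

text \<open>The integral of a test function is invariant under small translations along a coordinate axis; hence partial
  derivatives of test functions integrate to zero.\<close>

lemma integral_partial_test_function:
  fixes D :: "(real^'n) spatial_domain"
  assumes D: "admissible D" and \<theta>: "\<theta> \<in> test_functions D"
  shows "(LINT x|space_measure D. partial i \<theta> x) = 0"
proof -
  let ?S = "region D" and ?e = "axis i 1 :: real^'n"
  note reg = region_properties[OF D]
  obtain r where r: "0 < r" "\<And>h. 0 <= h ==> h < r ==>
      (LINT y|space_measure D. \<theta> (y + h *\<^sub>R ?e)) = (LINT y|space_measure D. \<theta> y)"
  proof (cases D)
    case Torus
    have "continuous_on UNIV \<theta>" using smooth_continuous[OF test_function_smooth[OF \<theta>]] .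
    then show ?thesis
      using that[of 1] \<theta> integral_periodic_translate[of \<theta> i] unfolding Torus by (auto simp del: region.simps)
  next
    case (Euclidean_Domain \<Omega>)
    then obtain r where "0 < r" "\<And>w. norm w < r ==> (LINT y|lebesgue_on \<Omega>. \<theta> (y + w)) = (LINT y|lebesgue_on \<Omega>. \<theta> y)"
      using Cc_infinity_integral_translate[of \<theta> \<Omega>] \<theta> D by auto
    then show ?thesis using that[of r] unfolding Euclidean_Domain by simp
  qed
  have sm: "smooth \<theta>" by (rule test_function_smooth[OF \<theta>])
  obtain v where v: "\<And>x. (\<theta> has_derivative (%h. v x \<bullet> h)) (at x)" "\<And>i. i \<in> Basis ==> smooth (%x. v x \<bullet> i)"
    using smooth_gradient[OF sm] by blast
  interpret finite_measure "space_measure D" by (rule finite_measure_region[OF D])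
  define I where "I = conv ?S (%z. \<theta> (- z)) (%_. 1)"
  have I: "I x = (LINT y|space_measure D. \<theta> (y - x))" for x by (simp add: I_def conv_def)
  have cv: "continuous_on UNIV (%z. (- v (- z)) \<bullet> b)" if "b \<in> Basis" for b
  proof -
    have "continuous_on UNIV (%z. v (- z) \<bullet> b)"
      by (rule continuous_on_compose2[OF smooth_continuous[OF v(2)[OF that]]]) (auto intro!: continuous_intros)
    then show ?thesis by (simp add: continuous_on_minus)
  qed
  have dv: "((%z. \<theta> (- z)) has_derivative (%h. (- v (- z)) \<bullet> h)) (at z)" for z
    using has_derivative_compose[OF _ v(1), of uminus uminus z UNIV] by (simp add: has_derivative_minus[OF has_derivative_ident])
  have "(I has_derivative (%h. (\<Sum>b\<in>Basis. conv ?S (%z. (- v (- z)) \<bullet> b) (%_. 1) 0 *\<^sub>R b) \<bullet> h)) (at 0)"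
    unfolding I_def by (rule conv_has_derivative[OF dv cv reg(1,2)]) auto
  then have der: "((%h. norm (I (0 + h) - I 0 - (\<Sum>b\<in>Basis. conv ?S (%z. (- v (- z)) \<bullet> b) (%_. 1) 0 *\<^sub>R b) \<bullet> h) / norm h)
      \<longlongrightarrow> 0) (at 0)" by (simp add: has_derivative_at)
  define h where "h n = (- (r / real (n + 2))) *\<^sub>R ?e" for n
  have h0: "h n ~= 0" for n using r(1) by (simp add: h_def axis_eq_0_iff)
  have "(%n. r / real (n + 2)) \<longlonglongrightarrow> 0" by (rule LIMSEQ_ignore_initial_segment[OF lim_const_over_n])
  then have "h \<longlonglongrightarrow> (- 0) *\<^sub>R ?e" unfolding h_def[abs_def] by (intro tendsto_intros)
  then have hl: "h \<longlonglongrightarrow> 0" by simp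
  have Ih: "I (h n) = I 0" for n
  proof -
    have "0 <= r / real (n + 2)" using r(1) by simp
    moreover have "r / real (n + 2) < r" using r(1) by (simp add: divide_less_eq distrib_left add_pos_nonneg)
    ultimately show ?thesis using r(2)[of "r / real (n + 2)"] by (simp add: I h_def)
  qed
  have Se: "(\<Sum>b\<in>Basis. conv ?S (%z. (- v (- z)) \<bullet> b) (%_. 1) 0 *\<^sub>R b) \<bullet> ?e = - (LINT x|space_measure D. partial i \<theta> x)"
  proof -
    have "?e \<in> Basis" by (auto simp: Basis_real_vec)
    then have "(\<Sum>b\<in>Basis. conv ?S (%z. (- v (- z)) \<bullet> b) (%_. 1) 0 *\<^sub>R b) \<bullet> ?e = conv ?S (%z. (- v (- z)) \<bullet> ?e) (%_. 1) 0"
      by (auto simp: inner_sum_left inner_Basis if_distrib cong: if_cong)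
    then show ?thesis using partial_eq[OF v(1)] by (simp add: conv_def)
  qed
  have "(%n. norm (I (0 + h n) - I 0 - (\<Sum>b\<in>Basis. conv ?S (%z. (- v (- z)) \<bullet> b) (%_. 1) 0 *\<^sub>R b) \<bullet> h n) / norm (h n)) \<longlonglongrightarrow> 0"
    using der h0 hl unfolding LIMSEQ_SEQ_conv[symmetric] by blast
  moreover have "norm (I (0 + h n) - I 0 - (\<Sum>b\<in>Basis. conv ?S (%z. (- v (- z)) \<bullet> b) (%_. 1) 0 *\<^sub>R b) \<bullet> h n) / norm (h n)
      = \<bar>LINT x|space_measure D. partial i \<theta> x\<bar>" for n
  proof -
    define t where "t = r / real (n + 2)"
    have t: "0 < t" using r(1) by (simp add: t_def)
    have hn: "h n = (- t) *\<^sub>R ?e" by (simp add: h_def t_def)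
    have "(\<Sum>b\<in>Basis. conv ?S (%z. (- v (- z)) \<bullet> b) (%_. 1) 0 *\<^sub>R b) \<bullet> h n = t * (LINT x|space_measure D. partial i \<theta> x)"
      unfolding hn inner_scaleR_right Se by simp
    moreover have "norm (h n) = t" using t by (simp add: hn)
    ultimately show ?thesis using Ih[of n] t by (simp add: abs_mult)
  qed
  ultimately have "(%n::nat. \<bar>LINT x|space_measure D. partial i \<theta> x\<bar>) \<longlonglongrightarrow> 0" by simp
  then show ?thesis by (simp add: LIMSEQ_const_iff)
qed

subsection \<open>Weak gradients\<close>

lemma weak_gradient_iff:
  "weak_gradient D q u v \<longleftrightarrow> (\<forall>i. (%x. v x $ i) \<in> Lp (space_measure D) q \<and>
     (\<forall>\<psi>\<in>test_functions D. (LINT x|space_measure D. u x * partial i \<psi> x) = - (LINT x|space_measure D. v x $ i * \<psi> x)))"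
  by (simp add: weak_gradient_def partial_def)

locale spatial_setting =
  fixes D :: "(real^'n) spatial_domain" and \<eta> :: "real => real"
  assumes D: "admissible D" and \<eta>: "mollifier_kernel \<eta>"
begin

abbreviation "M \<equiv> space_measure D"
abbreviation "nrm p \<equiv> Lp_norm (space_measure D) (ennreal p)"
abbreviation "L p \<equiv> Lp (space_measure D) (ennreal p)"
abbreviation "W p \<equiv> W1 D (ennreal p)"
abbreviation "W0 p \<equiv> W1_0 D (ennreal p)"
abbreviation "W1n p \<equiv> W1_norm D (ennreal p)"

lemma Lp_integrable: "1 <= p ==> u \<in> L p ==> integrable M u"
  using Lp_L1_bound[OF finite_measure_region[OF D]] by metis

lemma integrable_mult_smooth: "integrable M u ==> smooth \<psi> ==> integrable M (%x. u x * \<psi> x)"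
  using integrable_mult_continuous[OF smooth_continuous] region_properties[OF D] by blast

text \<open>The fundamental lemma of the calculus of variations: testing with the kernel shows that all mollifications vanish.\<close>

lemma fundamental_lemma:
  assumes u: "integrable M u" and z: "\<And>\<psi>. \<psi> \<in> test_functions D ==> (LINT x|M. u x * \<psi> x) = 0"
  shows "AE x in M. u x = 0"
proof (rule conv_zero_imp_AE_zero[OF approximate_identity_space_kernel[OF \<eta> D] region_properties(1-3)[OF D] u])
  fix C assume C: "compact C" "C \<subseteq> interior (region D)"
  show "\<forall>\<^sub>F n in sequentially. \<forall>x\<in>C. conv (region D) (space_kernel \<eta> D n) u x = 0"
    using space_kernel_test_function[OF \<eta> D C]
  proof eventually_elim
    case (elim n)
    show ?case
    proof
      fix x assume "x \<in> C"
      from z[OF bspec[OF elim this]] show "conv (region D) (space_kernel \<eta> D n) u x = 0"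
        by (simp add: conv_def mult.commute)
    qed
  qed
qed

text \<open>Consequently the norm, which refers to a chosen weak gradient, can be computed from any weak gradient.\<close>

lemma weak_gradient_unique:
  assumes p: "1 <= p" and v: "weak_gradient D (ennreal p) u v" "weak_gradient D (ennreal p) u w"
  shows "AE x in M. v x $ i = w x $ i"
proof -
  have L: "(%x. v x $ i) \<in> L p" "(%x. w x $ i) \<in> L p"
    using v by (auto simp: weak_gradient_iff)
  note int = Lp_integrable[OF p L(1)] Lp_integrable[OF p L(2)]
  have "AE x in M. v x $ i - w x $ i = 0"
  proof (rule fundamental_lemma)
    show "integrable M (%x. v x $ i - w x $ i)" using int by simp
    fix \<psi> assume \<psi>: "\<psi> \<in> test_functions D"
    have "(LINT x|M. u x * partial i \<psi> x) = - (LINT x|M. v x $ i * \<psi> x)"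
      "(LINT x|M. u x * partial i \<psi> x) = - (LINT x|M. w x $ i * \<psi> x)"
      using v \<psi> unfolding weak_gradient_iff by blast+
    then have "(LINT x|M. v x $ i * \<psi> x) = (LINT x|M. w x $ i * \<psi> x)" by simp
    then show "(LINT x|M. (v x $ i - w x $ i) * \<psi> x) = 0"
      using integrable_mult_smooth[OF int(1) test_function_smooth[OF \<psi>]] integrable_mult_smooth[OF int(2) test_function_smooth[OF \<psi>]]
      by (simp add: left_diff_distrib)
  qed
  then show ?thesis by eventually_elim simp
qed

lemma W1_norm_eq:
  assumes p: "1 <= p" and v: "weak_gradient D (ennreal p) u v"
  shows "W1n p u = nrm p u + (\<Sum>i\<in>UNIV. nrm p (%x. v x $ i))"
proof -
  define w where "w = (SOME v. weak_gradient D (ennreal p) u v)"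
  have w: "weak_gradient D (ennreal p) u w" unfolding w_def by (rule someI[of "weak_gradient D (ennreal p) u", OF v])
  have p0: "0 < p" using p by simp
  have "nrm p (%x. w x $ i) = nrm p (%x. v x $ i)" for i
  proof (rule Lp_norm_cong_AE[OF p0 _ _ weak_gradient_unique[OF p w v]])
    show "(%x. w x $ i) \<in> borel_measurable M" "(%x. v x $ i) \<in> borel_measurable M"
      using v w unfolding weak_gradient_iff by (auto dest: Lp_measurable)
  qed
  then show ?thesis unfolding W1_norm_def w_def[symmetric] by simp
qed

lemma W1_I: "u \<in> L p ==> weak_gradient D (ennreal p) u v ==> u \<in> W p"
  by (auto simp: W1_def)

lemma W1_D:
  assumes "u \<in> W p"
  obtains v where "u \<in> L p" "weak_gradient D (ennreal p) u v"
  using assms by (auto simp: W1_def)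

lemma weak_gradient_lincomb:
  assumes p: "1 <= p" and u: "u \<in> L p" "weak_gradient D (ennreal p) u v"
    and w: "w \<in> L p" "weak_gradient D (ennreal p) w z"
  shows "weak_gradient D (ennreal p) (%x. a * u x + b * w x) (%x. a *\<^sub>R v x + b *\<^sub>R z x)"
  unfolding weak_gradient_iff
proof (intro allI conjI ballI)
  fix i
  have L: "(%x. v x $ i) \<in> L p" "(%x. z x $ i) \<in> L p"
    using u w by (auto simp: weak_gradient_iff)
  then show "(%x. (a *\<^sub>R v x + b *\<^sub>R z x) $ i) \<in> L p"
    using p by (auto intro!: Lp_add Lp_scale)
  fix \<psi> assume \<psi>: "\<psi> \<in> test_functions D"
  note sm = test_function_smooth[OF \<psi>]
  note int = integrable_mult_smooth[OF Lp_integrable[OF p u(1)] smooth_partial(1)[OF sm, of i]]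
    integrable_mult_smooth[OF Lp_integrable[OF p w(1)] smooth_partial(1)[OF sm, of i]]
    integrable_mult_smooth[OF Lp_integrable[OF p L(1)] sm] integrable_mult_smooth[OF Lp_integrable[OF p L(2)] sm]
  have e: "(LINT x|M. u x * partial i \<psi> x) = - (LINT x|M. v x $ i * \<psi> x)"
    "(LINT x|M. w x * partial i \<psi> x) = - (LINT x|M. z x $ i * \<psi> x)"
    using u(2) w(2) \<psi> by (auto simp: weak_gradient_iff)
  have "(LINT x|M. (a * u x + b * w x) * partial i \<psi> x) = a * (LINT x|M. u x * partial i \<psi> x) + b * (LINT x|M. w x * partial i \<psi> x)"
    using int by (simp add: distrib_right mult.assoc)
  moreover have "(LINT x|M. (a *\<^sub>R v x + b *\<^sub>R z x) $ i * \<psi> x) = a * (LINT x|M. v x $ i * \<psi> x) + b * (LINT x|M. z x $ i * \<psi> x)"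
    using int by (simp add: distrib_right mult.assoc)
  ultimately show "(LINT x|M. (a * u x + b * w x) * partial i \<psi> x) = - (LINT x|M. (a *\<^sub>R v x + b *\<^sub>R z x) $ i * \<psi> x)"
    using e by simp
qed

lemma W1_lincomb:
  assumes p: "1 <= p" and u: "u \<in> W p" and w: "w \<in> W p"
  shows "(%x. a * u x + b * w x) \<in> W p"
    and "W1n p (%x. a * u x + b * w x) <= \<bar>a\<bar> * W1n p u + \<bar>b\<bar> * W1n p w"
proof -
  obtain v where v: "u \<in> L p" "weak_gradient D (ennreal p) u v" using W1_D[OF u] .
  obtain z where z: "w \<in> L p" "weak_gradient D (ennreal p) w z" using W1_D[OF w] .
  note wg = weak_gradient_lincomb[OF p v z, of a b]
  have p0: "0 < p" using p by simp
  have L: "(%x. v x $ i) \<in> L p" "(%x. z x $ i) \<in> L p" for i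
    using v z by (auto simp: weak_gradient_iff)
  have tri: "nrm p (%x. a * f x + b * g x) <= \<bar>a\<bar> * nrm p f + \<bar>b\<bar> * nrm p g"
    if "f \<in> L p" "g \<in> L p" for f g
    using Lp_norm_add[OF p Lp_scale[OF p0 that(1), of a] Lp_scale[OF p0 that(2), of b]] by (simp add: Lp_norm_scale[OF p0])
  show "(%x. a * u x + b * w x) \<in> W p"
    using v z p p0 by (intro W1_I[OF _ wg] Lp_add Lp_scale) auto
  have "W1n p (%x. a * u x + b * w x) =
      nrm p (%x. a * u x + b * w x) + (\<Sum>i\<in>UNIV. nrm p (%x. a * v x $ i + b * z x $ i))"
    using W1_norm_eq[OF p wg] by simp
  also have "... <= (\<bar>a\<bar> * nrm p u + \<bar>b\<bar> * nrm p w) + (\<Sum>i\<in>UNIV. \<bar>a\<bar> * nrm p (%x. v x $ i) + \<bar>b\<bar> * nrm p (%x. z x $ i))"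
    by (intro add_mono sum_mono tri v z L)
  also have "... = \<bar>a\<bar> * W1n p u + \<bar>b\<bar> * W1n p w"
    unfolding W1_norm_eq[OF p v(2)] W1_norm_eq[OF p z(2)] by (simp add: sum.distrib sum_distrib_left algebra_simps)
  finally show "W1n p (%x. a * u x + b * w x) <= \<bar>a\<bar> * W1n p u + \<bar>b\<bar> * W1n p w" .
qed

lemma W1_diff:
  assumes p: "1 <= p" and uw: "u \<in> W p" "w \<in> W p"
  shows "(%x. u x - w x) \<in> W p" "W1n p (%x. u x - w x) <= W1n p u + W1n p w"
  using W1_lincomb[OF p uw, of 1 "- 1"] by simp_all

lemma W1_norm_minus_commute:
  assumes p: "1 <= p" and uw: "u \<in> W p" "w \<in> W p"
  shows "W1n p (%x. u x - w x) = W1n p (%x. w x - u x)"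
  using W1_lincomb(2)[OF p W1_diff(1)[OF p uw] W1_diff(1)[OF p uw], of "- 1" 0]
    W1_lincomb(2)[OF p W1_diff(1)[OF p uw(2,1)] W1_diff(1)[OF p uw(2,1)], of "- 1" 0] by simp

lemma W1_norm_nonneg: "1 <= p ==> 0 <= W1n p u"
  by (simp add: W1_norm_def Lp_norm_nonneg sum_nonneg)

lemma Lp_norm_le_W1_norm: "1 <= p ==> nrm p u <= W1n p u"
  by (simp add: W1_norm_def Lp_norm_nonneg sum_nonneg)

lemma L1_limit_integral:
  assumes u: "\<And>k. integrable M (u k)" "integrable M w" and lim: "(%k. LINT x|M. \<bar>u k x - w x\<bar>) \<longlonglongrightarrow> 0"
    and \<psi>: "smooth \<psi>"
  shows "(%k. LINT x|M. u k x * \<psi> x) \<longlonglongrightarrow> (LINT x|M. w x * \<psi> x)"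
proof -
  obtain B where B: "0 <= B" "\<And>x. x \<in> region D ==> \<bar>\<psi> x\<bar> <= B"
    using continuous_bound_on[OF smooth_continuous[OF \<psi>] region_properties(2)[OF D]] by blast
  have "norm ((LINT x|M. u k x * \<psi> x) - (LINT x|M. w x * \<psi> x)) <= B * (LINT x|M. \<bar>u k x - w x\<bar>)" for k
  proof -
    note i = integrable_mult_smooth[OF u(1)[of k] \<psi>] integrable_mult_smooth[OF u(2) \<psi>]
    have "(LINT x|M. u k x * \<psi> x) - (LINT x|M. w x * \<psi> x) = (LINT x|M. (u k x - w x) * \<psi> x)"
      using i by (simp add: left_diff_distrib)
    also have "norm ... <= (LINT x|M. \<bar>(u k x - w x) * \<psi> x\<bar>)" unfolding real_norm_def by (rule integral_abs_bound)
    also have "... <= (LINT x|M. B * \<bar>u k x - w x\<bar>)"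
    proof (rule integral_mono)
      show "integrable M (%x. \<bar>(u k x - w x) * \<psi> x\<bar>)" using i by (simp add: left_diff_distrib)
      show "integrable M (%x. B * \<bar>u k x - w x\<bar>)" using u by simp
      show "\<bar>(u k x - w x) * \<psi> x\<bar> <= B * \<bar>u k x - w x\<bar>" if "x \<in> space M" for x
        using mult_left_mono[OF B(2)[of x], of "\<bar>u k x - w x\<bar>"] that by (simp add: abs_mult mult.commute)
    qed
    finally show ?thesis by simp
  qed
  moreover have "(%k. B * (LINT x|M. \<bar>u k x - w x\<bar>)) \<longlonglongrightarrow> 0" using tendsto_mult_left[OF lim, of B] by simp
  ultimately have "(%k. (LINT x|M. u k x * \<psi> x) - (LINT x|M. w x * \<psi> x)) \<longlonglongrightarrow> 0"
    by (rule Lim_null_comparison[OF always_eventually[OF allI]])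
  then show ?thesis by (rule LIM_zero_cancel)
qed

lemma Lp_limit_L1:
  assumes p: "1 <= p" and u: "\<And>k. u k \<in> L p" "w \<in> L p"
    and lim: "(%k. nrm p (%x. u k x - w x)) \<longlonglongrightarrow> 0"
  shows "(%k. LINT x|M. \<bar>u k x - w x\<bar>) \<longlonglongrightarrow> 0"
proof -
  obtain C where C: "0 <= C" "\<And>u. u \<in> L p ==> integrable M u \<and> (LINT x|M. \<bar>u x\<bar>) <= C * nrm p u"
    using Lp_L1_bound[OF finite_measure_region[OF D] p] by blast
  show ?thesis
  proof (rule Lim_null_comparison)
    show "\<forall>\<^sub>F k in sequentially. norm (LINT x|M. \<bar>u k x - w x\<bar>) <= C * nrm p (%x. u k x - w x)"
      using C(2)[OF Lp_diff[OF p u(1) u(2)]] by (auto simp: Lintegral_nonneg)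
    show "(%k. C * nrm p (%x. u k x - w x)) \<longlonglongrightarrow> 0" using tendsto_mult_left[OF lim, of C] by simp
  qed
qed

text \<open>Weak gradients are closed under joint \<open>L\<^sup>p\<close> convergence of functions and gradients, since the defining identity is
  continuous in \<open>L\<^sup>1\<close>.\<close>

lemma weak_gradient_limit:
  assumes p: "1 <= p" and u: "\<And>k. u k \<in> L p" "\<And>k. weak_gradient D (ennreal p) (u k) (v k)"
    and w: "w \<in> L p" "\<And>i. (%x. z x $ i) \<in> L p"
    and lim: "(%k. nrm p (%x. u k x - w x)) \<longlonglongrightarrow> 0"
      "\<And>i. (%k. nrm p (%x. v k x $ i - z x $ i)) \<longlonglongrightarrow> 0"
  shows "weak_gradient D (ennreal p) w z" "(%k. W1n p (%x. u k x - w x)) \<longlonglongrightarrow> 0"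
proof -
  have vL: "(%x. v k x $ i) \<in> L p" for k i using u(2) by (auto simp: weak_gradient_iff)
  show wg: "weak_gradient D (ennreal p) w z"
    unfolding weak_gradient_iff
  proof (intro allI conjI ballI)
    fix i \<psi> assume \<psi>: "\<psi> \<in> test_functions D"
    note sm = test_function_smooth[OF \<psi>]
    have "(%k. LINT x|M. u k x * partial i \<psi> x) \<longlonglongrightarrow> (LINT x|M. w x * partial i \<psi> x)"
      by (intro L1_limit_integral Lp_integrable[OF p] u w Lp_limit_L1[OF p] lim smooth_partial sm)
    moreover have "(%k. - (LINT x|M. v k x $ i * \<psi> x)) \<longlonglongrightarrow> - (LINT x|M. z x $ i * \<psi> x)"
      by (intro tendsto_minus L1_limit_integral Lp_integrable[OF p] vL w Lp_limit_L1[OF p] lim sm)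
    moreover have "(LINT x|M. u k x * partial i \<psi> x) = - (LINT x|M. v k x $ i * \<psi> x)" for k
      using u(2)[of k] \<psi> by (simp add: weak_gradient_iff)
    ultimately show "(LINT x|M. w x * partial i \<psi> x) = - (LINT x|M. z x $ i * \<psi> x)"
      using LIMSEQ_unique by fastforce
  qed (rule w(2))
  have "W1n p (%x. u k x - w x) = nrm p (%x. u k x - w x) + (\<Sum>i\<in>UNIV. nrm p (%x. v k x $ i - z x $ i))" for k
    using W1_norm_eq[OF p weak_gradient_lincomb[OF p u(1)[of k] u(2)[of k] w(1) wg, of 1 "-1"]] by simp
  then show "(%k. W1n p (%x. u k x - w x)) \<longlonglongrightarrow> 0"
    using tendsto_add[OF lim(1) tendsto_sum[of UNIV, OF lim(2)]] by simp
qed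

lemma W1_norm_diff_eq:
  assumes p: "1 <= p" and u: "u \<in> L p" "weak_gradient D (ennreal p) u v"
    and w: "w \<in> L p" "weak_gradient D (ennreal p) w z"
  shows "W1n p (%x. u x - w x) = nrm p (%x. u x - w x) + (\<Sum>i\<in>UNIV. nrm p (%x. v x $ i - z x $ i))"
  using W1_norm_eq[OF p weak_gradient_lincomb[OF p u w, of 1 "-1"]] by simp

text \<open>Completeness of \<open>W\<^sup>1\<^sup>,\<^sup>p\<close>, with the limit prescribed in \<open>L\<^sup>1\<close>.\<close>

lemma W1_Cauchy_L1_limit:
  assumes p: "1 <= p" and u: "\<And>k. u k \<in> W p"
    and cauchy: "\<And>e. 0 < e ==> \<exists>N. \<forall>k\<ge>N. \<forall>l\<ge>N. W1n p (%x. u k x - u l x) <= e"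
    and w: "integrable M w" and lim: "(%k. LINT x|M. \<bar>u k x - w x\<bar>) \<longlonglongrightarrow> 0"
  shows "w \<in> W p" "(%k. W1n p (%x. u k x - w x)) \<longlonglongrightarrow> 0"
proof -
  have p0: "0 < p" using p by simp
  have "\<exists>v. \<forall>k. weak_gradient D (ennreal p) (u k) (v k)" using u unfolding W1_def by (intro choice) auto
  then obtain v where v: "\<And>k. weak_gradient D (ennreal p) (u k) (v k)" by blast
  have uL: "u k \<in> L p" for k using u by (auto simp: W1_def)
  have vL: "(%x. v k x $ i) \<in> L p" for k i using v by (auto simp: weak_gradient_iff)
  have eq: "W1n p (%x. u k x - u l x) = nrm p (%x. u k x - u l x) + (\<Sum>i\<in>UNIV. nrm p (%x. v k x $ i - v l x $ i))" for k l
    by (rule W1_norm_diff_eq[OF p uL v uL v])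
  have le1: "nrm p (%x. u k x - u l x) <= W1n p (%x. u k x - u l x)" for k l
    by (rule Lp_norm_le_W1_norm[OF p])
  have le2: "nrm p (%x. v k x $ i - v l x $ i) <= W1n p (%x. u k x - u l x)" for k l i
  proof -
    have "nrm p (%x. v k x $ i - v l x $ i) <= (\<Sum>i\<in>UNIV. nrm p (%x. v k x $ i - v l x $ i))"
      by (rule member_le_sum) (auto simp: Lp_norm_nonneg[OF p0])
    then show ?thesis unfolding eq using Lp_norm_nonneg[OF p0, of M "%x. u k x - u l x"] by linarith
  qed
  have c1: "\<exists>N. \<forall>k\<ge>N. \<forall>l\<ge>N. nrm p (%x. u k x - u l x) <= e"
    "\<exists>N. \<forall>k\<ge>N. \<forall>l\<ge>N. nrm p (%x. v k x $ i - v l x $ i) <= e" if "0 < e" for e i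
    using cauchy[OF that] le1 le2 by (meson order.trans)+
  have fin: "finite_measure M" by (rule finite_measure_region[OF D])
  have "\<forall>i. \<exists>z. z \<in> L p \<and> (%k. nrm p (%x. v k x $ i - z x)) \<longlonglongrightarrow> 0"
  proof
    fix i
    obtain z where "z \<in> L p" "(%k. nrm p (%x. v k x $ i - z x)) \<longlonglongrightarrow> 0"
      by (rule Lp_complete[where u = "%k x. v k x $ i", OF fin p vL c1(2)])
    then show "\<exists>z. z \<in> L p \<and> (%k. nrm p (%x. v k x $ i - z x)) \<longlonglongrightarrow> 0" by blast
  qed
  from choice[OF this] obtain z where
    "\<forall>i. z i \<in> L p \<and> (%k. nrm p (%x. v k x $ i - z i x)) \<longlonglongrightarrow> 0" ..
  then have z: "z i \<in> L p" "(%k. nrm p (%x. v k x $ i - z i x)) \<longlonglongrightarrow> 0" for i by simp_all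
  note wl = Lp_Cauchy_L1_limit[OF fin p uL c1(1) w lim]
  have zz: "(%x. (\<chi> i. z i x) $ i) \<in> L p" "(%k. nrm p (%x. v k x $ i - (\<chi> i. z i x) $ i)) \<longlonglongrightarrow> 0" for i
    using z by simp_all
  note wg = weak_gradient_limit[OF p uL v wl(1) zz(1) wl(2) zz(2)]
  show "w \<in> W p" using wl(1) wg(1) by (rule W1_I)
  show "(%k. W1n p (%x. u k x - w x)) \<longlonglongrightarrow> 0" by (rule wg(2))
qed

end

lemma partial_reflect:
  assumes "smooth K"
  shows "partial i (%y. K (x - y)) y = - partial i K (x - y)"
proof -
  have "((%y. x - y) has_derivative (%h. - h)) (at y)" by (auto intro!: derivative_eq_intros)
  from partial_eq[OF has_derivative_compose[OF this has_derivative_frechet[OF assms]]]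
  have "partial i (%y. K (x - y)) y = frechet_derivative K (at (x - y)) (- axis i 1)" .
  also have "... = - frechet_derivative K (at (x - y)) (axis i 1)"
    using has_derivative_frechet[OF assms, of "x - y"] by (intro linear_neg has_derivative_linear)
  finally show ?thesis by (simp add: partial_def)
qed

lemma partial_conv:
  fixes K u :: "real^'n => real"
  assumes K: "smooth K" and S: "S \<in> sets lebesgue" "bounded S" and u: "integrable (lebesgue_on S) u"
  shows "partial i (conv S K u) x = conv S (partial i K) u x"
proof -
  obtain v where v: "\<And>x. (K has_derivative (%h. v x \<bullet> h)) (at x)" "\<And>i. i \<in> Basis ==> smooth (%x. v x \<bullet> i)"
    using smooth_gradient[OF K] by blast
  let ?e = "axis i 1 :: real^'n"
  have e: "?e \<in> Basis" by (auto simp: Basis_real_vec)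
  have "partial i (conv S K u) x = (\<Sum>b\<in>Basis. conv S (%z. v z \<bullet> b) u x *\<^sub>R b) \<bullet> ?e"
    by (rule partial_eq[OF conv_has_derivative[OF v(1) smooth_continuous[OF v(2)] S u]])
  also have "... = conv S (%z. v z \<bullet> ?e) u x"
    using e by (auto simp: inner_sum_left inner_Basis if_distrib cong: if_cong)
  also have "(%z. v z \<bullet> ?e) = partial i K" using partial_eq[OF v(1)] by auto
  finally show ?thesis .
qed

context spatial_setting
begin

abbreviation "K \<equiv> space_kernel \<eta> D"

lemma smooth_Lp:
  assumes p: "1 <= p" and \<psi>: "smooth \<psi>"
  shows "\<psi> \<in> L p"
proof -
  obtain B where B: "0 <= B" "\<And>x. x \<in> region D ==> \<bar>\<psi> x\<bar> <= B"
    using continuous_bound_on[OF smooth_continuous[OF \<psi>] region_properties(2)[OF D]] by blast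
  have "\<psi> \<in> borel_measurable M"
    using smooth_continuous[OF \<psi>] by (intro measurable_restrict_space1 measurable_completion) (simp add: borel_measurable_continuous_onI)
  then show ?thesis by (rule Lp_norm_le_sup(1)[OF finite_measure_region[OF D] p]) (use B in auto)
qed

lemma weak_gradient_test_function:
  assumes p: "1 <= p" and \<psi>: "\<psi> \<in> test_functions D"
  shows "weak_gradient D (ennreal p) \<psi> (%x. \<chi> i. partial i \<psi> x)"
  unfolding weak_gradient_iff
proof (intro allI conjI ballI)
  fix i
  have sm: "smooth \<psi>" by (rule test_function_smooth[OF \<psi>])
  show "(%x. (\<chi> i. partial i \<psi> x) $ i) \<in> L p"
    using smooth_Lp[OF p smooth_partial(1)[OF sm]] by simp
  fix \<theta> assume \<theta>: "\<theta> \<in> test_functions D"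
  have sm': "smooth \<theta>" by (rule test_function_smooth[OF \<theta>])
  have i1: "integrable M (%x. \<psi> x * partial i \<theta> x)" "integrable M (%x. partial i \<psi> x * \<theta> x)"
    by (intro Lp_integrable[of 1] smooth_Lp smooth_mult sm sm' smooth_partial(1); simp)+
  have "0 = (LINT x|M. partial i (%x. \<psi> x * \<theta> x) x)"
    using integral_partial_test_function[OF D test_function_mult[OF \<psi> test_function_multiplier[OF \<theta>]]] by simp
  also have "... = (LINT x|M. \<psi> x * partial i \<theta> x) + (LINT x|M. partial i \<psi> x * \<theta> x)"
    unfolding partial_mult[OF sm sm'] using i1 by simp
  finally show "(LINT x|M. \<psi> x * partial i \<theta> x) = - (LINT x|M. (\<chi> i. partial i \<psi> x) $ i * \<theta> x)" by simp
qed

text \<open>Mollification in space commutes with the gradient as soon as the weak formulation holds for all multipliers,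
  which include the functions \<open>y \<mapsto> K(x - y)\<close>.\<close>

lemma mollified_test_functions_dense:
  assumes p: "1 <= p" and u: "u \<in> L p" and v: "\<And>i. (%x. v x $ i) \<in> L p"
    and wk: "\<And>i \<theta>. \<theta> \<in> multipliers D ==> (LINT x|M. u x * partial i \<theta> x) = - (LINT x|M. v x $ i * \<theta> x)"
    and test: "\<forall>\<^sub>F n in sequentially. conv (region D) (K n) u \<in> test_functions D"
  obtains \<psi> where "\<And>k. \<psi> k \<in> test_functions D" "(%k. W1n p (%x. u x - \<psi> k x)) \<longlonglongrightarrow> 0"
    and "u \<in> W p"
proof -
  note reg = region_properties[OF D]
  let ?c = "%n. conv (region D) (K n) u"
  obtain N where N: "\<And>n. N <= n ==> ?c n \<in> test_functions D" using test by (auto simp: eventually_sequentially)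
  have iu: "integrable M u" by (rule Lp_integrable[OF p u])
  have Ks: "smooth (K n)" for n by (rule space_kernel_smooth[OF \<eta>])
  have grad: "partial i (?c n) = conv (region D) (K n) (%x. v x $ i)" for i n
  proof
    fix x
    have "partial i (?c n) x = (LINT y|M. partial i (K n) (x - y) * u y)"
      unfolding partial_conv[OF Ks reg(1,2) iu] by (simp add: conv_def)
    also have "... = - (LINT y|M. u y * partial i (%y. K n (x - y)) y)"
      unfolding partial_reflect[OF Ks] by (simp add: mult.commute)
    also have "... = (LINT y|M. v y $ i * K n (x - y))"
      using wk[OF space_kernel_multiplier[OF \<eta>]] by simp
    finally show "partial i (?c n) x = conv (region D) (K n) (%x. v x $ i) x" by (simp add: conv_def mult.commute)
  qed
  have wgu: "weak_gradient D (ennreal p) u v" unfolding weak_gradient_iff using v wk test_function_multiplier by blast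
  note ai = approximate_identity_space_kernel[OF \<eta> D]
  have lim: "(%n. nrm p (%x. ?c n x - u x)) \<longlonglongrightarrow> 0"
    "(%n. nrm p (%x. conv (region D) (K n) (%x. v x $ i) x - v x $ i)) \<longlonglongrightarrow> 0" for i
    by (rule approximate_identity_Lp[OF ai reg(1-3) p u], rule approximate_identity_Lp[OF ai reg(1-3) p v])
  have cL: "?c n \<in> L p" if "N <= n" for n
    by (rule smooth_Lp[OF p test_function_smooth[OF N[OF that]]])
  have eq: "W1n p (%x. u x - ?c n x) = nrm p (%x. ?c n x - u x) +
      (\<Sum>i\<in>UNIV. nrm p (%x. conv (region D) (K n) (%x. v x $ i) x - v x $ i))" if n: "N <= n" for n
  proof -
    have p0: "0 < p" using p by simp
    have "W1n p (%x. u x - ?c n x) = nrm p (%x. u x - ?c n x) + (\<Sum>i\<in>UNIV. nrm p (%x. v x $ i - (\<chi> i. partial i (?c n) x) $ i))"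
      by (rule W1_norm_diff_eq[OF p u wgu cL[OF n] weak_gradient_test_function[OF p N[OF n]]])
    then show ?thesis
      unfolding vec_lambda_beta grad Lp_norm_minus[OF p0, of _ u] Lp_norm_minus[OF p0, of _ "%x. v x $ _"] .
  qed
  have "(%n. nrm p (%x. ?c n x - u x) + (\<Sum>i\<in>UNIV. nrm p (%x. conv (region D) (K n) (%x. v x $ i) x - v x $ i))) \<longlonglongrightarrow> 0"
    using tendsto_add[OF lim(1) tendsto_sum[of UNIV, OF lim(2)]] by simp
  from LIMSEQ_ignore_initial_segment[OF this, of N]
  have "(%k. W1n p (%x. u x - ?c (k + N) x)) \<longlonglongrightarrow> 0" by (simp add: eq)
  moreover have "u \<in> W p" by (rule W1_I[OF u wgu])
  ultimately show ?thesis using that[of "%k. ?c (k + N)"] N by simp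
qed

lemma conv_periodic_test_function:
  assumes "D = Torus" "integrable M u"
  shows "conv (region D) (K n) u \<in> test_functions D"
proof -
  have "smooth (conv (region D) (K n) u)"
    by (rule smooth_conv[OF region_properties(1,2)[OF D] assms(2) space_kernel_smooth[OF \<eta>]])
  moreover have "conv (region D) (K n) u (x + axis i 1) = conv (region D) (K n) u x" for x i
  proof -
    have "K n (x + axis i 1 - y) = K n (x - y)" for y
      using periodic_kernel_translate[OF \<eta>, of n "x - y" i] unfolding assms(1) space_kernel.simps
      by (metis add_diff_eq add.commute diff_add_eq)
    then show ?thesis unfolding conv_def by simp
  qed
  ultimately show ?thesis unfolding assms(1) by simp
qed

text \<open>If \<open>u\<close> vanishes off a compact subset of the domain, its mollifications are compactly supported in the domain as soon as
  the support of the kernel is smaller than the distance to the boundary.\<close>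

lemma conv_compact_test_function:
  assumes \<Omega>: "D = Euclidean_Domain \<Omega>" and u: "integrable M u" and C: "compact C" "C \<subseteq> \<Omega>" "\<And>x. x \<notin> C ==> u x = 0"
  shows "\<forall>\<^sub>F n in sequentially. conv (region D) (K n) u \<in> test_functions D"
proof -
  have "open \<Omega>" using D \<Omega> by simp
  obtain r where r: "0 < r" "(\<Union>x\<in>C. ball x r) \<subseteq> \<Omega>"
    using compact_subset_open_imp_ball_epsilon_subset[OF C(1) \<open>open \<Omega>\<close> C(2)] by blast
  define C' where "C' = {x + y |x y. x \<in> C \<and> y \<in> cball 0 (r / 2)}"
  have C': "compact C'" unfolding C'_def using C(1) by (intro compact_sums) auto
  have C'\<Omega>: "C' \<subseteq> \<Omega>"
  proof
    fix z assume "z \<in> C'"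
    then obtain x y where "x \<in> C" "norm y <= r / 2" "z = x + y" by (auto simp: C'_def)
    then have "x \<in> C" "z \<in> ball x r" using r(1) by (auto simp: dist_norm)
    then show "z \<in> \<Omega>" using r(2) by blast
  qed
  have "\<forall>\<^sub>F n in sequentially. \<forall>z::real^'n. euclid_kernel \<eta> n z ~= 0 --> norm z < r / 2"
    using r by (intro eventually_euclid_kernel_support[OF \<eta>]) auto
  then show ?thesis
  proof eventually_elim
    case (elim n)
    have sm: "smooth (conv (region D) (K n) u)"
      by (rule smooth_conv[OF region_properties(1,2)[OF D] u space_kernel_smooth[OF \<eta>]])
    have z: "conv (region D) (K n) u x = 0" if x: "x \<notin> C'" for x
    proof -
      have z0: "K n (x - y) * u y = 0" for y
      proof (rule ccontr)
        assume "K n (x - y) * u y ~= 0"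
        then have "euclid_kernel \<eta> n (x - y) ~= 0" "y \<in> C" using C(3)[of y] by (auto simp: \<Omega>)
        then have "norm (x - y) <= r / 2" "y \<in> C" using elim by (auto intro: less_imp_le)
        then have "y + (x - y) \<in> C'" unfolding C'_def by (intro CollectI exI[of _ y] exI[of _ "x - y"]) auto
        then show False using x by simp
      qed
      show ?thesis unfolding conv_def z0 by simp
    qed
    have sub: "closure {x. conv (region D) (K n) u x ~= 0} \<subseteq> C'"
      using z compact_imp_closed[OF C'] by (intro closure_minimal) auto
    then have "compact (closure {x. conv (region D) (K n) u x ~= 0})"
      unfolding compact_eq_bounded_closed using bounded_subset[OF compact_imp_bounded[OF C'] sub] by simp
    then have "conv (region D) (K n) u \<in> Cc_infinity \<Omega>"
      unfolding Cc_infinity_def using sm sub C'\<Omega> by blast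
    then show ?case unfolding \<Omega> by simp
  qed
qed

text \<open>On the torus, where \<open>W\<^sub>0\<^sup>1\<^sup>,\<^sup>p\<close> is all of \<open>W\<^sup>1\<^sup>,\<^sup>p\<close>, density of the test functions is a theorem; on a domain
  it is the definition.\<close>

lemma W1_0_iff:
  assumes p: "1 <= p"
  shows "u \<in> W0 p \<longleftrightarrow> u \<in> W p \<and>
    (\<exists>\<psi>. (\<forall>k. \<psi> k \<in> test_functions D) \<and> (%k. W1n p (%x. u x - \<psi> k x)) \<longlonglongrightarrow> 0)"
proof (cases D)
  case (Euclidean_Domain \<Omega>)
  then show ?thesis by (simp add: fun_diff_def)
next
  case Torus
  have "\<exists>\<psi>. (\<forall>k. \<psi> k \<in> test_functions D) \<and> (%k. W1n p (%x. u x - \<psi> k x)) \<longlonglongrightarrow> 0" if u: "u \<in> W p"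
  proof -
    obtain v where v: "u \<in> L p" "weak_gradient D (ennreal p) u v" using W1_D[OF u] .
    have vL: "(%x. v x $ i) \<in> L p" for i using v(2) by (simp add: weak_gradient_iff)
    have wk: "(LINT x|M. u x * partial i \<theta> x) = - (LINT x|M. v x $ i * \<theta> x)" if "\<theta> \<in> multipliers D" for i \<theta>
      using that v(2) unfolding Torus multipliers.simps weak_gradient_iff by blast
    have "\<forall>\<^sub>F n in sequentially. conv (region D) (K n) u \<in> test_functions D"
      by (intro always_eventually allI conv_periodic_test_function[OF Torus] Lp_integrable[OF p v(1)])
    from mollified_test_functions_dense[OF p v(1) vL wk this] show ?thesis by metis
  qed
  then show ?thesis unfolding Torus W1_0.simps by blast
qed

lemma W1_0_subset_W1: "u \<in> W1_0 D q ==> u \<in> W1 D q"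
  by (cases D) simp_all

lemma W1_norm_triangle:
  assumes p: "1 <= p" and "u \<in> W p" "w \<in> W p" "z \<in> W p"
  shows "W1n p (%x. u x - z x) <=
     W1n p (%x. u x - w x) + W1n p (%x. w x - z x)"
proof -
  have 1: "(%x. u x - w x) \<in> W p" "(%x. w x - z x) \<in> W p"
    using W1_lincomb(1)[OF p assms(2,3), of 1 "-1"] W1_lincomb(1)[OF p assms(3,4), of 1 "-1"] by simp_all
  from W1_lincomb(2)[OF p 1, of 1 1] show ?thesis by simp
qed

lemma test_function_W1: "1 <= p ==> \<psi> \<in> test_functions D ==> \<psi> \<in> W p"
  using W1_I[OF smooth_Lp weak_gradient_test_function] test_function_smooth by blast

text \<open>Being approximable by test functions is preserved under limits, by a diagonal choice of the approximating test functions.\<close>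

lemma W1_0_closed:
  assumes p: "1 <= p" and u: "u \<in> W p" and w: "\<And>k. w k \<in> W0 p"
    and lim: "(%k. W1n p (%x. u x - w k x)) \<longlonglongrightarrow> 0"
  shows "u \<in> W0 p"
proof -
  have "\<forall>k. \<exists>\<psi>. \<psi> \<in> test_functions D \<and> W1n p (%x. w k x - \<psi> x) < 1 / real (Suc k)"
  proof
    fix k
    obtain \<psi> where \<psi>: "\<And>j. \<psi> j \<in> test_functions D" "(%j. W1n p (%x. w k x - \<psi> j x)) \<longlonglongrightarrow> 0"
      using w[of k] unfolding W1_0_iff[OF p] by blast
    have "\<forall>\<^sub>F j in sequentially. W1n p (%x. w k x - \<psi> j x) < 1 / real (Suc k)"
      by (rule order_tendstoD(2)[OF \<psi>(2)]) simp
    then show "\<exists>\<psi>. \<psi> \<in> test_functions D \<and> W1n p (%x. w k x - \<psi> x) < 1 / real (Suc k)"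
      using \<psi>(1) by (auto simp: eventually_sequentially)
  qed
  from choice[OF this] obtain \<psi> where
    \<psi>: "\<And>k. \<psi> k \<in> test_functions D" "\<And>k. W1n p (%x. w k x - \<psi> k x) < 1 / real (Suc k)" by blast
  have "(%k. W1n p (%x. u x - \<psi> k x)) \<longlonglongrightarrow> 0"
  proof (rule Lim_null_comparison)
    show "\<forall>\<^sub>F k in sequentially. norm (W1n p (%x. u x - \<psi> k x)) <=
        W1n p (%x. u x - w k x) + 1 / real (Suc k)"
    proof (intro always_eventually allI)
      fix k
      have "W1n p (%x. u x - \<psi> k x) <= W1n p (%x. u x - w k x) + W1n p (%x. w k x - \<psi> k x)"
        by (rule W1_norm_triangle[OF p u W1_0_subset_W1[OF w] test_function_W1[OF p \<psi>(1)]])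
      then show "norm (W1n p (%x. u x - \<psi> k x)) <= W1n p (%x. u x - w k x) + 1 / real (Suc k)"
        using \<psi>(2)[of k] W1_norm_nonneg[OF p, of "%x. u x - \<psi> k x"] by simp
    qed
    have "(%k. 1 / real (Suc k)) \<longlonglongrightarrow> 0" by (rule LIMSEQ_Suc[OF lim_const_over_n])
    from tendsto_add[OF lim this] show "(%k. W1n p (%x. u x - w k x) + 1 / real (Suc k)) \<longlonglongrightarrow> 0" by simp
  qed
  then show ?thesis unfolding W1_0_iff[OF p] using u \<psi>(1) by blast
qed

lemma test_function_lincomb:
  assumes "\<psi> \<in> test_functions D" "\<theta> \<in> test_functions D"
  shows "(%x. a * \<psi> x + b * \<theta> x) \<in> test_functions D"
proof (cases D)
  case Torus
  have "smooth \<psi>" "smooth \<theta>" "\<And>x i. \<psi> (x + axis i 1) = \<psi> x" "\<And>x i. \<theta> (x + axis i 1) = \<theta> x"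
    using assms unfolding Torus by simp_all
  then show ?thesis unfolding Torus by (simp add: smooth_mult smooth_add smooth_const)
next
  case (Euclidean_Domain \<Omega>)
  have "\<psi> \<in> Cc_infinity \<Omega>" "\<theta> \<in> Cc_infinity \<Omega>" using assms unfolding Euclidean_Domain by simp_all
  from Cc_infinity_add[OF Cc_infinity_mult[OF this(1) smooth_const] Cc_infinity_mult[OF this(2) smooth_const], of a b]
  show ?thesis unfolding Euclidean_Domain by (simp add: mult.commute)
qed

lemma W1_0_lincomb:
  assumes p: "1 <= p" and u: "u \<in> W0 p" and w: "w \<in> W0 p"
  shows "(%x. a * u x + b * w x) \<in> W0 p"
proof -
  obtain \<psi> where \<psi>: "\<And>j. \<psi> j \<in> test_functions D" "(%j. W1n p (%x. u x - \<psi> j x)) \<longlonglongrightarrow> 0"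
    using u unfolding W1_0_iff[OF p] by blast
  obtain \<theta> where \<theta>: "\<And>j. \<theta> j \<in> test_functions D" "(%j. W1n p (%x. w x - \<theta> j x)) \<longlonglongrightarrow> 0"
    using w unfolding W1_0_iff[OF p] by blast
  note uw = W1_0_subset_W1[OF u] W1_0_subset_W1[OF w]
  have d: "(%x. u x - \<psi> j x) \<in> W p" "(%x. w x - \<theta> j x) \<in> W p" for j
    using W1_lincomb(1)[OF p uw(1) test_function_W1[OF p \<psi>(1)], of 1 "-1"]
      W1_lincomb(1)[OF p uw(2) test_function_W1[OF p \<theta>(1)], of 1 "-1"] by simp_all
  have "(%j. W1n p (%x. (a * u x + b * w x) - (a * \<psi> j x + b * \<theta> j x))) \<longlonglongrightarrow> 0"
  proof (rule Lim_null_comparison)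
    show "\<forall>\<^sub>F j in sequentially. norm (W1n p (%x. (a * u x + b * w x) - (a * \<psi> j x + b * \<theta> j x))) <=
        \<bar>a\<bar> * W1n p (%x. u x - \<psi> j x) + \<bar>b\<bar> * W1n p (%x. w x - \<theta> j x)"
    proof (intro always_eventually allI)
      fix j
      have "(%x. (a * u x + b * w x) - (a * \<psi> j x + b * \<theta> j x)) = (%x. a * (u x - \<psi> j x) + b * (w x - \<theta> j x))"
        by (auto simp: algebra_simps)
      then show "norm (W1n p (%x. (a * u x + b * w x) - (a * \<psi> j x + b * \<theta> j x))) <=
        \<bar>a\<bar> * W1n p (%x. u x - \<psi> j x) + \<bar>b\<bar> * W1n p (%x. w x - \<theta> j x)"
        using W1_lincomb(2)[OF p d(1)[of j] d(2)[of j], of a b] W1_norm_nonneg[OF p] by simp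
    qed
    show "(%j. \<bar>a\<bar> * W1n p (%x. u x - \<psi> j x) + \<bar>b\<bar> * W1n p (%x. w x - \<theta> j x)) \<longlonglongrightarrow> 0"
      using tendsto_add[OF tendsto_mult_left[OF \<psi>(2), of "\<bar>a\<bar>"] tendsto_mult_left[OF \<theta>(2), of "\<bar>b\<bar>"]] by simp
  qed
  then show ?thesis
    unfolding W1_0_iff[OF p]
    by (intro conjI exI[of _ "%j x. a * \<psi> j x + b * \<theta> j x"] allI W1_lincomb(1)[OF p uw]
        test_function_lincomb[OF \<psi>(1) \<theta>(1)])
qed

subsection \<open>Products\<close>

text \<open>The product of a test function and a Sobolev function vanishes near the boundary, so its mollifications are test
  functions that approximate it.\<close>

lemma test_function_times_W1:
  assumes r: "1 <= r" "r <= q" and \<psi>: "\<psi> \<in> test_functions D"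
    and b: "b \<in> L q" "weak_gradient D (ennreal q) b v"
  shows "(%x. \<psi> x * b x) \<in> W0 r"
    and "weak_gradient D (ennreal r) (%x. \<psi> x * b x) (%x. \<chi> i. \<psi> x * v x $ i + partial i \<psi> x * b x)"
proof -
  let ?w = "%x. \<chi> i. \<psi> x * v x $ i + partial i \<psi> x * b x"
  have q: "1 <= q" "0 < q" "0 < r" using r by auto
  have sm: "smooth \<psi>" by (rule test_function_smooth[OF \<psi>])
  have vL: "(%x. v x $ i) \<in> L q" for i using b(2) by (simp add: weak_gradient_iff)
  have mL: "(%x. \<theta> x * u x) \<in> L q" if t: "smooth \<theta>" "u \<in> L q" for \<theta> u
  proof -
    obtain B where "0 <= B" "\<And>x. x \<in> region D ==> \<bar>\<theta> x\<bar> <= B"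
      using continuous_bound_on[OF smooth_continuous[OF t(1)] region_properties(2)[OF D]] by blast
    then show ?thesis using Lp_mult_bounded[OF q(2) t(2) smooth_continuous[OF t(1)]] region_properties(1)[OF D] by blast
  qed
  have sub: "u \<in> L r" if "u \<in> L q" for u
    by (rule Lp_subset_finite_measure[OF finite_measure_region[OF D] q(3) r(2) that])
  have u: "(%x. \<psi> x * b x) \<in> L r" by (rule sub[OF mL[OF sm b(1)]])
  have w: "(%x. ?w x $ i) \<in> L r" for i
    using sub[OF Lp_add[OF q(1) mL[OF sm vL] mL[OF smooth_partial(1)[OF sm] b(1)]]] by simp
  have wk: "(LINT x|M. \<psi> x * b x * partial i \<theta> x) = - (LINT x|M. ?w x $ i * \<theta> x)" if \<theta>: "\<theta> \<in> multipliers D" for i \<theta>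
  proof -
    have sm': "smooth \<theta>" by (rule multiplier_smooth[OF \<theta>])
    note ib = Lp_integrable[OF q(1) b(1)] and iv = Lp_integrable[OF q(1) vL]
    have i1: "integrable M (%x. b x * (\<psi> x * partial i \<theta> x))" "integrable M (%x. b x * (partial i \<psi> x * \<theta> x))"
      "integrable M (%x. v x $ i * (\<psi> x * \<theta> x))"
      by (intro integrable_mult_smooth ib iv smooth_mult sm sm' smooth_partial(1))+
    have "(LINT x|M. b x * partial i (%x. \<psi> x * \<theta> x) x) = - (LINT x|M. v x $ i * (\<psi> x * \<theta> x))"
      using b(2) test_function_mult[OF \<psi> \<theta>] unfolding weak_gradient_iff by blast
    also have "(LINT x|M. b x * partial i (%x. \<psi> x * \<theta> x) x) =
        (LINT x|M. b x * (\<psi> x * partial i \<theta> x)) + (LINT x|M. b x * (partial i \<psi> x * \<theta> x))"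
      unfolding partial_mult[OF sm sm'] using i1 by (simp add: distrib_left)
    finally have "(LINT x|M. b x * (\<psi> x * partial i \<theta> x)) =
        - ((LINT x|M. v x $ i * (\<psi> x * \<theta> x)) + (LINT x|M. b x * (partial i \<psi> x * \<theta> x)))" by simp
    also have "(LINT x|M. v x $ i * (\<psi> x * \<theta> x)) + (LINT x|M. b x * (partial i \<psi> x * \<theta> x)) =
        (LINT x|M. v x $ i * (\<psi> x * \<theta> x) + b x * (partial i \<psi> x * \<theta> x))" using i1 by simp
    finally show ?thesis by (simp add: algebra_simps)
  qed
  show wg: "weak_gradient D (ennreal r) (%x. \<psi> x * b x) ?w"
    unfolding weak_gradient_iff using w wk test_function_multiplier by blast
  have uW: "(%x. \<psi> x * b x) \<in> W r" by (rule W1_I[OF u wg])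
  show "(%x. \<psi> x * b x) \<in> W0 r"
  proof (cases D)
    case Torus
    then show ?thesis using uW by simp
  next
    case (Euclidean_Domain \<Omega>)
    have C: "compact (closure {x. \<psi> x ~= 0})" "closure {x. \<psi> x ~= 0} \<subseteq> \<Omega>"
      using \<psi> unfolding Euclidean_Domain by (simp_all add: Cc_infinity_def)
    have z: "\<psi> x * b x = 0" if "x \<notin> closure {x. \<psi> x ~= 0}" for x
      using that closure_subset[of "{x. \<psi> x ~= 0}"] by auto
    have "\<forall>\<^sub>F n in sequentially. conv (region D) (K n) (%x. \<psi> x * b x) \<in> test_functions D"
      by (rule conv_compact_test_function[OF Euclidean_Domain Lp_integrable[OF r(1) u] C z])
    from mollified_test_functions_dense[OF r(1) u w wk this]
    show ?thesis unfolding W1_0_iff[OF r(1)] by metis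
  qed
qed

text \<open>The product of \<open>W\<^sub>0\<^sup>1\<^sup>,\<^sup>p\<close> and \<open>W\<^sup>1\<^sup>,\<^sup>q\<close>: approximate the first factor by test functions and use Hoelder's
  inequality for the function and its gradient.\<close>

lemma W1_0_times_W1:
  assumes pqr: "1 <= p" "1 <= q" "1 <= r" "1 / r = 1 / p + 1 / q"
    and a: "a \<in> W0 p" and b: "b \<in> W q"
  shows "(%x. a x * b x) \<in> W0 r"
    and "W1n r (%x. a x * b x) <= W1n p a * W1n q b"
proof -
  have pos: "0 < p" "0 < q" "0 < r" using pqr by auto
  have rq: "r <= q"
  proof -
    have "1 / q <= 1 / r" using pqr pos by simp
    then show ?thesis using pos by (simp add: field_simps)
  qed
  note hoelder = Lp_mult[OF pos pqr(4)]
  obtain va where va: "a \<in> L p" "weak_gradient D (ennreal p) a va" using W1_D[OF W1_0_subset_W1[OF a]] .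
  obtain vb where vb: "b \<in> L q" "weak_gradient D (ennreal q) b vb" using W1_D[OF b] .
  have vaL: "(%x. va x $ i) \<in> L p" for i using va(2) by (simp add: weak_gradient_iff)
  have vbL: "(%x. vb x $ i) \<in> L q" for i using vb(2) by (simp add: weak_gradient_iff)
  obtain \<psi> where \<psi>: "\<And>k. \<psi> k \<in> test_functions D" "(%k. W1n p (%x. a x - \<psi> k x)) \<longlonglongrightarrow> 0"
    using a unfolding W1_0_iff[OF pqr(1)] by blast
  have sm: "smooth (\<psi> k)" for k by (rule test_function_smooth[OF \<psi>(1)])
  have \<psi>L: "\<psi> k \<in> L p" "partial i (\<psi> k) \<in> L p" for k i
    by (rule smooth_Lp[OF pqr(1) sm], rule smooth_Lp[OF pqr(1) smooth_partial(1)[OF sm]])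
  have dn: "W1n p (%x. a x - \<psi> k x) = nrm p (%x. \<psi> k x - a x) + (\<Sum>i\<in>UNIV. nrm p (%x. partial i (\<psi> k) x - va x $ i))" for k
  proof -
    have "W1n p (%x. a x - \<psi> k x) = nrm p (%x. a x - \<psi> k x) + (\<Sum>i\<in>UNIV. nrm p (%x. va x $ i - (\<chi> i. partial i (\<psi> k) x) $ i))"
      by (rule W1_norm_diff_eq[OF pqr(1) va \<psi>L(1) weak_gradient_test_function[OF pqr(1) \<psi>(1)]])
    then show ?thesis unfolding vec_lambda_beta Lp_norm_minus[OF pos(1), of _ a] Lp_norm_minus[OF pos(1), of _ "%x. va x $ _"] .
  qed
  have le: "nrm p (%x. \<psi> k x - a x) <= W1n p (%x. a x - \<psi> k x)"
    "nrm p (%x. partial i (\<psi> k) x - va x $ i) <= W1n p (%x. a x - \<psi> k x)" for k i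
  proof -
    have "nrm p (%x. partial i (\<psi> k) x - va x $ i) <= (\<Sum>i\<in>UNIV. nrm p (%x. partial i (\<psi> k) x - va x $ i))"
      by (rule member_le_sum) (auto simp: Lp_norm_nonneg[OF pos(1)])
    moreover have "0 <= (\<Sum>i\<in>UNIV. nrm p (%x. partial i (\<psi> k) x - va x $ i))" by (intro sum_nonneg Lp_norm_nonneg pos)
    ultimately show "nrm p (%x. \<psi> k x - a x) <= W1n p (%x. a x - \<psi> k x)"
      "nrm p (%x. partial i (\<psi> k) x - va x $ i) <= W1n p (%x. a x - \<psi> k x)"
      unfolding dn using Lp_norm_nonneg[OF pos(1), of M "%x. \<psi> k x - a x"] by linarith+
  qed
  let ?v = "%x. \<chi> i. a x * vb x $ i + va x $ i * b x"
  let ?vk = "%k x. \<chi> i. \<psi> k x * vb x $ i + partial i (\<psi> k) x * b x"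
  note tw = test_function_times_W1[OF pqr(3) rq \<psi>(1) vb]
  have abL: "(%x. a x * b x) \<in> L r" by (rule hoelder(1)[OF va(1) vb(1)])
  have vL: "(%x. ?v x $ i) \<in> L r" for i
    using Lp_add[OF pqr(3) hoelder(1)[OF va(1) vbL] hoelder(1)[OF vaL vb(1)]] by simp
  have l1: "(%k. nrm r (%x. \<psi> k x * b x - a x * b x)) \<longlonglongrightarrow> 0"
  proof (rule Lim_null_comparison)
    show "\<forall>\<^sub>F k in sequentially. norm (nrm r (%x. \<psi> k x * b x - a x * b x)) <= W1n p (%x. a x - \<psi> k x) * nrm q b"
    proof (intro always_eventually allI)
      fix k
      have "nrm r (%x. (\<psi> k x - a x) * b x) <= nrm p (%x. \<psi> k x - a x) * nrm q b"
        by (rule hoelder(2)[OF Lp_diff[OF pqr(1) \<psi>L(1) va(1)] vb(1)])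
      also have "... <= W1n p (%x. a x - \<psi> k x) * nrm q b"
        by (intro mult_right_mono le Lp_norm_nonneg pos)
      finally show "norm (nrm r (%x. \<psi> k x * b x - a x * b x)) <= W1n p (%x. a x - \<psi> k x) * nrm q b"
        by (simp add: left_diff_distrib Lp_norm_nonneg[OF pos(3)])
    qed
    show "(%k. W1n p (%x. a x - \<psi> k x) * nrm q b) \<longlonglongrightarrow> 0" by (rule tendsto_mult_left_zero[OF \<psi>(2)])
  qed
  have l2: "(%k. nrm r (%x. ?vk k x $ i - ?v x $ i)) \<longlonglongrightarrow> 0" for i
  proof (rule Lim_null_comparison)
    show "\<forall>\<^sub>F k in sequentially. norm (nrm r (%x. ?vk k x $ i - ?v x $ i)) <=
        W1n p (%x. a x - \<psi> k x) * (nrm q (%x. vb x $ i) + nrm q b)"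
    proof (intro always_eventually allI)
      fix k
      note d1 = Lp_diff[OF pqr(1) \<psi>L(1)[of k] va(1)] and d2 = Lp_diff[OF pqr(1) \<psi>L(2)[of i k] vaL[of i]]
      have "nrm r (%x. (\<psi> k x - a x) * vb x $ i + (partial i (\<psi> k) x - va x $ i) * b x) <=
          nrm r (%x. (\<psi> k x - a x) * vb x $ i) + nrm r (%x. (partial i (\<psi> k) x - va x $ i) * b x)"
        by (rule Lp_norm_add[OF pqr(3) hoelder(1)[OF d1 vbL] hoelder(1)[OF d2 vb(1)]])
      also have "... <= nrm p (%x. \<psi> k x - a x) * nrm q (%x. vb x $ i) + nrm p (%x. partial i (\<psi> k) x - va x $ i) * nrm q b"
        by (intro add_mono hoelder(2) d1 d2 vbL vb(1))
      also have "... <= W1n p (%x. a x - \<psi> k x) * nrm q (%x. vb x $ i) + W1n p (%x. a x - \<psi> k x) * nrm q b"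
        by (intro add_mono mult_right_mono le Lp_norm_nonneg pos)
      finally show "norm (nrm r (%x. ?vk k x $ i - ?v x $ i)) <= W1n p (%x. a x - \<psi> k x) * (nrm q (%x. vb x $ i) + nrm q b)"
        by (simp add: algebra_simps Lp_norm_nonneg[OF pos(3)])
    qed
    show "(%k. W1n p (%x. a x - \<psi> k x) * (nrm q (%x. vb x $ i) + nrm q b)) \<longlonglongrightarrow> 0"
      by (rule tendsto_mult_left_zero[OF \<psi>(2)])
  qed
  have twL: "(%x. \<psi> k x * b x) \<in> L r" for k by (rule hoelder(1)[OF \<psi>L(1) vb(1)])
  note wl = weak_gradient_limit[OF pqr(3) twL tw(2) abL vL l1 l2]
  have abW: "(%x. a x * b x) \<in> W r" by (rule W1_I[OF abL wl(1)])
  have sw: "W1n r (%x. a x * b x - \<psi> k x * b x) = W1n r (%x. \<psi> k x * b x - a x * b x)" for k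
    unfolding W1_norm_diff_eq[OF pqr(3) abL wl(1) twL tw(2)] W1_norm_diff_eq[OF pqr(3) twL tw(2) abL wl(1)]
    by (simp add: Lp_norm_ennreal[OF pos(3)] abs_minus_commute)
  show "(%x. a x * b x) \<in> W0 r"
    by (rule W1_0_closed[OF pqr(3) abW tw(1)]) (use wl(2) in \<open>simp only: sw\<close>)
  have "W1n r (%x. a x * b x) = nrm r (%x. a x * b x) + (\<Sum>i\<in>UNIV. nrm r (%x. a x * vb x $ i + va x $ i * b x))"
    using W1_norm_eq[OF pqr(3) wl(1)] by simp
  also have "... <= nrm p a * nrm q b + (\<Sum>i\<in>UNIV. nrm p a * nrm q (%x. vb x $ i) + nrm p (%x. va x $ i) * nrm q b)"
  proof (intro add_mono sum_mono hoelder(2) va vb)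
    fix i
    have "nrm r (%x. a x * vb x $ i + va x $ i * b x) <= nrm r (%x. a x * vb x $ i) + nrm r (%x. va x $ i * b x)"
      by (rule Lp_norm_add[OF pqr(3) hoelder(1)[OF va(1) vbL] hoelder(1)[OF vaL vb(1)]])
    also have "... <= nrm p a * nrm q (%x. vb x $ i) + nrm p (%x. va x $ i) * nrm q b"
      by (intro add_mono hoelder(2) va vb vaL vbL)
    finally show "nrm r (%x. a x * vb x $ i + va x $ i * b x) <= nrm p a * nrm q (%x. vb x $ i) + nrm p (%x. va x $ i) * nrm q b" .
  qed
  also have "... <= (nrm p a + (\<Sum>i\<in>UNIV. nrm p (%x. va x $ i))) * (nrm q b + (\<Sum>i\<in>UNIV. nrm q (%x. vb x $ i)))"
  proof -
    have "0 <= (\<Sum>i\<in>UNIV. nrm p (%x. va x $ i)) * (\<Sum>i\<in>UNIV. nrm q (%x. vb x $ i))"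
      by (intro mult_nonneg_nonneg sum_nonneg Lp_norm_nonneg pos)
    then show ?thesis by (simp add: sum.distrib sum_distrib_left[symmetric] sum_distrib_right[symmetric] algebra_simps)
  qed
  also have "... = W1n p a * W1n q b"
    unfolding W1_norm_eq[OF pqr(1) va(2)] W1_norm_eq[OF pqr(2) vb(2)] ..
  finally show "W1n r (%x. a x * b x) <= W1n p a * W1n q b" .
qed

end

section \<open>Functions of time\<close>

lemma AE_pair_both:
  assumes "sigma_finite_measure M1" "sigma_finite_measure M2" and P: "AE x in M1. P x" and Q: "AE y in M2. Q y"
  shows "AE z in M1 \<Otimes>\<^sub>M M2. P (fst z) \<and> Q (snd z)"
proof -
  interpret M1: sigma_finite_measure M1 by fact
  interpret M2: sigma_finite_measure M2 by fact
  interpret pair_sigma_finite M1 M2 ..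
  obtain A where A: "\<And>x. x \<in> space M1 - A ==> P x" "A \<in> null_sets M1" using AE_E3[OF P] by blast
  obtain B where B: "\<And>x. x \<in> space M2 - B ==> Q x" "B \<in> null_sets M2" using AE_E3[OF Q] by blast
  have m: "{z \<in> space (M1 \<Otimes>\<^sub>M M2). fst z \<notin> A \<and> snd z \<notin> B} \<in> sets (M1 \<Otimes>\<^sub>M M2)"
  proof -
    have "{z \<in> space (M1 \<Otimes>\<^sub>M M2). fst z \<notin> A \<and> snd z \<notin> B} = (space M1 - A) \<times> (space M2 - B)"
      by (auto simp: space_pair_measure)
    then show ?thesis using A(2) B(2) by auto
  qed
  have "AE z in M1 \<Otimes>\<^sub>M M2. fst z \<notin> A \<and> snd z \<notin> B"
  proof (rule AE_pair_measure[OF m])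
    have "AE y in M2. y \<notin> B" using B(2) by (rule AE_not_in)
    moreover have "AE x in M1. x \<notin> A" using A(2) by (rule AE_not_in)
    ultimately show "AE x in M1. AE y in M2. fst (x, y) \<notin> A \<and> snd (x, y) \<notin> B"
      by (auto elim!: eventually_mono)
  qed
  then show ?thesis
    by (rule AE_mp) (rule AE_I2, use A(1) B(1) in \<open>auto simp: space_pair_measure\<close>)
qed

lemma integrable_pair_mult:
  fixes a b :: "_ => real"
  assumes "sigma_finite_measure M1" "sigma_finite_measure M2" and a: "integrable M1 a" and b: "integrable M2 b"
  shows "integrable (M1 \<Otimes>\<^sub>M M2) (%(x, y). a x * b y)"
proof -
  interpret M1: sigma_finite_measure M1 by fact
  interpret M2: sigma_finite_measure M2 by fact
  interpret pair_sigma_finite M1 M2 ..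
  have [measurable]: "a \<in> borel_measurable M1" "b \<in> borel_measurable M2" using a b by auto
  show ?thesis
  proof (rule Fubini_integrable)
    have "(%x. LINT y|M2. norm (case (x, y) of (x, y) => a x * b y)) = (%x. \<bar>a x\<bar> * (LINT y|M2. \<bar>b y\<bar>))"
      by (simp add: abs_mult)
    then show "integrable M1 (%x. LINT y|M2. norm (case (x, y) of (x, y) => a x * b y))" using a by simp
  qed (use b in auto)
qed

text \<open>Lebesgue measure is complete, so functions that are only known almost everywhere, such as the sections of
  elements of Bochner spaces, are measurable nevertheless.\<close>

lemma borel_measurable_lebesgue_on_AE:
  fixes f :: "'a::euclidean_space => real"
  assumes S: "S \<in> sets lebesgue" and f: "f \<in> borel_measurable (lebesgue_on S)" and ae: "AE x in lebesgue_on S. f x = g x"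
  shows "g \<in> borel_measurable (lebesgue_on S)"
proof -
  have "(%x. if x \<in> S then f x else 0) \<in> borel_measurable lebesgue"
    using borel_measurable_if[OF S, of f] f by simp
  moreover have "AE x in lebesgue. (if x \<in> S then f x else 0) = (if x \<in> S then g x else 0)"
    using ae S by (auto simp: AE_restrict_space_iff elim!: eventually_mono)
  ultimately have "(%x. if x \<in> S then g x else 0) \<in> borel_measurable lebesgue" by (rule borel_measurable_AE)
  then show ?thesis using borel_measurable_if[OF S, of g] by simp
qed

lemma borel_measurable_lebesgue_on_LIMSEQ:
  fixes f :: "nat => 'a::euclidean_space => real"
  assumes S: "S \<in> sets lebesgue" and f: "\<And>k. f k \<in> borel_measurable (lebesgue_on S)"
    and lim: "AE x in lebesgue_on S. (%k. f k x) \<longlonglongrightarrow> g x"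
  shows "g \<in> borel_measurable (lebesgue_on S)"
proof (rule borel_measurable_lebesgue_on_AE[OF S])
  show "(%x. lim (%k. f k x)) \<in> borel_measurable (lebesgue_on S)" using f by measurable
  show "AE x in lebesgue_on S. lim (%k. f k x) = g x" using lim by eventually_elim (rule limI)
qed

lemma time_measurable_set: "{0<..<T::real} \<in> sets lebesgue" "bounded {0<..<T}" by auto

lemma finite_measure_time: "finite_measure (time_measure T)"
  by (intro finite_measure_lebesgue_on bounded_set_imp_lmeasurable time_measurable_set)

lemma sigma_finite_time: "sigma_finite_measure (time_measure T)"
  by (rule finite_measure.axioms(1)[OF finite_measure_time])

text \<open>Integrals over \<open>(\<epsilon>, T - \<epsilon>)\<close> are rewritten as integrals over \<open>(0, T)\<close>, in order that a single measure is used for all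
  \<open>\<epsilon>\<close>. For \<open>2 \<epsilon> \<ge> T\<close> both sides are zero.\<close>

lemma integral_restrict_time:
  assumes "0 < eps"
  shows "(LINT t|lebesgue_on {eps<..<T - eps}. h t) = (LINT t|time_measure T. indicator {eps<..<T - eps} t * (h t :: real))"
proof -
  have "(LINT t|time_measure T. indicator {eps<..<T - eps} t * h t) =
      (LINT t|lebesgue. indicator {0<..<T} t *\<^sub>R (indicator {eps<..<T - eps} t * h t))"
    by (intro integral_restrict_space) auto
  also have "... = (LINT t|lebesgue. indicator {eps<..<T - eps} t *\<^sub>R h t)"
    using assms by (intro Lintegral_cong) (auto simp: indicator_def)
  also have "... = (LINT t|lebesgue_on {eps<..<T - eps}. h t)" by (intro integral_restrict_space[symmetric]) auto
  finally show ?thesis ..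
qed

subsection \<open>Simple functions in Bochner spaces\<close>

text \<open>Truncating the approximating simple functions where their norm exceeds \<open>2 \<parallel>u(t)\<parallel>\<close> makes dominated
  convergence applicable.\<close>

lemma bochner_simple_approximation:
  fixes u :: "real => 'a => real" and nrm :: "('a => real) => real"
  assumes p: "1 <= p" and u: "u \<in> bochner_Lp T (ennreal p) X nrm"
    and zero: "(%x. 0) \<in> X" "nrm (%x. 0) = 0" and nn: "\<And>a. 0 <= nrm a"
    and tri: "\<And>a b c. a \<in> X ==> b \<in> X ==> c \<in> X ==> nrm (%x. a x - c x) <= nrm (%x. a x - b x) + nrm (%x. b x - c x)"
    and sym: "\<And>a b. a \<in> X ==> b \<in> X ==> nrm (%x. a x - b x) = nrm (%x. b x - a x)"
  obtains s where "\<And>k. simple_function (time_measure T) (s k)" "\<And>k t. t \<in> {0<..<T} ==> s k t \<in> X"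
    "AE t in time_measure T. (%k. nrm (%x. u t x - s k t x)) \<longlonglongrightarrow> 0"
    "\<And>k t. t \<in> {0<..<T} ==> nrm (s k t) <= 2 * nrm (u t)"
    "\<And>k. (%t. nrm (%x. u t x - s k t x)) \<in> Lp (time_measure T) (ennreal p)"
    "(%k. Lp_norm (time_measure T) (ennreal p) (%t. nrm (%x. u t x - s k t x))) \<longlonglongrightarrow> 0"
proof -
  let ?M = "time_measure T"
  have p0: "0 < p" using p by simp
  have uX: "AE t in ?M. u t \<in> X" and uL: "(%t. nrm (u t)) \<in> Lp ?M (ennreal p)"
    using u by (auto simp: bochner_Lp_def strongly_measurable_def)
  obtain s where s: "\<And>k. simple_function ?M (s k)" "\<And>k t. t \<in> {0<..<T} ==> s k t \<in> X"
    "AE t in ?M. (%k. nrm (%x. u t x - s k t x)) \<longlonglongrightarrow> 0"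
  proof -
    obtain s where "(\<forall>k. simple_function ?M (s k) \<and> (\<forall>t\<in>{0<..<T}. s k t \<in> X)) \<and>
        (AE t in ?M. (%k. nrm (u t - s k t)) \<longlonglongrightarrow> 0)"
      using u unfolding bochner_Lp_def strongly_measurable_def by blast
    then show ?thesis using that[of s] by (simp add: fun_diff_def)
  qed
  have norm0: "nrm (%x. a x - 0) = nrm a" for a by simp
  have tri2: "nrm (%x. a x - b x) <= nrm a + nrm b" "nrm b <= nrm a + nrm (%x. a x - b x)" if "a \<in> X" "b \<in> X" for a b
    using tri[OF that(1) zero(1) that(2)] sym[OF zero(1) that(2)] tri[OF that(2,1) zero(1)] sym[OF that] norm0 by simp_all
  have [measurable]: "(%t. nrm (u t)) \<in> borel_measurable ?M" using uL by (rule Lp_measurable)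
  define s' where "s' k t = (if nrm (s k t) <= 2 * nrm (u t) then s k t else (%x. 0))" for k t
  have simp': "simple_function ?M (s' k)" for k
  proof -
    have [measurable]: "(%t. nrm (s k t)) \<in> borel_measurable ?M"
      by (rule borel_measurable_simple_function[OF simple_function_compose1[OF s(1)]])
    have "{t \<in> space ?M. nrm (s k t) <= 2 * nrm (u t)} \<in> sets ?M" by measurable
    then show ?thesis unfolding s'_def[abs_def] by (intro simple_function_If s(1)) auto
  qed
  have X': "s' k t \<in> X" if "t \<in> {0<..<T}" for k t using s(2)[OF that] zero by (auto simp: s'_def)
  have bd: "nrm (s' k t) <= 2 * nrm (u t)" for k t using nn[of "u t"] zero by (auto simp: s'_def)
  have AEspace: "AE t in ?M. t \<in> {0<..<T}" by (rule AE_I2) simp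
  have conv: "AE t in ?M. (%k. nrm (%x. u t x - s' k t x)) \<longlonglongrightarrow> 0"
    using uX s(3) AEspace
  proof eventually_elim
    case (elim t)
    show ?case
    proof (cases "nrm (u t) = 0")
      case True
      have "nrm (%x. u t x - s' k t x) = 0" for k
        using tri2(1)[OF elim(1) X'[OF elim(3), of k]] bd[of k t] True nn[of "%x. u t x - s' k t x"] nn[of "s' k t"] by simp
      then show ?thesis by simp
    next
      case False
      then have "0 < nrm (u t)" using nn[of "u t"] by simp
      then have "\<forall>\<^sub>F k in sequentially. nrm (%x. u t x - s k t x) < nrm (u t)" using elim(2) by (rule order_tendstoD(2)[rotated])
      then have "\<forall>\<^sub>F k in sequentially. nrm (%x. u t x - s' k t x) = nrm (%x. u t x - s k t x)"
      proof eventually_elim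
        case (elim k)
        then have "nrm (s k t) <= 2 * nrm (u t)" using tri2(2)[OF \<open>u t \<in> X\<close> s(2)[OF \<open>t \<in> {0<..<T}\<close>, of k]] by simp
        then show ?case by (simp add: s'_def)
      qed
      then show ?thesis using elim(2) by (simp add: tendsto_cong)
    qed
  qed
  have meas: "(%t. nrm (%x. u t x - s' k t x)) \<in> borel_measurable ?M" for k
  proof (rule borel_measurable_lebesgue_on_LIMSEQ[OF time_measurable_set(1)])
    show "(%t. nrm (%x. s' l t x - s' k t x)) \<in> borel_measurable ?M" for l
      by (rule borel_measurable_simple_function[OF simple_function_compose2[OF simp' simp']])
    show "AE t in ?M. (%l. nrm (%x. s' l t x - s' k t x)) \<longlonglongrightarrow> nrm (%x. u t x - s' k t x)"
      using uX conv AEspace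
    proof eventually_elim
      case (elim t)
      have "norm (nrm (%x. s' l t x - s' k t x) - nrm (%x. u t x - s' k t x)) <= nrm (%x. u t x - s' l t x)" for l
        using tri[OF X'[OF elim(3), of l] elim(1) X'[OF elim(3), of k]] tri[OF elim(1) X'[OF elim(3), of l] X'[OF elim(3), of k]]
          sym[OF elim(1) X'[OF elim(3)], of l] by simp
      then have "(%l. nrm (%x. s' l t x - s' k t x) - nrm (%x. u t x - s' k t x)) \<longlonglongrightarrow> 0"
        by (intro Lim_null_comparison[OF _ elim(2)] always_eventually allI)
      then show ?case by (rule LIM_zero_cancel)
    qed
  qed
  have dom: "AE t in ?M. nrm (%x. u t x - s' k t x) <= 3 * nrm (u t)" for k
    using uX AEspace
  proof eventually_elim
    case (elim t)
    show ?case using tri2(1)[OF elim(1) X'[OF elim(2), of k]] bd[of k t] by simp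
  qed
  have L: "(%t. nrm (%x. u t x - s' k t x)) \<in> Lp ?M (ennreal p)" for k
    by (rule Lp_norm_mono(1)[OF p0 Lp_scale[OF p0 uL, of 3] meas]) (use dom[of k] nn in \<open>auto elim!: eventually_mono\<close>)
  have "(%k. Lp_norm ?M (ennreal p) (%t. 0 - (- nrm (%x. u t x - s' k t x)))) \<longlonglongrightarrow> 0"
  proof (rule Lp_dominated_convergence[OF p0 _ _ _ Lp_scale[OF p0 uL, of 3]])
    show "AE t in ?M. (%k. - nrm (%x. u t x - s' k t x)) \<longlonglongrightarrow> 0"
      using conv by eventually_elim (use tendsto_minus in fastforce)
    show "AE t in ?M. \<bar>0 - (- nrm (%x. u t x - s' k t x))\<bar> <= \<bar>3 * nrm (u t)\<bar>" for k
      using dom[of k] by eventually_elim (use nn in auto)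
  qed (use meas in auto)
  then have "(%k. Lp_norm ?M (ennreal p) (%t. nrm (%x. u t x - s' k t x))) \<longlonglongrightarrow> 0" by simp
  from that[OF simp' X' conv bd L this] show ?thesis by blast
qed

subsection \<open>Jointly measurable representatives\<close>

text \<open>Joint Lebesgue measurability does not give measurability with respect to the product of the two Lebesgue measures on the
  factors; a Borel representative does, and it agrees with \<open>u\<close> on almost every section in either direction.\<close>

lemma jointly_measurable_representative:
  fixes u :: "real => real^'n => real"
  assumes D: "admissible D" and u: "u \<in> jointly_measurable T D"
  obtains u' where "(%(t, x). u' t x) \<in> borel_measurable (time_measure T \<Otimes>\<^sub>M space_measure D)"
    "AE t in time_measure T. AE x in space_measure D. u t x = u' t x"
    "AE x in space_measure D. AE t in time_measure T. u t x = u' t x"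
proof -
  let ?A = "{0<..<T}" and ?B = "region D"
  have B: "?B \<in> sets lebesgue" by (rule region_properties(1)[OF D])
  define v where "v z = (if z \<in> ?A \<times> ?B then u (fst z) (snd z) else 0)" for z
  have "?A \<times> ?B \<in> sets (borel \<Otimes>\<^sub>M borel)" using region_borel[OF D] by (intro pair_measureI) auto
  then have "?A \<times> ?B \<in> sets borel" by (simp only: borel_prod)
  then have AB: "?A \<times> ?B \<in> sets lebesgue" by (intro sets_completionI_sets) (simp only: sets_lborel)
  have "(%z. u (fst z) (snd z)) \<in> borel_measurable (lebesgue_on (?A \<times> ?B))"
    using u by (simp add: jointly_measurable_def split_beta')
  then have "v \<in> borel_measurable (completion lborel)"
    unfolding v_def using borel_measurable_if[OF AB, of "%z. u (fst z) (snd z)"] by simp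
  then obtain v' where v': "v' \<in> borel_measurable lborel" "AE z in lborel. v z = v' z"
    using completion_ex_borel_measurable_real by blast
  obtain N where N: "\<And>z. z \<notin> N ==> v z = v' z" "N \<in> null_sets lborel" using AE_E3[OF v'(2)] by auto
  have N': "N \<in> null_sets (lborel \<Otimes>\<^sub>M lborel)" using N(2) by (simp add: lborel_prod)
  have AEN: "AE z in lborel \<Otimes>\<^sub>M lborel. (fst z, snd z) \<notin> N" using AE_not_in[OF N'] by simp
  have NS: "{z \<in> space (lborel \<Otimes>\<^sub>M lborel). (fst z, snd z) \<notin> N} \<in> sets (lborel \<Otimes>\<^sub>M lborel)"
  proof -
    have "{z \<in> space (lborel \<Otimes>\<^sub>M lborel). (fst z, snd z) \<notin> N} = space (lborel \<Otimes>\<^sub>M lborel) - N" by auto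
    then show ?thesis using sets.compl_sets[OF null_setsD2[OF N']] by (simp only:)
  qed
  have 1: "AE t in lborel. AE x in lborel. (t, x) \<notin> N" using lborel_pair.AE_pair[OF AEN] by simp
  then have 2: "AE x in lborel. AE t in lborel. (t, x) \<notin> N" using lborel_pair.AE_commute[OF NS] by simp
  have restr: "AE y in lebesgue_on S. P y" if "AE y in lborel. P y" "S \<in> sets lebesgue" for S and P :: "'b::euclidean_space => bool"
  proof -
    have "AE y in lebesgue. P y" using that(1) by (rule AE_completion)
    then show ?thesis using that(2) by (auto simp: AE_restrict_space_iff elim!: eventually_mono)
  qed
  have eq: "u t x = v' (t, x)" if "t \<in> ?A" "x \<in> ?B" "(t, x) \<notin> N" for t x
    using N(1)[OF that(3)] that by (simp add: v_def)
  have S: "AE t in time_measure T. t \<in> ?A" "AE x in space_measure D. x \<in> ?B" by (auto intro: AE_I2)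
  have [measurable]: "v' \<in> borel_measurable borel" using v'(1) by simp
  have id: "(%x. x) \<in> measurable (lebesgue_on S) borel" for S :: "'b::euclidean_space set"
    by (intro measurable_restrict_space1 measurable_completion) auto
  show ?thesis
  proof (rule that[of "%t x. v' (t, x)"])
    have "(%z. (fst z, snd z)) \<in> measurable (time_measure T \<Otimes>\<^sub>M space_measure D) (borel \<Otimes>\<^sub>M borel)"
      by (intro measurable_Pair measurable_compose[OF measurable_fst id] measurable_compose[OF measurable_snd id])
    then have "(%z. (fst z, snd z)) \<in> measurable (time_measure T \<Otimes>\<^sub>M space_measure D) borel" by (simp add: borel_prod)
    from measurable_compose[OF this \<open>v' \<in> borel_measurable borel\<close>]
    show "(%(t, x). v' (t, x)) \<in> borel_measurable (time_measure T \<Otimes>\<^sub>M space_measure D)" by (simp add: split_beta)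
    have "AE t in time_measure T. AE x in lborel. (t, x) \<notin> N" by (rule restr[OF 1]) auto
    then show "AE t in time_measure T. AE x in space_measure D. u t x = v' (t, x)"
      using S(1)
    proof eventually_elim
      case (elim t)
      show ?case using restr[OF elim(1) B] S(2) by eventually_elim (use eq elim(2) in auto)
    qed
    have "AE x in space_measure D. AE t in lborel. (t, x) \<notin> N" by (rule restr[OF 2 B])
    then show "AE x in space_measure D. AE t in time_measure T. u t x = v' (t, x)"
      using S(2)
    proof eventually_elim
      case (elim x)
      show ?case using restr[OF elim(1) time_measurable_set(1)] S(1) by eventually_elim (use eq elim(2) in auto)
    qed
  qed
qed

subsection \<open>Mollification in time\<close>

definition time_kernel :: "(real => real) => real => real => real" where
  "time_kernel \<eta> eps z = (1 / eps) * \<eta> (z / eps)"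

definition time_kernel' :: "(real => real) => real => real => real" where
  "time_kernel' \<eta> eps z = (1 / eps\<^sup>2) * deriv \<eta> (z / eps)"

text \<open>Up to constants a majorant of the mollifying kernel and of \<open>\<epsilon>\<close> times its derivative, of total mass at most one. It is
  continuous, even and positive on \<open>(-2\<epsilon>, 2\<epsilon>)\<close>, so that the convolution estimates apply to it; on \<open>[-\<epsilon>, \<epsilon>]\<close> it is at
  least \<open>1/(8\<epsilon>)\<close>.\<close>

definition tent :: "real => real => real" where
  "tent eps z = max 0 (2 * eps - \<bar>z\<bar>) / (8 * eps\<^sup>2)"

lemma tent_props:
  assumes "0 < eps"
  shows "continuous_on UNIV (tent eps)" "0 <= tent eps z" "tent eps (- z) = tent eps z"
    "(LINT y|time_measure T. tent eps (x - y)) <= 1" "\<bar>z\<bar> <= eps ==> 1 / eps <= 8 * tent eps z"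
    "tent eps z ~= 0 ==> \<bar>z\<bar> < 2 * eps"
proof -
  show c: "continuous_on UNIV (tent eps)" unfolding tent_def[abs_def] using assms by (auto intro!: continuous_intros)
  show nn: "0 <= tent eps z" for z by (simp add: tent_def)
  show "tent eps (- z) = tent eps z" by (simp add: tent_def)
  show "1 / eps <= 8 * tent eps z" if "\<bar>z\<bar> <= eps"
  proof -
    have "tent eps z = (2 * eps - \<bar>z\<bar>) / (8 * eps\<^sup>2)" using that assms by (simp add: tent_def max_def)
    moreover have "8 * (x / (8 * y)) = x / y" for x y :: real by simp
    ultimately have "8 * tent eps z = (2 * eps - \<bar>z\<bar>) / eps\<^sup>2" by (simp only:)
    moreover have "1 / eps = eps / eps\<^sup>2" using assms by (simp add: power2_eq_square)
    moreover have "eps / eps\<^sup>2 <= (2 * eps - \<bar>z\<bar>) / eps\<^sup>2" using that assms by (intro divide_right_mono) auto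
    ultimately show ?thesis by simp
  qed
  show "\<bar>z\<bar> < 2 * eps" if "tent eps z ~= 0" using that by (auto simp: tent_def max_def split: if_splits)
  let ?I = "{x - 2 * eps..x + 2 * eps}"
  have le: "tent eps (x - y) <= (1 / (4 * eps)) * indicator ?I y" for y
  proof (cases "y \<in> ?I")
    case True
    have "tent eps (x - y) <= (2 * eps) / (8 * eps\<^sup>2)" unfolding tent_def using assms by (intro divide_right_mono) auto
    then show ?thesis using True assms by (simp add: power2_eq_square)
  next
    case False
    then have "tent eps (x - y) = 0" by (auto simp: tent_def max_def abs_if split: if_splits)
    then show ?thesis using assms by simp
  qed
  interpret finite_measure "time_measure T" by (rule finite_measure_time)
  have Im: "?I \<inter> {0<..<T} \<in> sets lebesgue" by auto
  have ii: "integrable (time_measure T) (indicator ?I :: real => real)"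
  proof -
    have "?I \<inter> space (time_measure T) \<in> sets (time_measure T)" using Im by (simp add: sets_restrict_space_iff)
    then show ?thesis by (simp add: integrable_indicator_iff emeasure_finite less_top[symmetric])
  qed
  have "(LINT y|time_measure T. tent eps (x - y)) <= (LINT y|time_measure T. (1 / (4 * eps)) * indicator ?I y)"
    using ii le nn assms by (intro integral_mono') auto
  also have "... = (1 / (4 * eps)) * measure (time_measure T) (?I \<inter> {0<..<T})" by simp
  also have "... <= (1 / (4 * eps)) * (4 * eps)"
  proof (rule mult_left_mono)
    have "measure (time_measure T) (?I \<inter> {0<..<T}) = measure lebesgue (?I \<inter> {0<..<T})"
      by (intro measure_restrict_space) auto
    also have "... <= measure lebesgue ?I" by (intro measure_mono_fmeasurable Im) auto
    also have "measure lebesgue ?I = 4 * eps" using assms by simp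
    finally show "measure (time_measure T) (?I \<inter> {0<..<T}) <= 4 * eps" .
  qed (use assms in simp)
  finally show "(LINT y|time_measure T. tent eps (x - y)) <= 1" using assms by simp
qed

lemma mollifier_deriv:
  assumes \<eta>: "mollifier_kernel \<eta>"
  shows "(\<eta> has_real_derivative deriv \<eta> t) (at t)" "continuous_on UNIV (deriv \<eta>)" "1 < \<bar>t\<bar> ==> deriv \<eta> t = 0"
proof -
  obtain v where v: "\<And>x. (\<eta> has_derivative (%h. v x \<bullet> h)) (at x)" "\<And>i. i \<in> Basis ==> smooth (%x. v x \<bullet> i)"
    using smooth_gradient[OF mollifier_kernelD(1)[OF \<eta>]] by blast
  have d: "(\<eta> has_real_derivative v x) (at x)" for x
    using v(1)[of x] by (simp add: has_field_derivative_def)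
  then have eq: "deriv \<eta> = v" using DERIV_imp_deriv by blast
  show "(\<eta> has_real_derivative deriv \<eta> t) (at t)" using d eq by simp
  show "continuous_on UNIV (deriv \<eta>)" using smooth_continuous[OF v(2)[of 1]] eq by simp
  show "deriv \<eta> t = 0" if "1 < \<bar>t\<bar>"
  proof -
    have "((%_. 0) has_real_derivative deriv \<eta> t) (at t)"
    proof (rule has_field_derivative_transform_within_open[where S = "{x. 1 < \<bar>x\<bar>}"])
      show "(\<eta> has_real_derivative deriv \<eta> t) (at t)" using d eq by simp
      show "open {x::real. 1 < \<bar>x\<bar>}" by (intro open_Collect_less continuous_intros)
    qed (use that mollifier_kernelD(4)[OF \<eta>] in auto)
    then show ?thesis using DERIV_unique[OF _ DERIV_const] by blast
  qed
qed

lemma time_kernel_props: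
  assumes \<eta>: "mollifier_kernel \<eta>" and eps: "0 < eps"
  shows "continuous_on UNIV (time_kernel \<eta> eps)" "continuous_on UNIV (time_kernel' \<eta> eps)"
    "(time_kernel \<eta> eps has_real_derivative time_kernel' \<eta> eps z) (at z)"
    "eps < \<bar>z\<bar> ==> time_kernel \<eta> eps z = 0" "eps < \<bar>z\<bar> ==> time_kernel' \<eta> eps z = 0"
proof -
  show "continuous_on UNIV (time_kernel \<eta> eps)" unfolding time_kernel_def[abs_def]
    using eps by (intro continuous_intros continuous_on_compose2[OF mollifier_kernelD(5)[OF \<eta>]]) auto
  show "continuous_on UNIV (time_kernel' \<eta> eps)" unfolding time_kernel'_def[abs_def]
    using eps by (intro continuous_intros continuous_on_compose2[OF mollifier_deriv(2)[OF \<eta>]]) auto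
  have "((%z. (1 / eps) * \<eta> (z / eps)) has_real_derivative (1 / eps) * (deriv \<eta> (z / eps) * (1 / eps))) (at z)"
    using eps by (intro DERIV_cmult DERIV_chain2[OF mollifier_deriv(1)[OF \<eta>]]) (auto intro!: derivative_eq_intros)
  then show "(time_kernel \<eta> eps has_real_derivative time_kernel' \<eta> eps z) (at z)"
    by (simp add: time_kernel_def[abs_def] time_kernel'_def power2_eq_square mult.commute)
  show "time_kernel \<eta> eps z = 0" "time_kernel' \<eta> eps z = 0" if "eps < \<bar>z\<bar>"
    using that eps mollifier_kernelD(4)[OF \<eta>, of "z / eps"] mollifier_deriv(3)[OF \<eta>, of "z / eps"]
    by (auto simp: time_kernel_def time_kernel'_def field_simps abs_divide)
qed

lemma time_kernel_bounds:
  assumes \<eta>: "mollifier_kernel \<eta>"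
  obtains C where "0 <= C" "\<And>eps z. 0 < eps ==> \<bar>time_kernel \<eta> eps z\<bar> <= C * tent eps z"
    "\<And>eps z. 0 < eps ==> \<bar>time_kernel' \<eta> eps z\<bar> <= C / eps * tent eps z"
proof -
  obtain B where B: "0 <= B" "\<And>x. x \<in> {-1..1} ==> \<bar>\<eta> x\<bar> <= B"
    using continuous_bound_on[OF mollifier_kernelD(5)[OF \<eta>], of "{-1..1}"] by auto
  obtain B' where B': "0 <= B'" "\<And>x. x \<in> {-1..1} ==> \<bar>deriv \<eta> x\<bar> <= B'"
    using continuous_bound_on[OF mollifier_deriv(2)[OF \<eta>], of "{-1..1}"] by auto
  define b where "b = max B B'"
  have b: "0 <= b" "\<bar>\<eta> x\<bar> <= b" "\<bar>deriv \<eta> x\<bar> <= b" for x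
  proof -
    have "\<bar>\<eta> x\<bar> <= b \<and> \<bar>deriv \<eta> x\<bar> <= b"
    proof (cases "\<bar>x\<bar> <= 1")
      case True
      then have "x \<in> {-1..1}" by auto
      then show ?thesis using B(2)[of x] B'(2)[of x] by (auto simp: b_def)
    next
      case False
      then show ?thesis using mollifier_kernelD(4)[OF \<eta>, of x] mollifier_deriv(3)[OF \<eta>, of x] B B' by (auto simp: b_def)
    qed
    then show "\<bar>\<eta> x\<bar> <= b" "\<bar>deriv \<eta> x\<bar> <= b" by auto
    show "0 <= b" using B by (auto simp: b_def)
  qed
  show ?thesis
  proof (rule that[of "8 * b"])
    show "0 <= 8 * b" using b by simp
    fix eps z :: real assume eps: "0 < eps"
    have t0: "0 <= tent eps z" by (rule tent_props(2)[OF eps])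
    show "\<bar>time_kernel \<eta> eps z\<bar> <= 8 * b * tent eps z"
    proof (cases "\<bar>z\<bar> <= eps")
      case True
      have "\<bar>time_kernel \<eta> eps z\<bar> = (1 / eps) * \<bar>\<eta> (z / eps)\<bar>" using eps by (simp add: time_kernel_def abs_mult)
      also have "... <= (8 * tent eps z) * b"
        using tent_props(5)[OF eps True] b t0 by (intro mult_mono) auto
      finally show ?thesis by (simp add: mult_ac)
    qed (use time_kernel_props(4)[OF \<eta> eps, of z] t0 b in auto)
    show "\<bar>time_kernel' \<eta> eps z\<bar> <= 8 * b / eps * tent eps z"
    proof (cases "\<bar>z\<bar> <= eps")
      case True
      have "\<bar>time_kernel' \<eta> eps z\<bar> = (1 / eps) * ((1 / eps) * \<bar>deriv \<eta> (z / eps)\<bar>)"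
        using eps by (simp add: time_kernel'_def abs_mult power2_eq_square)
      also have "... <= (1 / eps) * ((8 * tent eps z) * b)"
        using tent_props(5)[OF eps True] b t0 eps by (intro mult_left_mono mult_mono) auto
      finally show ?thesis by (simp add: mult_ac)
    qed (use time_kernel_props(5)[OF \<eta> eps, of z] t0 b eps in auto)
  qed
qed

lemma mollify_eq_conv: "mollify \<eta> T eps h t x = conv {0<..<T} (time_kernel \<eta> eps) (%s. h s x) t"
  by (simp add: mollify_def conv_def time_kernel_def)

lemma conv_real_has_derivative:
  fixes K v :: "real => real"
  assumes "\<And>z. (K has_real_derivative v z) (at z)" "continuous_on UNIV v" "S \<in> sets lebesgue" "bounded S"
    "integrable (lebesgue_on S) u"
  shows "(conv S K u has_real_derivative conv S v u t) (at t)"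
proof -
  have "(K has_derivative (%h. v z \<bullet> h)) (at z)" for z
    using assms(1)[of z] by (simp add: has_field_derivative_def)
  moreover have "continuous_on UNIV (%z. v z \<bullet> i)" for i by (intro continuous_intros assms)
  ultimately show ?thesis
    using conv_has_derivative[of K v S u t] assms(2-5) by (simp add: has_field_derivative_def)
qed

lemma deriv_mollify:
  assumes \<eta>: "mollifier_kernel \<eta>" and eps: "0 < eps" and h: "integrable (time_measure T) (%s. h s x)"
  shows "deriv (%\<tau>. mollify \<eta> T eps h \<tau> x) t = (LINT s|time_measure T. time_kernel' \<eta> eps (t - s) * h s x)"
proof -
  have "(conv {0<..<T} (time_kernel \<eta> eps) (%s. h s x) has_real_derivative
      conv {0<..<T} (time_kernel' \<eta> eps) (%s. h s x) t) (at t)"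
    by (intro conv_real_has_derivative time_kernel_props[OF \<eta> eps] time_measurable_set h)
  from DERIV_imp_deriv[OF this] show ?thesis
    unfolding mollify_eq_conv conv_def[of _ "time_kernel' \<eta> eps"] .
qed

text \<open>Integration against this density is \<open>\<integral>\<^sub>t\<^sup>s\<close>, for either order of \<open>t\<close> and \<open>s\<close>.\<close>

definition oriented :: "real => real => real => real" where
  "oriented t s r = indicator {t<..s} r - indicator {s<..t} r"

lemma oriented_props:
  "\<bar>oriented t s r\<bar> <= 1" "\<bar>s - t\<bar> < \<bar>r - t\<bar> ==> oriented t s r = 0"
  by (auto simp: oriented_def indicator_def abs_if split: if_splits)

lemma integral_oriented_FTC:
  assumes f: "\<And>x. x \<in> {0<..<T} ==> min t s <= x ==> x <= max t s ==> (f has_real_derivative g x) (at x)"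
    and g: "continuous_on UNIV g" and ts: "t \<in> {0<..<T}" "s \<in> {0<..<T}"
  shows "(LINT r|time_measure T. oriented t s r * g r) = f s - f t"
proof -
  have main: "(LINT r|time_measure T. indicator {a<..b} r * g r) = f b - f a"
    if ab: "a <= b" "a \<in> {0<..<T}" "b \<in> {0<..<T}" "min t s <= a" "b <= max t s" for a b
  proof -
    have "(LINT r|time_measure T. indicator {a<..b} r * g r) = (LINT r|lebesgue. indicator {0<..<T} r *\<^sub>R (indicator {a<..b} r * g r))"
      by (intro integral_restrict_space) auto
    also have "... = (LINT r|lebesgue. indicator {a<..b} r * g r)"
      using ab by (intro Lintegral_cong) (auto simp: indicator_def)
    also have "... = (LINT r|lborel. indicator {a<..b} r * g r)"
      using borel_measurable_continuous_onI[OF g] by (intro integral_completion) auto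
    also have "... = (LINT r|lborel. indicator {a..b} r *\<^sub>R g r)"
    proof (rule integral_cong_AE)
      show "AE r in lborel. indicator {a<..b} r * g r = indicator {a..b} r *\<^sub>R g r"
        using AE_lborel_singleton[of a] by eventually_elim (auto simp: indicator_def)
    qed (use borel_measurable_continuous_onI[OF g] in auto)
    also have "... = f b - f a"
    proof (rule integral_FTC_Icc[OF ab(1)])
      show "(f has_vector_derivative g x) (at x within {a..b})" if "a <= x" "x <= b" for x
        using f[of x] ab that by (auto simp: has_real_derivative_iff_has_vector_derivative intro: has_vector_derivative_at_within)
    qed (use g continuous_on_subset in blast)
    finally show ?thesis .
  qed
  show ?thesis
  proof (cases "t <= s")
    case True
    then have "oriented t s = indicator {t<..s}" by (auto simp: oriented_def indicator_def fun_eq_iff)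
    then show ?thesis using main[of t s] True ts by simp
  next
    case False
    then have "oriented t s = (%r. - indicator {s<..t} r)" by (auto simp: oriented_def indicator_def fun_eq_iff)
    then show ?thesis using main[of s t] False ts by simp
  qed
qed

lemma measurable_oriented: "oriented t s \<in> borel_measurable (time_measure T)"
  unfolding oriented_def[abs_def] by (intro measurable_restrict_space1 measurable_completion) auto

lemma integrable_oriented:
  assumes "integrable (time_measure T) h"
  shows "integrable (time_measure T) (%r. oriented t s r * h r)"
proof (rule Lintegrable_bound[OF assms])
  show "AE r in time_measure T. norm (oriented t s r * h r) <= norm (h r)"
    using oriented_props(1) by (auto simp: abs_mult intro!: mult_left_le_one_le)
qed (use assms measurable_oriented in auto)

text \<open>A function with weak derivative \<open>F\<close> is absolutely continuous: its mollifications have derivative \<open>F * \<eta>\<^sub>n\<close>, and one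
  passes to the limit in the fundamental theorem of calculus along an almost everywhere convergent subsequence.\<close>

lemma weak_derivative_increment:
  assumes \<eta>: "mollifier_kernel \<eta>" and f: "integrable (time_measure T) f" and F: "integrable (time_measure T) F"
    and weak: "\<And>\<theta>. \<theta> \<in> Cc_infinity {0<..<T} ==>
      (LINT t|time_measure T. deriv \<theta> t * f t) = - (LINT t|time_measure T. \<theta> t * F t)"
  shows "AE t in time_measure T. AE s in time_measure T. f s - f t = (LINT r|time_measure T. oriented t s r * F r)"
proof -
  let ?S = "{0<..<T}" and ?M = "time_measure T"
  let ?K = "euclid_kernel \<eta> :: nat => real => real"
  note Sm = time_measurable_set[of T]
  have ai: "approximate_identity ?S ?K" by (rule approximate_identity_euclid[OF \<eta>]) auto
  have Sn: "?S - interior ?S \<in> null_sets lebesgue" by (simp add: interior_open)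
  have sm: "smooth (?K n)" for n by (rule euclid_kernel_smooth[OF \<eta>])
  have K': "\<exists>v. (\<forall>z. (?K n has_real_derivative v z) (at z)) \<and> continuous_on UNIV v" for n
  proof -
    obtain v where v: "\<And>x. (?K n has_derivative (%h. v x \<bullet> h)) (at x)" "\<And>i. i \<in> Basis ==> smooth (%x. v x \<bullet> i)"
      using smooth_gradient[OF sm] by blast
    have "continuous_on UNIV v" using smooth_continuous[OF v(2)[of 1]] by simp
    then show ?thesis using v(1) by (auto simp: has_field_derivative_def)
  qed
  define v where "v n = (SOME v. (\<forall>z. (?K n has_real_derivative v z) (at z)) \<and> continuous_on UNIV v)" for n
  have v: "(?K n has_real_derivative v n z) (at z)" "continuous_on UNIV (v n)" for n z
    using someI_ex[OF K'[of n]] unfolding v_def by blast+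
  define fn where "fn n = conv ?S (?K n) f" for n
  define Fn where "Fn n = conv ?S (?K n) F" for n
  have kn: "continuous_on UNIV (?K n)" "0 <= ?K n z" "?K n (- z) = ?K n z" "(LINT y|lebesgue_on ?S. ?K n (x - y)) <= 1" for n x z
    using ai by (auto simp: approximate_identity_def)
  have L1: "integrable ?M (conv ?S (?K n) u) \<and> (%n. LINT x|?M. \<bar>conv ?S (?K n) u x - u x\<bar>) \<longlonglongrightarrow> 0" if "integrable ?M u" for n u
  proof -
    have u1: "u \<in> Lp ?M (ennreal 1)" using that by (simp add: Lp_1)
    show ?thesis using conv_Lp_contraction(1)[OF Sm kn(1) kn(2) kn(3) kn(4) _ u1, of n]
        approximate_identity_Lp[OF ai Sm Sn _ u1] by (simp add: Lp_1 Lp_norm_1)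
  qed
  have fl: "(%n. LINT x|?M. \<bar>fn n x - f x\<bar>) \<longlonglongrightarrow> 0" and Fl: "(%n. LINT x|?M. \<bar>Fn n x - F x\<bar>) \<longlonglongrightarrow> 0"
    and fi: "integrable ?M (fn n)" and Fi: "integrable ?M (Fn n)" for n
    using L1[OF f] L1[OF F] by (auto simp: fn_def Fn_def)
  obtain \<rho> where \<rho>: "strict_mono \<rho>" "AE x in ?M. (%n. fn (\<rho> n) x - f x) \<longlonglongrightarrow> 0"
    using tendsto_L1_AE_subseq[of ?M "%n x. fn n x - f x"] fl fi f by (auto simp: )
  have key: "f s - f t = (LINT r|?M. oriented t s r * F r)"
    if ts: "t \<in> ?S" "s \<in> ?S" and lim: "(%n. fn (\<rho> n) t - f t) \<longlonglongrightarrow> 0" "(%n. fn (\<rho> n) s - f s) \<longlonglongrightarrow> 0" for t s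
  proof -
    let ?C = "{min t s..max t s}"
    have "\<forall>\<^sub>F n in sequentially. \<forall>x\<in>?C. (%y. ?K n (x - y)) \<in> Cc_infinity ?S"
      using ts by (intro euclid_kernel_test_function[OF \<eta>]) auto
    then have "\<forall>\<^sub>F n in sequentially. fn n s - fn n t = (LINT r|?M. oriented t s r * Fn n r)"
    proof eventually_elim
      case (elim n)
      have der: "(fn n has_real_derivative Fn n x) (at x)" if x: "x \<in> ?C" for x
      proof -
        have d: "(fn n has_real_derivative conv ?S (v n) f x) (at x)"
          unfolding fn_def by (rule conv_real_has_derivative[OF v Sm f])
        have "((%y. ?K n (x - y)) has_real_derivative v n (x - y) * (- 1)) (at y)" for y
          by (rule DERIV_chain2[OF v(1)]) (auto intro!: derivative_eq_intros)
        then have "deriv (%y. ?K n (x - y)) y = - v n (x - y)" for y by (metis DERIV_imp_deriv mult_minus1_right)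
        with weak[OF bspec[OF elim x]] have "(LINT y|?M. - v n (x - y) * f y) = - (LINT y|?M. ?K n (x - y) * F y)" by simp
        then have "conv ?S (v n) f x = Fn n x" by (simp add: conv_def Fn_def)
        with d show ?thesis by simp
      qed
      have "continuous_on UNIV (Fn n)" unfolding Fn_def by (rule smooth_continuous[OF smooth_conv[OF Sm F sm]])
      then show ?case by (intro integral_oriented_FTC[symmetric] ts der) auto
    qed
    then have ev: "\<forall>\<^sub>F n in sequentially. fn (\<rho> n) s - fn (\<rho> n) t = (LINT r|?M. oriented t s r * Fn (\<rho> n) r)"
      using \<rho>(1) by (rule eventually_subseq[rotated])
    have "(%n. (LINT r|?M. oriented t s r * Fn n r) - (LINT r|?M. oriented t s r * F r)) \<longlonglongrightarrow> 0"
    proof (rule Lim_null_comparison[OF _ Fl], intro always_eventually allI)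
      fix n
      have "(LINT r|?M. oriented t s r * Fn n r) - (LINT r|?M. oriented t s r * F r) = (LINT r|?M. oriented t s r * (Fn n r - F r))"
        using integrable_oriented[OF Fi[of n], of t s] integrable_oriented[OF F, of t s] by (simp add: right_diff_distrib)
      also have "norm ... <= (LINT r|?M. norm (oriented t s r * (Fn n r - F r)))" by (rule integral_norm_bound)
      also have "... <= (LINT r|?M. \<bar>Fn n r - F r\<bar>)"
        using Fi[of n] F oriented_props(1) by (intro integral_mono') (auto simp: abs_mult intro!: mult_left_le_one_le)
      finally show "norm ((LINT r|?M. oriented t s r * Fn n r) - (LINT r|?M. oriented t s r * F r)) <= (LINT r|?M. \<bar>Fn n r - F r\<bar>)" .
    qed
    from LIMSEQ_subseq_LIMSEQ[OF LIM_zero_cancel[OF this] \<rho>(1)]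
    have r: "(%n. LINT r|?M. oriented t s r * Fn (\<rho> n) r) \<longlonglongrightarrow> (LINT r|?M. oriented t s r * F r)" by (simp add: comp_def)
    have "(%n. fn (\<rho> n) s - fn (\<rho> n) t) \<longlonglongrightarrow> f s - f t"
      by (rule tendsto_diff[OF LIM_zero_cancel[OF lim(2)] LIM_zero_cancel[OF lim(1)]])
    then have "(%n. LINT r|?M. oriented t s r * Fn (\<rho> n) r) \<longlonglongrightarrow> f s - f t"
      using ev by (rule Lim_transform_eventually)
    then show ?thesis using r LIMSEQ_unique by blast
  qed
  have good: "AE t in ?M. t \<in> ?S \<and> (%n. fn (\<rho> n) t - f t) \<longlonglongrightarrow> 0" using \<rho>(2) AE_space[of ?M] by eventually_elim simp
  show ?thesis using good
  proof eventually_elim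
    case (elim t)
    show ?case using good by eventually_elim (use key elim in blast)
  qed
qed

definition mean_oscillation :: "real => (real => real) => real => real" where
  "mean_oscillation T H eps = (LINT t|time_measure T. LINT r|time_measure T. tent eps (t - r) * \<bar>H r - H t\<bar>)"

lemma mean_oscillation_integrable:
  assumes eps: "0 < eps" and H: "integrable (time_measure T) H"
  shows "integrable (time_measure T) (%t. LINT r|time_measure T. tent eps (t - r) * \<bar>H r - H t\<bar>)"
    and "integrable (time_measure T) (%r. tent eps (t - r) * \<bar>H r - c\<bar>)"
proof -
  let ?M = "time_measure T"
  note te = tent_props[OF eps] and Sm = time_measurable_set[of T]
  interpret finite_measure ?M by (rule finite_measure_time)
  show i: "integrable ?M (%r. tent eps (t - r) * \<bar>H r - c\<bar>)" for t c
    by (rule integrable_conv[OF te(1) Sm]) (use H in auto)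
  have ab: "integrable ?M (%t. \<bar>H t\<bar>)" using H by auto
  note cv = integral_conv_le(1)[OF Sm te(1) te(2) te(3) te(4) ab]
  have mk: "(%(t, r). tent eps (t - r)) \<in> borel_measurable (?M \<Otimes>\<^sub>M ?M)" by (rule measurable_kernel_pair[OF te(1)])
  have "(%(t, r). tent eps (t - r) * \<bar>H r - H t\<bar>) \<in> borel_measurable (?M \<Otimes>\<^sub>M ?M)"
    using mk borel_measurable_integrable[OF H] unfolding split_beta' by measurable
  from borel_measurable_lebesgue_integral[OF this]
  have m: "(%t. LINT r|?M. tent eps (t - r) * \<bar>H r - H t\<bar>) \<in> borel_measurable ?M" by simp
  have bd: "(LINT r|?M. tent eps (t - r) * \<bar>H r - H t\<bar>) <= conv {0<..<T} (tent eps) (%r. \<bar>H r\<bar>) t + \<bar>H t\<bar>" for t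
  proof -
    have i1: "integrable ?M (%r. tent eps (t - r) * \<bar>H r\<bar>)" by (rule integrable_conv[OF te(1) Sm ab])
    have i2: "integrable ?M (%r. tent eps (t - r))" by (rule integrable_kernel[OF Sm te(1) te(2) te(3) te(4)])
    have "(LINT r|?M. tent eps (t - r) * \<bar>H r - H t\<bar>) <= (LINT r|?M. tent eps (t - r) * \<bar>H r\<bar> + tent eps (t - r) * \<bar>H t\<bar>)"
    proof (rule integral_mono[OF i])
      show "tent eps (t - r) * \<bar>H r - H t\<bar> <= tent eps (t - r) * \<bar>H r\<bar> + tent eps (t - r) * \<bar>H t\<bar>" for r
        using mult_left_mono[OF abs_triangle_ineq4[of "H r" "H t"] te(2)[of "t - r"]] by (simp add: distrib_left)
    qed (use i1 i2 in auto)
    also have "... = conv {0<..<T} (tent eps) (%r. \<bar>H r\<bar>) t + (LINT r|?M. tent eps (t - r)) * \<bar>H t\<bar>"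
      using i1 i2 by (simp add: conv_def)
    also have "(LINT r|?M. tent eps (t - r)) * \<bar>H t\<bar> <= 1 * \<bar>H t\<bar>" by (intro mult_right_mono te(4)) auto
    finally show ?thesis by simp
  qed
  show "integrable ?M (%t. LINT r|?M. tent eps (t - r) * \<bar>H r - H t\<bar>)"
  proof (rule Lintegrable_bound[OF _ m])
    show "integrable ?M (%t. conv {0<..<T} (tent eps) (%r. \<bar>H r\<bar>) t + \<bar>H t\<bar>)" using cv ab by auto
    show "AE t in ?M. norm (LINT r|?M. tent eps (t - r) * \<bar>H r - H t\<bar>) <= norm (conv {0<..<T} (tent eps) (%r. \<bar>H r\<bar>) t + \<bar>H t\<bar>)"
      using bd te(2) by (intro AE_I2) (smt (verit) real_norm_def Lintegral_nonneg mult_nonneg_nonneg abs_ge_zero)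
  qed
qed

text \<open>The convolution with the tent bounds the mean oscillation by a multiple of the \<open>L\<^sup>1\<close> norm; for continuous functions the
  claim is uniform continuity.\<close>

lemma mean_oscillation_tendsto_0:
  assumes H: "integrable (time_measure T) H"
  shows "(mean_oscillation T H \<longlongrightarrow> 0) (at_right 0)"
proof (rule tendstoI)
  let ?M = "time_measure T" and ?S = "{0<..<T}"
  fix e :: real assume e: "0 < e"
  note Sm = time_measurable_set[of T]
  interpret finite_measure ?M by (rule finite_measure_time)
  obtain c where c: "c \<in> Cc_functions ?S" "(LINT x|?M. \<bar>H x - c x\<bar>) <= e / 8"
    using Cc_dense_Lp[of ?S ?S 1 H "e / 8"] H e by (auto simp: Lp_1 Lp_norm_1)
  have ic: "integrable ?M c" by (rule Cc_functions_integrable[OF Sm(1) c(1)])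
  have cc: "continuous_on UNIV c" using c(1) by (simp add: Cc_functions_def)
  define m where "m = measure ?M (space ?M) + 1"
  have mp: "0 < m" by (simp add: m_def add_nonneg_pos)
  define b where "b = e / (4 * m)"
  have b: "0 < b" "measure ?M (space ?M) * b <= e / 4"
  proof -
    show "0 < b" using e mp by (simp add: b_def)
    then have "measure ?M (space ?M) * b <= m * b" by (simp add: m_def)
    also have "... = e / 4" using mp by (simp add: b_def)
    finally show "measure ?M (space ?M) * b <= e / 4" .
  qed
  have "uniformly_continuous_on {0..T} c"
    using cc by (intro compact_uniformly_continuous) (auto intro: continuous_on_subset)
  then obtain d where d: "0 < d" "\<And>x y. x \<in> {0..T} ==> y \<in> {0..T} ==> dist x y < d ==> dist (c x) (c y) < b"
    using b(1) unfolding uniformly_continuous_on_def by metis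
  have "mean_oscillation T H eps <= e / 2" if eps: "0 < eps" "eps < d / 2" for eps
  proof -
    note te = tent_props[OF eps(1)]
    have id: "integrable ?M (%r. \<bar>H r - c r\<bar>)" using H ic by auto
    note cv = integral_conv_le[OF Sm te(1) te(2) te(3) te(4) id abs_ge_zero]
    have pt: "(LINT r|?M. tent eps (t - r) * \<bar>H r - H t\<bar>) <= conv ?S (tent eps) (%r. \<bar>H r - c r\<bar>) t + (b + \<bar>H t - c t\<bar>)"
      if t: "t \<in> ?S" for t
    proof -
      have i1: "integrable ?M (%r. tent eps (t - r) * \<bar>H r - c r\<bar>)" by (rule integrable_conv[OF te(1) Sm id])
      have i2: "integrable ?M (%r. tent eps (t - r))" by (rule integrable_kernel[OF Sm te(1) te(2) te(3) te(4)])
      have "(LINT r|?M. tent eps (t - r) * \<bar>H r - H t\<bar>) <=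
          (LINT r|?M. tent eps (t - r) * \<bar>H r - c r\<bar> + tent eps (t - r) * (b + \<bar>H t - c t\<bar>))"
      proof (rule integral_mono[OF mean_oscillation_integrable(2)[OF eps(1) H]])
        fix r assume "r \<in> space ?M"
        then have r: "r \<in> ?S" by simp
        show "tent eps (t - r) * \<bar>H r - H t\<bar> <= tent eps (t - r) * \<bar>H r - c r\<bar> + tent eps (t - r) * (b + \<bar>H t - c t\<bar>)"
        proof (cases "tent eps (t - r) = 0")
          case False
          then have "\<bar>t - r\<bar> < d" using te(6) eps(2) by fastforce
          then have "\<bar>c t - c r\<bar> < b" using d(2)[of t r] t r by (simp add: dist_real_def)
          then have "\<bar>H r - H t\<bar> <= \<bar>H r - c r\<bar> + (b + \<bar>H t - c t\<bar>)" by linarith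
          from mult_left_mono[OF this te(2)] show ?thesis by (simp only: distrib_left)
        qed simp
      qed (use i1 i2 in auto)
      also have "... = conv ?S (tent eps) (%r. \<bar>H r - c r\<bar>) t + (LINT r|?M. tent eps (t - r)) * (b + \<bar>H t - c t\<bar>)"
        using i1 i2 by (simp add: conv_def)
      also have "(LINT r|?M. tent eps (t - r)) * (b + \<bar>H t - c t\<bar>) <= 1 * (b + \<bar>H t - c t\<bar>)"
        using b by (intro mult_right_mono te(4)) auto
      finally show ?thesis by simp
    qed
    have "mean_oscillation T H eps <= (LINT t|?M. conv ?S (tent eps) (%r. \<bar>H r - c r\<bar>) t + (b + \<bar>H t - c t\<bar>))"
      unfolding mean_oscillation_def
      using cv(1) id by (intro integral_mono mean_oscillation_integrable[OF eps(1) H] pt) auto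
    also have "... = (LINT t|?M. conv ?S (tent eps) (%r. \<bar>H r - c r\<bar>) t) + (measure ?M (space ?M) * b + (LINT t|?M. \<bar>H t - c t\<bar>))"
      using cv(1) id by simp
    also have "... <= e / 8 + (e / 4 + e / 8)" using cv(2) c(2) b(2) by (intro add_mono) auto
    finally show ?thesis by simp
  qed
  moreover have "0 <= mean_oscillation T H eps" if "0 < eps" for eps
    unfolding mean_oscillation_def using tent_props(2)[OF that] by (intro Lintegral_nonneg) auto
  ultimately have "dist (mean_oscillation T H eps) 0 < e" if "0 < eps" "eps < d / 2" for eps
    using e that by (smt (verit) dist_real_def field_sum_of_halves)
  then show "\<forall>\<^sub>F eps in at_right 0. dist (mean_oscillation T H eps) 0 < e"
    using d(1) by (auto simp: eventually_at_right intro!: exI[of _ "d / 2"])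
qed

section \<open>The commutator as an integral over pairs of times\<close>

lemma integral_cong_AE_complete:
  fixes f g :: "'a::euclidean_space => real"
  assumes S: "S \<in> sets lebesgue" and g: "g \<in> borel_measurable (lebesgue_on S)" and eq: "AE x in lebesgue_on S. f x = g x"
  shows "(LINT x|lebesgue_on S. f x) = (LINT x|lebesgue_on S. g x)"
proof (rule integral_cong_AE[OF _ g eq])
  have "AE x in lebesgue_on S. g x = f x" using eq by eventually_elim simp
  then show "f \<in> borel_measurable (lebesgue_on S)" by (rule borel_measurable_lebesgue_on_AE[OF S g])
qed

lemma Lp_cong_AE_ennreal:
  assumes c: "1 <= s" and u: "u \<in> Lp M s" and v: "v \<in> borel_measurable M" and eq: "AE x in M. u x = v x"
  shows "v \<in> Lp M s" "Lp_norm M s v = Lp_norm M s u"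
proof -
  have um: "u \<in> borel_measurable M" using u by (rule Lp_measurable)
  have "v \<in> Lp M s \<and> Lp_norm M s v = Lp_norm M s u"
  proof (cases "s = \<infinity>")
    case True
    have "esssup M (%x. ereal \<bar>u x\<bar>) = esssup M (%x. ereal \<bar>v x\<bar>)"
      using um v eq by (intro esssup_AE_cong) auto
    then show ?thesis using u v True by (simp add: Lp_def Lp_norm_def)
  next
    case False
    then obtain s' where s: "s = ennreal s'" "1 <= s'" using c by (cases s) (auto simp: ennreal_ge_1)
    then have "0 < s'" by simp
    from Lp_cong_AE[OF this _ v eq] Lp_norm_cong_AE[OF this um v eq] show ?thesis using u s by simp
  qed
  then show "v \<in> Lp M s" "Lp_norm M s v = Lp_norm M s u" by auto
qed

lemma const_Lp:
  assumes "finite_measure M" "1 <= p"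
  shows "(%x. 1) \<in> Lp M (ennreal p)"
proof -
  interpret finite_measure M by fact
  show ?thesis using assms(2) by (simp add: Lp_ennreal)
qed

text \<open>Integrability on a product from integrable sections whose norms have an integrable majorant, by Tonelli's theorem.\<close>

lemma integrable_pairI:
  fixes k :: "_ => _ => real"
  assumes "sigma_finite_measure M1" "sigma_finite_measure M2"
    and k: "(%(s, x). k s x) \<in> borel_measurable (M1 \<Otimes>\<^sub>M M2)"
    and bd: "AE s in M1. integrable M2 (k s) \<and> (LINT x|M2. \<bar>k s x\<bar>) <= B s" and B: "integrable M1 B"
  shows "integrable (M1 \<Otimes>\<^sub>M M2) (%(s, x). k s x)"
proof -
  interpret M1: sigma_finite_measure M1 by fact
  interpret M2: sigma_finite_measure M2 by fact
  interpret pair_sigma_finite M1 M2 ..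
  show ?thesis
  proof (rule Fubini_integrable[OF k])
    show "AE s in M1. integrable M2 (%x. case (s, x) of (s, x) => k s x)" using bd by eventually_elim simp
    have "(%z. norm (case z of (s, x) => k s x)) \<in> borel_measurable (M1 \<Otimes>\<^sub>M M2)" using k by auto
    then have "(%(s, x). \<bar>k s x\<bar>) \<in> borel_measurable (M1 \<Otimes>\<^sub>M M2)" by (simp add: split_beta')
    from M2.borel_measurable_lebesgue_integral[OF this]
    have m: "(%s. LINT x|M2. \<bar>k s x\<bar>) \<in> borel_measurable M1" .
    have "integrable M1 (%s. LINT x|M2. \<bar>k s x\<bar>)"
    proof (rule Lintegrable_bound[OF B m])
      show "AE s in M1. norm (LINT x|M2. \<bar>k s x\<bar>) <= norm (B s)"
        using bd
      proof eventually_elim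
        case (elim s)
        have "0 <= (LINT x|M2. \<bar>k s x\<bar>)" by (rule Lintegral_nonneg) auto
        then have "norm (LINT x|M2. \<bar>k s x\<bar>) <= B s" using elim by simp
        then show ?case by (rule order.trans) (simp add: abs_ge_self)
      qed
    qed
    then show "integrable M1 (%s. LINT x|M2. norm (case (s, x) of (s, x) => k s x))" by simp
  qed
qed

context spatial_setting
begin

abbreviation "tk eps \<equiv> time_kernel \<eta> eps"
abbreviation "tk' eps \<equiv> time_kernel' \<eta> eps"
abbreviation "moll T eps \<equiv> mollify \<eta> T eps"

end

text \<open>The exponents of \<open>\<phi>\<close> and \<open>g\<close> are finite and thus real numbers. The reals \<open>r\<close> and \<open>rt\<close> are the exponents conjugate to
  those of \<open>F\<close> in space and in time, and at the same time the exponents of the product \<open>\<phi> g\<close>.\<close>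

locale commutator_setting = spatial_setting D \<eta>
  for D :: "(real^'n) spatial_domain" and \<eta> :: "real => real" +
  fixes T pb qb p2 q2 r rt :: real and p1 q1 :: ennreal
    and f :: "real => real^'n => real" and F :: "real => (real^'n => real) => real"
  assumes T: "0 < T" and exponents: "1 <= pb" "1 <= qb" "1 <= p2" "1 <= q2"
    and cx: "conjugate_exponents r q1" "1 / r = 1 / qb + 1 / q2" "conj_exponent q1 = ennreal r"
    and ct: "conjugate_exponents rt p1" "1 / rt = 1 / pb + 1 / p2"
    and f: "f \<in> Lp_Lq T p1 D q1" and weak: "has_weak_time_derivative T D q1 f F" and F: "F \<in> Lp_W_minus1 T p1 D q1"
begin

abbreviation "\<mu> \<equiv> time_measure T"
abbreviation "nP \<equiv> W1n qb"
abbreviation "nG \<equiv> W1n q2"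
abbreviation "XP \<equiv> W0 qb"
abbreviation "XG \<equiv> W q2"
abbreviation "XW \<equiv> W0 r"
abbreviation "nW \<equiv> W1n r"

definition "N t = W_minus1_norm D q1 (F t)"

lemma r1: "1 <= r" using cx(1) by (simp add: conjugate_exponents_def)
lemma rt1: "1 <= rt" using ct(1) by (simp add: conjugate_exponents_def)

lemma sfM: "sigma_finite_measure M" by (rule finite_measure.axioms(1)[OF finite_measure_region[OF D]])
lemma sfT: "sigma_finite_measure \<mu>" by (rule sigma_finite_time)

lemma AE_time: "AE t in \<mu>. t \<in> {0<..<T}" by (rule AE_I2) simp

lemmas product = W1_0_times_W1[OF exponents(2,4) r1 cx(2)]

text \<open>The operator norm is an upper bound also for elements of seminorm zero, on which every bounded functional
  vanishes.\<close>

lemma W_minus1_bound: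
  assumes G: "G \<in> W_minus1 D q1" and w: "w \<in> XW"
  shows "\<bar>G w\<bar> <= W_minus1_norm D q1 G * nW w"
proof -
  have lin: "\<And>u v a b. u \<in> XW ==> v \<in> XW ==> G (%x. a * u x + b * v x) = a * G u + b * G v"
    and "\<exists>C. \<forall>u\<in>XW. \<bar>G u\<bar> <= C * nW u"
    using G by (auto simp: W_minus1_def cx(3))
  then obtain C where C: "\<And>u. u \<in> XW ==> \<bar>G u\<bar> <= C * nW u" by blast
  have nn: "0 <= nW w" by (rule W1_norm_nonneg[OF r1])
  show ?thesis
  proof (cases "nW w = 0")
    case True
    then show ?thesis using C[OF w] by simp
  next
    case False
    then have n: "0 < nW w" using nn by simp
    define u where "u = (%x. (1 / nW w) * w x + 0 * w x)"
    have u: "u \<in> XW" unfolding u_def by (rule W1_0_lincomb[OF r1 w w])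
    have "nW u <= \<bar>1 / nW w\<bar> * nW w + \<bar>0\<bar> * nW w"
      unfolding u_def by (rule W1_lincomb(2)[OF r1 W1_0_subset_W1[OF w] W1_0_subset_W1[OF w]])
    then have nu: "nW u <= 1" using n by simp
    have bdd: "bdd_above {\<bar>G u\<bar> |u. u \<in> XW \<and> nW u <= 1}"
    proof (rule bdd_aboveI)
      fix y assume "y \<in> {\<bar>G u\<bar> |u. u \<in> XW \<and> nW u <= 1}"
      then obtain u where u: "y = \<bar>G u\<bar>" "u \<in> XW" "nW u <= 1" by blast
      have "C * nW u <= \<bar>C\<bar> * 1" using u(3) W1_norm_nonneg[OF r1, of u] by (intro mult_mono) auto
      then show "y <= \<bar>C\<bar>" using C[OF u(2)] u(1) by simp
    qed
    have "\<bar>G u\<bar> <= W_minus1_norm D q1 G"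
      unfolding W_minus1_norm_def cx(3) using u nu by (intro cSup_upper[OF _ bdd]) blast
    moreover have "G u = (1 / nW w) * G w" unfolding u_def using lin[OF w w, of "1 / nW w" 0] by simp
    ultimately show ?thesis using n by (simp add: abs_mult field_simps)
  qed
qed

text \<open>Strong measurability of \<open>F\<close> is only used through the scalar functions \<open>\<langle>F(t), w\<rangle>\<close> and the norm of \<open>F(t)\<close>.\<close>

lemma F_properties:
  shows "AE t in \<mu>. F t \<in> W_minus1 D q1" "N \<in> Lp \<mu> p1" "integrable \<mu> N"
    "w \<in> XW ==> (%t. F t w) \<in> borel_measurable \<mu>" "w \<in> XW ==> integrable \<mu> (%t. F t w)"
proof -
  have sm: "strongly_measurable T (W_minus1 D q1) (W_minus1_norm D q1) F" and NL: "N \<in> Lp \<mu> p1"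
    using F unfolding Lp_W_minus1_def bochner_Lp_def N_def[abs_def] by auto
  then show AEF: "AE t in \<mu>. F t \<in> W_minus1 D q1" and "N \<in> Lp \<mu> p1" by (auto simp: strongly_measurable_def)
  have "integrable \<mu> (%t. 1 * N t)" by (rule Lp_mult_conjugate(1)[OF ct(1) const_Lp[OF finite_measure_time rt1] NL])
  then show iN: "integrable \<mu> N" by simp
  assume w: "w \<in> XW"
  obtain s where "(\<forall>k. simple_function \<mu> (s k) \<and> (\<forall>t\<in>{0<..<T}. s k t \<in> W_minus1 D q1)) \<and>
      (AE t in \<mu>. (%k. W_minus1_norm D q1 (F t - s k t)) \<longlonglongrightarrow> 0)"
    using sm unfolding strongly_measurable_def by blast
  then have s: "\<And>k. simple_function \<mu> (s k)" "\<And>k t. t \<in> {0<..<T} ==> s k t \<in> W_minus1 D q1"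
    "AE t in \<mu>. (%k. W_minus1_norm D q1 (%w. F t w - s k t w)) \<longlonglongrightarrow> 0" by (auto simp: fun_diff_def)
  have diff: "(%w. G w - H w) \<in> W_minus1 D q1" if GH: "G \<in> W_minus1 D q1" "H \<in> W_minus1 D q1" for G H
  proof -
    obtain C1 where C1: "\<forall>u\<in>XW. \<bar>G u\<bar> <= C1 * nW u" using GH(1) by (auto simp: W_minus1_def cx(3))
    obtain C2 where C2: "\<forall>u\<in>XW. \<bar>H u\<bar> <= C2 * nW u" using GH(2) by (auto simp: W_minus1_def cx(3))
    have "\<forall>u\<in>XW. \<bar>G u - H u\<bar> <= (C1 + C2) * nW u"
      using C1 C2 by (auto simp: distrib_right intro!: order.trans[OF abs_triangle_ineq4] add_mono)
    moreover have "\<forall>u\<in>XW. \<forall>v\<in>XW. \<forall>a b. G (%x. a * u x + b * v x) - H (%x. a * u x + b * v x) = a * (G u - H u) + b * (G v - H v)"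
      using GH by (simp add: W_minus1_def cx(3) algebra_simps)
    ultimately show ?thesis unfolding W_minus1_def cx(3) by blast
  qed
  show m: "(%t. F t w) \<in> borel_measurable \<mu>"
  proof (rule borel_measurable_lebesgue_on_LIMSEQ[OF time_measurable_set(1)])
    show "(%t. s k t w) \<in> borel_measurable \<mu>" for k
      by (rule borel_measurable_simple_function[OF simple_function_compose1[OF s(1)]])
    show "AE t in \<mu>. (%k. s k t w) \<longlonglongrightarrow> F t w"
      using AEF s(3) AE_time
    proof eventually_elim
      case (elim t)
      have "norm (s k t w - F t w) <= W_minus1_norm D q1 (%w. F t w - s k t w) * nW w" for k
        using W_minus1_bound[OF diff[OF elim(1) s(2)[OF elim(3)]] w, of k] by (simp add: abs_minus_commute)
      then have "(%k. s k t w - F t w) \<longlonglongrightarrow> 0"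
        by (intro Lim_null_comparison[OF _ tendsto_mult_left_zero[OF elim(2)]] always_eventually allI)
      then show ?case by (rule LIM_zero_cancel)
    qed
  qed
  show "integrable \<mu> (%t. F t w)"
  proof (rule Lintegrable_bound[OF _ m])
    show "integrable \<mu> (%t. N t * nW w)" using iN by simp
    show "AE t in \<mu>. norm (F t w) <= norm (N t * nW w)"
      using AEF by eventually_elim (use W_minus1_bound[OF _ w] in \<open>fastforce simp: N_def\<close>)
  qed
qed

subsection \<open>Measurable representatives\<close>

text \<open>The function \<open>u'\<close> is a representative of \<open>u\<close> that is measurable for the product measure, together with a majorant \<open>A\<close> of
  the spatial norms; Fubini's theorem is applied to \<open>u'\<close> while the claim concerns \<open>u\<close>.\<close>

definition datum :: "ennreal => (real => real) => (real => real^'n => real) => (real => real^'n => real) => bool" where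
  "datum q A u u' \<longleftrightarrow> (%(t, x). u' t x) \<in> borel_measurable (\<mu> \<Otimes>\<^sub>M M) \<and>
     (AE t in \<mu>. AE x in M. u t x = u' t x) \<and> (AE x in M. AE t in \<mu>. u t x = u' t x) \<and>
     (AE t in \<mu>. u' t \<in> Lp M q \<and> Lp_norm M q (u' t) <= A t)"

lemma datum_section:
  "(%(t, x). u' t x) \<in> borel_measurable (\<mu> \<Otimes>\<^sub>M M) ==> t \<in> {0<..<T} ==> u' t \<in> borel_measurable M"
  using measurable_Pair2[of "%(t, x). u' t x" \<mu> M borel t] by simp

lemma datum_exists:
  assumes u: "u \<in> jointly_measurable T D" and c: "1 <= q"
    and L: "AE t in \<mu>. u t \<in> Lp M q \<and> Lp_norm M q (u t) <= A t"
  obtains u' where "datum q A u u'"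
proof -
  obtain u' where u': "(%(t, x). u' t x) \<in> borel_measurable (\<mu> \<Otimes>\<^sub>M M)"
    "AE t in \<mu>. AE x in M. u t x = u' t x" "AE x in M. AE t in \<mu>. u t x = u' t x"
    using jointly_measurable_representative[OF D u] by blast
  have "AE t in \<mu>. u' t \<in> Lp M q \<and> Lp_norm M q (u' t) <= A t"
    using L u'(2) AE_time
  proof eventually_elim
    case (elim t)
    then show ?case using Lp_cong_AE_ennreal[OF c _ datum_section[OF u'(1)]] by auto
  qed
  then show ?thesis using that[of u'] u' by (simp add: datum_def)
qed

definition "Af t = Lp_norm M q1 (f t)"

lemma Af_Lp: "Af \<in> Lp \<mu> p1"
  using f unfolding Lp_Lq_def bochner_Lp_def Af_def[abs_def] by auto

lemma q1: "1 <= q1" using cx(1) by (auto simp: conjugate_exponents_def)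

lemma f_datum_ex: "\<exists>f'. datum q1 Af f f'"
proof -
  have "f \<in> jointly_measurable T D" "AE t in \<mu>. f t \<in> Lp M q1 \<and> Lp_norm M q1 (f t) <= Af t"
    using f unfolding Lp_Lq_def bochner_Lp_def strongly_measurable_def Af_def by auto
  from datum_exists[OF this(1) q1 this(2)] show ?thesis by metis
qed

definition "f' = (SOME f'. datum q1 Af f f')"

lemma f_datum: "datum q1 Af f f'"
  unfolding f'_def by (rule someI_ex[OF f_datum_ex])

definition "tri a b c = (LINT x|M. a x * b x * (c x :: real))"

lemmas tri_hoelder = triple_Hoelder[OF cx(1) exponents(2,4) cx(2)]
lemmas time_hoelder = triple_Hoelder[OF ct(1) exponents(1,3) ct(2)]

lemma tri_bound:
  assumes "a \<in> L qb" "b \<in> L q2" "c \<in> Lp M q1"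
  shows "\<bar>tri a b c\<bar> <= nrm qb a * nrm q2 b * Lp_norm M q1 c"
  unfolding tri_def using tri_hoelder(2)[OF assms] by (rule order.trans[OF integral_abs_bound])

text \<open>The derivative of a mollification in time is the convolution with \<open>k'\<close> for almost every point \<open>x\<close>; integrating against a
  function of \<open>x\<close> and exchanging the integrals leaves an integral over the second time variable.\<close>

lemma integral_deriv_mollify:
  assumes eps: "0 < eps" and eq: "AE x in M. AE s in \<mu>. h s x = h' s x"
    and h': "integrable (\<mu> \<Otimes>\<^sub>M M) (%(s, x). h' s x)"
    and c: "c' \<in> borel_measurable M" "AE x in M. c x = c' x"
    and ch: "integrable (\<mu> \<Otimes>\<^sub>M M) (%(s, x). c' x * h' s x)"
  shows "(LINT x|M. c x * deriv (%\<tau>. moll T eps h \<tau> x) t) =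
    (LINT s|\<mu>. tk' eps (t - s) * (LINT x|M. c' x * h' s x))"
proof -
  interpret t: sigma_finite_measure \<mu> by (rule sfT)
  interpret x: sigma_finite_measure M by (rule sfM)
  interpret tx: pair_sigma_finite \<mu> M ..
  interpret xt: pair_sigma_finite M \<mu> ..
  let ?k = "tk' eps"
  note kc = time_kernel_props(2)[OF \<eta> eps]
  note Sm = time_measurable_set[of T]
  have hm: "(%(s, x). h' s x) \<in> borel_measurable (\<mu> \<Otimes>\<^sub>M M)" using h' by auto
  have km: "(%s. ?k (t - s)) \<in> borel_measurable \<mu>" by (rule continuous_measurable_lebesgue_on[OF kc])
  have hm': "(%(x, s). ?k (t - s) * h' s x) \<in> borel_measurable (M \<Otimes>\<^sub>M \<mu>)"
  proof -
    have "(%(x, s). h' s x) \<in> borel_measurable (M \<Otimes>\<^sub>M \<mu>)" using measurable_pair_swap[OF hm] by (simp add: split_beta')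
    then show ?thesis using measurable_compose[OF measurable_snd km] unfolding split_beta' by (intro borel_measurable_times)
  qed
  have "AE x in M. integrable \<mu> (%s. h' s x)" using tx.AE_integrable_snd[OF h'] by simp
  then have d: "AE x in M. deriv (%\<tau>. moll T eps h \<tau> x) t = (LINT s|\<mu>. ?k (t - s) * h' s x)"
    using eq
  proof eventually_elim
    case (elim x)
    have eq': "AE s in \<mu>. h' s x = h s x" using elim(2) by eventually_elim simp
    have hx: "(%s. h s x) \<in> borel_measurable \<mu>"
      by (rule borel_measurable_lebesgue_on_AE[OF Sm(1) borel_measurable_integrable[OF elim(1)] eq'])
    have "integrable \<mu> (%s. h s x)"
      by (rule integrable_cong_AE_imp[OF elim(1) hx eq'])
    then have "deriv (%\<tau>. moll T eps h \<tau> x) t = (LINT s|\<mu>. ?k (t - s) * h s x)" by (rule deriv_mollify[OF \<eta> eps])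
    also have "... = (LINT s|\<mu>. ?k (t - s) * h' s x)"
    proof (rule integral_cong_AE_complete[OF Sm(1)])
      show "(%s. ?k (t - s) * h' s x) \<in> borel_measurable \<mu>" using km elim(1) by auto
      show "AE s in \<mu>. ?k (t - s) * h s x = ?k (t - s) * h' s x" using elim(2) by eventually_elim simp
    qed
    finally show ?case .
  qed
  have "(LINT x|M. c x * deriv (%\<tau>. moll T eps h \<tau> x) t) = (LINT x|M. c' x * (LINT s|\<mu>. ?k (t - s) * h' s x))"
  proof (rule integral_cong_AE_complete[OF region_properties(1)[OF D]])
    show "(%x. c' x * (LINT s|\<mu>. ?k (t - s) * h' s x)) \<in> borel_measurable M"
      using t.borel_measurable_lebesgue_integral[OF hm'] c(1) by (intro borel_measurable_times) auto
    show "AE x in M. c x * deriv (%\<tau>. moll T eps h \<tau> x) t = c' x * (LINT s|\<mu>. ?k (t - s) * h' s x)"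
      using d c(2) by eventually_elim simp
  qed
  also have "... = (LINT x|M. LINT s|\<mu>. ?k (t - s) * (c' x * h' s x))"
    by (simp only: integral_mult_right_zero[symmetric] mult.left_commute)
  also have "... = (LINT s|\<mu>. LINT x|M. ?k (t - s) * (c' x * h' s x))"
  proof (rule tx.Fubini_integral)
    obtain B where B: "0 <= B" "\<And>x y. x \<in> {t} ==> y \<in> {0<..<T} ==> \<bar>?k (x - y)\<bar> <= B"
      using kernel_bounded[OF kc Sm(2), of "{t}"] by auto
    have chm: "(%(s, x). c' x * h' s x) \<in> borel_measurable (\<mu> \<Otimes>\<^sub>M M)" using ch by auto
    show "integrable (\<mu> \<Otimes>\<^sub>M M) (%(s, x). ?k (t - s) * (c' x * h' s x))"
    proof (rule Lintegrable_bound[where f = "%z. B * (case z of (s, x) => c' x * h' s x)"])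
      show "integrable (\<mu> \<Otimes>\<^sub>M M) (%z. B * (case z of (s, x) => c' x * h' s x))" using ch by simp
      show "(%(s, x). ?k (t - s) * (c' x * h' s x)) \<in> borel_measurable (\<mu> \<Otimes>\<^sub>M M)"
        using measurable_compose[OF measurable_fst km] chm unfolding split_beta' by (rule borel_measurable_times)
      show "AE z in \<mu> \<Otimes>\<^sub>M M. norm (case z of (s, x) => ?k (t - s) * (c' x * h' s x)) <= norm (B * (case z of (s, x) => c' x * h' s x))"
      proof (rule AE_I2)
        fix z assume "z \<in> space (\<mu> \<Otimes>\<^sub>M M)"
        then have "\<bar>?k (t - fst z)\<bar> <= B" using B(2)[of t "fst z"] by (auto simp: space_pair_measure)
        from mult_right_mono[OF this abs_ge_zero[of "c' (snd z) * h' (fst z) (snd z)"]]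
        show "norm (case z of (s, x) => ?k (t - s) * (c' x * h' s x)) <= norm (B * (case z of (s, x) => c' x * h' s x))"
          using B(1) by (simp add: split_beta' abs_mult)
      qed
    qed
  qed
  also have "... = (LINT s|\<mu>. ?k (t - s) * (LINT x|M. c' x * h' s x))" by simp
  finally show ?thesis .
qed

end

context commutator_setting
begin

definition "interior_time eps t = (indicator {eps<..<T - eps} t :: real)"

text \<open>At \<open>z = (t, s)\<close> these are \<open>k'(t - s) \<integral> \<phi>(t) g(s) f(s) dx\<close> and \<open>k'(t - s) \<integral> \<phi>(t) g(s) f(t) dx\<close>, cut off to interior times
  \<open>t\<close>: the integrands of \<open>\<integral>\<integral> \<phi> \<partial>\<^sub>t(fg)\<^sub>\<epsilon>\<close> and of \<open>\<integral>\<integral> \<phi> f \<partial>\<^sub>t g\<^sub>\<epsilon>\<close>.\<close>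

definition "E1 eps \<phi>' g' z = interior_time eps (fst z) * (tk' eps (fst z - snd z) * tri (\<phi>' (fst z)) (g' (snd z)) (f' (snd z)))"
definition "E2 eps \<phi>' g' z = interior_time eps (fst z) * (tk' eps (fst z - snd z) * tri (\<phi>' (fst z)) (g' (snd z)) (f' (fst z)))"

lemma interior_time_bounds: "0 <= interior_time eps t" "interior_time eps t <= 1"
  by (auto simp: interior_time_def indicator_def)

lemma interior_time_measurable [measurable]: "interior_time eps \<in> borel_measurable \<mu>"
  unfolding interior_time_def[abs_def] by (intro measurable_restrict_space1 measurable_completion) auto

lemma f'_good: "AE t in \<mu>. f' t \<in> Lp M q1 \<and> Lp_norm M q1 (f' t) <= Af t"
  and f'_measurable: "(%(t, x). f' t x) \<in> borel_measurable (\<mu> \<Otimes>\<^sub>M M)"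
  using f_datum by (auto simp: datum_def)

lemma tri_measurable:
  assumes "(%(t, x). u t x) \<in> borel_measurable (\<mu> \<Otimes>\<^sub>M M)" "(%(t, x). v t x) \<in> borel_measurable (\<mu> \<Otimes>\<^sub>M M)"
    and p: "p \<in> measurable (\<mu> \<Otimes>\<^sub>M \<mu>) \<mu>" "p' \<in> measurable (\<mu> \<Otimes>\<^sub>M \<mu>) \<mu>" "p'' \<in> measurable (\<mu> \<Otimes>\<^sub>M \<mu>) \<mu>"
  shows "(%z. tri (u (p z)) (v (p' z)) (f' (p'' z))) \<in> borel_measurable (\<mu> \<Otimes>\<^sub>M \<mu>)"
proof -
  interpret x: sigma_finite_measure M by (rule sfM)
  have c: "(%y. w (P (fst y)) (snd y)) \<in> borel_measurable ((\<mu> \<Otimes>\<^sub>M \<mu>) \<Otimes>\<^sub>M M)"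
    if "(%(t, x). w t x) \<in> borel_measurable (\<mu> \<Otimes>\<^sub>M M)" "P \<in> measurable (\<mu> \<Otimes>\<^sub>M \<mu>) \<mu>" for w :: "real => real^'n => real" and P
  proof -
    have "(%y. (P (fst y), snd y)) \<in> measurable ((\<mu> \<Otimes>\<^sub>M \<mu>) \<Otimes>\<^sub>M M) (\<mu> \<Otimes>\<^sub>M M)"
      by (intro measurable_Pair measurable_compose[OF measurable_fst that(2)] measurable_snd)
    from measurable_compose[OF this that(1)] show ?thesis by simp
  qed
  have "(%(z, x). u (p z) x * v (p' z) x * f' (p'' z) x) \<in> borel_measurable ((\<mu> \<Otimes>\<^sub>M \<mu>) \<Otimes>\<^sub>M M)"
    unfolding split_beta' by (intro borel_measurable_times c assms f'_measurable)
  from x.borel_measurable_lebesgue_integral[OF this] show ?thesis by (simp add: tri_def)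
qed

lemma kernel_difference_measurable:
  assumes "continuous_on UNIV (k :: real => real)"
  shows "(%z. k (fst z - snd z)) \<in> borel_measurable (\<mu> \<Otimes>\<^sub>M \<mu>)"
  using measurable_kernel_pair[OF assms, of "{0<..<T}"] by (simp add: split_beta')

lemma E_measurable:
  assumes "0 < eps" "(%(t, x). \<phi>' t x) \<in> borel_measurable (\<mu> \<Otimes>\<^sub>M M)" "(%(t, x). g' t x) \<in> borel_measurable (\<mu> \<Otimes>\<^sub>M M)"
  shows "E1 eps \<phi>' g' \<in> borel_measurable (\<mu> \<Otimes>\<^sub>M \<mu>)" "E2 eps \<phi>' g' \<in> borel_measurable (\<mu> \<Otimes>\<^sub>M \<mu>)"
proof -
  note i = measurable_compose[OF measurable_fst interior_time_measurable]
  note k = kernel_difference_measurable[OF time_kernel_props(2)[OF \<eta> assms(1)]]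
  note tr = tri_measurable[OF assms(2,3) measurable_fst measurable_snd]
  show "E1 eps \<phi>' g' \<in> borel_measurable (\<mu> \<Otimes>\<^sub>M \<mu>)"
    unfolding E1_def[abs_def] by (rule borel_measurable_times[OF i borel_measurable_times[OF k tr[OF measurable_snd]]])
  show "E2 eps \<phi>' g' \<in> borel_measurable (\<mu> \<Otimes>\<^sub>M \<mu>)"
    unfolding E2_def[abs_def] by (rule borel_measurable_times[OF i borel_measurable_times[OF k tr[OF measurable_fst]]])
qed

lemma time_products_integrable:
  assumes A: "A \<in> Lp \<mu> (ennreal pb)" and B: "B \<in> Lp \<mu> (ennreal p2)" and H: "H \<in> Lp \<mu> p1"
  shows "integrable \<mu> A" "integrable \<mu> B" "integrable \<mu> (%s. B s * H s)" "integrable \<mu> (%t. A t * H t)"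
proof -
  note one = const_Lp[OF finite_measure_time]
  have L1: "integrable \<mu> u" if "1 <= p" "u \<in> Lp \<mu> (ennreal p)" for p and u :: "real => real"
    using Lp_subset_finite_measure[OF finite_measure_time _ that(1) that(2)] by (simp add: Lp_1)
  show "integrable \<mu> A" "integrable \<mu> B" using L1 A B exponents by blast+
  show "integrable \<mu> (%s. B s * H s)" using time_hoelder(1)[OF one[OF exponents(1)] B H] by simp
  show "integrable \<mu> (%t. A t * H t)" using time_hoelder(1)[OF A one[OF exponents(3)] H] by simp
qed

text \<open>A majorant up to a constant that blows up as \<open>\<epsilon> \<rightarrow> 0\<close>: it only justifies Fubini's theorem for fixed \<open>\<epsilon>\<close>.\<close>

definition "dominating A B z = A (fst z) * (B (snd z) * Af (snd z)) + (A (fst z) * Af (fst z)) * (B (snd z) :: real)"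

lemma dominating_integrable:
  assumes A: "A \<in> Lp \<mu> (ennreal pb)" and B: "B \<in> Lp \<mu> (ennreal p2)"
  shows "integrable (\<mu> \<Otimes>\<^sub>M \<mu>) (dominating A B)"
  using integrable_pair_mult[OF sfT sfT time_products_integrable(1,3)[OF A B Af_Lp]]
    integrable_pair_mult[OF sfT sfT time_products_integrable(4,2)[OF A B Af_Lp]]
  unfolding dominating_def[abs_def] split_beta' by (rule Lintegrable_add)

lemma E_bound:
  assumes eps: "0 < eps" and d: "datum (ennreal qb) A \<phi> \<phi>'" "datum (ennreal q2) B g g'"
  obtains C where "AE z in \<mu> \<Otimes>\<^sub>M \<mu>. \<bar>E1 eps \<phi>' g' z\<bar> <= C * dominating A B z \<and> \<bar>E2 eps \<phi>' g' z\<bar> <= C * dominating A B z"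
proof -
  obtain C where C: "0 <= C" "\<And>x y. x \<in> {0<..<T} ==> y \<in> {0<..<T} ==> \<bar>tk' eps (x - y)\<bar> <= C"
    using kernel_bounded[OF time_kernel_props(2)[OF \<eta> eps] time_measurable_set(2) time_measurable_set(2)] by blast
  show ?thesis
  proof (rule that[of C])
    have "AE t in \<mu>. t \<in> {0<..<T} \<and> \<phi>' t \<in> L qb \<and> nrm qb (\<phi>' t) <= A t \<and> f' t \<in> Lp M q1 \<and> Lp_norm M q1 (f' t) <= Af t"
      using d(1) f'_good AE_time unfolding datum_def by auto
    moreover have "AE s in \<mu>. s \<in> {0<..<T} \<and> g' s \<in> L q2 \<and> nrm q2 (g' s) <= B s \<and> f' s \<in> Lp M q1 \<and> Lp_norm M q1 (f' s) <= Af s"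
      using d(2) f'_good AE_time unfolding datum_def by auto
    ultimately have "AE z in \<mu> \<Otimes>\<^sub>M \<mu>.
        (fst z \<in> {0<..<T} \<and> \<phi>' (fst z) \<in> L qb \<and> nrm qb (\<phi>' (fst z)) <= A (fst z) \<and> f' (fst z) \<in> Lp M q1 \<and> Lp_norm M q1 (f' (fst z)) <= Af (fst z)) \<and>
        (snd z \<in> {0<..<T} \<and> g' (snd z) \<in> L q2 \<and> nrm q2 (g' (snd z)) <= B (snd z) \<and> f' (snd z) \<in> Lp M q1 \<and> Lp_norm M q1 (f' (snd z)) <= Af (snd z))"
      by (rule AE_pair_both[OF sfT sfT])
    then show "AE z in \<mu> \<Otimes>\<^sub>M \<mu>. \<bar>E1 eps \<phi>' g' z\<bar> <= C * dominating A B z \<and> \<bar>E2 eps \<phi>' g' z\<bar> <= C * dominating A B z"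
    proof eventually_elim
      case (elim z)
      let ?t = "fst z" and ?s = "snd z"
      have p0: "0 < qb" "0 < q2" using exponents by auto
      note nn = Lp_norm_nonneg[OF p0(1), of M "\<phi>' ?t"] Lp_norm_nonneg[OF p0(2), of M "g' ?s"]
        Lp_norm_nonneg_conj[OF cx(1), of M "f' ?s"] Lp_norm_nonneg_conj[OF cx(1), of M "f' ?t"]
      have kb: "\<bar>interior_time eps ?t * (tk' eps (?t - ?s) * y)\<bar> <= C * \<bar>y\<bar>" for y
      proof -
        have "\<bar>interior_time eps ?t * (tk' eps (?t - ?s) * y)\<bar> <= \<bar>tk' eps (?t - ?s) * y\<bar>"
          using interior_time_bounds[of eps ?t] by (simp add: abs_mult mult_left_le_one_le)
        also have "... <= C * \<bar>y\<bar>" using C(2)[of ?t ?s] elim by (simp add: abs_mult mult_right_mono)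
        finally show ?thesis .
      qed
      have "\<bar>tri (\<phi>' ?t) (g' ?s) (f' ?s)\<bar> <= A ?t * B ?s * Af ?s" "\<bar>tri (\<phi>' ?t) (g' ?s) (f' ?t)\<bar> <= A ?t * B ?s * Af ?t"
      proof -
        have "nrm qb (\<phi>' ?t) * nrm q2 (g' ?s) * Lp_norm M q1 (f' ?s) <= A ?t * B ?s * Af ?s"
          "nrm qb (\<phi>' ?t) * nrm q2 (g' ?s) * Lp_norm M q1 (f' ?t) <= A ?t * B ?s * Af ?t"
          using elim nn by (auto intro!: mult_mono mult_nonneg_nonneg)
        then show "\<bar>tri (\<phi>' ?t) (g' ?s) (f' ?s)\<bar> <= A ?t * B ?s * Af ?s" "\<bar>tri (\<phi>' ?t) (g' ?s) (f' ?t)\<bar> <= A ?t * B ?s * Af ?t"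
          using tri_bound[of "\<phi>' ?t" "g' ?s" "f' ?s"] tri_bound[of "\<phi>' ?t" "g' ?s" "f' ?t"] elim by auto
      qed
      moreover have "0 <= A ?t * B ?s * Af ?s" "0 <= A ?t * B ?s * Af ?t"
      proof -
        have "0 <= A ?t" "0 <= B ?s" "0 <= Af ?s" "0 <= Af ?t" using elim nn by auto
        then show "0 <= A ?t * B ?s * Af ?s" "0 <= A ?t * B ?s * Af ?t" by auto
      qed
      ultimately have "\<bar>tri (\<phi>' ?t) (g' ?s) (f' ?s)\<bar> <= dominating A B z" "\<bar>tri (\<phi>' ?t) (g' ?s) (f' ?t)\<bar> <= dominating A B z"
        unfolding dominating_def by (auto simp: mult_ac)
      from mult_left_mono[OF this(1) C(1)] mult_left_mono[OF this(2) C(1)]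
      show ?case unfolding E1_def E2_def using kb by (meson order.trans)
    qed
  qed
qed

lemma E_integrable:
  assumes eps: "0 < eps" and d: "datum (ennreal qb) A \<phi> \<phi>'" "datum (ennreal q2) B g g'"
    and A: "A \<in> Lp \<mu> (ennreal pb)" and B: "B \<in> Lp \<mu> (ennreal p2)"
  shows "integrable (\<mu> \<Otimes>\<^sub>M \<mu>) (E1 eps \<phi>' g')" "integrable (\<mu> \<Otimes>\<^sub>M \<mu>) (E2 eps \<phi>' g')"
proof -
  obtain C where C: "AE z in \<mu> \<Otimes>\<^sub>M \<mu>. \<bar>E1 eps \<phi>' g' z\<bar> <= C * dominating A B z \<and> \<bar>E2 eps \<phi>' g' z\<bar> <= C * dominating A B z"
    by (rule E_bound[OF eps d])
  have i: "integrable (\<mu> \<Otimes>\<^sub>M \<mu>) (%z. C * dominating A B z)" using dominating_integrable[OF A B] by simp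
  have m: "E1 eps \<phi>' g' \<in> borel_measurable (\<mu> \<Otimes>\<^sub>M \<mu>)" "E2 eps \<phi>' g' \<in> borel_measurable (\<mu> \<Otimes>\<^sub>M \<mu>)"
    using E_measurable[OF eps] d by (auto simp: datum_def)
  show "integrable (\<mu> \<Otimes>\<^sub>M \<mu>) (E1 eps \<phi>' g')"
    by (rule Lintegrable_bound[OF i m(1)]) (use C in eventually_elim, auto)
  show "integrable (\<mu> \<Otimes>\<^sub>M \<mu>) (E2 eps \<phi>' g')"
    by (rule Lintegrable_bound[OF i m(2)]) (use C in eventually_elim, auto)
qed

text \<open>For almost every \<open>t\<close> the derivative of the mollification is computed pointwise in \<open>x\<close>; the double integrals over pairs of times
  then only involve the measurable representatives.\<close>

lemma mollified_terms_eq: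
  assumes eps: "0 < eps" and d: "datum (ennreal qb) A \<phi> \<phi>'" "datum (ennreal q2) B g g'"
    and A: "A \<in> Lp \<mu> (ennreal pb)" and B: "B \<in> Lp \<mu> (ennreal p2)"
  shows "integral_dt_mollified_fg \<eta> T D eps \<phi> f g = (LINT z|(\<mu> \<Otimes>\<^sub>M \<mu>). E1 eps \<phi>' g' z)"
    and "(LINT t|lebesgue_on {eps<..<T - eps}. LINT x|M. \<phi> t x * f t x * deriv (%\<tau>. moll T eps g \<tau> x) t) =
       (LINT z|(\<mu> \<Otimes>\<^sub>M \<mu>). E2 eps \<phi>' g' z)"
proof -
  interpret t: sigma_finite_measure \<mu> by (rule sfT)
  interpret tt: pair_sigma_finite \<mu> \<mu> ..
  note tp = time_products_integrable[OF A B Af_Lp]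
  note EI = E_integrable[OF eps d A B]
  have dm: "(%(t, x). \<phi>' t x) \<in> borel_measurable (\<mu> \<Otimes>\<^sub>M M)" "(%(t, x). g' t x) \<in> borel_measurable (\<mu> \<Otimes>\<^sub>M M)"
    using d by (auto simp: datum_def)
  have G: "AE s in \<mu>. g' s \<in> L q2 \<and> nrm q2 (g' s) <= B s" using d(2) by (auto simp: datum_def)
  have P: "AE t in \<mu>. \<phi>' t \<in> L qb \<and> nrm qb (\<phi>' t) <= A t" using d(1) by (auto simp: datum_def)
  have eqg: "AE x in M. AE s in \<mu>. g s x = g' s x" using d(2) by (auto simp: datum_def)
  have eqf: "AE x in M. AE s in \<mu>. f s x = f' s x" "AE t in \<mu>. AE x in M. f t x = f' t x" using f_datum by (auto simp: datum_def)
  have eqp: "AE t in \<mu>. AE x in M. \<phi> t x = \<phi>' t x" using d(1) by (auto simp: datum_def)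
  have p0: "0 < qb" "0 < q2" using exponents by auto
  have oneP: "(%x. 1) \<in> L qb" by (rule const_Lp[OF finite_measure_region[OF D] exponents(2)])
  define c1 where "c1 = nrm qb (%x. 1)"
  have c1: "0 <= c1" unfolding c1_def by (rule Lp_norm_nonneg[OF p0(1)])
  have nn: "0 <= nrm q2 u" "0 <= nrm qb u" "0 <= Lp_norm M q1 u" for u
    using Lp_norm_nonneg[OF p0(1)] Lp_norm_nonneg[OF p0(2)] Lp_norm_nonneg_conj[OF cx(1)] by auto
  \<comment> \<open>Both summands are instances of the same computation, with different factors kept outside the mollification.\<close>
  have ihfg: "integrable (\<mu> \<Otimes>\<^sub>M M) (%(s, x). a x * (f' s x * g' s x))"
    if a: "a \<in> L qb" for a
  proof (rule integrable_pairI[OF sfT sfM])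
    have "(%z. a (snd z)) \<in> borel_measurable (\<mu> \<Otimes>\<^sub>M M)" by (rule measurable_compose[OF measurable_snd Lp_measurable[OF a]])
    then show "(%(s, x). a x * (f' s x * g' s x)) \<in> borel_measurable (\<mu> \<Otimes>\<^sub>M M)"
      using f'_measurable dm(2) unfolding split_beta' by (intro borel_measurable_times)
    show "AE s in \<mu>. integrable M (%x. a x * (f' s x * g' s x)) \<and> (LINT x|M. \<bar>a x * (f' s x * g' s x)\<bar>) <= nrm qb a * (B s * Af s)"
      using G f'_good
    proof eventually_elim
      case (elim s)
      have e: "a x * (f' s x * g' s x) = a x * g' s x * f' s x" for x by simp
      have "nrm qb a * nrm q2 (g' s) * Lp_norm M q1 (f' s) <= nrm qb a * B s * Af s"
        using elim nn[of "g' s"] nn(2)[of a] nn(3)[of "f' s"] by (intro mult_mono mult_nonneg_nonneg) auto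
      then show ?case unfolding e using tri_hoelder[OF a, of "g' s" "f' s"] elim by (auto simp: mult.assoc)
    qed
    show "integrable \<mu> (%s. nrm qb a * (B s * Af s))" using tp(3) by simp
  qed
  have ihg: "integrable (\<mu> \<Otimes>\<^sub>M M) (%(s, x). (a x * b x) * g' s x)"
    if a: "a \<in> L qb" and b: "b \<in> Lp M q1" for a b
  proof (rule integrable_pairI[OF sfT sfM])
    have "(%z. a (snd z) * b (snd z)) \<in> borel_measurable (\<mu> \<Otimes>\<^sub>M M)"
      by (intro borel_measurable_times measurable_compose[OF measurable_snd Lp_measurable[OF a]] measurable_compose[OF measurable_snd Lp_measurable[OF b]])
    then show "(%(s, x). (a x * b x) * g' s x) \<in> borel_measurable (\<mu> \<Otimes>\<^sub>M M)"
      using dm(2) unfolding split_beta' by (rule borel_measurable_times)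
    show "AE s in \<mu>. integrable M (%x. (a x * b x) * g' s x) \<and> (LINT x|M. \<bar>(a x * b x) * g' s x\<bar>) <= nrm qb a * Lp_norm M q1 b * B s"
      using G
    proof eventually_elim
      case (elim s)
      have e: "(a x * b x) * g' s x = a x * g' s x * b x" for x by simp
      have "nrm qb a * nrm q2 (g' s) * Lp_norm M q1 b <= nrm qb a * B s * Lp_norm M q1 b"
        using elim nn[of "g' s"] nn(2)[of a] nn(3)[of b] by (intro mult_mono mult_nonneg_nonneg) auto
      then show ?case unfolding e using tri_hoelder[OF a _ b, of "g' s"] elim by (auto simp: mult_ac)
    qed
    show "integrable \<mu> (%s. nrm qb a * Lp_norm M q1 b * B s)" using tp(2) by simp
  qed
  have ig: "integrable (\<mu> \<Otimes>\<^sub>M M) (%(s, x). g' s x)"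
  proof -
    obtain C where C: "0 <= C" "\<And>u. u \<in> L q2 ==> integrable M u \<and> (LINT x|M. \<bar>u x\<bar>) <= C * nrm q2 u"
      using Lp_L1_bound[OF finite_measure_region[OF D] exponents(4)] by blast
    show ?thesis
    proof (rule integrable_pairI[OF sfT sfM dm(2)])
      show "AE s in \<mu>. integrable M (g' s) \<and> (LINT x|M. \<bar>g' s x\<bar>) <= C * B s"
        using G
      proof eventually_elim
        case (elim s)
        then have "C * nrm q2 (g' s) <= C * B s" using C(1) by (simp add: mult_left_mono)
        then show ?case using C(2)[of "g' s"] elim by auto
      qed
      show "integrable \<mu> (%s. C * B s)" using tp(2) by simp
    qed
  qed
  have ifg: "integrable (\<mu> \<Otimes>\<^sub>M M) (%(s, x). f' s x * g' s x)" using ihfg[OF oneP] by simp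
  have conv: "(LINT t|lebesgue_on {eps<..<T - eps}. h t) = (LINT z|(\<mu> \<Otimes>\<^sub>M \<mu>). E z)"
    if "AE t in \<mu>. interior_time eps t * h t = (LINT s|\<mu>. E (t, s))" "integrable (\<mu> \<Otimes>\<^sub>M \<mu>) E" for h :: "real => real" and E :: "real \<times> real => real"
  proof -
    have Em: "(%(t, s). E (t, s)) \<in> borel_measurable (\<mu> \<Otimes>\<^sub>M \<mu>)" using that(2) by simp
    have "(LINT t|lebesgue_on {eps<..<T - eps}. h t) = (LINT t|\<mu>. interior_time eps t * h t)"
      unfolding interior_time_def by (rule integral_restrict_time[OF eps])
    also have "... = (LINT t|\<mu>. LINT s|\<mu>. E (t, s))"
      by (rule integral_cong_AE_complete[OF time_measurable_set(1) t.borel_measurable_lebesgue_integral[OF Em] that(1)])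
    also have "... = (LINT z|(\<mu> \<Otimes>\<^sub>M \<mu>). E z)" by (rule tt.integral_fst'[OF that(2)])
    finally show ?thesis .
  qed
  show "integral_dt_mollified_fg \<eta> T D eps \<phi> f g = (LINT z|(\<mu> \<Otimes>\<^sub>M \<mu>). E1 eps \<phi>' g' z)"
    unfolding integral_dt_mollified_fg_def
  proof (rule conv[OF _ EI(1)])
    have eqfg: "AE x in M. AE s in \<mu>. f s x * g s x = f' s x * g' s x"
      using eqg eqf(1)
    proof eventually_elim
      case (elim x)
      from elim show ?case by eventually_elim simp
    qed
    show "AE t in \<mu>. interior_time eps t * (LINT x|M. \<phi> t x * deriv (%\<tau>. moll T eps (%s y. f s y * g s y) \<tau> x) t) =
       (LINT s|\<mu>. E1 eps \<phi>' g' (t, s))"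
      using P eqp
    proof eventually_elim
      case (elim t)
      have "(LINT x|M. \<phi> t x * deriv (%\<tau>. moll T eps (%s y. f s y * g s y) \<tau> x) t) =
          (LINT s|\<mu>. tk' eps (t - s) * (LINT x|M. \<phi>' t x * (f' s x * g' s x)))"
        using elim by (intro integral_deriv_mollify[OF eps eqfg ifg _ _ ihfg]) auto
      then show ?case by (simp add: E1_def tri_def mult_ac)
    qed
  qed
  show "(LINT t|lebesgue_on {eps<..<T - eps}. LINT x|M. \<phi> t x * f t x * deriv (%\<tau>. moll T eps g \<tau> x) t) =
       (LINT z|(\<mu> \<Otimes>\<^sub>M \<mu>). E2 eps \<phi>' g' z)"
  proof (rule conv[OF _ EI(2)])
    show "AE t in \<mu>. interior_time eps t * (LINT x|M. \<phi> t x * f t x * deriv (%\<tau>. moll T eps g \<tau> x) t) =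
       (LINT s|\<mu>. E2 eps \<phi>' g' (t, s))"
      using P eqp eqf(2) f'_good
    proof eventually_elim
      case (elim t)
      have c: "AE x in M. \<phi> t x * f t x = \<phi>' t x * f' t x" using elim(2,3) by eventually_elim simp
      have "(LINT x|M. (\<phi> t x * f t x) * deriv (%\<tau>. moll T eps g \<tau> x) t) =
          (LINT s|\<mu>. tk' eps (t - s) * (LINT x|M. (\<phi>' t x * f' t x) * g' s x))"
        using elim by (intro integral_deriv_mollify[OF eps eqg ig _ c ihg]) (auto intro!: borel_measurable_times)
      then show ?case by (simp add: E2_def tri_def mult_ac)
    qed
  qed
qed

end

section \<open>Increments of \<open>f\<close>\<close>

text \<open>Almost all values of a strongly measurable function are limits of the countably many values of the approximating simple
  functions.\<close>

lemma bochner_separable: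
  fixes u :: "real => 'a => real"
  assumes u: "u \<in> bochner_Lp T p X nrm"
  obtains S where "countable S" "S \<subseteq> X"
    "AE t in time_measure T. u t \<in> X \<and> (\<exists>a. (\<forall>k. a k \<in> S) \<and> (%k. nrm (%x. u t x - a k x)) \<longlonglongrightarrow> 0)"
proof -
  have u0: "AE t in time_measure T. u t \<in> X" using u by (auto simp: bochner_Lp_def strongly_measurable_def)
  obtain s where s: "\<And>k. simple_function (time_measure T) (s k)" "\<And>k t. t \<in> {0<..<T} ==> s k t \<in> X"
    "AE t in time_measure T. (%k. nrm (%x. u t x - s k t x)) \<longlonglongrightarrow> 0"
    using u unfolding bochner_Lp_def strongly_measurable_def fun_diff_def by blast
  show ?thesis
  proof (rule that[of "\<Union>k. s k ` {0<..<T}"])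
    have "finite (s k ` {0<..<T})" for k using s(1)[of k] by (simp add: simple_function_def)
    then show "countable (\<Union>k. s k ` {0<..<T})" by (intro countable_UN[OF _ countable_finite]) auto
    show "(\<Union>k. s k ` {0<..<T}) \<subseteq> X" using s(2) by auto
    have "AE t in time_measure T. t \<in> {0<..<T}" by (rule AE_I2) simp
    then show "AE t in time_measure T. u t \<in> X \<and>
        (\<exists>a. (\<forall>k. a k \<in> (\<Union>k. s k ` {0<..<T})) \<and> (%k. nrm (%x. u t x - a k x)) \<longlonglongrightarrow> 0)"
      using u0 s(3)
    proof eventually_elim
      case (elim t)
      have "\<forall>k. s k t \<in> (\<Union>k. s k ` {0<..<T})" using elim(1) by blast
      then show ?case using elim(2,3) by (intro conjI exI[of _ "%k. s k t"])
    qed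
  qed
qed

context commutator_setting
begin

lemma W_minus1_diff:
  assumes G: "G \<in> W_minus1 D q1" and w: "w \<in> XW" "v \<in> XW"
  shows "G w - G v = G (%x. w x - v x)" "\<bar>G w - G v\<bar> <= W_minus1_norm D q1 G * nW (%x. w x - v x)"
proof -
  have "G (%x. 1 * w x + (- 1) * v x) = 1 * G w + (- 1) * G v"
    using G w unfolding W_minus1_def cx(3) by blast
  then show e: "G w - G v = G (%x. w x - v x)" by simp
  have "(%x. w x - v x) \<in> XW" using W1_0_lincomb[OF r1 w, of 1 "- 1"] by simp
  from W_minus1_bound[OF G this] show "\<bar>G w - G v\<bar> <= W_minus1_norm D q1 G * nW (%x. w x - v x)" using e by simp
qed

lemma XW_diff: "w \<in> XW ==> v \<in> XW ==> (%x. w x - v x) \<in> XW"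
  using W1_0_lincomb[OF r1, of w v 1 "- 1"] by simp

lemma XP_diff: "w \<in> XP ==> v \<in> XP ==> (%x. w x - v x) \<in> XP"
  using W1_0_lincomb[OF exponents(2), of w v 1 "- 1"] by simp

lemmas XG_diff = W1_diff[OF exponents(4)]

lemma nP_nonneg: "0 <= nP a" and nG_nonneg: "0 <= nG b" and nW_nonneg: "0 <= nW w"
  using W1_norm_nonneg exponents r1 by auto

text \<open>Bilinearity of the product; the second factor of the last term may be the approximation, whose norm is controlled.\<close>

lemma product_diff:
  assumes a: "a \<in> XP" "a' \<in> XP" and b: "b \<in> XG" "b' \<in> XG"
  shows "nW (%x. a x * b x - a' x * b' x) <= nP a * nG (%x. b x - b' x) + nP (%x. a x - a' x) * nG b'"
proof -
  note p1 = product[OF a(1) XG_diff(1)[OF b]] and p2 = product[OF XP_diff[OF a] b(2)]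
  have "nW (%x. 1 * (a x * (b x - b' x)) + 1 * ((a x - a' x) * b' x)) <=
      \<bar>1\<bar> * nW (%x. a x * (b x - b' x)) + \<bar>1\<bar> * nW (%x. (a x - a' x) * b' x)"
    by (rule W1_lincomb(2)[OF r1 W1_0_subset_W1[OF p1(1)] W1_0_subset_W1[OF p2(1)]])
  also have "(%x. 1 * (a x * (b x - b' x)) + 1 * ((a x - a' x) * b' x)) = (%x. a x * b x - a' x * b' x)"
    by (simp add: algebra_simps)
  finally show ?thesis using p1(2) p2(2) by simp
qed

lemma XW_Lp: "w \<in> XW ==> w \<in> L r"
  using W1_0_subset_W1 by (auto simp: W1_def)

lemma pairing_bound:
  assumes w: "w \<in> XW" and c: "c \<in> Lp M q1"
  shows "integrable M (%x. c x * w x)" "\<bar>LINT x|M. c x * w x\<bar> <= Lp_norm M q1 c * nW w"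
proof -
  note h = Lp_mult_conjugate[OF cx(1) XW_Lp[OF w] c]
  show "integrable M (%x. c x * w x)" using h(1) by (simp add: mult.commute)
  have "\<bar>LINT x|M. w x * c x\<bar> <= (LINT x|M. \<bar>w x * c x\<bar>)" by (rule integral_abs_bound)
  also have "... <= nrm r w * Lp_norm M q1 c" by (rule h(2))
  also have "... <= nW w * Lp_norm M q1 c"
    by (rule mult_right_mono[OF Lp_norm_le_W1_norm[OF r1] Lp_norm_nonneg_conj[OF cx(1)]])
  finally show "\<bar>LINT x|M. c x * w x\<bar> <= Lp_norm M q1 c * nW w" by (simp add: mult.commute)
qed

text \<open>For a fixed test function this is the scalar statement that a function with integrable weak derivative is absolutely
  continuous.\<close>

lemma weak_increment:
  assumes w: "w \<in> XW"
  shows "AE t in \<mu>. AE s in \<mu>. (LINT x|M. f' s x * w x) - (LINT x|M. f' t x * w x) = (LINT r|\<mu>. oriented t s r * F r w)"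
proof -
  interpret x: sigma_finite_measure M by (rule sfM)
  let ?h = "%t. LINT x|M. f t x * w x" and ?h' = "%t. LINT x|M. f' t x * w x"
  have wm: "w \<in> borel_measurable M" by (rule Lp_measurable[OF XW_Lp[OF w]])
  have eq: "AE t in \<mu>. AE x in M. f t x = f' t x" using f_datum by (auto simp: datum_def)
  have m: "(%(t, x). f' t x * w x) \<in> borel_measurable (\<mu> \<Otimes>\<^sub>M M)"
    using f'_measurable measurable_compose[OF measurable_snd wm] unfolding split_beta' by (rule borel_measurable_times)
  have hm: "?h' \<in> borel_measurable \<mu>" by (rule x.borel_measurable_lebesgue_integral[OF m])
  have heq: "AE t in \<mu>. ?h' t = ?h t"
    using eq f'_good
  proof eventually_elim
    case (elim t)
    have "f' t \<in> borel_measurable M" using elim(2) Lp_measurable by blast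
    from borel_measurable_times[OF this wm] have "?h t = ?h' t"
      by (rule integral_cong_AE_complete[OF region_properties(1)[OF D]]) (use elim(1) in eventually_elim, simp)
    then show ?case by simp
  qed
  have "integrable \<mu> (%t. 1 * Af t)" by (rule Lp_mult_conjugate(1)[OF ct(1) const_Lp[OF finite_measure_time rt1] Af_Lp])
  then have iA: "integrable \<mu> (%t. Af t * nW w)" by simp
  have hi': "integrable \<mu> ?h'"
  proof (rule Lintegrable_bound[OF iA hm])
    show "AE t in \<mu>. norm (?h' t) <= norm (Af t * nW w)"
      using f'_good
    proof eventually_elim
      case (elim t)
      have "\<bar>?h' t\<bar> <= Lp_norm M q1 (f' t) * nW w" using pairing_bound(2)[OF w] elim by blast
      also have "... <= Af t * nW w" using elim nW_nonneg by (intro mult_right_mono) auto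
      finally show ?case by simp
    qed
  qed
  have hi: "integrable \<mu> ?h"
    by (rule integrable_cong_AE_imp[OF hi' borel_measurable_lebesgue_on_AE[OF time_measurable_set(1) hm heq]])
      (use heq in eventually_elim, simp)
  have "AE t in \<mu>. AE s in \<mu>. ?h s - ?h t = (LINT r|\<mu>. oriented t s r * F r w)"
  proof (rule weak_derivative_increment[OF \<eta> hi F_properties(5)[OF w]])
    fix \<theta> assume "\<theta> \<in> Cc_infinity {0<..<T}"
    then show "(LINT t|\<mu>. deriv \<theta> t * ?h t) = - (LINT t|\<mu>. \<theta> t * F t w)"
      using weak w unfolding has_weak_time_derivative_def cx(3) by blast
  qed
  then show ?thesis
    using heq
  proof eventually_elim
    case (elim t)
    from elim(1) heq show ?case by eventually_elim (simp add: elim(2))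
  qed
qed

text \<open>The exceptional null sets of times depend on \<open>w\<close>; since \<open>\<phi>\<close> and \<open>g\<close> take almost all their values in the closure of a
  countable set, the identity survives for products that vary with both times.\<close>

lemma weak_increment_product:
  assumes \<phi>: "\<phi> \<in> bochner_Lp T pe XP nP" and g: "g \<in> bochner_Lp T pe' XG nG"
  shows "AE t in \<mu>. AE s in \<mu>. (LINT x|M. f' s x * (\<phi> t x * g s x)) - (LINT x|M. f' t x * (\<phi> t x * g s x)) =
     (LINT r|\<mu>. oriented t s r * F r (%x. \<phi> t x * g s x))"
proof -
  obtain S1 where S1: "countable S1" "S1 \<subseteq> XP"
    "AE t in \<mu>. \<phi> t \<in> XP \<and> (\<exists>a. (\<forall>k. a k \<in> S1) \<and> (%k. nP (%x. \<phi> t x - a k x)) \<longlonglongrightarrow> 0)"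
    by (rule bochner_separable[OF \<phi>])
  obtain S2 where S2: "countable S2" "S2 \<subseteq> XG"
    "AE t in \<mu>. g t \<in> XG \<and> (\<exists>a. (\<forall>k. a k \<in> S2) \<and> (%k. nG (%x. g t x - a k x)) \<longlonglongrightarrow> 0)"
    by (rule bochner_separable[OF g])
  define S where "S = (%(a, b) x. a x * b x :: real) ` (S1 \<times> S2)"
  have S: "countable S" "S \<subseteq> XW"
    using S1(1,2) S2(1,2) product(1) by (auto simp: S_def)
  let ?L = "%t s w. (LINT x|M. f' s x * w x) - (LINT x|M. f' t x * w x)" and ?R = "%t s w. LINT r|\<mu>. oriented t s r * F r w"
  have "AE t in \<mu>. \<forall>w\<in>S. AE s in \<mu>. ?L t s w = ?R t s w"
    using weak_increment S by (subst AE_ball_countable[OF S(1)]) auto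
  then have id: "AE t in \<mu>. AE s in \<mu>. \<forall>w\<in>S. ?L t s w = ?R t s w"
    by eventually_elim (simp add: AE_ball_countable[OF S(1)])
  show ?thesis
    using S1(3) id f'_good
  proof eventually_elim
    case (elim t)
    obtain a where a: "\<And>k. a k \<in> S1" "(%k. nP (%x. \<phi> t x - a k x)) \<longlonglongrightarrow> 0" using elim(1) by blast
    show ?case
      using S2(3) elim(2) f'_good
    proof eventually_elim
      case (elim s)
      obtain b where b: "\<And>k. b k \<in> S2" "(%k. nG (%x. g s x - b k x)) \<longlonglongrightarrow> 0" using elim(1) by blast
      define w where "w = (%x. \<phi> t x * g s x)"
      define v where "v = (%k x. a k x * b k x)"
      have pt: "\<phi> t \<in> XP" "f' t \<in> Lp M q1" using \<open>\<phi> t \<in> XP \<and> _\<close> \<open>f' t \<in> Lp M q1 \<and> _\<close> by auto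
      have gs: "g s \<in> XG" "f' s \<in> Lp M q1" using elim by auto
      have ab: "a k \<in> XP" "b k \<in> XG" for k using a(1) b(1) S1(2) S2(2) by auto
      have w: "w \<in> XW" unfolding w_def by (rule product(1)[OF pt(1) gs(1)])
      have v: "v k \<in> XW" "v k \<in> S" for k unfolding v_def S_def using product(1)[OF ab] a(1) b(1) by auto
      have nv: "(%k. nW (%x. w x - v k x)) \<longlonglongrightarrow> 0"
      proof -
        let ?e = "%k. nP (\<phi> t) * nG (%x. g s x - b k x) + nP (%x. \<phi> t x - a k x) * (nG (g s) + nG (%x. g s x - b k x))"
        have le: "norm (nW (%x. w x - v k x)) <= ?e k" for k
        proof -
          have "nG (b k) <= nG (g s) + nG (%x. g s x - b k x)"
            using XG_diff(2)[OF gs(1) XG_diff(1)[OF gs(1) ab(2)[of k]]] by simp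
          from mult_left_mono[OF this nP_nonneg[of "%x. \<phi> t x - a k x"]]
          show ?thesis using product_diff[OF pt(1) ab(1)[of k] gs(1) ab(2)[of k]] nW_nonneg[of "%x. w x - v k x"]
            unfolding w_def v_def by simp
        qed
        have "?e \<longlonglongrightarrow> nP (\<phi> t) * 0 + 0 * (nG (g s) + 0)" by (intro tendsto_intros a b)
        then have "?e \<longlonglongrightarrow> 0" by simp
        with le show ?thesis by (rule Lim_null_comparison[OF always_eventually[OF allI]])
      qed
      let ?c = "Lp_norm M q1 (f' s) + Lp_norm M q1 (f' t) + (LINT r|\<mu>. \<bar>N r\<bar>)"
      have le: "norm (?L t s w - ?R t s w) <= ?c * nW (%x. w x - v k x)" for k
      proof -
        let ?z = "%x. w x - v k x"
        have z: "?z \<in> XW" by (rule XW_diff[OF w v(1)])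
        have Lz: "?L t s w - ?L t s (v k) = ?L t s ?z"
        proof -
          have "(LINT x|M. c x * ?z x) = (LINT x|M. c x * w x) - (LINT x|M. c x * v k x)" if "c \<in> Lp M q1" for c
            using pairing_bound(1)[OF w that] pairing_bound(1)[OF v(1)[of k] that] by (simp add: right_diff_distrib)
          then show ?thesis using pt(2) gs(2) by simp
        qed
        have Rz: "?R t s w - ?R t s (v k) = (LINT r|\<mu>. oriented t s r * (F r w - F r (v k)))"
          using integrable_oriented[OF F_properties(5)[OF w]] integrable_oriented[OF F_properties(5)[OF v(1)[of k]]]
          by (simp add: right_diff_distrib)
        have iN: "integrable \<mu> (%r. \<bar>N r\<bar> * nW ?z)" using F_properties(3) by simp
        have "\<bar>LINT r|\<mu>. oriented t s r * (F r w - F r (v k))\<bar> <= (LINT r|\<mu>. \<bar>N r\<bar> * nW ?z)"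
        proof -
          have "\<bar>LINT r|\<mu>. oriented t s r * (F r w - F r (v k))\<bar> <= (LINT r|\<mu>. \<bar>oriented t s r * (F r w - F r (v k))\<bar>)"
            by (rule integral_abs_bound)
          also have "... <= (LINT r|\<mu>. \<bar>N r\<bar> * nW ?z)"
          proof (rule integral_mono_AE[OF _ iN])
            show "integrable \<mu> (%r. \<bar>oriented t s r * (F r w - F r (v k))\<bar>)"
              by (intro integrable_abs integrable_oriented Lintegrable_diff F_properties(5) w v)
            show "AE r in \<mu>. \<bar>oriented t s r * (F r w - F r (v k))\<bar> <= \<bar>N r\<bar> * nW ?z"
              using F_properties(1)
            proof eventually_elim
              case (elim r)
              have "\<bar>F r w - F r (v k)\<bar> <= N r * nW ?z" unfolding N_def by (rule W_minus1_diff(2)[OF elim w v(1)])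
              also have "... <= \<bar>N r\<bar> * nW ?z" by (rule mult_right_mono[OF abs_ge_self nW_nonneg])
              finally have "\<bar>oriented t s r\<bar> * \<bar>F r w - F r (v k)\<bar> <= 1 * (\<bar>N r\<bar> * nW ?z)"
                by (intro mult_mono oriented_props) auto
              then show ?case by (simp add: abs_mult)
            qed
          qed
          finally show ?thesis .
        qed
        then have "\<bar>?R t s w - ?R t s (v k)\<bar> <= (LINT r|\<mu>. \<bar>N r\<bar>) * nW ?z" unfolding Rz by simp
        moreover have "\<bar>?L t s ?z\<bar> <= (Lp_norm M q1 (f' s) + Lp_norm M q1 (f' t)) * nW ?z"
          using pairing_bound(2)[OF z gs(2)] pairing_bound(2)[OF z pt(2)] by (simp add: distrib_right)
        moreover have "?L t s (v k) = ?R t s (v k)" using elim(2) v(2) by blast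
        ultimately show ?thesis using Lz by (simp add: distrib_right)
      qed
      have "(%k. ?c * nW (%x. w x - v k x)) \<longlonglongrightarrow> 0" by (rule tendsto_mult_right_zero[OF nv])
      from tendsto_lowerbound[OF this always_eventually[OF allI[OF le]]] have "norm (?L t s w - ?R t s w) <= 0" by simp
      then show ?case by (simp add: w_def)
    qed
  qed
qed

end

section \<open>Scalar commutators\<close>

lemma measurable_integral_oriented:
  fixes h :: "real => real"
  assumes h: "h \<in> borel_measurable (time_measure T)"
  shows "(%s. LINT r|time_measure T. oriented t s r * h r) \<in> borel_measurable (time_measure T)"
proof -
  let ?M = "time_measure T"
  interpret sigma_finite_measure ?M by (rule sigma_finite_time)
  have id: "(%s. s) \<in> borel_measurable ?M" by (intro measurable_restrict_space1 measurable_completion) simp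
  note [measurable] = measurable_compose[OF measurable_fst id] measurable_compose[OF measurable_snd id]
  have "(%z. oriented t (fst z) (snd z)) = (%z. (if t < snd z \<and> snd z <= fst z then 1 else 0) - (if fst z < snd z \<and> snd z <= t then 1 else 0))"
    by (auto simp: oriented_def indicator_def fun_eq_iff)
  also have "... \<in> borel_measurable (?M \<Otimes>\<^sub>M ?M)" by measurable
  finally have "(%z. oriented t (fst z) (snd z) * h (snd z)) \<in> borel_measurable (?M \<Otimes>\<^sub>M ?M)"
    by (rule borel_measurable_times[OF _ measurable_compose[OF measurable_snd h]])
  then have "(%(s, r). oriented t s r * h r) \<in> borel_measurable (?M \<Otimes>\<^sub>M ?M)" by (simp add: split_beta')
  from borel_measurable_lebesgue_integral[OF this] show ?thesis .
qed

lemma integrable_tent: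
  assumes "0 < eps" "integrable (time_measure T) h"
  shows "integrable (time_measure T) (%r. tent eps (t - r) * h r)"
  by (rule integrable_conv[OF tent_props(1)[OF assms(1)] time_measurable_set assms(2)])

text \<open>The factor \<open>1/\<epsilon>\<close> lost by differentiating the kernel is regained because the increment only involves times within
  \<open>\<epsilon>\<close> of \<open>t\<close>, where \<open>1/\<epsilon>\<close> is dominated by the tent.\<close>

lemma kernel_increment_bound:
  assumes \<eta>: "mollifier_kernel \<eta>" and eps: "0 < eps" and h: "integrable (time_measure T) h"
    and C: "0 <= C" "\<bar>time_kernel' \<eta> eps (t - s)\<bar> <= C / eps * tent eps (t - s)"
  shows "\<bar>time_kernel' \<eta> eps (t - s) * (LINT r|time_measure T. oriented t s r * h r)\<bar> <=
    8 * C * tent eps (t - s) * (LINT r|time_measure T. tent eps (t - r) * \<bar>h r\<bar>)"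
proof (cases "eps < \<bar>t - s\<bar>")
  case True
  have "0 <= (LINT r|time_measure T. tent eps (t - r) * \<bar>h r\<bar>)"
    by (rule Lintegral_nonneg) (simp add: tent_props(2)[OF eps])
  then show ?thesis using True time_kernel_props(5)[OF \<eta> eps] C(1) tent_props(2)[OF eps, of "t - s"] by simp
next
  case False
  let ?I = "LINT r|time_measure T. tent eps (t - r) * \<bar>h r\<bar>"
  have "\<bar>LINT r|time_measure T. oriented t s r * h r\<bar> <= (LINT r|time_measure T. \<bar>oriented t s r * h r\<bar>)" by (rule integral_abs_bound)
  also have "... <= (LINT r|time_measure T. (8 * eps) * (tent eps (t - r) * \<bar>h r\<bar>))"
  proof (rule integral_mono)
    show "integrable (time_measure T) (%r. \<bar>oriented t s r * h r\<bar>)" using integrable_oriented[OF h] by simp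
    show "integrable (time_measure T) (%r. (8 * eps) * (tent eps (t - r) * \<bar>h r\<bar>))"
      using integrable_tent[OF eps, of T "%r. \<bar>h r\<bar>"] h by simp
    fix r
    have "\<bar>oriented t s r\<bar> <= 8 * eps * tent eps (t - r)"
    proof (cases "\<bar>s - t\<bar> < \<bar>r - t\<bar>")
      case True
      then show ?thesis using oriented_props(2) tent_props(2)[OF eps, of "t - r"] eps by simp
    next
      case False
      then have "1 / eps <= 8 * tent eps (t - r)" using \<open>\<not> eps < \<bar>t - s\<bar>\<close> by (intro tent_props(5)[OF eps]) linarith
      then have "1 <= 8 * eps * tent eps (t - r)" using eps by (simp add: field_simps)
      then show ?thesis using oriented_props(1)[of t s r] by linarith
    qed
    from mult_right_mono[OF this abs_ge_zero[of "h r"]]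
    show "\<bar>oriented t s r * h r\<bar> <= (8 * eps) * (tent eps (t - r) * \<bar>h r\<bar>)" by (simp add: abs_mult mult.assoc)
  qed
  also have "... = 8 * eps * ?I" by simp
  finally have "\<bar>time_kernel' \<eta> eps (t - s)\<bar> * \<bar>LINT r|time_measure T. oriented t s r * h r\<bar> <= (C / eps * tent eps (t - s)) * (8 * eps * ?I)"
    using C tent_props(2)[OF eps] eps by (intro mult_mono) auto
  also have "... = 8 * C * tent eps (t - s) * ?I" using eps by simp
  finally show ?thesis by (simp add: abs_mult)
qed

text \<open>The commutator vanishes when \<open>H\<close> is constant, since \<open>(s - t) k'(t - s) - k(t - s)\<close> is the \<open>s\<close>-derivative of \<open>(t - s) k(t - s)\<close>, which is
  supported in \<open>[t - \<epsilon>, t + \<epsilon>]\<close>.\<close>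

lemma kernel_moment:
  assumes \<eta>: "mollifier_kernel \<eta>" and eps: "0 < eps" and t: "t \<in> {eps<..<T - eps}"
  shows "(LINT s|time_measure T. time_kernel' \<eta> eps (t - s) * (s - t) - time_kernel \<eta> eps (t - s)) = 0"
proof -
  let ?m = "%s. time_kernel' \<eta> eps (t - s) * (s - t) - time_kernel \<eta> eps (t - s)"
  let ?P = "%s. (t - s) * time_kernel \<eta> eps (t - s)"
  note kp = time_kernel_props[OF \<eta> eps]
  \<comment> \<open>Two admissible times on either side of the support of the integrand.\<close>
  define a where "a = (t - eps) / 2"
  define b where "b = (t + eps + T) / 2"
  have ab: "a \<in> {0<..<T}" "b \<in> {0<..<T}" "a < t - eps" "t + eps < b" "a < b" using t eps by (auto simp: a_def b_def)
  have "?m s = oriented a b s * ?m s" for s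
  proof (cases "a < s \<and> s <= b")
    case True
    then show ?thesis by (simp add: oriented_def)
  next
    case False
    then have "eps < \<bar>t - s\<bar>" using ab by linarith
    then show ?thesis using kp(4,5)[of "t - s"] by simp
  qed
  then have "(LINT s|time_measure T. ?m s) = (LINT s|time_measure T. oriented a b s * ?m s)"
    by (intro Lintegral_cong) simp_all
  also have "... = ?P b - ?P a"
  proof (rule integral_oriented_FTC[OF _ _ ab(1,2)])
    show "(?P has_real_derivative ?m s) (at s)" for s
    proof -
      have "((%s. time_kernel \<eta> eps (t - s)) has_real_derivative time_kernel' \<eta> eps (t - s) * (- 1)) (at s)"
        by (rule DERIV_chain2[OF kp(3)]) (auto intro!: derivative_eq_intros)
      then show ?thesis by (auto intro!: derivative_eq_intros simp: algebra_simps)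
    qed
    show "continuous_on UNIV ?m"
      by (intro continuous_intros continuous_on_compose2[OF kp(1)] continuous_on_compose2[OF kp(2)]) auto
  qed
  also have "... = 0" using kp(4)[of "t - a"] kp(4)[of "t - b"] ab by simp
  finally show ?thesis .
qed

text \<open>Subtracting \<open>H(t)\<close> from \<open>H\<close> splits the commutator into an increment of \<open>H - H(t)\<close>, which the previous estimate bounds by
  the oscillation of \<open>H\<close>, and \<open>H(t) \<integral> \<kappa>(s) m(s) ds\<close> with a kernel \<open>m\<close> of mean zero. By the latter \<open>\<kappa>(s)\<close> may be replaced by
  \<open>\<kappa>(s) - \<kappa>(t)\<close>, and \<open>(\<kappa>(s) - \<kappa>(t)) H(t)\<close> is controlled by the oscillations of \<open>H \<kappa>\<close> and of \<open>H\<close>.\<close>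

lemma scalar_commutator_bound:
  assumes \<eta>: "mollifier_kernel \<eta>" and eps: "0 < eps" and t: "t \<in> {eps<..<T - eps}"
    and C: "0 <= C" "\<And>z. \<bar>time_kernel \<eta> eps z\<bar> <= C * tent eps z" "\<And>z. \<bar>time_kernel' \<eta> eps z\<bar> <= C / eps * tent eps z"
    and H: "integrable (time_measure T) H" and \<kappa>: "\<kappa> \<in> borel_measurable (time_measure T)" "\<And>s. 0 <= \<kappa> s" "\<And>s. \<kappa> s <= 1"
  defines "X \<equiv> %s. \<kappa> s * (time_kernel' \<eta> eps (t - s) * (LINT r|time_measure T. oriented t s r * H r) - time_kernel \<eta> eps (t - s) * H t)"
  shows "integrable (time_measure T) X"
    and "\<bar>LINT s|time_measure T. X s\<bar> <= 10 * C * ((LINT r|time_measure T. tent eps (t - r) * \<bar>H r - H t\<bar>) +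
       (LINT r|time_measure T. tent eps (t - r) * \<bar>H r * \<kappa> r - H t * \<kappa> t\<bar>))"
proof -
  let ?M = "time_measure T" and ?k = "%s. time_kernel \<eta> eps (t - s)" and ?k' = "%s. time_kernel' \<eta> eps (t - s)"
  interpret finite_measure ?M by (rule finite_measure_time)
  note kp = time_kernel_props[OF \<eta> eps] and Sm = time_measurable_set[of T] and tp = tent_props[OF eps]
  have tT: "t \<in> {0<..<T}" using t eps by auto
  define h where "h r = H r - H t" for r
  define m where "m s = ?k' s * (s - t) - ?k s" for s
  let ?o = "LINT r|?M. tent eps (t - r) * \<bar>h r\<bar>" and ?o' = "LINT r|?M. tent eps (t - r) * \<bar>H r * \<kappa> r - H t * \<kappa> t\<bar>"
  let ?U = "%s. \<kappa> s * (?k' s * (LINT r|?M. oriented t s r * h r))" and ?V = "%s. \<kappa> s * (m s * H t)"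
  have h: "integrable ?M h" unfolding h_def using H by simp
  have o: "0 <= ?o" by (rule Lintegral_nonneg) (simp add: tp(2))
  have k'm: "?k' \<in> borel_measurable ?M" by (rule continuous_measurable_lebesgue_on[OF kp(2)])
  have it: "integrable ?M (%s. tent eps (t - s))" using integrable_tent[OF eps, of T "%_. 1"] by simp
  have mc: "continuous_on UNIV m" unfolding m_def
    by (intro continuous_intros continuous_on_compose2[OF kp(1)] continuous_on_compose2[OF kp(2)]) auto
  then have mm: "m \<in> borel_measurable ?M" using continuous_measurable_lebesgue_on[of "%z. m (- z)" 0]
    by (simp add: continuous_on_compose2[OF mc] continuous_on_minus)
  have mb: "\<bar>m s\<bar> <= 2 * C * tent eps (t - s)" for s
  proof -
    have "\<bar>?k' s * (s - t)\<bar> <= C * tent eps (t - s)"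
    proof (cases "eps < \<bar>t - s\<bar>")
      case True
      then show ?thesis using kp(5) C(1) tp(2) by simp
    next
      case False
      then have "\<bar>?k' s\<bar> * \<bar>s - t\<bar> <= (C / eps * tent eps (t - s)) * eps"
        using C(1,3) tp(2) eps by (intro mult_mono) auto
      then show ?thesis using eps by (simp add: abs_mult)
    qed
    then show ?thesis using C(2)[of "t - s"] unfolding m_def by linarith
  qed
  have im: "integrable ?M m"
    by (rule Lintegrable_bound[OF _ mm, of "%s. 2 * C * tent eps (t - s)"]) (use it in simp, rule AE_I2, use order.trans[OF mb abs_ge_self] in simp)
  have X: "X s = ?U s + ?V s" if s: "s \<in> {0<..<T}" for s
  proof -
    have o1: "(LINT r|?M. oriented t s r * 1) = s - t"
      by (rule integral_oriented_FTC[OF _ _ tT s]) (auto intro!: derivative_eq_intros)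
    have "(LINT r|?M. oriented t s r * H r) = (LINT r|?M. oriented t s r * h r + H t * (oriented t s r * 1))"
      by (intro Lintegral_cong) (auto simp: h_def algebra_simps)
    also have "... = (LINT r|?M. oriented t s r * h r) + H t * (LINT r|?M. oriented t s r * 1)"
      using integrable_oriented[OF h] integrable_oriented[of T "%_. 1"] by simp
    finally have o2: "(LINT r|?M. oriented t s r * H r) = (LINT r|?M. oriented t s r * h r) + H t * (s - t)" unfolding o1 .
    show ?thesis unfolding X_def m_def o2 by (simp add: algebra_simps)
  qed
  have Ub: "\<bar>?U s\<bar> <= 8 * C * tent eps (t - s) * ?o" for s
  proof -
    have "\<bar>?U s\<bar> <= \<bar>?k' s * (LINT r|?M. oriented t s r * h r)\<bar>" using \<kappa>(2,3)[of s] by (simp add: abs_mult mult_left_le_one_le)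
    also have "... <= 8 * C * tent eps (t - s) * ?o" by (rule kernel_increment_bound[OF \<eta> eps h C(1) C(3)])
    finally show ?thesis .
  qed
  have iU: "integrable ?M ?U"
  proof (rule Lintegrable_bound)
    show "integrable ?M (%s. 8 * C * tent eps (t - s) * ?o)" using it by simp
    show "?U \<in> borel_measurable ?M"
      by (rule borel_measurable_times[OF \<kappa>(1) borel_measurable_times[OF k'm measurable_integral_oriented[OF borel_measurable_integrable[OF h]]]])
    show "AE s in ?M. norm (?U s) <= norm (8 * C * tent eps (t - s) * ?o)"
      using Ub order.trans[OF _ abs_ge_self] by (intro AE_I2) auto
  qed
  have iV: "integrable ?M ?V"
  proof (rule Lintegrable_bound)
    show "integrable ?M (%s. m s * H t)" using im by simp
    show "?V \<in> borel_measurable ?M" using \<kappa>(1) mm by (intro borel_measurable_times) auto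
    show "AE s in ?M. norm (?V s) <= norm (m s * H t)"
      using \<kappa>(2,3) by (intro AE_I2) (simp add: abs_mult mult_left_le_one_le)
  qed
  show "integrable ?M X"
    by (rule Lintegrable_cong[THEN iffD2, OF refl _ Lintegrable_add[OF iU iV]]) (use X in auto)
  have "(LINT s|?M. X s) = (LINT s|?M. ?U s + ?V s)" by (rule Lintegral_cong) (use X in auto)
  also have "... = (LINT s|?M. ?U s) + (LINT s|?M. ?V s)" by (rule Lintegral_add[OF iU iV])
  finally have eq: "(LINT s|?M. X s) = (LINT s|?M. ?U s) + (LINT s|?M. ?V s)" .
  have t1: "(LINT s|?M. tent eps (t - s)) <= 1" by (rule tp(4))
  have "\<bar>LINT s|?M. ?U s\<bar> <= (LINT s|?M. \<bar>?U s\<bar>)" by (rule integral_abs_bound)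
  also have "... <= (LINT s|?M. 8 * C * tent eps (t - s) * ?o)"
    by (rule integral_mono) (use iU it Ub in auto)
  also have "... = (LINT s|?M. tent eps (t - s)) * (8 * C * ?o)" by (simp add: mult_ac)
  also have "... <= 1 * (8 * C * ?o)" using t1 C(1) o by (intro mult_right_mono) auto
  finally have U: "\<bar>LINT s|?M. ?U s\<bar> <= 8 * C * ?o" by simp
  have iH\<kappa>: "integrable ?M (%r. H r * \<kappa> r)"
  proof (rule Lintegrable_bound[OF H])
    show "(%r. H r * \<kappa> r) \<in> borel_measurable ?M" using H \<kappa>(1) by (intro borel_measurable_times) auto
    show "AE r in ?M. norm (H r * \<kappa> r) <= norm (H r)" using \<kappa>(2,3) by (intro AE_I2) (simp add: abs_mult mult_right_le_one_le)
  qed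
  let ?W = "%s. m s * ((\<kappa> s - \<kappa> t) * H t)"
  have iW: "integrable ?M ?W"
  proof -
    have "integrable ?M (%s. ?V s - m s * (\<kappa> t * H t))" using iV im by simp
    also have "(%s. ?V s - m s * (\<kappa> t * H t)) = ?W" by (simp add: algebra_simps)
    finally show ?thesis .
  qed
  have "(LINT s|?M. ?V s) = (LINT s|?M. ?W s + m s * (\<kappa> t * H t))"
    by (intro Lintegral_cong) (auto simp: algebra_simps)
  also have "... = (LINT s|?M. ?W s) + (LINT s|?M. m s) * (\<kappa> t * H t)" using iW im by simp
  also have "(LINT s|?M. m s) = 0" unfolding m_def by (rule kernel_moment[OF \<eta> eps t])
  finally have "\<bar>LINT s|?M. ?V s\<bar> <= (LINT s|?M. \<bar>?W s\<bar>)" using integral_abs_bound[of ?M ?W] by simp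
  also have "... <= (LINT s|?M. (2 * C) * (tent eps (t - s) * \<bar>H s * \<kappa> s - H t * \<kappa> t\<bar> + tent eps (t - s) * \<bar>h s\<bar>))"
  proof (rule integral_mono)
    show "integrable ?M (%s. \<bar>?W s\<bar>)" using iW by simp
    show "integrable ?M (%s. (2 * C) * (tent eps (t - s) * \<bar>H s * \<kappa> s - H t * \<kappa> t\<bar> + tent eps (t - s) * \<bar>h s\<bar>))"
      using iH\<kappa> h by (intro integrable_mult_right Lintegrable_add integrable_tent[OF eps]) auto
    fix s
    have "(\<kappa> s - \<kappa> t) * H t = (H s * \<kappa> s - H t * \<kappa> t) - \<kappa> s * h s" by (simp add: h_def algebra_simps)
    moreover have "\<bar>\<kappa> s * h s\<bar> <= \<bar>h s\<bar>" using \<kappa>(2,3)[of s] by (simp add: abs_mult mult_left_le_one_le)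
    ultimately have "\<bar>(\<kappa> s - \<kappa> t) * H t\<bar> <= \<bar>H s * \<kappa> s - H t * \<kappa> t\<bar> + \<bar>h s\<bar>" by linarith
    then have "\<bar>m s\<bar> * \<bar>(\<kappa> s - \<kappa> t) * H t\<bar> <= (2 * C * tent eps (t - s)) * (\<bar>H s * \<kappa> s - H t * \<kappa> t\<bar> + \<bar>h s\<bar>)"
      using mb[of s] C(1) tp(2) by (intro mult_mono) auto
    then show "\<bar>?W s\<bar> <= (2 * C) * (tent eps (t - s) * \<bar>H s * \<kappa> s - H t * \<kappa> t\<bar> + tent eps (t - s) * \<bar>h s\<bar>)"
      unfolding abs_mult[of "m s"] by (simp only: distrib_left mult.assoc)
  qed
  also have "... = 2 * C * (?o' + ?o)"
  proof -
    have "integrable ?M (%s. tent eps (t - s) * \<bar>H s * \<kappa> s - H t * \<kappa> t\<bar>)" "integrable ?M (%s. tent eps (t - s) * \<bar>h s\<bar>)"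
      using iH\<kappa> h by (auto intro!: integrable_tent[OF eps])
    then show ?thesis by simp
  qed
  finally have V: "\<bar>LINT s|?M. ?V s\<bar> <= 2 * C * (?o' + ?o)" .
  have "0 <= ?o'" by (rule Lintegral_nonneg) (simp add: tp(2))
  then have "0 <= C * ?o'" using C(1) by simp
  then show "\<bar>LINT s|?M. X s\<bar> <= 10 * C * ((LINT r|?M. tent eps (t - r) * \<bar>H r - H t\<bar>) + ?o')"
    using U V eq unfolding h_def by (simp add: distrib_left)
qed

section \<open>Mollification of functions with values in a Sobolev space\<close>

text \<open>Stated for an arbitrary function of the values of \<open>G\<close>, this covers the pointwise mollification, its norm bound and the
  action of a functional at the same time.\<close>

lemma integral_simple_sum:
  assumes G: "simple_function (time_measure T) G" and k: "integrable (time_measure T) (k :: real => real)"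
  shows "integrable (time_measure T) (%s. k s * \<phi> (G s))"
    and "(LINT s|time_measure T. k s * \<phi> (G s)) =
       (\<Sum>b\<in>G ` {0<..<T}. \<phi> b * (LINT s|time_measure T. k s * indicator (G -` {b}) s))"
proof -
  let ?M = "time_measure T"
  have fin: "finite (G ` {0<..<T})" using G by (simp add: simple_function_def)
  have i: "integrable ?M (%s. k s * indicator (G -` {b}) s)" for b
  proof -
    have "G -` {b} \<inter> space ?M \<in> sets ?M" by (rule simple_functionD(2)[OF G])
    from integrable_real_mult_indicator[OF this k] show ?thesis
      by (rule Lintegrable_cong[THEN iffD1, rotated 2]) (auto simp: indicator_def)
  qed
  have eq: "k s * \<phi> (G s) = (\<Sum>b\<in>G ` {0<..<T}. \<phi> b * (k s * indicator (G -` {b}) s))" if "s \<in> space ?M" for s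
  proof -
    have "(\<Sum>b\<in>G ` {0<..<T}. \<phi> b * (k s * indicator (G -` {b}) s)) = (\<Sum>b\<in>G ` {0<..<T}. if b = G s then \<phi> b * k s else 0)"
      by (intro sum.cong) (auto simp: indicator_def)
    also have "... = \<phi> (G s) * k s" using fin that by simp
    finally show ?thesis by simp
  qed
  show "integrable ?M (%s. k s * \<phi> (G s))"
    by (rule Lintegrable_cong[THEN iffD2, OF refl eq]) (auto intro!: Lintegrable_sum i)
  have "(LINT s|?M. k s * \<phi> (G s)) = (LINT s|?M. (\<Sum>b\<in>G ` {0<..<T}. \<phi> b * (k s * indicator (G -` {b}) s)))"
    by (rule Lintegral_cong[OF refl eq])
  also have "... = (\<Sum>b\<in>G ` {0<..<T}. \<phi> b * (LINT s|?M. k s * indicator (G -` {b}) s))"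
    by (subst Lintegral_sum) (auto intro!: i)
  finally show "(LINT s|?M. k s * \<phi> (G s)) = (\<Sum>b\<in>G ` {0<..<T}. \<phi> b * (LINT s|?M. k s * indicator (G -` {b}) s))" .
qed

lemma time_kernel_integrable:
  assumes "mollifier_kernel \<eta>" "0 < eps"
  shows "integrable (time_measure T) (%s. time_kernel \<eta> eps (t - s))"
proof -
  interpret finite_measure "time_measure T" by (rule finite_measure_time)
  show ?thesis using integrable_conv[OF time_kernel_props(1)[OF assms] time_measurable_set, of T "%_. 1" t] by simp
qed

lemma mollify_eq: "mollify \<eta> T eps h t x = (LINT s|time_measure T. time_kernel \<eta> eps (t - s) * h s x)"
  by (simp add: mollify_def time_kernel_def mult.assoc)

context spatial_setting
begin

lemma zero_W1: "1 <= p ==> (%x. 0) \<in> W p" "1 <= p ==> W1n p (%x. 0) = 0"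
proof -
  assume p: "1 <= p"
  have z: "(%x. 0) \<in> test_functions D" by (cases D) (auto simp: smooth_const Cc_infinity_def)
  show w: "(%x. 0) \<in> W p" by (rule test_function_W1[OF p z])
  have "W1n p (%x. 0) <= 0" using W1_lincomb(2)[OF p w w, of 0 0] by simp
  then show "W1n p (%x. 0) = 0" using W1_norm_nonneg[OF p, of "%x. 0"] by linarith
qed

lemma zero_W1_0: "1 <= p ==> (%x. 0) \<in> W0 p"
proof -
  assume p: "1 <= p"
  have "(%x. 0) \<in> test_functions D" by (cases D) (auto simp: smooth_const Cc_infinity_def)
  then show ?thesis unfolding W1_0_iff[OF p] using zero_W1[OF p] by (auto intro!: exI[of _ "%k x. 0"])
qed

lemma W1_sum:
  assumes p: "1 <= p" and I: "finite I" and b: "\<And>i. i \<in> I ==> b i \<in> W p"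
  shows "(%x. \<Sum>i\<in>I. c i * b i x) \<in> W p \<and>
    W1n p (%x. \<Sum>i\<in>I. c i * b i x) <= (\<Sum>i\<in>I. \<bar>c i\<bar> * W1n p (b i))"
  using I b
proof (induction I)
  case empty
  then show ?case using zero_W1[OF p] by simp
next
  case (insert i I)
  let ?u = "%x. \<Sum>i\<in>I. c i * b i x"
  have u: "?u \<in> W p" "W1n p ?u <= (\<Sum>i\<in>I. \<bar>c i\<bar> * W1n p (b i))"
    and bi: "b i \<in> W p"
    using insert by auto
  have "(%x. \<Sum>i\<in>insert i I. c i * b i x) = (%x. c i * b i x + 1 * ?u x)" using insert by simp
  then show ?case using W1_lincomb[OF p bi u(1), of "c i" 1] u(2) insert by simp
qed

lemma mollify_simple:
  assumes p: "1 <= p" and eps: "0 < eps" and G: "simple_function (time_measure T) G" "\<And>t. t \<in> {0<..<T} ==> G t \<in> W p"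
  shows "moll T eps G t \<in> W p"
    and "W1n p (moll T eps G t) <= (LINT s|time_measure T. tk eps (t - s) * W1n p (G s))"
proof -
  let ?M = "time_measure T"
  let ?c = "%b. LINT s|?M. tk eps (t - s) * indicator (G -` {b}) s"
  note ki = time_kernel_integrable[OF \<eta> eps, of T t]
  have fin: "finite (G ` {0<..<T})" using G by (simp add: simple_function_def)
  have c0: "0 <= ?c b" for b
    using mollifier_kernelD(2)[OF \<eta>] eps by (intro Lintegral_nonneg) (simp add: time_kernel_def)
  have "moll T eps G t = (%x. \<Sum>b\<in>G ` {0<..<T}. ?c b * b x)"
    unfolding mollify_eq[abs_def] using integral_simple_sum(2)[OF G(1) ki, of "%b. b _"] by (simp add: mult.commute)
  moreover have "(LINT s|?M. tk eps (t - s) * W1n p (G s)) = (\<Sum>b\<in>G ` {0<..<T}. \<bar>?c b\<bar> * W1n p b)"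
    using integral_simple_sum(2)[OF G(1) ki, of "W1n p"] c0 by (simp add: mult.commute)
  moreover have "(%x. \<Sum>b\<in>G ` {0<..<T}. ?c b * b x) \<in> W p \<and>
      W1n p (%x. \<Sum>b\<in>G ` {0<..<T}. ?c b * b x) <= (\<Sum>b\<in>G ` {0<..<T}. \<bar>?c b\<bar> * W1n p b)"
    by (rule W1_sum[OF p fin]) (use G(2) in auto)
  ultimately show "moll T eps G t \<in> W p"
    "W1n p (moll T eps G t) <= (LINT s|?M. tk eps (t - s) * W1n p (G s))"
    by auto
qed

end

context spatial_setting
begin

lemma simple_pair_measurable:
  assumes G: "simple_function (time_measure T) G" "\<And>t. t \<in> {0<..<T} ==> G t \<in> borel_measurable M"
  shows "(%(t, x). G t x :: real) \<in> borel_measurable (time_measure T \<Otimes>\<^sub>M M)"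
proof -
  have fin: "finite (G ` {0<..<T})" using G by (simp add: simple_function_def)
  have "(%z. \<Sum>b\<in>G ` {0<..<T}. indicator (G -` {b} \<inter> space (time_measure T)) (fst z) * b (snd z) :: real) \<in> borel_measurable (time_measure T \<Otimes>\<^sub>M M)"
  proof (rule borel_measurable_sum)
    fix b assume "b \<in> G ` {0<..<T}"
    then have b: "b \<in> borel_measurable M" using G(2) by auto
    have "(%t. indicator (G -` {b} \<inter> space (time_measure T)) t :: real) \<in> borel_measurable (time_measure T)"
      by (rule borel_measurable_indicator[OF simple_functionD(2)[OF G(1)]])
    from borel_measurable_times[OF measurable_compose[OF measurable_fst this] measurable_compose[OF measurable_snd b]]
    show "(%z. indicator (G -` {b} \<inter> space (time_measure T)) (fst z) * b (snd z) :: real) \<in> borel_measurable (time_measure T \<Otimes>\<^sub>M M)" .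
  qed
  also have "?this \<longleftrightarrow> ?thesis"
  proof (rule measurable_cong)
    fix z assume "z \<in> space (time_measure T \<Otimes>\<^sub>M M)"
    then have z: "fst z \<in> {0<..<T}" by (auto simp: space_pair_measure)
    have "(\<Sum>b\<in>G ` {0<..<T}. indicator (G -` {b} \<inter> space (time_measure T)) (fst z) * b (snd z) :: real) =
        (\<Sum>b\<in>G ` {0<..<T}. if b = G (fst z) then b (snd z) else 0)"
      using z by (intro sum.cong) (auto simp: indicator_def)
    also have "... = G (fst z) (snd z)" using fin z by simp
    finally show "(\<Sum>b\<in>G ` {0<..<T}. indicator (G -` {b} \<inter> space (time_measure T)) (fst z) * b (snd z)) = (case z of (t, x) => G t x)"
      by (simp add: split_beta')
  qed
  finally show ?thesis .
qed

text \<open>The mollification is defined pointwise in \<open>x\<close>; that it is the Bochner integral of \<open>\<eta>\<^sub>\<epsilon>(t - s) g(s)\<close> in the Sobolev space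
  follows from the case of simple functions, because a Cauchy sequence in the Sobolev space converges to its \<open>L\<^sup>1\<close> limit.\<close>

lemma mollify_W1:
  assumes p: "1 <= p" and eps: "0 < eps"
    and G: "\<And>k. simple_function (time_measure T) (G k)" "\<And>k t. t \<in> {0<..<T} ==> G k t \<in> W p"
    and g: "AE t in time_measure T. g t \<in> W p"
    and e: "\<And>k. integrable (time_measure T) (%t. W1n p (%x. g t x - G k t x))"
      "(%k. LINT t|time_measure T. W1n p (%x. g t x - G k t x)) \<longlonglongrightarrow> 0"
    and g': "(%(t, x). g' t x) \<in> borel_measurable (time_measure T \<Otimes>\<^sub>M M)" "AE t in time_measure T. AE x in M. g t x = g' t x"
      "AE x in M. AE t in time_measure T. g t x = g' t x"
  shows "moll T eps g t \<in> W p"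
    and "W1n p (%x. moll T eps g t x - moll T eps (G k) t x) <=
       (LINT s|time_measure T. tk eps (t - s) * W1n p (%x. g s x - G k s x))"
    and "(%k. W1n p (%x. moll T eps g t x - moll T eps (G k) t x)) \<longlonglongrightarrow> 0"
proof -
  let ?M = "time_measure T" and ?n = "W1n p" and ?k = "%s. tk eps (t - s)"
  let ?m = "%h. moll T eps h t" and ?e = "%k s. W1n p (%x. g s x - G k s x)"
  have sfT: "sigma_finite_measure ?M" by (rule sigma_finite_time)
  have sfM: "sigma_finite_measure M" by (rule finite_measure.axioms(1)[OF finite_measure_region[OF D]])
  interpret T: sigma_finite_measure ?M by (rule sfT)
  interpret X: sigma_finite_measure M by (rule sfM)
  interpret TX: pair_sigma_finite ?M M ..
  interpret XT: pair_sigma_finite M ?M ..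
  note Sm = time_measurable_set[of T]
  note kc = time_kernel_props(1)[OF \<eta> eps]
  have k0: "0 <= ?k s" for s using mollifier_kernelD(2)[OF \<eta>] eps by (simp add: time_kernel_def)
  have km: "?k \<in> borel_measurable ?M" by (rule continuous_measurable_lebesgue_on[OF kc])
  have ki: "integrable ?M ?k" by (rule time_kernel_integrable[OF \<eta> eps])
  obtain B where B: "0 <= B" "\<And>s. s \<in> {0<..<T} ==> ?k s <= B"
    using kernel_bounded[OF kc Sm(2), of "{t}"] abs_le_D1 by (metis bounded_insert bounded_empty singletonI)
  have kmul: "integrable ?M (%s. ?k s * h s)" if "integrable ?M h" for h
    by (rule integrable_conv[OF kc Sm that])
  have kle: "(LINT s|?M. ?k s * h s) <= B * (LINT s|?M. h s)" if "integrable ?M h" "\<And>s. 0 <= h s" for h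
  proof -
    have "(LINT s|?M. ?k s * h s) <= (LINT s|?M. B * h s)"
      using kmul[OF that(1)] that B by (intro integral_mono) (auto intro!: mult_right_mono)
    then show ?thesis by simp
  qed
  have nn: "0 <= ?n u" for u by (rule W1_norm_nonneg[OF p])
  have bj: "G k s \<in> W p" if "s \<in> {0<..<T}" for k s using G(2) that .
  have AET: "AE s in ?M. s \<in> {0<..<T}" by (rule AE_I2) simp
  note diffW = W1_diff(1)[OF p] and sym = W1_norm_minus_commute[OF p]
  have mG: "?m (G k) \<in> W p" for k by (rule mollify_simple(1)[OF p eps G(1,2)])
  have mGG: "?n (%x. ?m (G k) x - ?m (G l) x) <= (LINT s|?M. ?k s * ?e k s) + (LINT s|?M. ?k s * ?e l s)" for k l
  proof -
    let ?d = "%s x. G k s x - G l s x"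
    have sd: "simple_function ?M ?d" by (rule simple_function_compose2[OF G(1) G(1)])
    have "?m ?d = (%x. ?m (G k) x - ?m (G l) x)"
    proof
      fix x
      show "?m ?d x = ?m (G k) x - ?m (G l) x"
        using integral_simple_sum(1)[OF G(1)[of k] ki, of "%b. b x"] integral_simple_sum(1)[OF G(1)[of l] ki, of "%b. b x"]
        unfolding mollify_eq by (simp add: right_diff_distrib)
    qed
    moreover have "?n (?m ?d) <= (LINT s|?M. ?k s * ?n (?d s))"
      by (rule mollify_simple(2)[OF p eps sd]) (rule diffW[OF bj bj])
    moreover have "(LINT s|?M. ?k s * ?n (?d s)) <= (LINT s|?M. ?k s * ?e k s + ?k s * ?e l s)"
    proof (rule integral_mono_AE)
      show "integrable ?M (%s. ?k s * ?n (?d s))" by (rule integral_simple_sum(1)[OF sd ki])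
      show "integrable ?M (%s. ?k s * ?e k s + ?k s * ?e l s)" by (intro Lintegrable_add kmul e)
      show "AE s in ?M. ?k s * ?n (?d s) <= ?k s * ?e k s + ?k s * ?e l s"
        using g AET
      proof eventually_elim
        case (elim s)
        have "?n (?d s) <= ?e k s + ?e l s"
          using W1_norm_triangle[OF p bj[OF elim(2), of k] elim(1) bj[OF elim(2), of l]] sym[OF bj[OF elim(2), of k] elim(1)] by simp
        from mult_left_mono[OF this k0] show ?case by (simp add: distrib_left)
      qed
    qed
    moreover have "(LINT s|?M. ?k s * ?e k s + ?k s * ?e l s) = (LINT s|?M. ?k s * ?e k s) + (LINT s|?M. ?k s * ?e l s)"
      by (intro Lintegral_add kmul e)
    ultimately show ?thesis by simp
  qed
  have ke0: "(%k. LINT s|?M. ?k s * ?e k s) \<longlonglongrightarrow> 0"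
  proof (rule Lim_null_comparison[OF always_eventually[OF allI]])
    fix k
    have "0 <= (LINT s|?M. ?k s * ?e k s)" by (rule Lintegral_nonneg) (simp add: k0 nn)
    then show "norm (LINT s|?M. ?k s * ?e k s) <= B * (LINT s|?M. ?e k s)" using kle[OF e(1) nn] by simp
    show "(%k. B * (LINT s|?M. ?e k s)) \<longlonglongrightarrow> 0" by (rule tendsto_mult_right_zero[OF e(2)])
  qed
  have cauchy: "\<exists>N. \<forall>k\<ge>N. \<forall>l\<ge>N. ?n (%x. ?m (G k) x - ?m (G l) x) <= d" if d: "0 < d" for d
  proof -
    have "0 < d / 2" using d by simp
    from order_tendstoD(2)[OF ke0 this] obtain N where N: "\<And>k. N <= k ==> (LINT s|?M. ?k s * ?e k s) < d / 2"
      by (auto simp: eventually_sequentially)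
    have "?n (%x. ?m (G k) x - ?m (G l) x) <= d" if "N <= k" "N <= l" for k l
      using mGG[of k l] N[OF that(1)] N[OF that(2)] by linarith
    then show ?thesis by blast
  qed
  obtain C where C: "0 <= C" "\<And>u. u \<in> L p ==> integrable M u \<and> (LINT x|M. \<bar>u x\<bar>) <= C * nrm p u"
    using Lp_L1_bound[OF finite_measure_region[OF D] p] by blast
  have C1: "integrable M u \<and> (LINT x|M. \<bar>u x\<bar>) <= C * ?n u" if "u \<in> W p" for u
  proof -
    have "u \<in> L p" using that by (auto simp: W1_def)
    moreover have "C * nrm p u <= C * ?n u" by (rule mult_left_mono[OF Lp_norm_le_W1_norm[OF p] C(1)])
    ultimately show ?thesis using C(2)[of u] by auto
  qed
  have Gm: "(%(s, x). G k s x) \<in> borel_measurable (?M \<Otimes>\<^sub>M M)" for k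
    by (rule simple_pair_measurable[OF G(1)]) (use C1[OF bj] in auto)
  have dI: "AE s in ?M. integrable M (%x. g' s x - G k s x) \<and> (LINT x|M. \<bar>g' s x - G k s x\<bar>) <= C * ?e k s" for k
    using g g'(2) AET
  proof eventually_elim
    case (elim s)
    have 1: "integrable M (%x. g s x - G k s x)" "(LINT x|M. \<bar>g s x - G k s x\<bar>) <= C * ?e k s"
      using C1[OF diffW[OF elim(1) bj[OF elim(3)]]] by auto
    have eq: "AE x in M. g s x - G k s x = g' s x - G k s x" using elim(2) by eventually_elim simp
    have m: "(%x. g' s x - G k s x) \<in> borel_measurable M"
      by (rule borel_measurable_lebesgue_on_AE[OF region_properties(1)[OF D] borel_measurable_integrable[OF 1(1)] eq])
    have 2: "integrable M (%x. g' s x - G k s x)" by (rule integrable_cong_AE_imp[OF 1(1) m]) (use eq in eventually_elim, simp)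
    have "(LINT x|M. \<bar>g s x - G k s x\<bar>) = (LINT x|M. \<bar>g' s x - G k s x\<bar>)"
      using 1(1) 2 eq by (intro integral_cong_AE) (auto elim!: eventually_mono)
    then show ?case using 1 2 by simp
  qed
  have iG: "integrable (?M \<Otimes>\<^sub>M M) (%(s, x). g' s x - G k s x)" for k
  proof (rule integrable_pairI[OF sfT sfM _ dI])
    show "(%(s, x). g' s x - G k s x) \<in> borel_measurable (?M \<Otimes>\<^sub>M M)"
      using g'(1) Gm[of k] unfolding split_beta' by (rule borel_measurable_diff)
    show "integrable ?M (%s. C * ?e k s)" using e(1) by simp
  qed
  have ikG: "integrable (?M \<Otimes>\<^sub>M M) (%(s, x). ?k s * (g' s x - G k s x))" for k
  proof (rule integrable_pairI[OF sfT sfM])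
    show "(%(s, x). ?k s * (g' s x - G k s x)) \<in> borel_measurable (?M \<Otimes>\<^sub>M M)"
      using borel_measurable_times[OF measurable_compose[OF measurable_fst km] borel_measurable_integrable[OF iG[of k]]]
      by (simp add: split_beta')
    show "AE s in ?M. integrable M (%x. ?k s * (g' s x - G k s x)) \<and> (LINT x|M. \<bar>?k s * (g' s x - G k s x)\<bar>) <= ?k s * (C * ?e k s)"
      using dI[of k]
    proof eventually_elim
      case (elim s)
      then show ?case using mult_left_mono[OF conjunct2[OF elim] k0[of s]] k0[of s] by (simp add: abs_mult)
    qed
    show "integrable ?M (%s. ?k s * (C * ?e k s))" by (rule kmul) (use e(1) in simp)
  qed
  \<comment> \<open>For almost every \<open>x\<close> the difference is an honest integral in time, to which Fubini applies.\<close>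
  have AEx: "AE x in M. ?m g x - ?m (G k) x = (LINT s|?M. ?k s * (g' s x - G k s x)) \<and> integrable ?M (%s. ?k s * (g' s x - G k s x))" for k
    using TX.AE_integrable_snd[OF ikG[of k]] g'(3)
  proof eventually_elim
    case (elim x)
    have 1: "integrable ?M (%s. ?k s * (g' s x - G k s x))" using elim(1) by simp
    have 2: "integrable ?M (%s. ?k s * G k s x)" using integral_simple_sum(1)[OF G(1)[of k] ki, of "%b. b x"] by simp
    have 3: "integrable ?M (%s. ?k s * g' s x)" using Lintegrable_add[OF 1 2] by (simp add: algebra_simps)
    have "?m g x = (LINT s|?M. ?k s * g' s x)"
      unfolding mollify_eq using elim(2) by (intro integral_cong_AE_complete[OF Sm(1)] borel_measurable_integrable[OF 3]) (auto elim!: eventually_mono)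
    then show ?case using 1 2 3 by (simp add: mollify_eq right_diff_distrib)
  qed
  have wm: "?m g \<in> borel_measurable M"
  proof (rule borel_measurable_lebesgue_on_AE[OF region_properties(1)[OF D]])
    have "(%(x, s). ?k s * (g' s x - G 0 s x)) \<in> borel_measurable (M \<Otimes>\<^sub>M ?M)"
      using measurable_pair_swap[OF borel_measurable_integrable[OF ikG[of 0]]] by (simp add: split_beta')
    from T.borel_measurable_lebesgue_integral[OF this]
    show "(%x. (LINT s|?M. ?k s * (g' s x - G 0 s x)) + ?m (G 0) x) \<in> borel_measurable M"
      using C1[OF mG[of 0]] by (intro borel_measurable_add) auto
    show "AE x in M. (LINT s|?M. ?k s * (g' s x - G 0 s x)) + ?m (G 0) x = ?m g x"
      using AEx[of 0] by eventually_elim simp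
  qed
  have L1: "integrable M (%x. ?m g x - ?m (G k) x) \<and> (LINT x|M. \<bar>?m g x - ?m (G k) x\<bar>) <= C * (LINT s|?M. ?k s * ?e k s)" for k
  proof -
    let ?z = "%s x. ?k s * (g' s x - G k s x)"
    have iz: "integrable (M \<Otimes>\<^sub>M ?M) (%(x, s). ?z s x)" using TX.integrable_product_swap[OF ikG[of k]] by (simp add: split_beta')
    have ia: "integrable (M \<Otimes>\<^sub>M ?M) (%(x, s). \<bar>?z s x\<bar>)" using integrable_abs[OF iz] by (simp add: split_beta')
    have i1: "integrable M (%x. LINT s|?M. ?z s x)" using XT.integrable_fst'[OF iz] by simp
    have i2: "integrable M (%x. LINT s|?M. \<bar>?z s x\<bar>)" using XT.integrable_fst'[OF ia] by simp
    have mm: "(%x. ?m g x - ?m (G k) x) \<in> borel_measurable M" using wm C1[OF mG[of k]] by (intro borel_measurable_diff) auto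
    have i: "integrable M (%x. ?m g x - ?m (G k) x)"
      by (rule integrable_cong_AE_imp[OF i1 mm]) (use AEx[of k] in eventually_elim, simp)
    have "(LINT x|M. \<bar>?m g x - ?m (G k) x\<bar>) <= (LINT x|M. LINT s|?M. \<bar>?z s x\<bar>)"
    proof (rule integral_mono_AE[OF _ i2])
      show "integrable M (%x. \<bar>?m g x - ?m (G k) x\<bar>)" using i by simp
      show "AE x in M. \<bar>?m g x - ?m (G k) x\<bar> <= (LINT s|?M. \<bar>?z s x\<bar>)"
        using AEx[of k]
      proof eventually_elim
        case (elim x)
        show ?case unfolding conjunct1[OF elim] by (rule integral_abs_bound)
      qed
    qed
    also have "... = (LINT s|?M. LINT x|M. \<bar>?z s x\<bar>)"
      by (rule TX.Fubini_integral) (use integrable_abs[OF ikG[of k]] in \<open>simp add: split_beta'\<close>)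
    also have "... <= (LINT s|?M. C * (?k s * ?e k s))"
    proof (rule integral_mono_AE)
      have "integrable (?M \<Otimes>\<^sub>M M) (%(s, x). \<bar>?z s x\<bar>)" using integrable_abs[OF ikG[of k]] by (simp add: split_beta')
      from TX.integrable_fst'[OF this] show "integrable ?M (%s. LINT x|M. \<bar>?z s x\<bar>)" by simp
      show "integrable ?M (%s. C * (?k s * ?e k s))" using kmul[OF e(1)[of k]] by simp
      show "AE s in ?M. (LINT x|M. \<bar>?z s x\<bar>) <= C * (?k s * ?e k s)"
        using dI[of k]
      proof eventually_elim
        case (elim s)
        have "(LINT x|M. \<bar>?z s x\<bar>) = ?k s * (LINT x|M. \<bar>g' s x - G k s x\<bar>)" using k0[of s] by (simp add: abs_mult)
        also have "... <= ?k s * (C * ?e k s)" by (rule mult_left_mono[OF conjunct2[OF elim] k0])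
        finally show ?case by (simp add: mult_ac)
      qed
    qed
    finally show ?thesis using i by simp
  qed
  have iw: "integrable M (?m g)"
    using Lintegrable_add[OF conjunct1[OF L1[of 0]] conjunct1[OF C1[OF mG[of 0]]]] by simp
  have l1: "(%k. LINT x|M. \<bar>?m (G k) x - ?m g x\<bar>) \<longlonglongrightarrow> 0"
  proof (rule Lim_null_comparison[OF always_eventually[OF allI] tendsto_mult_right_zero[OF ke0]])
    fix k show "norm (LINT x|M. \<bar>?m (G k) x - ?m g x\<bar>) <= C * (LINT s|?M. ?k s * ?e k s)"
      using L1[of k] by (simp add: abs_minus_commute)
  qed
  note lim = W1_Cauchy_L1_limit[OF p mG cauchy iw l1]
  show mg: "?m g \<in> W p" by (rule lim(1))
  show lim': "(%k. ?n (%x. ?m g x - ?m (G k) x)) \<longlonglongrightarrow> 0" using lim(2) by (simp add: sym[OF mg mG])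
  show "?n (%x. ?m g x - ?m (G k) x) <= (LINT s|?M. ?k s * ?e k s)"
  proof (rule tendsto_lowerbound[OF _ always_eventually[OF allI]])
    fix l
    show "?n (%x. ?m g x - ?m (G k) x) <= ?n (%x. ?m g x - ?m (G l) x) + ((LINT s|?M. ?k s * ?e l s) + (LINT s|?M. ?k s * ?e k s))"
      using W1_norm_triangle[OF p mg mG[of l] mG[of k]] mGG[of l k] by linarith
    have "(%l. ?n (%x. ?m g x - ?m (G l) x) + ((LINT s|?M. ?k s * ?e l s) + (LINT s|?M. ?k s * ?e k s))) \<longlonglongrightarrow> 0 + (0 + (LINT s|?M. ?k s * ?e k s))"
      by (intro tendsto_add lim' ke0 tendsto_const)
    then show "(%l. ?n (%x. ?m g x - ?m (G l) x) + ((LINT s|?M. ?k s * ?e l s) + (LINT s|?M. ?k s * ?e k s))) \<longlonglongrightarrow> (LINT s|?M. ?k s * ?e k s)"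
      by simp
  qed simp
qed

end

section \<open>Averages and simple functions in time\<close>

lemma Lp_abs: "u \<in> Lp M p ==> (%x. \<bar>u x\<bar>) \<in> Lp M p" "Lp_norm M p (%x. \<bar>u x\<bar>) = Lp_norm M p u"
  by (auto simp: Lp_def Lp_norm_def)

lemma Lp_infinityI:
  assumes u: "u \<in> borel_measurable M" and c: "AE x in M. \<bar>u x\<bar> <= c" "0 <= c"
  shows "u \<in> Lp M \<infinity>" "Lp_norm M \<infinity> u <= c"
proof -
  have le: "esssup M (%x. ereal \<bar>u x\<bar>) <= ereal c"
    by (rule esssup_I) (use u c(1) in \<open>auto elim!: eventually_mono\<close>)
  then show "u \<in> Lp M \<infinity>" using u by (auto simp: Lp_def intro: order.strict_trans1)
  show "Lp_norm M \<infinity> u <= c" using le c(2) by (cases "esssup M (%x. ereal \<bar>u x\<bar>)") (auto simp: Lp_norm_def)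
qed

text \<open>The contraction property includes the exponent infinity, which occurs for the norm of \<open>F(t)\<close>.\<close>

lemma conv_tent_Lp:
  assumes eps: "0 < eps" and p: "1 <= p" and u: "u \<in> Lp (time_measure T) p"
  shows "conv {0<..<T} (tent eps) u \<in> Lp (time_measure T) p"
    and "Lp_norm (time_measure T) p (conv {0<..<T} (tent eps) u) <= Lp_norm (time_measure T) p u"
proof -
  let ?M = "time_measure T"
  note tp = tent_props[OF eps]
  note K = time_measurable_set[of T] tp(1-4)
  have "conv {0<..<T} (tent eps) u \<in> Lp ?M p \<and> Lp_norm ?M p (conv {0<..<T} (tent eps) u) <= Lp_norm ?M p u"
  proof (cases "p = \<infinity>")
    case False
    then obtain s where s: "p = ennreal s" "1 <= s" using p by (cases p) (auto simp: ennreal_ge_1)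
    then show ?thesis using conv_Lp_contraction[OF K s(2)] u by auto
  next
    case True
    let ?c = "Lp_norm ?M \<infinity> u"
    have u': "u \<in> Lp ?M \<infinity>" using u True by simp
    have c: "0 <= ?c" by (rule Lp_norm_nonneg_conj[of 1]) (simp add: conjugate_exponents_def)
    interpret finite_measure ?M by (rule finite_measure_time)
    have ui: "integrable ?M u"
      using Lp_measurable[OF u'] Lp_infinity_AE[OF u'] by (intro integrable_const_bound[where B = ?c]) auto
    have it: "integrable ?M (%s. tent eps (t - s))" for t using integrable_tent[OF eps, of T "%_. 1"] by simp
    have "\<bar>conv {0<..<T} (tent eps) u t\<bar> <= ?c" for t
    proof -
      have "\<bar>conv {0<..<T} (tent eps) u t\<bar> <= (LINT s|?M. \<bar>tent eps (t - s) * u s\<bar>)" unfolding conv_def by (rule integral_abs_bound)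
      also have "... <= (LINT s|?M. tent eps (t - s) * ?c)"
      proof (rule integral_mono_AE)
        show "integrable ?M (%s. \<bar>tent eps (t - s) * u s\<bar>)" using integrable_tent[OF eps ui] by simp
        show "integrable ?M (%s. tent eps (t - s) * ?c)" using it by simp
        show "AE s in ?M. \<bar>tent eps (t - s) * u s\<bar> <= tent eps (t - s) * ?c"
          using Lp_infinity_AE[OF u'] by eventually_elim (simp add: abs_mult tp(2) mult_left_mono)
      qed
      also have "... = (LINT s|?M. tent eps (t - s)) * ?c" by simp
      also have "... <= 1 * ?c" by (rule mult_right_mono[OF tp(4) c])
      finally show ?thesis by simp
    qed
    then show ?thesis unfolding True
      using Lp_infinityI[OF conv_measurable[OF K Lp_measurable[OF u']] _ c] by auto
  qed
  then show "conv {0<..<T} (tent eps) u \<in> Lp ?M p" "Lp_norm ?M p (conv {0<..<T} (tent eps) u) <= Lp_norm ?M p u" by auto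
qed

text \<open>A measurable family indexed by the values of a simple function is measurable along that function.\<close>

lemma simple_dependent_measurable:
  assumes \<Phi>: "simple_function M \<Phi>" and h: "\<And>a. a \<in> \<Phi> ` space M ==> h a \<in> borel_measurable M"
  shows "(%t. h (\<Phi> t) t :: real) \<in> borel_measurable M"
proof -
  have fin: "finite (\<Phi> ` space M)" using \<Phi> by (simp add: simple_function_def)
  have "(%t. \<Sum>a\<in>\<Phi> ` space M. indicator (\<Phi> -` {a} \<inter> space M) t * h a t) \<in> borel_measurable M"
    using h by (intro borel_measurable_sum borel_measurable_times borel_measurable_indicator simple_functionD(2)[OF \<Phi>])
  also have "?this \<longleftrightarrow> ?thesis"
  proof (rule measurable_cong)
    fix t assume t: "t \<in> space M"
    have "(\<Sum>a\<in>\<Phi> ` space M. indicator (\<Phi> -` {a} \<inter> space M) t * h a t) = (\<Sum>a\<in>\<Phi> ` space M. if a = \<Phi> t then h a t else 0)"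
      using t by (intro sum.cong) (auto simp: indicator_def)
    then show "(\<Sum>a\<in>\<Phi> ` space M. indicator (\<Phi> -` {a} \<inter> space M) t * h a t) = h (\<Phi> t) t" using fin t by simp
  qed
  finally show ?thesis .
qed

context commutator_setting
begin

lemma W_minus1_lincomb:
  "H \<in> W_minus1 D q1 ==> u \<in> XW ==> v \<in> XW ==> H (%x. a * u x + b * v x) = a * H u + b * H v"
  by (auto simp: W_minus1_def cx(3))

lemma W_minus1_sum:
  assumes H: "H \<in> W_minus1 D q1" and I: "finite I" and w: "\<And>i. i \<in> I ==> w i \<in> XW"
  shows "(%x. \<Sum>i\<in>I. c i * w i x) \<in> XW \<and> H (%x. \<Sum>i\<in>I. c i * w i x) = (\<Sum>i\<in>I. c i * H (w i))"
  using I w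
proof (induction I)
  case empty
  have z: "(%x. 0) \<in> XW" by (rule zero_W1_0[OF r1])
  show ?case using z W_minus1_lincomb[OF H z z, of 0 0] by simp
next
  case (insert i I)
  let ?u = "%x. \<Sum>i\<in>I. c i * w i x"
  have u: "?u \<in> XW" "H ?u = (\<Sum>i\<in>I. c i * H (w i))" and wi: "w i \<in> XW" using insert by auto
  have e: "(%x. \<Sum>i\<in>insert i I. c i * w i x) = (%x. c i * w i x + 1 * ?u x)" using insert by simp
  have "H (%x. c i * w i x + 1 * ?u x) = c i * H (w i) + 1 * H ?u"
    by (rule W_minus1_lincomb[OF H wi u(1)])
  moreover have "(%x. c i * w i x + 1 * ?u x) \<in> XW" by (rule W1_0_lincomb[OF r1 wi u(1)])
  ultimately show ?case unfolding e using u(2) insert by simp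
qed

text \<open>The mollification of a simple function is a finite linear combination of its values, so that a linear functional can be
  taken inside without any continuity argument.\<close>

lemma functional_mollify_simple:
  assumes eps: "0 < eps" and G: "simple_function \<mu> G" "\<And>t. t \<in> {0<..<T} ==> G t \<in> XG" and a: "a \<in> XP" and H: "H \<in> W_minus1 D q1"
  shows "H (%x. a x * moll T eps G t x) =
    (\<Sum>b\<in>G ` {0<..<T}. (LINT s|\<mu>. tk eps (t - s) * indicator (G -` {b}) s) * H (%x. a x * b x))"
proof -
  have fin: "finite (G ` {0<..<T})" using G by (simp add: simple_function_def)
  let ?c = "%b. LINT s|\<mu>. tk eps (t - s) * indicator (G -` {b}) s"
  have "moll T eps G t x = (\<Sum>b\<in>G ` {0<..<T}. ?c b * b x)" for x
    unfolding mollify_eq using integral_simple_sum(2)[OF G(1) time_kernel_integrable[OF \<eta> eps], where \<phi> = "%b. b x"] by (simp add: mult.commute)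
  then have e: "(%x. a x * moll T eps G t x) = (%x. \<Sum>b\<in>G ` {0<..<T}. ?c b * (a x * b x))"
    by (simp add: sum_distrib_left mult_ac)
  have "(%x. \<Sum>b\<in>G ` {0<..<T}. ?c b * (a x * b x)) \<in> XW \<and>
      H (%x. \<Sum>b\<in>G ` {0<..<T}. ?c b * (a x * b x)) = (\<Sum>b\<in>G ` {0<..<T}. ?c b * H (%x. a x * b x))"
    by (rule W_minus1_sum[OF H fin, of "%b x. a x * b x"]) (use G(2) product(1)[OF a] in auto)
  then show ?thesis unfolding e by blast
qed

text \<open>For simple \<open>\<Phi>\<close> and \<open>G\<close> the commutator at time \<open>t\<close> is a finite sum of scalar commutators.\<close>

lemma simple_commutator_bound:
  assumes eps: "0 < eps" and t: "t \<in> {eps<..<T - eps}" and Ft: "F t \<in> W_minus1 D q1"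
    and C: "0 <= C" "\<And>z. \<bar>tk eps z\<bar> <= C * tent eps z" "\<And>z. \<bar>tk' eps z\<bar> <= C / eps * tent eps z"
    and G: "simple_function \<mu> G" "\<And>t. t \<in> {0<..<T} ==> G t \<in> XG" and a: "a \<in> XP"
  defines "H \<equiv> %b r. F r (%x. a x * b x)"
  shows "integrable \<mu> (%s. tk' eps (t - s) * (LINT r|\<mu>. oriented t s r * F r (%x. a x * G s x)))"
    and "\<bar>(LINT s|\<mu>. tk' eps (t - s) * (LINT r|\<mu>. oriented t s r * F r (%x. a x * G s x))) -
        F t (%x. a x * moll T eps G t x)\<bar> <=
      10 * C * (\<Sum>b\<in>G ` {0<..<T}. (LINT r|\<mu>. tent eps (t - r) * \<bar>H b r - H b t\<bar>) +
        (LINT r|\<mu>. tent eps (t - r) * \<bar>H b r * indicator (G -` {b} \<inter> space \<mu>) r - H b t * indicator (G -` {b} \<inter> space \<mu>) t\<bar>))"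
proof -
  let ?R = "G ` {0<..<T}" and ?k = "%s. tk eps (t - s)" and ?k' = "%s. tk' eps (t - s)"
  let ?i = "%b. indicator (G -` {b} \<inter> space \<mu>) :: real => real"
  let ?X = "%b s. ?i b s * (?k' s * (LINT r|\<mu>. oriented t s r * H b r) - ?k s * H b t)"
  have fin: "finite ?R" using G by (simp add: simple_function_def)
  have Hi: "integrable \<mu> (H b)" if "b \<in> ?R" for b
    unfolding H_def using that G(2) by (intro F_properties(5) product(1)[OF a]) auto
  have im: "?i b \<in> borel_measurable \<mu>" for b by (rule borel_measurable_indicator[OF simple_functionD(2)[OF G(1)]])
  note sc = scalar_commutator_bound[OF \<eta> eps t C Hi im]
  have X: "integrable \<mu> (?X b)" "\<bar>LINT s|\<mu>. ?X b s\<bar> <= 10 * C * ((LINT r|\<mu>. tent eps (t - r) * \<bar>H b r - H b t\<bar>) +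
       (LINT r|\<mu>. tent eps (t - r) * \<bar>H b r * ?i b r - H b t * ?i b t\<bar>))" if "b \<in> ?R" for b
    using sc[OF that, of b] by (auto simp: indicator_def)
  have ki: "integrable \<mu> (%s. ?k s * H (G s) t)" by (rule integral_simple_sum(1)[OF G(1) time_kernel_integrable[OF \<eta> eps]])
  have sum: "(\<Sum>b\<in>?R. ?X b s) = ?k' s * (LINT r|\<mu>. oriented t s r * H (G s) r) - ?k s * H (G s) t" if "s \<in> space \<mu>" for s
  proof -
    have "(\<Sum>b\<in>?R. ?X b s) = (\<Sum>b\<in>?R. if b = G s then ?k' s * (LINT r|\<mu>. oriented t s r * H b r) - ?k s * H b t else 0)"
      using that by (intro sum.cong) (auto simp: indicator_def)
    then show ?thesis using fin that by simp
  qed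
  have si: "integrable \<mu> (%s. ?k' s * (LINT r|\<mu>. oriented t s r * H (G s) r) - ?k s * H (G s) t)"
    by (rule Lintegrable_cong[THEN iffD1, OF refl sum Lintegrable_sum[OF X(1)]])
  from Lintegrable_add[OF this ki]
  have k'i: "integrable \<mu> (%s. ?k' s * (LINT r|\<mu>. oriented t s r * H (G s) r))" by simp
  then show "integrable \<mu> (%s. ?k' s * (LINT r|\<mu>. oriented t s r * F r (%x. a x * G s x)))" unfolding H_def .
  have "F t (%x. a x * moll T eps G t x) =
      (\<Sum>b\<in>?R. (LINT s|\<mu>. ?k s * indicator (G -` {b}) s) * F t (%x. a x * b x))"
    by (rule functional_mollify_simple[OF eps G a Ft])
  also have "... = (LINT s|\<mu>. ?k s * H (G s) t)"
    unfolding H_def using integral_simple_sum(2)[OF G(1) time_kernel_integrable[OF \<eta> eps], where \<phi> = "%b. F t (%x. a x * b x)"] by (simp add: mult.commute)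
  finally have "(LINT s|\<mu>. ?k' s * (LINT r|\<mu>. oriented t s r * H (G s) r)) - F t (%x. a x * moll T eps G t x) =
      (LINT s|\<mu>. ?k' s * (LINT r|\<mu>. oriented t s r * H (G s) r) - ?k s * H (G s) t)"
    using k'i ki by simp
  also have "... = (LINT s|\<mu>. (\<Sum>b\<in>?R. ?X b s))" by (rule Lintegral_cong[OF refl sum[symmetric]])
  also have "... = (\<Sum>b\<in>?R. LINT s|\<mu>. ?X b s)" by (rule Lintegral_sum[OF X(1)])
  finally have eq: "(LINT s|\<mu>. ?k' s * (LINT r|\<mu>. oriented t s r * H (G s) r)) - F t (%x. a x * moll T eps G t x) = (\<Sum>b\<in>?R. LINT s|\<mu>. ?X b s)" .
  have "\<bar>\<Sum>b\<in>?R. LINT s|\<mu>. ?X b s\<bar> <= (\<Sum>b\<in>?R. \<bar>LINT s|\<mu>. ?X b s\<bar>)" by (rule sum_abs)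
  also have "... <= (\<Sum>b\<in>?R. 10 * C * ((LINT r|\<mu>. tent eps (t - r) * \<bar>H b r - H b t\<bar>) +
       (LINT r|\<mu>. tent eps (t - r) * \<bar>H b r * ?i b r - H b t * ?i b t\<bar>)))" by (rule sum_mono[OF X(2)])
  finally show "\<bar>(LINT s|\<mu>. ?k' s * (LINT r|\<mu>. oriented t s r * F r (%x. a x * G s x))) - F t (%x. a x * moll T eps G t x)\<bar> <=
      10 * C * (\<Sum>b\<in>?R. (LINT r|\<mu>. tent eps (t - r) * \<bar>H b r - H b t\<bar>) + (LINT r|\<mu>. tent eps (t - r) * \<bar>H b r * ?i b r - H b t * ?i b t\<bar>))"
    using eq unfolding H_def by (simp add: sum_distrib_left)
qed

end

section \<open>Approximation by simple functions\<close>

locale commutator_data = commutator_setting D \<eta> T pb qb p2 q2 r rt p1 q1 f F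
  for D :: "(real^'n) spatial_domain" and \<eta> :: "real => real" and T pb qb p2 q2 r rt p1 q1 f F +
  fixes \<phi> g :: "real => real^'n => real"
  assumes \<phi>: "\<phi> \<in> Lp_W1_0 T (ennreal pb) D (ennreal qb)" and g: "g \<in> Lp_W1 T (ennreal p2) D (ennreal q2)"
begin

definition "A t = nP (\<phi> t)"
definition "B t = nG (g t)"

lemma \<phi>_bochner: "\<phi> \<in> bochner_Lp T (ennreal pb) XP nP" and g_bochner: "g \<in> bochner_Lp T (ennreal p2) XG nG"
  using \<phi> g by (auto simp: Lp_W1_0_def Lp_W1_def)

lemma AE_spaces: "AE t in \<mu>. \<phi> t \<in> XP" "AE t in \<mu>. g t \<in> XG"
  and A_Lp: "A \<in> Lp \<mu> (ennreal pb)" and B_Lp: "B \<in> Lp \<mu> (ennreal p2)"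
  using \<phi>_bochner g_bochner by (auto simp: bochner_Lp_def strongly_measurable_def A_def[abs_def] B_def[abs_def])

lemma data_ex: "\<exists>\<phi>'. datum (ennreal qb) A \<phi> \<phi>'" "\<exists>g'. datum (ennreal q2) B g g'"
proof -
  have ex: "1 <= ennreal qb" "1 <= ennreal q2" using exponents by (simp_all add: ennreal_ge_1)
  have L1: "AE t in \<mu>. \<phi> t \<in> L qb \<and> nrm qb (\<phi> t) <= A t"
    using AE_spaces(1)
  proof eventually_elim
    case (elim t)
    then show ?case using W1_0_subset_W1[OF elim] Lp_norm_le_W1_norm[OF exponents(2)] by (auto simp: W1_def A_def)
  qed
  have j1: "\<phi> \<in> jointly_measurable T D" using \<phi> by (simp add: Lp_W1_0_def)
  show "\<exists>\<phi>'. datum (ennreal qb) A \<phi> \<phi>'" by (rule datum_exists[OF j1 ex(1) L1]) (erule exI)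
  have L2: "AE t in \<mu>. g t \<in> L q2 \<and> nrm q2 (g t) <= B t"
    using AE_spaces(2) by eventually_elim (use Lp_norm_le_W1_norm[OF exponents(4)] in \<open>auto simp: W1_def B_def\<close>)
  have j2: "g \<in> jointly_measurable T D" using g by (simp add: Lp_W1_def)
  show "\<exists>g'. datum (ennreal q2) B g g'" by (rule datum_exists[OF j2 ex(2) L2]) (erule exI)
qed

definition "\<phi>' = (SOME \<phi>'. datum (ennreal qb) A \<phi> \<phi>')"
definition "g' = (SOME g'. datum (ennreal q2) B g g')"

lemma \<phi>_datum: "datum (ennreal qb) A \<phi> \<phi>'" and g_datum: "datum (ennreal q2) B g g'"
  unfolding \<phi>'_def g'_def by (rule someI_ex[OF data_ex(1)], rule someI_ex[OF data_ex(2)])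

text \<open>Sequences of simple functions that converge to \<open>\<phi>\<close> and \<open>g\<close> almost everywhere and in the Bochner norm, dominated by twice
  the norm of the limit.\<close>

definition "P_approx \<Phi> \<longleftrightarrow> (\<forall>k. simple_function \<mu> (\<Phi> k)) \<and> (\<forall>k. \<forall>t\<in>{0<..<T}. \<Phi> k t \<in> XP) \<and>
  (AE t in \<mu>. (%k. nP (%x. \<phi> t x - \<Phi> k t x)) \<longlonglongrightarrow> 0) \<and> (\<forall>k. \<forall>t\<in>{0<..<T}. nP (\<Phi> k t) <= 2 * A t) \<and>
  (\<forall>k. (%t. nP (%x. \<phi> t x - \<Phi> k t x)) \<in> Lp \<mu> (ennreal pb)) \<and>
  (%k. Lp_norm \<mu> (ennreal pb) (%t. nP (%x. \<phi> t x - \<Phi> k t x))) \<longlonglongrightarrow> 0"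

definition "G_approx G \<longleftrightarrow> (\<forall>k. simple_function \<mu> (G k)) \<and> (\<forall>k. \<forall>t\<in>{0<..<T}. G k t \<in> XG) \<and>
  (AE t in \<mu>. (%k. nG (%x. g t x - G k t x)) \<longlonglongrightarrow> 0) \<and> (\<forall>k. \<forall>t\<in>{0<..<T}. nG (G k t) <= 2 * B t) \<and>
  (\<forall>k. (%t. nG (%x. g t x - G k t x)) \<in> Lp \<mu> (ennreal p2)) \<and>
  (%k. Lp_norm \<mu> (ennreal p2) (%t. nG (%x. g t x - G k t x))) \<longlonglongrightarrow> 0"

lemma approx_ex: "\<exists>\<Phi>. P_approx \<Phi>" "\<exists>G. G_approx G"
proof -
  have tri: "nP (%x. a x - c x) <= nP (%x. a x - b x) + nP (%x. b x - c x)" if "a \<in> XP" "b \<in> XP" "c \<in> XP" for a b c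
    by (rule W1_norm_triangle[OF exponents(2)]) (rule W1_0_subset_W1, rule that)+
  have sym: "nP (%x. a x - b x) = nP (%x. b x - a x)" if "a \<in> XP" "b \<in> XP" for a b
    by (rule W1_norm_minus_commute[OF exponents(2)]) (rule W1_0_subset_W1, rule that)+
  show "\<exists>\<Phi>. P_approx \<Phi>"
  proof (rule bochner_simple_approximation[OF exponents(1) \<phi>_bochner zero_W1_0[OF exponents(2)] zero_W1(2)[OF exponents(2)] nP_nonneg tri sym])
    fix s assume "\<And>k. simple_function \<mu> (s k)" "\<And>k t. t \<in> {0<..<T} ==> s k t \<in> XP"
      "AE t in \<mu>. (%k. nP (%x. \<phi> t x - s k t x)) \<longlonglongrightarrow> 0" "\<And>k t. t \<in> {0<..<T} ==> nP (s k t) <= 2 * nP (\<phi> t)"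
      "\<And>k. (%t. nP (%x. \<phi> t x - s k t x)) \<in> Lp \<mu> (ennreal pb)"
      "(%k. Lp_norm \<mu> (ennreal pb) (%t. nP (%x. \<phi> t x - s k t x))) \<longlonglongrightarrow> 0"
    then have "P_approx s" by (auto simp: P_approx_def A_def)
    then show "\<exists>\<Phi>. P_approx \<Phi>" by blast
  qed
  show "\<exists>G. G_approx G"
  proof (rule bochner_simple_approximation[OF exponents(3) g_bochner zero_W1(1)[OF exponents(4)] zero_W1(2)[OF exponents(4)] nG_nonneg
      W1_norm_triangle[OF exponents(4)] W1_norm_minus_commute[OF exponents(4)]])
    fix s assume "\<And>k. simple_function \<mu> (s k)" "\<And>k t. t \<in> {0<..<T} ==> s k t \<in> XG"
      "AE t in \<mu>. (%k. nG (%x. g t x - s k t x)) \<longlonglongrightarrow> 0" "\<And>k t. t \<in> {0<..<T} ==> nG (s k t) <= 2 * nG (g t)"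
      "\<And>k. (%t. nG (%x. g t x - s k t x)) \<in> Lp \<mu> (ennreal p2)"
      "(%k. Lp_norm \<mu> (ennreal p2) (%t. nG (%x. g t x - s k t x))) \<longlonglongrightarrow> 0"
    then have "G_approx s" by (auto simp: G_approx_def B_def)
    then show "\<exists>G. G_approx G" by blast
  qed
qed

definition "\<Phi> = (SOME \<Phi>. P_approx \<Phi>)"
definition "G = (SOME G. G_approx G)"
definition "dP k t = nP (%x. \<phi> t x - \<Phi> k t x)"
definition "dG k t = nG (%x. g t x - G k t x)"

lemma approx: "P_approx \<Phi>" "G_approx G"
  unfolding \<Phi>_def G_def by (rule someI_ex[OF approx_ex(1)], rule someI_ex[OF approx_ex(2)])

lemma \<Phi>: "simple_function \<mu> (\<Phi> k)" "t \<in> {0<..<T} ==> \<Phi> k t \<in> XP" "AE t in \<mu>. (%k. dP k t) \<longlonglongrightarrow> 0"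
    "t \<in> {0<..<T} ==> nP (\<Phi> k t) <= 2 * A t" "dP k \<in> Lp \<mu> (ennreal pb)" "(%k. Lp_norm \<mu> (ennreal pb) (dP k)) \<longlonglongrightarrow> 0"
  using approx(1) unfolding P_approx_def dP_def[abs_def] by auto

lemma G: "simple_function \<mu> (G k)" "t \<in> {0<..<T} ==> G k t \<in> XG" "AE t in \<mu>. (%k. dG k t) \<longlonglongrightarrow> 0"
    "t \<in> {0<..<T} ==> nG (G k t) <= 2 * B t" "dG k \<in> Lp \<mu> (ennreal p2)" "(%k. Lp_norm \<mu> (ennreal p2) (dG k)) \<longlonglongrightarrow> 0"
  using approx(2) unfolding G_approx_def dG_def[abs_def] by auto

lemma time_Lp_integrable: "1 <= p ==> u \<in> Lp \<mu> (ennreal p) ==> integrable \<mu> u"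
  using Lp_subset_finite_measure[OF finite_measure_time _ _ , of 1 p u T] by (simp add: Lp_1)

lemma norms_integrable: "integrable \<mu> A" "integrable \<mu> B" "integrable \<mu> (dP k)" "integrable \<mu> (dG k)"
  using time_Lp_integrable exponents A_Lp B_Lp \<Phi>(5) G(5) by blast+

lemma norms_nonneg: "0 <= A t" "0 <= B t" "0 <= dP k t" "0 <= dG k t"
  by (simp_all add: A_def B_def dP_def dG_def nP_nonneg nG_nonneg)

lemma mollified_g:
  assumes eps: "0 < eps"
  shows "moll T eps g t \<in> XG"
    and "nG (%x. moll T eps g t x - moll T eps (G k) t x) <= (LINT s|\<mu>. tk eps (t - s) * dG k s)"
    and "(%k. nG (%x. moll T eps g t x - moll T eps (G k) t x)) \<longlonglongrightarrow> 0"
proof -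
  have "(%k. LINT t|\<mu>. dG k t) \<longlonglongrightarrow> 0"
  proof -
    obtain C where C: "0 <= C" "\<And>u. u \<in> Lp \<mu> (ennreal p2) ==> integrable \<mu> u \<and> (LINT x|\<mu>. \<bar>u x\<bar>) <= C * Lp_norm \<mu> (ennreal p2) u"
      using Lp_L1_bound[OF finite_measure_time exponents(3)] by blast
    have "norm (LINT t|\<mu>. dG k t) <= C * Lp_norm \<mu> (ennreal p2) (dG k)" for k
      unfolding real_norm_def by (rule order.trans[OF integral_abs_bound conjunct2[OF C(2)[OF G(5)]]])
    then show ?thesis by (rule Lim_null_comparison[OF always_eventually[OF allI] tendsto_mult_right_zero[OF G(6)]])
  qed
  note e = norms_integrable(4)[unfolded dG_def[abs_def]] this[unfolded dG_def]
  have d: "(%(t, x). g' t x) \<in> borel_measurable (\<mu> \<Otimes>\<^sub>M M)" "AE t in \<mu>. AE x in M. g t x = g' t x" "AE x in M. AE t in \<mu>. g t x = g' t x"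
    using g_datum by (auto simp: datum_def)
  note m = mollify_W1[OF exponents(4) eps G(1) G(2) AE_spaces(2) e d]
  show "moll T eps g t \<in> XG"
    "nG (%x. moll T eps g t x - moll T eps (G k) t x) <= (LINT s|\<mu>. tk eps (t - s) * dG k s)"
    "(%k. nG (%x. moll T eps g t x - moll T eps (G k) t x)) \<longlonglongrightarrow> 0"
    unfolding dG_def by (rule m; assumption)+
qed

lemma mollified_G:
  assumes eps: "0 < eps"
  shows "moll T eps (G k) t \<in> XG"
    and "nG (moll T eps (G k) t) <= (LINT s|\<mu>. tk eps (t - s) * (2 * B s))"
proof -
  note m = mollify_simple[OF exponents(4) eps G(1) G(2)]
  have k0: "0 <= tk eps (t - s)" for s using mollifier_kernelD(2)[OF \<eta>] eps by (simp add: time_kernel_def)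
  show "moll T eps (G k) t \<in> XG" by (rule m)
  have "nG (moll T eps (G k) t) <= (LINT s|\<mu>. tk eps (t - s) * nG (G k s))" by (rule m)
  also have "... <= (LINT s|\<mu>. tk eps (t - s) * (2 * B s))"
  proof (rule integral_mono)
    show "integrable \<mu> (%s. tk eps (t - s) * nG (G k s))"
      by (rule integral_simple_sum(1)[OF G(1) time_kernel_integrable[OF \<eta> eps]])
    show "integrable \<mu> (%s. tk eps (t - s) * (2 * B s))"
      by (rule integrable_conv[OF time_kernel_props(1)[OF \<eta> eps] time_measurable_set]) (use norms_integrable(2) in simp)
    show "tk eps (t - s) * nG (G k s) <= tk eps (t - s) * (2 * B s)" if "s \<in> space \<mu>" for s
      using G(4)[of s k] that k0 by (intro mult_left_mono) auto
  qed
  finally show "nG (moll T eps (G k) t) <= (LINT s|\<mu>. tk eps (t - s) * (2 * B s))" .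
qed

text \<open>The products \<open>\<phi>(t) g\<^sub>\<epsilon>(t)\<close> vary with \<open>t\<close>, so measurability of \<open>\<langle>F(t), w\<rangle>\<close> for fixed \<open>w\<close> does not apply directly; for simple approximations the
  function is a finite sum of measurable ones, and the limit exists in \<open>W\<^sub>0\<^sup>1\<^sup>,\<^sup>r\<close> for almost every \<open>t\<close>.\<close>

lemma functional_measurable:
  assumes eps: "0 < eps"
  shows "(%t. F t (%x. \<phi> t x * moll T eps g t x)) \<in> borel_measurable \<mu>"
proof (rule borel_measurable_lebesgue_on_LIMSEQ[OF time_measurable_set(1)])
  interpret T: sigma_finite_measure \<mu> by (rule sfT)
  let ?c = "%k b t. LINT s|\<mu>. tk eps (t - s) * indicator (G k -` {b} \<inter> space \<mu>) s"
  let ?S = "%k t. \<Sum>b\<in>G k ` {0<..<T}. ?c k b t * F t (%x. \<Phi> k t x * b x)"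
  show "?S k \<in> borel_measurable \<mu>" for k
  proof (rule borel_measurable_sum)
    fix b assume "b \<in> G k ` {0<..<T}"
    then have b: "b \<in> XG" using G(2) by auto
    have "(%t. F t (%x. a x * b x)) \<in> borel_measurable \<mu>" if "a \<in> \<Phi> k ` space \<mu>" for a
      using that \<Phi>(2) by (intro F_properties(4) product(1) b) auto
    from simple_dependent_measurable[OF \<Phi>(1) this]
    have 1: "(%t. F t (%x. \<Phi> k t x * b x)) \<in> borel_measurable \<mu>" .
    have "(%z. tk eps (fst z - snd z) * indicator (G k -` {b} \<inter> space \<mu>) (snd z)) \<in> borel_measurable (\<mu> \<Otimes>\<^sub>M \<mu>)"
      by (rule borel_measurable_times[OF kernel_difference_measurable[OF time_kernel_props(1)[OF \<eta> eps]]
          measurable_compose[OF measurable_snd borel_measurable_indicator[OF simple_functionD(2)[OF G(1)]]]])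
    then have "(%(t, s). tk eps (t - s) * indicator (G k -` {b} \<inter> space \<mu>) s) \<in> borel_measurable (\<mu> \<Otimes>\<^sub>M \<mu>)"
      by (simp add: split_beta')
    from borel_measurable_times[OF T.borel_measurable_lebesgue_integral[OF this] 1]
    show "(%t. ?c k b t * F t (%x. \<Phi> k t x * b x)) \<in> borel_measurable \<mu>" .
  qed
  show "AE t in \<mu>. (%k. ?S k t) \<longlonglongrightarrow> F t (%x. \<phi> t x * moll T eps g t x)"
    using AE_time AE_spaces(1) F_properties(1) \<Phi>(3)
  proof eventually_elim
    case (elim t)
    let ?m = "moll T eps g t" and ?M = "%k. moll T eps (G k) t"
    let ?d = "%k. nG (%x. ?m x - ?M k x)"
    have S: "?S k t = F t (%x. \<Phi> k t x * ?M k x)" for k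
    proof -
      have "?c k b t = (LINT s|\<mu>. tk eps (t - s) * indicator (G k -` {b}) s)" for b
        by (rule Lintegral_cong) (auto simp: indicator_def)
      then show ?thesis using functional_mollify_simple[OF eps G(1) G(2) \<Phi>(2)[OF elim(1)] elim(3), where t = t] by simp
    qed
    have le: "norm (?S k t - F t (%x. \<phi> t x * ?m x)) <= \<bar>N t\<bar> * (nP (\<phi> t) * ?d k + dP k t * (LINT s|\<mu>. tk eps (t - s) * (2 * B s)))" for k
    proof -
      note pr = product(1)[OF elim(2) mollified_g(1)[OF eps]] product(1)[OF \<Phi>(2)[OF elim(1)] mollified_G(1)[OF eps]]
      have "\<bar>F t (%x. \<phi> t x * ?m x) - F t (%x. \<Phi> k t x * ?M k x)\<bar> <= N t * nW (%x. \<phi> t x * ?m x - \<Phi> k t x * ?M k x)"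
        unfolding N_def by (rule W_minus1_diff(2)[OF elim(3) pr])
      also have "... <= \<bar>N t\<bar> * nW (%x. \<phi> t x * ?m x - \<Phi> k t x * ?M k x)" by (rule mult_right_mono[OF abs_ge_self nW_nonneg])
      also have "... <= \<bar>N t\<bar> * (nP (\<phi> t) * ?d k + dP k t * nG (?M k))"
        unfolding dP_def by (intro mult_left_mono product_diff elim \<Phi>(2) mollified_g mollified_G eps) auto
      also have "... <= \<bar>N t\<bar> * (nP (\<phi> t) * ?d k + dP k t * (LINT s|\<mu>. tk eps (t - s) * (2 * B s)))"
        by (intro mult_left_mono add_left_mono mollified_G eps norms_nonneg) auto
      finally show ?thesis unfolding S by (simp add: abs_minus_commute)
    qed
    have "(%k. \<bar>N t\<bar> * (nP (\<phi> t) * ?d k + dP k t * (LINT s|\<mu>. tk eps (t - s) * (2 * B s)))) \<longlonglongrightarrow>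
        \<bar>N t\<bar> * (nP (\<phi> t) * 0 + 0 * (LINT s|\<mu>. tk eps (t - s) * (2 * B s)))"
      by (intro tendsto_mult tendsto_add tendsto_const mollified_g(3)[OF eps] elim(4))
    then have "(%k. \<bar>N t\<bar> * (nP (\<phi> t) * ?d k + dP k t * (LINT s|\<mu>. tk eps (t - s) * (2 * B s)))) \<longlonglongrightarrow> 0" by simp
    from Lim_null_comparison[OF always_eventually[OF allI[OF le]] this] show ?case by (rule LIM_zero_cancel)
  qed
qed

end

context commutator_data
begin

abbreviation "tent_conv eps \<equiv> conv {0<..<T} (tent eps)"

text \<open>For simple data only these scalar functions of time occur, and the sets on which \<open>G k\<close> takes a given value.\<close>

definition "duality a b s = F s (%x. a x * b x)"
definition "cell k b = (indicator (G k -` {b} \<inter> space \<mu>) :: real => real)"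

definition "oscillation_at eps h t = (LINT r|\<mu>. tent eps (t - r) * \<bar>h r - h t\<bar>)"

definition "simple_oscillation k eps t = (\<Sum>a\<in>\<Phi> k ` {0<..<T}. \<Sum>b\<in>G k ` {0<..<T}.
  oscillation_at eps (duality a b) t + oscillation_at eps (%r. duality a b r * cell k b r) t)"

definition "approximation_error k eps t =
  (8 * tent_conv eps (%r. \<bar>N r\<bar>) t + \<bar>N t\<bar>) * (A t * tent_conv eps (dG k) t + dP k t * (2 * tent_conv eps B t))"

lemma tent_conv_nonneg: "0 < eps ==> (\<And>s. 0 <= u s) ==> 0 <= tent_conv eps u t"
  unfolding conv_def by (intro Lintegral_nonneg mult_nonneg_nonneg tent_props(2)) auto

lemma error_nonneg: "0 < eps ==> 0 <= approximation_error k eps t"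
  unfolding approximation_error_def
  by (intro mult_nonneg_nonneg add_nonneg_nonneg tent_conv_nonneg norms_nonneg) auto

lemma oscillation_nonneg: "0 < eps ==> 0 <= oscillation_at eps h t" "0 < eps ==> 0 <= simple_oscillation k eps t"
proof -
  assume eps: "0 < eps"
  show o: "0 <= oscillation_at eps h t" for h
    unfolding oscillation_at_def by (intro Lintegral_nonneg mult_nonneg_nonneg tent_props(2) eps) auto
  show "0 <= simple_oscillation k eps t" unfolding simple_oscillation_def by (intro sum_nonneg add_nonneg_nonneg o)
qed

lemma tri_cong:
  assumes "AE x in M. a x = a' x" "AE x in M. b x = b' x" "a' \<in> borel_measurable M" "b' \<in> borel_measurable M" "c \<in> borel_measurable M"
  shows "(LINT x|M. c x * (a x * b x)) = tri a' b' c"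
  unfolding tri_def
proof (rule integral_cong_AE_complete[OF region_properties(1)[OF D]])
  show "(%x. a' x * b' x * c x) \<in> borel_measurable M" using assms(3-5) by (intro borel_measurable_times)
  show "AE x in M. c x * (a x * b x) = a' x * b' x * c x" using assms(1,2) by eventually_elim simp
qed

text \<open>Replacing \<open>\<phi>\<close>, \<open>g\<close> by simple functions costs only the approximation error, uniformly in \<open>\<epsilon>\<close>.\<close>

lemma increment_error:
  assumes eps: "0 < eps" and C: "0 <= C" "\<And>z. \<bar>tk' eps z\<bar> <= C / eps * tent eps z"
    and t: "t \<in> {0<..<T}" "\<phi> t \<in> XP" and s: "s \<in> {0<..<T}" "g s \<in> XG"
  shows "\<bar>tk' eps (t - s) * (LINT r|\<mu>. oriented t s r * F r (%x. \<phi> t x * g s x)) -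
      tk' eps (t - s) * (LINT r|\<mu>. oriented t s r * F r (%x. \<Phi> k t x * G k s x))\<bar> <=
    8 * C * tent_conv eps (%r. \<bar>N r\<bar>) t * (A t * (tent eps (t - s) * dG k s) + dP k t * (2 * (tent eps (t - s) * B s)))"
proof -
  let ?w = "%x. \<phi> t x * g s x" and ?v = "%x. \<Phi> k t x * G k s x"
  let ?h = "%r. F r ?w - F r ?v" and ?d = "A t * dG k s + dP k t * (2 * B s)"
  have w: "?w \<in> XW" "?v \<in> XW" using product(1)[OF t(2) s(2)] product(1)[OF \<Phi>(2)[OF t(1)] G(2)[OF s(1)]] .
  have h: "integrable \<mu> ?h" by (intro Lintegrable_diff F_properties(5) w)
  have iN: "integrable \<mu> (%r. \<bar>N r\<bar>)" using F_properties(3) by simp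
  have d: "nW (%x. ?w x - ?v x) <= ?d"
  proof -
    have "nW (%x. ?w x - ?v x) <= A t * dG k s + dP k t * nG (G k s)"
      unfolding A_def dG_def dP_def by (rule product_diff[OF t(2) \<Phi>(2)[OF t(1)] s(2) G(2)[OF s(1)]])
    also have "... <= ?d" by (intro add_left_mono mult_left_mono G(4) s norms_nonneg)
    finally show ?thesis .
  qed
  have "(LINT r|\<mu>. tent eps (t - r) * \<bar>?h r\<bar>) <= (LINT r|\<mu>. (tent eps (t - r) * \<bar>N r\<bar>) * ?d)"
  proof (rule integral_mono_AE)
    show "integrable \<mu> (%r. tent eps (t - r) * \<bar>?h r\<bar>)" by (rule integrable_tent[OF eps]) (use h in simp)
    show "integrable \<mu> (%r. (tent eps (t - r) * \<bar>N r\<bar>) * ?d)" by (rule integrable_mult_left) (rule integrable_tent[OF eps iN])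
    show "AE r in \<mu>. tent eps (t - r) * \<bar>?h r\<bar> <= (tent eps (t - r) * \<bar>N r\<bar>) * ?d"
      using F_properties(1)
    proof eventually_elim
      case (elim r)
      have "\<bar>?h r\<bar> <= N r * nW (%x. ?w x - ?v x)" unfolding N_def by (rule W_minus1_diff(2)[OF elim w])
      also have "... <= \<bar>N r\<bar> * nW (%x. ?w x - ?v x)" by (rule mult_right_mono[OF abs_ge_self nW_nonneg])
      also have "... <= \<bar>N r\<bar> * ?d" by (rule mult_left_mono[OF d abs_ge_zero])
      finally show ?case unfolding mult.assoc by (rule mult_left_mono[OF _ tent_props(2)[OF eps]])
    qed
  qed
  also have "... = tent_conv eps (%r. \<bar>N r\<bar>) t * ?d" by (simp add: conv_def)
  finally have le: "(LINT r|\<mu>. tent eps (t - r) * \<bar>?h r\<bar>) <= tent_conv eps (%r. \<bar>N r\<bar>) t * ?d" .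
  have "(LINT r|\<mu>. oriented t s r * ?h r) = (LINT r|\<mu>. oriented t s r * F r ?w) - (LINT r|\<mu>. oriented t s r * F r ?v)"
    using integrable_oriented[OF F_properties(5)[OF w(1)]] integrable_oriented[OF F_properties(5)[OF w(2)]]
    by (simp add: right_diff_distrib)
  then have "\<bar>tk' eps (t - s) * (LINT r|\<mu>. oriented t s r * F r ?w) - tk' eps (t - s) * (LINT r|\<mu>. oriented t s r * F r ?v)\<bar> =
      \<bar>tk' eps (t - s) * (LINT r|\<mu>. oriented t s r * ?h r)\<bar>" by (simp only: right_diff_distrib)
  also have "... <= 8 * C * tent eps (t - s) * (LINT r|\<mu>. tent eps (t - r) * \<bar>?h r\<bar>)"
    by (rule kernel_increment_bound[OF \<eta> eps h C(1) C(2)])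
  also have "... <= 8 * C * tent eps (t - s) * (tent_conv eps (%r. \<bar>N r\<bar>) t * ?d)"
    by (intro mult_left_mono[OF le] mult_nonneg_nonneg tent_props(2)[OF eps] C) auto
  also have "... = 8 * C * tent_conv eps (%r. \<bar>N r\<bar>) t * (A t * (tent eps (t - s) * dG k s) + dP k t * (2 * (tent eps (t - s) * B s)))"
    by (simp add: algebra_simps)
  finally show ?thesis .
qed

text \<open>The term with \<open>F(t)\<close> is compared directly, using the norm of \<open>g\<^sub>\<epsilon>(t)\<close> in the Sobolev space.\<close>

lemma functional_error:
  assumes eps: "0 < eps" and C: "\<And>z. \<bar>tk eps z\<bar> <= C * tent eps z"
    and t: "t \<in> {0<..<T}" "\<phi> t \<in> XP" "F t \<in> W_minus1 D q1"
  shows "\<bar>F t (%x. \<phi> t x * moll T eps g t x) - F t (%x. \<Phi> k t x * moll T eps (G k) t x)\<bar> <=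
    C * \<bar>N t\<bar> * (A t * tent_conv eps (dG k) t + dP k t * (2 * tent_conv eps B t))"
proof -
  let ?m = "moll T eps g t" and ?n = "moll T eps (G k) t"
  have tk: "(LINT s|\<mu>. tk eps (t - s) * u s) <= C * tent_conv eps u t" if u: "integrable \<mu> u" "\<And>s. 0 <= u s" for u
  proof -
    have "(LINT s|\<mu>. tk eps (t - s) * u s) <= (LINT s|\<mu>. C * (tent eps (t - s) * u s))"
    proof (rule integral_mono)
      show "integrable \<mu> (%s. tk eps (t - s) * u s)"
        by (rule integrable_conv[OF time_kernel_props(1)[OF \<eta> eps] time_measurable_set u(1)])
      show "integrable \<mu> (%s. C * (tent eps (t - s) * u s))" by (rule integrable_mult_right[OF integrable_tent[OF eps u(1)]])
      show "tk eps (t - s) * u s <= C * (tent eps (t - s) * u s)" for s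
        using mult_right_mono[OF abs_le_D1[OF C[of "t - s"]] u(2)] by (simp add: mult.assoc)
    qed
    then show ?thesis by (simp add: conv_def)
  qed
  have m: "nG (%x. ?m x - ?n x) <= C * tent_conv eps (dG k) t"
    using mollified_g(2)[OF eps, of t k] tk[OF norms_integrable(4) norms_nonneg(4), of k] by linarith
  have n: "nG ?n <= C * (2 * tent_conv eps B t)"
  proof -
    have "tent_conv eps (%s. 2 * B s) t = 2 * tent_conv eps B t" by (simp add: conv_def mult.left_commute)
    then show ?thesis using mollified_G(2)[OF eps, of k t] tk[of "%s. 2 * B s"] norms_integrable(2) norms_nonneg(2) by simp
  qed
  have "\<bar>F t (%x. \<phi> t x * ?m x) - F t (%x. \<Phi> k t x * ?n x)\<bar> <= N t * nW (%x. \<phi> t x * ?m x - \<Phi> k t x * ?n x)"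
    unfolding N_def by (rule W_minus1_diff(2)[OF t(3) product(1)[OF t(2) mollified_g(1)[OF eps]] product(1)[OF \<Phi>(2)[OF t(1)] mollified_G(1)[OF eps]]])
  also have "... <= \<bar>N t\<bar> * nW (%x. \<phi> t x * ?m x - \<Phi> k t x * ?n x)" by (rule mult_right_mono[OF abs_ge_self nW_nonneg])
  also have "... <= \<bar>N t\<bar> * (A t * nG (%x. ?m x - ?n x) + dP k t * nG ?n)"
    unfolding A_def dP_def by (intro mult_left_mono product_diff t \<Phi>(2) mollified_g(1) mollified_G(1) eps) auto
  also have "... <= \<bar>N t\<bar> * (A t * (C * tent_conv eps (dG k) t) + dP k t * (C * (2 * tent_conv eps B t)))"
    by (intro mult_left_mono add_mono m n norms_nonneg) auto
  also have "... = C * \<bar>N t\<bar> * (A t * tent_conv eps (dG k) t + dP k t * (2 * tent_conv eps B t))" by (simp add: algebra_simps)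
  finally show ?thesis .
qed

text \<open>At almost every time the commutator differs from that of the simple functions by the approximation error, and the latter
  is a sum of scalar commutators. By \<open>time_kernel_bounds\<close> one constant \<open>C\<close> serves all \<open>\<epsilon>\<close>.\<close>

lemma pointwise_bound:
  assumes eps: "0 < eps"
    and C: "0 <= C" "\<And>z. \<bar>tk eps z\<bar> <= C * tent eps z" "\<And>z. \<bar>tk' eps z\<bar> <= C / eps * tent eps z"
  shows "AE t in \<mu>. \<bar>(LINT s|\<mu>. E1 eps \<phi>' g' (t, s) - E2 eps \<phi>' g' (t, s)) -
      interior_time eps t * F t (%x. \<phi> t x * moll T eps g t x)\<bar> <=
    10 * C * simple_oscillation k eps t + C * approximation_error k eps t"
proof -
  interpret T: sigma_finite_measure \<mu> by (rule sfT)
  interpret TT: pair_sigma_finite \<mu> \<mu> ..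
  note EI = E_integrable[OF eps \<phi>_datum g_datum A_Lp B_Lp]
  have dG: "AE s in \<mu>. AE x in M. g s x = g' s x" "(%(t, x). g' t x) \<in> borel_measurable (\<mu> \<Otimes>\<^sub>M M)"
    and dP: "AE t in \<mu>. AE x in M. \<phi> t x = \<phi>' t x" "(%(t, x). \<phi>' t x) \<in> borel_measurable (\<mu> \<Otimes>\<^sub>M M)"
    using g_datum \<phi>_datum by (auto simp: datum_def)
  show ?thesis
    using AE_time AE_spaces(1) F_properties(1) weak_increment_product[OF \<phi>_bochner g_bochner] dP(1)
      TT.AE_integrable_fst'[OF EI(1)] TT.AE_integrable_fst'[OF EI(2)]
  proof eventually_elim
    case (elim t)
    show ?case
    proof (cases "t \<in> {eps<..<T - eps}")
      case False
      then have "interior_time eps t = 0" by (simp add: interior_time_def)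
      then have "(LINT s|\<mu>. E1 eps \<phi>' g' (t, s) - E2 eps \<phi>' g' (t, s)) - interior_time eps t * F t (%x. \<phi> t x * moll T eps g t x) = 0"
        by (simp add: E1_def E2_def)
      moreover have "0 <= 10 * C * simple_oscillation k eps t + C * approximation_error k eps t"
        by (intro add_nonneg_nonneg mult_nonneg_nonneg C oscillation_nonneg error_nonneg eps) auto
      ultimately show ?thesis by simp
    next
      case True
      then have i1: "interior_time eps t = 1" by (simp add: interior_time_def)
      let ?U = "%s. tk' eps (t - s) * (LINT r|\<mu>. oriented t s r * F r (%x. \<phi> t x * g s x))"
      let ?V = "%s. tk' eps (t - s) * (LINT r|\<mu>. oriented t s r * F r (%x. \<Phi> k t x * G k s x))"
      let ?Z = "%s. E1 eps \<phi>' g' (t, s) - E2 eps \<phi>' g' (t, s)"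
      have sec: "f' s \<in> borel_measurable M" "g' s \<in> borel_measurable M" "\<phi>' s \<in> borel_measurable M" if "s \<in> {0<..<T}" for s
        using datum_section[OF f'_measurable that] datum_section[OF dG(2) that] datum_section[OF dP(2) that] by auto
      have ZU: "AE s in \<mu>. ?Z s = ?U s"
        using elim(4) dG(1) AE_time
      proof eventually_elim
        case (elim s)
        note tc = tri_cong[OF \<open>AE x in M. \<phi> t x = \<phi>' t x\<close> elim(2) sec(3)[OF \<open>t \<in> {0<..<T}\<close>] sec(2)[OF elim(3)]]
        show ?case using elim(1) unfolding tc[OF sec(1)[OF elim(3)]] tc[OF sec(1)[OF \<open>t \<in> {0<..<T}\<close>]]
          by (simp add: E1_def E2_def i1 right_diff_distrib[symmetric])
      qed
      have Zi: "integrable \<mu> ?Z" using elim(6,7) by simp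
      have Ui: "integrable \<mu> ?U"
        by (rule integrable_cong_AE_imp[OF Zi borel_measurable_lebesgue_on_AE[OF time_measurable_set(1) borel_measurable_integrable[OF Zi] ZU]])
          (use ZU in eventually_elim, simp)
      have ZUi: "(LINT s|\<mu>. ?Z s) = (LINT s|\<mu>. ?U s)" using Zi Ui ZU by (intro integral_cong_AE) auto
      note sc = simple_commutator_bound[OF eps True elim(3) C G(1) G(2) \<Phi>(2)[OF elim(1)], of k k]
      have Vi: "integrable \<mu> ?V" by (rule sc(1))
      let ?cN = "tent_conv eps (%r. \<bar>N r\<bar>) t" and ?e = "A t * tent_conv eps (dG k) t + dP k t * (2 * tent_conv eps B t)"
      let ?b = "%s. 8 * C * ?cN * (A t * (tent eps (t - s) * dG k s) + dP k t * (2 * (tent eps (t - s) * B s)))"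
      note it = integrable_tent[OF eps norms_integrable(4)[of k], of t] integrable_tent[OF eps norms_integrable(2), of t]
      have "\<bar>(LINT s|\<mu>. ?U s) - (LINT s|\<mu>. ?V s)\<bar> = \<bar>LINT s|\<mu>. ?U s - ?V s\<bar>" using Ui Vi by simp
      also have "... <= (LINT s|\<mu>. \<bar>?U s - ?V s\<bar>)" by (rule integral_abs_bound)
      also have "... <= (LINT s|\<mu>. ?b s)"
      proof (rule integral_mono_AE)
        show "integrable \<mu> (%s. \<bar>?U s - ?V s\<bar>)" using Ui Vi by simp
        show "integrable \<mu> ?b" using it by (intro integrable_mult_right Lintegrable_add)
        show "AE s in \<mu>. \<bar>?U s - ?V s\<bar> <= ?b s"
          using AE_time AE_spaces(2)
        proof eventually_elim
          case (elim s)
          then show ?case by (rule increment_error[OF eps C(1,3) \<open>t \<in> {0<..<T}\<close> \<open>\<phi> t \<in> XP\<close>])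
        qed
      qed
      also have "... = 8 * C * ?cN * ?e" using it by (simp add: conv_def)
      finally have UV: "\<bar>(LINT s|\<mu>. ?U s) - (LINT s|\<mu>. ?V s)\<bar> <= 8 * C * ?cN * ?e" .
      have osc: "\<bar>(LINT s|\<mu>. ?V s) - F t (%x. \<Phi> k t x * moll T eps (G k) t x)\<bar> <= 10 * C * simple_oscillation k eps t"
      proof -
        let ?o = "%a. \<Sum>b\<in>G k ` {0<..<T}. oscillation_at eps (duality a b) t + oscillation_at eps (%r. duality a b r * cell k b r) t"
        have fin: "finite (\<Phi> k ` {0<..<T})" using \<Phi>(1)[of k] by (simp add: simple_function_def)
        have "?o (\<Phi> k t) <= (\<Sum>a\<in>\<Phi> k ` {0<..<T}. ?o a)"
          by (rule member_le_sum[OF _ _ fin]) (use elim(1) in \<open>auto intro!: sum_nonneg add_nonneg_nonneg oscillation_nonneg eps\<close>)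
        then have "10 * C * ?o (\<Phi> k t) <= 10 * C * simple_oscillation k eps t"
          unfolding simple_oscillation_def using C(1) by (intro mult_left_mono) auto
        with sc(2) show ?thesis unfolding oscillation_at_def duality_def cell_def by (rule order.trans)
      qed
      note fe = functional_error[OF eps C(2) elim(1-3), of k]
      have "C * approximation_error k eps t = 8 * C * ?cN * ?e + C * \<bar>N t\<bar> * ?e"
        unfolding approximation_error_def by (simp only: distrib_right distrib_left mult_ac)
      then show ?thesis using UV osc fe unfolding ZUi i1 by linarith
    qed
  qed
qed

end

context commutator_data
begin

lemma p1: "1 <= p1" using ct(1) by (auto simp: conjugate_exponents_def)

text \<open>Averaging with the tent does not increase the norms, so these integrals are bounded independently of \<open>\<epsilon>\<close>.\<close>

lemma error_term_integral:
  assumes eps: "0 < eps" and a: "a \<in> Lp \<mu> (ennreal pb)" "\<And>t. 0 <= a t" and u: "u \<in> Lp \<mu> (ennreal p2)" "\<And>t. 0 <= u t"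
    and n: "n \<in> Lp \<mu> p1" "\<And>t. 0 <= n t" "Lp_norm \<mu> p1 n <= c"
  shows "integrable \<mu> (%t. a t * tent_conv eps u t * n t)"
    and "(LINT t|\<mu>. a t * tent_conv eps u t * n t) <= c * (Lp_norm \<mu> (ennreal pb) a * Lp_norm \<mu> (ennreal p2) u)"
proof -
  have p2: "1 <= ennreal p2" using exponents(3) by (simp add: ennreal_ge_1)
  have p0: "0 < pb" "0 < p2" using exponents by auto
  note cu = conv_tent_Lp[OF eps p2 u(1)]
  note h = time_hoelder[OF a(1) cu(1) n(1)]
  show "integrable \<mu> (%t. a t * tent_conv eps u t * n t)" by (rule h(1))
  have "(LINT t|\<mu>. a t * tent_conv eps u t * n t) <= (LINT t|\<mu>. \<bar>a t * tent_conv eps u t * n t\<bar>)"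
    by (rule integral_mono) (use h(1) in auto)
  also have "... <= Lp_norm \<mu> (ennreal pb) a * Lp_norm \<mu> (ennreal p2) (tent_conv eps u) * Lp_norm \<mu> p1 n" by (rule h(2))
  also have "... <= Lp_norm \<mu> (ennreal pb) a * Lp_norm \<mu> (ennreal p2) u * c"
    by (intro mult_mono mult_left_mono cu(2) n(3) mult_nonneg_nonneg Lp_norm_nonneg p0 Lp_norm_nonneg_conj[OF ct(1)])
  finally show "(LINT t|\<mu>. a t * tent_conv eps u t * n t) <= c * (Lp_norm \<mu> (ennreal pb) a * Lp_norm \<mu> (ennreal p2) u)"
    by (simp add: mult_ac)
qed

definition "total_error k = 9 * Lp_norm \<mu> p1 N *
  (Lp_norm \<mu> (ennreal pb) A * Lp_norm \<mu> (ennreal p2) (dG k) + 2 * (Lp_norm \<mu> (ennreal pb) (dP k) * Lp_norm \<mu> (ennreal p2) B))"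

lemma total_error_tendsto_0: "total_error \<longlonglongrightarrow> 0"
proof -
  have "total_error \<longlonglongrightarrow> 9 * Lp_norm \<mu> p1 N * (Lp_norm \<mu> (ennreal pb) A * 0 + 2 * (0 * Lp_norm \<mu> (ennreal p2) B))"
    unfolding total_error_def[abs_def] by (intro tendsto_mult tendsto_add tendsto_const G(6) \<Phi>(6))
  then show ?thesis by simp
qed

lemma error_integral:
  assumes eps: "0 < eps"
  shows "integrable \<mu> (approximation_error k eps)" "(LINT t|\<mu>. approximation_error k eps t) <= total_error k"
proof -
  let ?n = "tent_conv eps (%r. \<bar>N r\<bar>)" and ?c = "Lp_norm \<mu> p1 N"
  have aN: "(%r. \<bar>N r\<bar>) \<in> Lp \<mu> p1" "Lp_norm \<mu> p1 (%r. \<bar>N r\<bar>) <= ?c"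
    by (rule Lp_abs(1)[OF F_properties(2)], rule eq_refl[OF Lp_abs(2)])
  have n: "?n \<in> Lp \<mu> p1" "\<And>t. 0 <= ?n t" "Lp_norm \<mu> p1 ?n <= ?c"
    using conv_tent_Lp[OF eps p1 aN(1)] aN(2) tent_conv_nonneg[OF eps] by auto
  note et = error_term_integral[OF eps A_Lp norms_nonneg(1) G(5) norms_nonneg(4)] error_term_integral[OF eps \<Phi>(5) norms_nonneg(3) B_Lp norms_nonneg(2)]
  note e1 = et[OF n] and e2 = et[OF aN(1) abs_ge_zero aN(2)]
  let ?X1 = "%t. A t * tent_conv eps (dG k) t * ?n t" and ?X2 = "%t. dP k t * tent_conv eps B t * ?n t"
    and ?Y1 = "%t. A t * tent_conv eps (dG k) t * \<bar>N t\<bar>" and ?Y2 = "%t. dP k t * tent_conv eps B t * \<bar>N t\<bar>"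
  have i: "integrable \<mu> ?X1" "integrable \<mu> ?X2" "integrable \<mu> ?Y1" "integrable \<mu> ?Y2" by (rule e1 e2)+
  have eq: "approximation_error k eps t = 8 * ?X1 t + 16 * ?X2 t + ?Y1 t + 2 * ?Y2 t" for t
    unfolding approximation_error_def by (simp add: algebra_simps)
  show "integrable \<mu> (approximation_error k eps)" unfolding eq[abs_def] using i by simp
  have "(LINT t|\<mu>. approximation_error k eps t) = 8 * (LINT t|\<mu>. ?X1 t) + 16 * (LINT t|\<mu>. ?X2 t) + (LINT t|\<mu>. ?Y1 t) + 2 * (LINT t|\<mu>. ?Y2 t)"
    unfolding eq using i by simp
  also have "... <= total_error k"
    using e1(2)[of k] e1(4)[of k] e2(2)[of k] e2(4)[of k] unfolding total_error_def distrib_left by linarith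
  finally show "(LINT t|\<mu>. approximation_error k eps t) <= total_error k" .
qed

definition "total_oscillation k eps = (\<Sum>a\<in>\<Phi> k ` {0<..<T}. \<Sum>b\<in>G k ` {0<..<T}.
  mean_oscillation T (duality a b) eps + mean_oscillation T (%r. duality a b r * cell k b r) eps)"

lemma duality_integrable:
  assumes "a \<in> \<Phi> k ` {0<..<T}" "b \<in> G k ` {0<..<T}"
  shows "integrable \<mu> (duality a b)" "integrable \<mu> (%r. duality a b r * cell k b r)"
proof -
  have "a \<in> XP" "b \<in> XG" using assms \<Phi>(2) G(2) by auto
  then show i: "integrable \<mu> (duality a b)" unfolding duality_def[abs_def] by (intro F_properties(5) product(1))
  show "integrable \<mu> (%r. duality a b r * cell k b r)"
    unfolding cell_def by (rule integrable_real_mult_indicator[OF simple_functionD(2)[OF G(1)] i])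
qed

lemma oscillation_integral:
  assumes eps: "0 < eps"
  shows "integrable \<mu> (simple_oscillation k eps)" "(LINT t|\<mu>. simple_oscillation k eps t) = total_oscillation k eps"
proof -
  have i: "integrable \<mu> (oscillation_at eps h)" "(LINT t|\<mu>. oscillation_at eps h t) = mean_oscillation T h eps" if "integrable \<mu> h" for h
    using mean_oscillation_integrable(1)[OF eps that] by (simp_all add: oscillation_at_def[abs_def] mean_oscillation_def)
  have di: "integrable \<mu> (%t. oscillation_at eps (duality a b) t + oscillation_at eps (%r. duality a b r * cell k b r) t)"
    if "a \<in> \<Phi> k ` {0<..<T}" "b \<in> G k ` {0<..<T}" for a b
    by (rule Lintegrable_add[OF i(1)[OF duality_integrable(1)[OF that]] i(1)[OF duality_integrable(2)[OF that]]])
  have dI: "(LINT t|\<mu>. (oscillation_at eps (duality a b) t + oscillation_at eps (%r. duality a b r * cell k b r) t)) =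
      mean_oscillation T (duality a b) eps + mean_oscillation T (%r. duality a b r * cell k b r) eps"
    if "a \<in> \<Phi> k ` {0<..<T}" "b \<in> G k ` {0<..<T}" for a b
    using Lintegral_add[OF i(1)[OF duality_integrable(1)[OF that]] i(1)[OF duality_integrable(2)[OF that]]]
    unfolding i(2)[OF duality_integrable(1)[OF that]] i(2)[OF duality_integrable(2)[OF that]] .
  show "integrable \<mu> (simple_oscillation k eps)"
    unfolding simple_oscillation_def[abs_def] by (rule Lintegrable_sum, rule Lintegrable_sum, rule di)
  show "(LINT t|\<mu>. simple_oscillation k eps t) = total_oscillation k eps"
    unfolding simple_oscillation_def total_oscillation_def
  proof (subst Lintegral_sum)
    fix a assume a: "a \<in> \<Phi> k ` {0<..<T}"
    show "integrable \<mu> (%t. \<Sum>b\<in>G k ` {0<..<T}. oscillation_at eps (duality a b) t + oscillation_at eps (%r. duality a b r * cell k b r) t)"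
      by (rule Lintegrable_sum[OF di[OF a]])
  next
    show "(\<Sum>a\<in>\<Phi> k ` {0<..<T}. LINT t|\<mu>. (\<Sum>b\<in>G k ` {0<..<T}. oscillation_at eps (duality a b) t + oscillation_at eps (%r. duality a b r * cell k b r) t)) =
        (\<Sum>a\<in>\<Phi> k ` {0<..<T}. \<Sum>b\<in>G k ` {0<..<T}. mean_oscillation T (duality a b) eps + mean_oscillation T (%r. duality a b r * cell k b r) eps)"
    proof (rule sum.cong[OF refl])
      fix a assume a: "a \<in> \<Phi> k ` {0<..<T}"
      have "(LINT t|\<mu>. (\<Sum>b\<in>G k ` {0<..<T}. oscillation_at eps (duality a b) t + oscillation_at eps (%r. duality a b r * cell k b r) t)) =
          (\<Sum>b\<in>G k ` {0<..<T}. LINT t|\<mu>. (oscillation_at eps (duality a b) t + oscillation_at eps (%r. duality a b r * cell k b r) t))"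
        by (rule Lintegral_sum[OF di[OF a]])
      also have "... = (\<Sum>b\<in>G k ` {0<..<T}. mean_oscillation T (duality a b) eps + mean_oscillation T (%r. duality a b r * cell k b r) eps)"
        by (rule sum.cong[OF refl dI[OF a]])
      finally show "(LINT t|\<mu>. (\<Sum>b\<in>G k ` {0<..<T}. oscillation_at eps (duality a b) t + oscillation_at eps (%r. duality a b r * cell k b r) t)) =
          (\<Sum>b\<in>G k ` {0<..<T}. mean_oscillation T (duality a b) eps + mean_oscillation T (%r. duality a b r * cell k b r) eps)" .
    qed
  qed
qed

lemma total_oscillation_tendsto_0: "(total_oscillation k \<longlongrightarrow> 0) (at_right 0)"
proof -
  have "(total_oscillation k \<longlongrightarrow> (\<Sum>a\<in>\<Phi> k ` {0<..<T}. \<Sum>b\<in>G k ` {0<..<T}. 0 + 0)) (at_right 0)"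
    unfolding total_oscillation_def[abs_def] by (intro tendsto_sum tendsto_add mean_oscillation_tendsto_0 duality_integrable)
  then show ?thesis by simp
qed

abbreviation "commutator eps \<equiv> integral_dt_mollified_fg \<eta> T D eps \<phi> f g - integral_dt_f_mollified_g \<eta> T D eps \<phi> f F g"

text \<open>The first term tends to \<open>0\<close> with \<open>\<epsilon>\<close> for fixed \<open>k\<close>, the second one with \<open>k\<close> uniformly in \<open>\<epsilon>\<close>.\<close>

lemma commutator_bound:
  assumes eps: "0 < eps"
    and C: "0 <= C" "\<And>z. \<bar>tk eps z\<bar> <= C * tent eps z" "\<And>z. \<bar>tk' eps z\<bar> <= C / eps * tent eps z"
  shows "\<bar>commutator eps\<bar> <= 10 * C * total_oscillation k eps + C * total_error k"
proof -
  interpret T: sigma_finite_measure \<mu> by (rule sfT)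
  interpret TT: pair_sigma_finite \<mu> \<mu> ..
  note EI = E_integrable[OF eps \<phi>_datum g_datum A_Lp B_Lp]
  note me = mollified_terms_eq[OF eps \<phi>_datum g_datum A_Lp B_Lp]
  let ?Z = "%t. LINT s|\<mu>. E1 eps \<phi>' g' (t, s) - E2 eps \<phi>' g' (t, s)"
  let ?Y = "%t. interior_time eps t * F t (%x. \<phi> t x * moll T eps g t x)"
  let ?b = "%t. 10 * C * simple_oscillation k eps t + C * approximation_error k eps t"
  have Ei: "integrable (\<mu> \<Otimes>\<^sub>M \<mu>) (%z. E1 eps \<phi>' g' z - E2 eps \<phi>' g' z)" by (rule Lintegrable_diff[OF EI])
  have Z: "integrable \<mu> ?Z" using TT.integrable_fst'[OF Ei] by simp
  have Ym: "?Y \<in> borel_measurable \<mu>" by (rule borel_measurable_times[OF interior_time_measurable functional_measurable[OF eps]])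
  have b: "integrable \<mu> ?b" using oscillation_integral(1)[OF eps] error_integral(1)[OF eps] by simp
  note pb = pointwise_bound[OF eps C, of k]
  have ZY: "integrable \<mu> (%t. ?Z t - ?Y t)"
  proof (rule Lintegrable_bound[OF b])
    show "(%t. ?Z t - ?Y t) \<in> borel_measurable \<mu>" by (rule borel_measurable_diff[OF borel_measurable_integrable[OF Z] Ym])
    show "AE t in \<mu>. norm (?Z t - ?Y t) <= norm (?b t)" using pb by eventually_elim simp
  qed
  have Y: "integrable \<mu> ?Y" using Lintegrable_diff[OF Z ZY] by simp
  have "(LINT t|lebesgue_on {eps<..<T - eps}. F t (%x. moll T eps g t x * \<phi> t x)) = (LINT t|\<mu>. ?Y t)"
    unfolding interior_time_def integral_restrict_time[OF eps] by (simp only: mult.commute[of "mollify _ _ _ _ _ _"])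
  moreover have "(LINT t|\<mu>. ?Z t) = (LINT z|(\<mu> \<Otimes>\<^sub>M \<mu>). E1 eps \<phi>' g' z) - (LINT z|(\<mu> \<Otimes>\<^sub>M \<mu>). E2 eps \<phi>' g' z)"
    using TT.integral_fst'[OF Ei] EI by simp
  ultimately have "commutator eps = (LINT t|\<mu>. ?Z t) - (LINT t|\<mu>. ?Y t)"
    unfolding integral_dt_f_mollified_g_def me by simp
  also have "... = (LINT t|\<mu>. ?Z t - ?Y t)" using Z Y by simp
  finally have "\<bar>commutator eps\<bar> = \<bar>LINT t|\<mu>. ?Z t - ?Y t\<bar>" by (rule arg_cong)
  also have "... <= (LINT t|\<mu>. \<bar>?Z t - ?Y t\<bar>)" by (rule integral_abs_bound)
  also have "... <= (LINT t|\<mu>. ?b t)" by (rule integral_mono_AE[OF integrable_abs[OF ZY] b pb])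
  also have "... = 10 * C * total_oscillation k eps + C * (LINT t|\<mu>. approximation_error k eps t)"
    using oscillation_integral[OF eps, of k] error_integral(1)[OF eps, of k] by simp
  also have "... <= 10 * C * total_oscillation k eps + C * total_error k"
    by (intro add_left_mono mult_left_mono error_integral(2)[OF eps] C(1))
  finally show ?thesis .
qed

theorem commutator_tendsto_0: "(commutator \<longlongrightarrow> 0) (at_right 0)"
proof (rule tendstoI)
  fix e :: real assume e: "0 < e"
  obtain C where C: "0 <= C" "\<And>eps z. 0 < eps ==> \<bar>tk eps z\<bar> <= C * tent eps z"
    "\<And>eps z. 0 < eps ==> \<bar>tk' eps z\<bar> <= C / eps * tent eps z"
    using time_kernel_bounds[OF \<eta>] by blast
  have "0 < e / 2" using e by simp
  from order_tendstoD(2)[OF tendsto_mult_right_zero[OF total_error_tendsto_0, of C] this]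
  obtain k where k: "C * total_error k < e / 2" by (auto simp: eventually_sequentially)
  from order_tendstoD(2)[OF tendsto_mult_right_zero[OF total_oscillation_tendsto_0, of "10 * C"] \<open>0 < e / 2\<close>]
  have "\<forall>\<^sub>F eps in at_right 0. 10 * C * total_oscillation k eps < e / 2" .
  then show "\<forall>\<^sub>F eps in at_right 0. dist (commutator eps) 0 < e"
    using eventually_at_right_less[of 0]
  proof eventually_elim
    case (elim eps)
    then show ?case using commutator_bound[OF elim(2) C(1) C(2)[OF elim(2)] C(3)[OF elim(2)], of k] k
      by (simp add: dist_real_def)
  qed
qed

end

text \<open>The exponent of the product is conjugate to the remaining one. This is computed in the extended reals, where \<open>q\<close> may be
  infinite.\<close>

lemma Hoelder_exponent:
  fixes a b :: real and q :: ennreal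
  assumes ab: "1 <= a" "1 <= b" and q: "1 <= q" and sum: "1 / ennreal a + 1 / q + 1 / ennreal b = 1"
  obtains r where "conjugate_exponents r q" "1 / r = 1 / a + 1 / b" "conj_exponent q = ennreal r"
proof -
  define c where "c = 1 / a + 1 / b"
  have inv: "1 / ennreal s = ennreal (1 / s)" if "0 < s" for s
    using divide_ennreal[of 1 s] that by simp
  have c0: "0 < c" unfolding c_def using ab by (intro add_pos_pos) auto
  have "ennreal c = 1 / ennreal a + 1 / ennreal b" unfolding c_def using ab by (simp add: inv)
  then have s: "ennreal c + 1 / q = 1" using sum by (simp add: add_ac)
  have r: "1 / (1 / c) = 1 / a + 1 / b" unfolding c_def using ab by simp
  show ?thesis
  proof (cases q)
    case top
    then have "ennreal c = 1" using s by simp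
    then have "c = 1" using c0 by (simp add: ennreal_eq_1)
    then show ?thesis using that[of 1] top r by (auto simp: conjugate_exponents_def conj_exponent_def)
  next
    case (real s')
    then have s': "1 <= s'" using q by (simp add: ennreal_ge_1)
    have "ennreal (c + 1 / s') = ennreal c + ennreal (1 / s')" using c0 s' by (intro ennreal_plus) auto
    also have "... = ennreal 1" using s real s' by (simp add: inv)
    finally have eq: "c + 1 / s' = 1" using c0 s' by (subst (asm) ennreal_inj) auto
    have "0 <= 1 / s'" using s' by simp
    then have "c <= 1" using eq by linarith
    then have r1: "1 <= 1 / c" using c0 by simp
    have "1 - 1 / q = ennreal (1 - 1 / s')" unfolding real using s' by (simp add: inv ennreal_minus[of "1 / s'" 1, symmetric])
    also have "1 - 1 / s' = c" using eq by simp
    finally have "conj_exponent q = ennreal (1 / c)" unfolding conj_exponent_def using inv[OF c0] by simp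
    moreover have "conjugate_exponents (1 / c) q" unfolding conjugate_exponents_def using r1 real s' eq by auto
    ultimately show ?thesis using that r by blast
  qed
qed

theorem lemma2p5:
  fixes T :: real and D :: "(real^'n) spatial_domain" and \<eta> :: "real \<Rightarrow> real"
    and p_bar q_bar p1 q1 p2 q2 :: ennreal
    and f g \<phi> :: "real \<Rightarrow> real^'n \<Rightarrow> real"
    and F :: "real \<Rightarrow> (real^'n \<Rightarrow> real) \<Rightarrow> real"
  assumes "0 < T" and "CARD('n) \<in> {2, 3}" and "admissible D" and "mollifier_kernel \<eta>"
    and "1 \<le> p_bar" "1 \<le> q_bar" "1 \<le> p1" "1 \<le> q1" "1 \<le> p2" "1 \<le> q2"
    and "1 / p_bar + 1 / p1 + 1 / p2 = 1" and "1 / q_bar + 1 / q1 + 1 / q2 = 1"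
    and "f \<in> Lp_Lq T p1 D q1"
    and "has_weak_time_derivative T D q1 f F" and "F \<in> Lp_W_minus1 T p1 D q1"
    and "g \<in> Lp_W1 T p2 D q2"
    and "\<phi> \<in> Lp_W1_0 T p_bar D q_bar"
    and "p2 < \<infinity>" "q2 < \<infinity>" "p_bar < \<infinity>" "q_bar < \<infinity>"
  shows "((\<lambda>\<epsilon>. integral_dt_mollified_fg \<eta> T D \<epsilon> \<phi> f g
              - integral_dt_f_mollified_g \<eta> T D \<epsilon> \<phi> f F g) \<longlongrightarrow> 0) (at_right 0)"
  proof -
  have real: "\<exists>s. e = ennreal s \<and> 1 \<le> s" if "1 \<le> e" "e < \<infinity>" for e :: ennreal
    using that by (cases e) (auto simp: ennreal_ge_1)
  obtain pb where pb: "p_bar = ennreal pb" "1 \<le> pb" using real assms(5,20) by blast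
  obtain qb where qb: "q_bar = ennreal qb" "1 \<le> qb" using real assms(6,21) by blast
  obtain p2' where p2: "p2 = ennreal p2'" "1 \<le> p2'" using real assms(9,18) by blast
  obtain q2' where q2: "q2 = ennreal q2'" "1 \<le> q2'" using real assms(10,19) by blast
  obtain r where r: "conjugate_exponents r q1" "1 / r = 1 / qb + 1 / q2'" "conj_exponent q1 = ennreal r"
    by (rule Hoelder_exponent[OF qb(2) q2(2) assms(8) assms(12)[unfolded qb q2]])
  obtain rt where rt: "conjugate_exponents rt p1" "1 / rt = 1 / pb + 1 / p2'" "conj_exponent p1 = ennreal rt"
    by (rule Hoelder_exponent[OF pb(2) p2(2) assms(7) assms(11)[unfolded pb p2]])
  interpret commutator_data D \<eta> T pb qb p2' q2' r rt p1 q1 f F \<phi> g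
    using assms pb qb p2 q2 r rt by unfold_locales auto
  show ?thesis by (rule commutator_tendsto_0)
qed

end
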